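(* Let $\widetilde\sigma>0$, $\widetilde u_2\in L^2(\widehat Q)$, and assume $$0<k<1\qquad\text{and}\qquad T>\frac{e^{\frac{2k(1+k)}{(1-k)^3}}-1}{k}.$$ Assume $\widehat\Sigma_1=\widehat\Sigma_2=\widehat\Sigma_0$. For $\widetilde w_1\in L^2(\widehat\Sigma_1)$ let $\widetilde w_2=\mathfrak F(\widetilde w_1)\in L^2(\widehat\Sigma_2)$ be the Nash equilibrium associated with $\widetilde w_1$, i.e. the minimizer of $\widehat w_2\mapsto\widetilde J_2(\widetilde w_1,\widehat w_2)$ over $L^2(\widehat\Sigma_2)$, and let $u=u(\widetilde w_1,\widetilde w_2)$ be the corresponding state. Then, as $\widetilde w_1$ ranges over $L^2(\widehat\Sigma_1)$, the pairs $$\big(u(\cdot,T;\widetilde w_1,\widetilde w_2),\,u'(\cdot,T;\widetilde w_1,\widetilde w_2)\big)$$ form a dense subset of $L^2(\Omega_T)\times H^{-1}(\Omega_T)$.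
   Context: Domain. For $T>0$ and $0<k<1$ put $\alpha_k(t)=1+kt$, $\Omega_t=(0,\alpha_k(t))$, and $\widehat Q=\{(x,t)\in\mathbb R^2: 0<x<\alpha_k(t),\ t\in(0,T)\}$. The lateral boundary is $\widehat\Sigma=\widehat\Sigma_0\cup\widehat\Sigma_0^*$ with $\widehat\Sigma_0=\{(0,t):t\in(0,T)\}$ and $\widehat\Sigma_0^*=\widehat\Sigma\setminus\widehat\Sigma_0=\{(\alpha_k(t),t):t\in(0,T)\}$. A prime denotes $\partial/\partial t$ and a subscript $x$ denotes $\partial/\partial x$. On $\widehat\Sigma_0$ (identified with $(0,T)$, with $d\widehat\Sigma=dt$), $\partial_\nu z(t)=-z_x(0,t)$ is the outward normal derivative. State. For $\widetilde w_1,\widetilde w_2\in L^2(\widehat\Sigma_0)$, $u(\widetilde w_1,\widetilde w_2)$ is the solution of $u''-u_{xx}=0$ in $\widehat Q$, $u=\widetilde w_1+\widetilde w_2$ on $\widehat\Sigma_0$, $u=0$ on $\widehat\Sigma\setminus\widehat\Sigma_0$, $u(\cdot,0)=u'(\cdot,0)=0$ in $\Omega_0$. Cost functional of the follower: $$\widetilde J_2(\widetilde w_1,\widetilde w_2)=\frac12\iint_{\widehat Q}\big(u(\widetilde w_1,\widetilde w_2)-\widetilde u_2\big)^2dx\,dt+\frac{\widetilde\sigma}{2}\int_{\widehat\Sigma_2}\widetilde w_2^2\,d\widehat\Sigma.$$ For each $\widetilde w_1$ the minimizer $\widetilde w_2=\mathfrak F(\widetilde w_1)$ exists and is unique, and equals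 $\frac1{\widetilde\sigma}\partial_\nu p$ on $\widehat\Sigma_0$, where $\{u,p\}$ is the unique solution of the optimality system: $u''-u_{xx}=0$ and $p''-p_{xx}=u-\widetilde u_2$ in $\widehat Q$; $u=\widetilde w_1+\frac1{\widetilde\sigma}\partial_\nu p$ on $\widehat\Sigma_0$, $u=0$ on $\widehat\Sigma\setminus\widehat\Sigma_0$; $p=0$ on $\widehat\Sigma$; $u(0)=u'(0)=0$ in $\Omega_0$; $p(T)=p'(T)=0$ in $\Omega_T$. Notion of solution. Problems with homogeneous Dirichlet data, source in $L^2(\widehat Q)$ and data in $H_0^1\times L^2$ at one time have a unique weak (finite-energy) solution $z$, with $z(t)\in H^1_0(\Omega_t)$, $z'(t)\in L^2(\Omega_t)$, and $z_x(0,\cdot)\in L^2(0,T)$. Problems with Dirichlet data $w\in L^2(0,T)$ at $x=0$, zero Dirichlet data on $\widehat\Sigma_0^*$ and zero initial data are solved by transposition: there is a unique solution $u$ with $u(t)\in L^2(\Omega_t)$, $u'(t)\in H^{-1}(\Omega_t)$ for $t\in[0,T]$ (continuously in $t$), characterized by: for every $s\in(0,T]$, $F\in L^2(\widehat Q)$, $(f^0,f^1)\in H_0^1(\Omega_s)\times L^2(\Omega_s)$, $$\int_0^s\!\!\int_{\Omega_t}uF\,dx\,dt=(u(s),f^1)_{L^2(\Omega_s)}-\langle u'(s),f^0\rangle_{H^{-1}(\Omega_s)\times H^1_0(\Omega_s)}+\int_0^s w(t)\,z_x(0,t)\,dt,$$ where $z$ is the weak solution of $z''-z_{xx}=F$ for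 $0<t<s$, $z=0$ on the lateral boundary, $z(s)=f^0$, $z'(s)=f^1$. *)

theory Defs
  imports "HOL-Analysis.Analysis"
begin

section \<open>Square-integrable functions\<close>

text \<open>Elements of \<open>L\<^sup>2(S)\<close> are represented by functions on the whole space; only their values
  almost everywhere on \<open>S\<close> matter.\<close>

definition L2_on :: "'a::euclidean_space set \<Rightarrow> ('a \<Rightarrow> real) set" where
  "L2_on S = {f. set_borel_measurable lborel S f \<and> set_integrable lborel S (\<lambda>x. (f x)\<^sup>2)}"

definition L2_norm_on :: "'a::euclidean_space set \<Rightarrow> ('a \<Rightarrow> real) \<Rightarrow> real" where
  "L2_norm_on S f = sqrt (LINT x:S|lborel. (f x)\<^sup>2)"


section \<open>Test functions, \<open>H\<^sup>1\<^sub>0(0,a)\<close> and \<open>H\<^sup>-\<^sup>1(0,a)\<close>\<close>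

text \<open>\<open>G\<close> is the gradient of \<open>\<phi>\<close>. On the plane, with points \<open>(x,t)\<close>, the two components of
  \<open>G p\<close> are the partial derivatives of \<open>\<phi>\<close> in \<open>x\<close> and in \<open>t\<close>.\<close>

definition test_fun :: "'a::euclidean_space set \<Rightarrow> ('a \<Rightarrow> real) \<Rightarrow> ('a \<Rightarrow> 'a) \<Rightarrow> bool" where
  "test_fun S \<phi> G \<longleftrightarrow>
     (\<forall>p. GDERIV \<phi> p :> G p) \<and> continuous_on UNIV G \<and>
     (\<exists>K. compact K \<and> K \<subseteq> S \<and> (\<forall>p. p \<notin> K \<longrightarrow> \<phi> p = 0))"

text \<open>\<open>f\<close> lies in \<open>H\<^sup>1\<^sub>0(0,a)\<close>, the closure of the compactly supported \<open>C\<^sup>1\<close> functions in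
  \<open>H\<^sup>1(0,a)\<close>, and \<open>g\<close> is its weak derivative.\<close>

definition H10_deriv :: "real \<Rightarrow> (real \<Rightarrow> real) \<Rightarrow> (real \<Rightarrow> real) \<Rightarrow> bool" where
  "H10_deriv a f g \<longleftrightarrow>
     f \<in> L2_on {0<..<a} \<and> g \<in> L2_on {0<..<a} \<and>
     (\<exists>\<phi> G. (\<forall>n::nat. test_fun {0<..<a} (\<phi> n) (G n)) \<and>
        (\<lambda>n. L2_norm_on {0<..<a} (\<lambda>x. \<phi> n x - f x)) \<longlonglongrightarrow> 0 \<and>
        (\<lambda>n. L2_norm_on {0<..<a} (\<lambda>x. G n x - g x)) \<longlonglongrightarrow> 0)"

definition H10 :: "real \<Rightarrow> (real \<Rightarrow> real) set" where
  "H10 a = {f. \<exists>g. H10_deriv a f g}"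

text \<open>Linearity and boundedness make such a functional independent of the chosen representative
  of its argument; its values outside \<open>H10 a\<close> are irrelevant.\<close>

definition Hm1 :: "real \<Rightarrow> ((real \<Rightarrow> real) \<Rightarrow> real) set" where
  "Hm1 a = {l.
     (\<forall>f\<in>H10 a. \<forall>h\<in>H10 a. l (\<lambda>x. f x + h x) = l f + l h) \<and>
     (\<forall>c. \<forall>f\<in>H10 a. l (\<lambda>x. c * f x) = c * l f) \<and>
     (\<exists>C. \<forall>f g. H10_deriv a f g \<longrightarrow>
        \<bar>l f\<bar> \<le> C * sqrt ((L2_norm_on {0<..<a} f)\<^sup>2 + (L2_norm_on {0<..<a} g)\<^sup>2))}"

definition Hm1_norm :: "real \<Rightarrow> ((real \<Rightarrow> real) \<Rightarrow> real) \<Rightarrow> real" where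
  "Hm1_norm a l = Sup {\<bar>l f\<bar> | f g. H10_deriv a f g \<and>
     (L2_norm_on {0<..<a} f)\<^sup>2 + (L2_norm_on {0<..<a} g)\<^sup>2 \<le> 1}"


section \<open>The moving domain\<close>

definition alpha :: "real \<Rightarrow> real \<Rightarrow> real" where
  "alpha k t = 1 + k * t"

definition Omega :: "real \<Rightarrow> real \<Rightarrow> real set" where
  "Omega k t = {0<..<alpha k t}"

definition Qhat :: "real \<Rightarrow> real \<Rightarrow> (real \<times> real) set" where
  "Qhat k s = {(x, t). 0 < x \<and> x < alpha k t \<and> 0 < t \<and> t < s}"

text \<open>Continuity of \<open>t \<mapsto> v(\<cdot>,t) \<in> L\<^sup>2(\<Omega>\<^sub>t)\<close> on \<open>[0,s]\<close>, the functions being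
  extended by zero outside \<open>\<Omega>\<^sub>t\<close>.\<close>

definition L2_continuous :: "real \<Rightarrow> real \<Rightarrow> (real \<times> real \<Rightarrow> real) \<Rightarrow> bool" where
  "L2_continuous k s v \<longleftrightarrow> (\<forall>t0\<in>{0..s}.
     ((\<lambda>t. L2_norm_on UNIV
        (\<lambda>x. indicator (Omega k t) x * v (x, t) - indicator (Omega k t0) x * v (x, t0)))
      \<longlongrightarrow> 0) (at t0 within {0..s}))"

text \<open>Continuity of \<open>t \<mapsto> l t \<in> H\<^sup>-\<^sup>1(\<Omega>\<^sub>t)\<close> on \<open>[0,s]\<close>, after pulling back to the fixed
  interval \<open>(0,1)\<close> by the dilation \<open>x \<mapsto> x / alpha k t\<close>.\<close>

definition Hm1_continuous :: "real \<Rightarrow> real \<Rightarrow> (real \<Rightarrow> (real \<Rightarrow> real) \<Rightarrow> real) \<Rightarrow> bool" where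
  "Hm1_continuous k s l \<longleftrightarrow> (\<forall>t0\<in>{0..s}.
     ((\<lambda>t. Hm1_norm 1 (\<lambda>f. l t (\<lambda>x. f (x / alpha k t)) - l t0 (\<lambda>x. f (x / alpha k t0))))
      \<longlongrightarrow> 0) (at t0 within {0..s}))"


section \<open>Solutions of the wave equation\<close>

text \<open>Finite-energy solution \<open>z\<close>, with \<open>zx\<close> and \<open>zt\<close> its partial derivatives, of
  \<open>z'' - z\<^sub>x\<^sub>x = F\<close> in \<open>Qhat k s\<close>, \<open>z = 0\<close> on the lateral boundary,
  \<open>z(s) = f0\<close>, \<open>z'(s) = f1\<close>.\<close>

definition weak_solution ::
  "real \<Rightarrow> real \<Rightarrow> (real \<times> real \<Rightarrow> real) \<Rightarrow> (real \<Rightarrow> real) \<Rightarrow> (real \<Rightarrow> real) \<Rightarrow>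
   (real \<times> real \<Rightarrow> real) \<Rightarrow> (real \<times> real \<Rightarrow> real) \<Rightarrow> (real \<times> real \<Rightarrow> real) \<Rightarrow> bool" where
  "weak_solution k s F f0 f1 z zx zt \<longleftrightarrow>
     z \<in> L2_on (Qhat k s) \<and> zx \<in> L2_on (Qhat k s) \<and> zt \<in> L2_on (Qhat k s) \<and>
     (\<forall>t\<in>{0..s}. H10_deriv (alpha k t) (\<lambda>x. z (x, t)) (\<lambda>x. zx (x, t)) \<and>
                  (\<lambda>x. zt (x, t)) \<in> L2_on (Omega k t)) \<and>
     L2_continuous k s z \<and> L2_continuous k s zx \<and> L2_continuous k s zt \<and>
     (\<forall>\<phi> G. test_fun (Qhat k s) \<phi> G \<longrightarrow>
        (LINT p:Qhat k s|lborel. z p * snd (G p)) = - (LINT p:Qhat k s|lborel. zt p * \<phi> p)) \<and>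
     (\<forall>\<phi> G. test_fun (Qhat k s) \<phi> G \<longrightarrow>
        (LINT p:Qhat k s|lborel. zx p * fst (G p) - zt p * snd (G p)) =
        (LINT p:Qhat k s|lborel. F p * \<phi> p)) \<and>
     (AE x in lborel. x \<in> Omega k s \<longrightarrow> z (x, s) = f0 x \<and> zt (x, s) = f1 x)"

text \<open>\<open>g = z\<^sub>x(0,\<cdot>)\<close>. Since \<open>z(0,t) = 0\<close>, the mean value of \<open>zx(\<cdot>,t)\<close> over \<open>(0,h)\<close> is the
  difference quotient \<open>(z(h,t) - z(0,t)) / h\<close>; it is required to converge in
  \<open>L\<^sup>2(0,s)\<close>.\<close>

definition x_deriv_at_0 :: "real \<Rightarrow> (real \<times> real \<Rightarrow> real) \<Rightarrow> (real \<Rightarrow> real) \<Rightarrow> bool" where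
  "x_deriv_at_0 s zx g \<longleftrightarrow> g \<in> L2_on {0<..<s} \<and>
     ((\<lambda>h. L2_norm_on {0<..<s} (\<lambda>t. (LINT x:{0<..<h}|lborel. zx (x, t)) / h - g t))
      \<longlongrightarrow> 0) (at_right 0)"

text \<open>Solution by transposition of \<open>u'' - u\<^sub>x\<^sub>x = 0\<close> in \<open>Qhat k T\<close> with \<open>u = w\<close> at \<open>x = 0\<close>,
  \<open>u = 0\<close> at \<open>x = alpha k t\<close> and zero initial data; \<open>ut t\<close> is \<open>u'(t) \<in> H\<^sup>-\<^sup>1(\<Omega>\<^sub>t)\<close>.\<close>

definition transposition_solution ::
  "real \<Rightarrow> real \<Rightarrow> (real \<Rightarrow> real) \<Rightarrow>
   (real \<times> real \<Rightarrow> real) \<Rightarrow> (real \<Rightarrow> (real \<Rightarrow> real) \<Rightarrow> real) \<Rightarrow> bool" where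
  "transposition_solution k T w u ut \<longleftrightarrow>
     u \<in> L2_on (Qhat k T) \<and>
     (\<forall>t\<in>{0..T}. (\<lambda>x. u (x, t)) \<in> L2_on (Omega k t) \<and> ut t \<in> Hm1 (alpha k t)) \<and>
     L2_continuous k T u \<and> Hm1_continuous k T ut \<and>
     (AE x in lborel. x \<in> Omega k 0 \<longrightarrow> u (x, 0) = 0) \<and> (\<forall>f\<in>H10 (alpha k 0). ut 0 f = 0) \<and>
     (\<forall>s F f0 f1 z zx zt g.
        0 < s \<and> s \<le> T \<and> F \<in> L2_on (Qhat k T) \<and>
        f0 \<in> H10 (alpha k s) \<and> f1 \<in> L2_on (Omega k s) \<and>
        weak_solution k s F f0 f1 z zx zt \<and> x_deriv_at_0 s zx g \<longrightarrow>
        (LINT p:Qhat k s|lborel. u p * F p) =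
        (LINT x:Omega k s|lborel. u (x, s) * f1 x) - ut s f0 + (LINT t:{0<..<s}|lborel. w t * g t))"

text \<open>The state \<open>u(w1,w2)\<close> and its time derivative. The solution is unique up to the choice of
  representatives, on which nothing below depends.\<close>

definition state_pair ::
  "real \<Rightarrow> real \<Rightarrow> (real \<Rightarrow> real) \<Rightarrow> (real \<Rightarrow> real) \<Rightarrow>
   (real \<times> real \<Rightarrow> real) \<times> (real \<Rightarrow> (real \<Rightarrow> real) \<Rightarrow> real)" where
  "state_pair k T w1 w2 =
     (SOME p. transposition_solution k T (\<lambda>t. w1 t + w2 t) (fst p) (snd p))"

definition state where "state k T w1 w2 = fst (state_pair k T w1 w2)"

definition state_dt where "state_dt k T w1 w2 = snd (state_pair k T w1 w2)"


section \<open>The follower and the reachable states\<close>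

text \<open>Controls live on the fixed end \<open>x = 0\<close> of the lateral boundary, identified with
  \<open>(0,T)\<close>.\<close>

definition J2 ::
  "real \<Rightarrow> real \<Rightarrow> real \<Rightarrow> (real \<times> real \<Rightarrow> real) \<Rightarrow> (real \<Rightarrow> real) \<Rightarrow> (real \<Rightarrow> real) \<Rightarrow> real" where
  "J2 k T \<sigma> u2 w1 w2 =
     1/2 * (LINT p:Qhat k T|lborel. (state k T w1 w2 p - u2 p)\<^sup>2) +
     \<sigma>/2 * (LINT t:{0<..<T}|lborel. (w2 t)\<^sup>2)"

definition nash ::
  "real \<Rightarrow> real \<Rightarrow> real \<Rightarrow> (real \<times> real \<Rightarrow> real) \<Rightarrow> (real \<Rightarrow> real) \<Rightarrow> (real \<Rightarrow> real) \<Rightarrow> bool" where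
  "nash k T \<sigma> u2 w1 w2 \<longleftrightarrow> is_arg_min (J2 k T \<sigma> u2 w1) (\<lambda>w. w \<in> L2_on {0<..<T}) w2"

definition reachable ::
  "real \<Rightarrow> real \<Rightarrow> real \<Rightarrow> (real \<times> real \<Rightarrow> real) \<Rightarrow>
   ((real \<Rightarrow> real) \<times> ((real \<Rightarrow> real) \<Rightarrow> real)) set" where
  "reachable k T \<sigma> u2 =
     {((\<lambda>x. state k T w1 w2 (x, T)), state_dt k T w1 w2 T) | w1 w2.
        w1 \<in> L2_on {0<..<T} \<and> nash k T \<sigma> u2 w1 w2}"

definition dense_in_L2_Hm1 :: "real \<Rightarrow> ((real \<Rightarrow> real) \<times> ((real \<Rightarrow> real) \<Rightarrow> real)) set \<Rightarrow> bool" where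
  "dense_in_L2_Hm1 a R \<longleftrightarrow>
     R \<subseteq> L2_on {0<..<a} \<times> Hm1 a \<and>
     (\<forall>v0\<in>L2_on {0<..<a}. \<forall>v1\<in>Hm1 a. \<forall>\<epsilon>>0. \<exists>(y0, y1)\<in>R.
        L2_norm_on {0<..<a} (\<lambda>x. y0 x - v0 x) < \<epsilon> \<and> Hm1_norm a (\<lambda>f. y1 f - v1 f) < \<epsilon>)"

end

theory Submission
  imports Defs
begin

text \<open>With \<open>q = (1 - k) / (1 + k)\<close> and \<open>r s = q * (s - 1) - 1\<close>, the state with total control \<open>w\<close> is
  \<open>u(x,t) = f(t - x) - f(r(t + x))\<close>, where \<open>f\<close> vanishes outside \<open>(0,T)\<close> and \<open>w = f - f \<circ> r\<close> there; that
  this is the solution by transposition follows by cutting off near the lateral boundary and testing the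
  weak formulation. It is the only one, because the adjoint problem is solved
  explicitly by d'Alembert's formula for enough final data.

  The leader is not restricted by the follower: the optimality condition determines \<open>w2\<close> from
  \<open>w1 + w2\<close> alone, so every total control occurs. Reaching prescribed \<open>u(T)\<close> and \<open>u'(T)\<close> then
  amounts to prescribing \<open>f(T - x)\<close> and \<open>f(r(T + x))\<close> separately, which is possible as soon as \<open>r T \<ge> 0\<close>,
  that is \<open>T \<ge> 2 / (1 - k)\<close>.\<close>

section \<open>Square-integrable functions\<close>

text \<open>The identity that characterises a solution by transposition must hold against every
  finite-energy \<open>z\<close>, while \<open>u\<close> is merely square integrable: neither factor
  may be differentiated twice. The two defects are separated. For a C2 profile \<open>f\<close> all
  second derivatives fall on \<open>travel k f\<close>, and the boundary terms emerge from cutoff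
  layers whose widths are sent to zero, first in space and then in time. For a general
  \<open>f\<close> every term of the identity is a functional of \<open>f\<close> given by an
  explicit L2 kernel, so that the C2 case decides it. The velocity \<open>u'\<close> is only a
  functional; it is carried by the conjugate function \<open>stream\<close>, since
  \<open>u' = - stream_x\<close> gives \<open><u', g> = (stream, g_x)\<close>. Final velocities are
  thereby replaced by L2 functions, and \<open>u(T)\<close> and \<open>u'(T)\<close> become
  difference and sum of two restrictions of the same \<open>f\<close>. Since \<open>state\<close> is
  picked by a choice operator, formulas for \<open>travel\<close> transfer to it only through
  uniqueness.\<close>

lemma L2_UNIV: "f \<in> L2_on UNIV \<longleftrightarrow> f \<in> borel_measurable borel \<and> integrable lborel (\<lambda>x. (f x)\<^sup>2)"
  by (auto simp: L2_on_def set_borel_measurable_def set_integrable_def)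

text \<open>Extension by zero. Estimates are proved on the whole space and carried to
  \<open>S\<close> by this lemma and \<open>L2_norm_on_eq\<close>, because representatives are
  arbitrary off \<open>S\<close>.\<close>

lemma L2_on_iff: "f \<in> L2_on S \<longleftrightarrow> (\<lambda>x. indicator S x * f x) \<in> L2_on UNIV"
proof -
  have "(\<lambda>x. (indicator S x * f x)\<^sup>2) = (\<lambda>x. indicator S x * (f x)\<^sup>2)"
    by (auto simp: indicator_def)
  then show ?thesis
    by (simp add: L2_UNIV) (simp add: L2_on_def set_borel_measurable_def set_integrable_def)
qed

lemma L2_norm_on_eq: "L2_norm_on S f = L2_norm_on UNIV (\<lambda>x. indicator S x * f x)"
proof -
  have "(\<lambda>x. (indicator S x * f x)\<^sup>2) = (\<lambda>x. indicator S x * (f x)\<^sup>2)"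
    by (auto simp: indicator_def)
  then show ?thesis
    by (simp add: L2_norm_on_def set_lebesgue_integral_def)
qed

lemma L2_UNIV_measurable: "f \<in> L2_on UNIV \<Longrightarrow> f \<in> borel_measurable borel"
  by (simp add: L2_UNIV)

lemma L2_norm_nonneg [simp]: "L2_norm_on S f \<ge> 0"
  unfolding L2_norm_on_def set_lebesgue_integral_def by (intro real_sqrt_ge_zero Bochner_Integration.integral_nonneg) simp

lemma L2_norm_sq: "(L2_norm_on S f)\<^sup>2 = (LINT x:S|lborel. (f x)\<^sup>2)"
  unfolding L2_norm_on_def set_lebesgue_integral_def by (intro real_sqrt_pow2 Bochner_Integration.integral_nonneg) simp

lemma L2_norm_UNIV_sq: "(L2_norm_on UNIV f)\<^sup>2 = (\<integral>x. (f x)\<^sup>2 \<partial>lborel)"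
  by (simp add: L2_norm_sq set_lebesgue_integral_def)

lemma L2_mult_integrable:
  assumes "f \<in> L2_on UNIV" "g \<in> L2_on UNIV"
  shows "integrable lborel (\<lambda>x. f x * g x)"
proof (rule Bochner_Integration.integrable_bound)
  show "integrable lborel (\<lambda>x. (f x)\<^sup>2 + (g x)\<^sup>2)" using assms by (simp add: L2_UNIV)
  show "(\<lambda>x. f x * g x) \<in> borel_measurable lborel"
    using assms[THEN L2_UNIV_measurable] by measurable
  have "\<bar>f x * g x\<bar> \<le> (f x)\<^sup>2 + (g x)\<^sup>2" for x
  proof -
    have "2 * \<bar>f x\<bar> * \<bar>g x\<bar> \<le> (f x)\<^sup>2 + (g x)\<^sup>2" using sum_squares_bound[of "\<bar>f x\<bar>" "\<bar>g x\<bar>"] by simp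
    moreover have "0 \<le> \<bar>f x\<bar> * \<bar>g x\<bar>" by simp
    ultimately show ?thesis unfolding abs_mult by linarith
  qed
  then show "AE x in lborel. norm (f x * g x) \<le> norm ((f x)\<^sup>2 + (g x)\<^sup>2)" by (simp add: abs_of_nonneg)
qed

lemma L2_scale: "f \<in> L2_on S \<Longrightarrow> (\<lambda>x. c * f x) \<in> L2_on S"
proof -
  assume "f \<in> L2_on S"
  then have "(\<lambda>x. indicator S x * f x) \<in> L2_on UNIV" by (simp add: L2_on_iff[of _ S])
  then have "(\<lambda>x. c * (indicator S x * f x)) \<in> L2_on UNIV"
    by (auto simp: L2_UNIV power_mult_distrib)
  then show ?thesis by (simp add: L2_on_iff[of _ S] algebra_simps)
qed

lemma L2_add: "f \<in> L2_on S \<Longrightarrow> g \<in> L2_on S \<Longrightarrow> (\<lambda>x. f x + g x) \<in> L2_on S"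
proof -
  have *: "(\<lambda>x. f x + g x) \<in> L2_on UNIV" if "f \<in> L2_on UNIV" "g \<in> L2_on UNIV" for f g :: "'a \<Rightarrow> real"
    using L2_mult_integrable[OF that] that by (auto simp: L2_UNIV power2_sum mult.assoc)
  assume "f \<in> L2_on S" "g \<in> L2_on S"
  then show ?thesis using *[of "\<lambda>x. indicator S x * f x" "\<lambda>x. indicator S x * g x"]
    by (simp add: L2_on_iff[of _ S] algebra_simps)
qed

lemma L2_minus: "f \<in> L2_on S \<Longrightarrow> (\<lambda>x. - f x) \<in> L2_on S"
  using L2_scale[of f S "-1"] by simp

lemma L2_diff: "f \<in> L2_on S \<Longrightarrow> g \<in> L2_on S \<Longrightarrow> (\<lambda>x. f x - g x) \<in> L2_on S"
  using L2_add[of f S "\<lambda>x. - g x"] L2_minus[of g S] by simp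

lemma L2_zero [simp]: "(\<lambda>x. 0) \<in> L2_on S"
  by (simp add: L2_on_def set_borel_measurable_def set_integrable_def)

lemma L2_on_mult_integrable:
  assumes "f \<in> L2_on S" "g \<in> L2_on S"
  shows "set_integrable lborel S (\<lambda>x. f x * g x)"
proof -
  have "integrable lborel (\<lambda>x. (indicator S x * f x) * (indicator S x * g x))"
    using assms by (intro L2_mult_integrable) (simp_all only: L2_on_iff[of _ S])
  also have "(\<lambda>x. (indicator S x * f x) * (indicator S x * g x)) = (\<lambda>x. indicator S x *\<^sub>R (f x * g x))"
    by (auto simp: indicator_def)
  finally show ?thesis unfolding set_integrable_def .
qed

text \<open>The squared norm of \<open>f + l g\<close> is a quadratic in \<open>l\<close> that is
  nonnegative everywhere. Its minimiser \<open>- ?b / ?c\<close> exists only for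
  \<open>?c > 0\<close>, hence the case split.\<close>

lemma L2_Cauchy_Schwarz_UNIV:
  assumes "f \<in> L2_on UNIV" "g \<in> L2_on UNIV"
  shows "\<bar>\<integral>x. f x * g x \<partial>lborel\<bar> \<le> L2_norm_on UNIV f * L2_norm_on UNIV g"
proof -
  let ?a = "\<integral>x. (f x)\<^sup>2 \<partial>lborel" and ?b = "\<integral>x. f x * g x \<partial>lborel" and ?c = "\<integral>x. (g x)\<^sup>2 \<partial>lborel"
  note I = L2_mult_integrable[OF assms]
  have q: "0 \<le> ?a + 2 * l * ?b + l\<^sup>2 * ?c" for l
  proof -
    have "0 \<le> (\<integral>x. (f x + l * g x)\<^sup>2 \<partial>lborel)" by simp
    also have "(\<lambda>x. (f x + l * g x)\<^sup>2) = (\<lambda>x. (f x)\<^sup>2 + ((2 * l) * (f x * g x) + l\<^sup>2 * (g x)\<^sup>2))"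
      by (auto simp: power2_eq_square algebra_simps)
    also have "(\<integral>x. (f x)\<^sup>2 + ((2 * l) * (f x * g x) + l\<^sup>2 * (g x)\<^sup>2) \<partial>lborel) = ?a + 2 * l * ?b + l\<^sup>2 * ?c"
      using I assms by (simp add: L2_UNIV)
    finally show ?thesis .
  qed
  have "?b\<^sup>2 \<le> ?a * ?c"
  proof (cases "?c = 0")
    case True
    have "?b = 0"
    proof (rule ccontr)
      assume b: "?b \<noteq> 0"
      \<comment> \<open>The quadratic is affine here, and this \<open>l\<close> makes its value
        -1.\<close>
      have "0 \<le> ?a + 2 * (-(?a+1)/(2* ?b)) * ?b" using q[of "-(?a+1)/(2* ?b)"] True by simp
      then show False using b by (simp add: field_simps)
    qed
    then show ?thesis using True by simp
  next
    case False
    have c: "?c > 0" using False by (metis less_eq_real_def Bochner_Integration.integral_nonneg zero_le_power2)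
    have "0 \<le> ?a + 2 * (- ?b/ ?c) * ?b + (- ?b/ ?c)\<^sup>2 * ?c" by (rule q)
    also have "\<dots> = ?a - ?b\<^sup>2 / ?c" using c by (simp add: power2_eq_square field_simps)
    finally have "0 \<le> (?a - ?b\<^sup>2 / ?c) * ?c" using c by simp
    then show ?thesis using c by (simp add: left_diff_distrib)
  qed
  then have "?b\<^sup>2 \<le> (L2_norm_on UNIV f * L2_norm_on UNIV g)\<^sup>2"
    by (simp add: power_mult_distrib L2_norm_UNIV_sq)
  then show ?thesis
    by (metis abs_le_square_iff abs_mult abs_of_nonneg L2_norm_nonneg)
qed

lemma L2_Cauchy_Schwarz:
  assumes "f \<in> L2_on S" "g \<in> L2_on S"
  shows "\<bar>LINT x:S|lborel. f x * g x\<bar> \<le> L2_norm_on S f * L2_norm_on S g"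
proof -
  have "(LINT x:S|lborel. f x * g x) = (\<integral>x. (indicator S x * f x) * (indicator S x * g x) \<partial>lborel)"
    unfolding set_lebesgue_integral_def by (rule Bochner_Integration.integral_cong) (auto simp: indicator_def)
  then show ?thesis
    using L2_Cauchy_Schwarz_UNIV assms by (simp add: L2_on_iff[of _ S] L2_norm_on_eq[of S])
qed

lemma L2_norm_triangle:
  assumes "f \<in> L2_on S" "g \<in> L2_on S"
  shows "L2_norm_on S (\<lambda>x. f x + g x) \<le> L2_norm_on S f + L2_norm_on S g"
proof -
  have *: "L2_norm_on UNIV (\<lambda>x. f x + g x) \<le> L2_norm_on UNIV f + L2_norm_on UNIV g"
    if fg: "f \<in> L2_on UNIV" "g \<in> L2_on UNIV" for f g :: "'a \<Rightarrow> real"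
  proof -
    note I = L2_mult_integrable[OF fg]
    have "(L2_norm_on UNIV (\<lambda>x. f x + g x))\<^sup>2 = (\<integral>x. (f x)\<^sup>2 + (2 * (f x * g x) + (g x)\<^sup>2) \<partial>lborel)"
      unfolding L2_norm_UNIV_sq by (rule Bochner_Integration.integral_cong) (auto simp: power2_eq_square algebra_simps)
    also have "\<dots> = (L2_norm_on UNIV f)\<^sup>2 + 2 * (\<integral>x. f x * g x \<partial>lborel) + (L2_norm_on UNIV g)\<^sup>2"
      using I fg by (simp add: L2_UNIV L2_norm_UNIV_sq)
    also have "\<dots> \<le> (L2_norm_on UNIV f)\<^sup>2 + 2 * (L2_norm_on UNIV f * L2_norm_on UNIV g) + (L2_norm_on UNIV g)\<^sup>2"
      using L2_Cauchy_Schwarz_UNIV[OF fg] by (simp add: abs_le_iff)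
    also have "\<dots> = (L2_norm_on UNIV f + L2_norm_on UNIV g)\<^sup>2" by (simp add: power2_sum)
    finally show ?thesis by (rule power2_le_imp_le) simp
  qed
  have e: "(\<lambda>x. indicator S x * (f x + g x)) = (\<lambda>x. indicator S x * f x + indicator S x * g x)"
    by (simp add: algebra_simps)
  show ?thesis using * assms unfolding L2_norm_on_eq[of S] L2_on_iff[of _ S] e by auto
qed

lemma L2_norm_scale: "L2_norm_on S (\<lambda>x. c * f x) = \<bar>c\<bar> * L2_norm_on S f"
  by (simp add: L2_norm_on_def power_mult_distrib real_sqrt_mult)

lemma L2_norm_diff_commute: "L2_norm_on S (\<lambda>x. f x - g x) = L2_norm_on S (\<lambda>x. g x - f x)"
  by (simp add: L2_norm_on_def power2_commute)

lemma L2_norm_triangle3: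
  assumes "f \<in> L2_on S" "g \<in> L2_on S" "h \<in> L2_on S"
  shows "L2_norm_on S (\<lambda>x. f x - h x) \<le> L2_norm_on S (\<lambda>x. f x - g x) + L2_norm_on S (\<lambda>x. g x - h x)"
  using L2_norm_triangle[OF L2_diff[OF assms(1,2)] L2_diff[OF assms(2,3)]] by simp

lemma L2_bound:
  assumes "g \<in> L2_on UNIV" "f \<in> borel_measurable borel" "AE x in lborel. \<bar>f x\<bar> \<le> \<bar>g x\<bar>"
  shows "f \<in> L2_on UNIV" "L2_norm_on UNIV f \<le> L2_norm_on UNIV g"
proof -
  have i: "integrable lborel (\<lambda>x. (f x)\<^sup>2)"
  proof (rule Bochner_Integration.integrable_bound)
    show "integrable lborel (\<lambda>x. (g x)\<^sup>2)" using assms by (simp add: L2_UNIV)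
    show "AE x in lborel. norm ((f x)\<^sup>2) \<le> norm ((g x)\<^sup>2)"
      using assms(3) by eventually_elim (simp add: abs_le_square_iff)
  qed (use assms in simp)
  then show f: "f \<in> L2_on UNIV" using assms by (simp add: L2_UNIV)
  have "(\<integral>x. (f x)\<^sup>2 \<partial>lborel) \<le> (\<integral>x. (g x)\<^sup>2 \<partial>lborel)"
  proof (rule integral_mono_AE)
    show "integrable lborel (\<lambda>x. (g x)\<^sup>2)" using assms by (simp add: L2_UNIV)
    show "AE x in lborel. (f x)\<^sup>2 \<le> (g x)\<^sup>2"
      using assms(3) by eventually_elim (simp add: abs_le_square_iff)
  qed (rule i)
  then have "(L2_norm_on UNIV f)\<^sup>2 \<le> (L2_norm_on UNIV g)\<^sup>2" by (simp add: L2_norm_UNIV_sq)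
  then show "L2_norm_on UNIV f \<le> L2_norm_on UNIV g" by (rule power2_le_imp_le) simp
qed

lemma L2_restrict:
  assumes "f \<in> L2_on S" "A \<in> sets borel" "A \<subseteq> S"
  shows "f \<in> L2_on A" "L2_norm_on A f \<le> L2_norm_on S f"
proof -
  have e: "(\<lambda>x. indicator A x * f x) = (\<lambda>x. indicator A x * (indicator S x * f x))"
    using assms(3) by (auto simp: indicator_def fun_eq_iff)
  have m: "(\<lambda>x. indicator S x * f x) \<in> L2_on UNIV" using assms(1) by (simp only: L2_on_iff[of _ S])
  have "(\<lambda>x. indicator A x * f x) \<in> borel_measurable borel"
    unfolding e using L2_UNIV_measurable[OF m] assms(2) by measurable
  moreover have "AE x in lborel. \<bar>indicator A x * f x\<bar> \<le> \<bar>indicator S x * f x\<bar>"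
    using assms(3) by (intro AE_I2) (auto simp: indicator_def)
  ultimately show "f \<in> L2_on A" "L2_norm_on A f \<le> L2_norm_on S f"
    using L2_bound[OF m] by (simp_all only: L2_on_iff[of _ A] L2_norm_on_eq[of A] L2_norm_on_eq[of S])
qed

lemma L2_UNIV_on: "f \<in> L2_on UNIV \<Longrightarrow> S \<in> sets borel \<Longrightarrow> f \<in> L2_on S"
  using L2_restrict(1)[of f UNIV S] by simp

lemma indicator_L2:
  assumes "S \<in> sets borel" "bounded S"
  shows "(\<lambda>x. c * indicator S x :: real) \<in> L2_on UNIV"
proof -
  have "emeasure lborel S < \<infinity>" by (rule emeasure_bounded_finite[OF assms(2)])
  moreover have "(\<lambda>x. (c * indicator S x)\<^sup>2) = (\<lambda>x. c\<^sup>2 * indicator S x :: real)" by (auto simp: indicator_def)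
  ultimately show ?thesis using assms(1)
    by (simp add: L2_UNIV) 
qed

lemma bounded_L2_on:
  assumes "S \<in> sets borel" "bounded S" "f \<in> borel_measurable borel" "\<And>x. x \<in> S \<Longrightarrow> \<bar>f x\<bar> \<le> c"
  shows "f \<in> L2_on S"
  unfolding L2_on_iff[of _ S]
proof (rule L2_bound(1)[OF indicator_L2[OF assms(1,2), of c]])
  show "(\<lambda>x. indicator S x * f x) \<in> borel_measurable borel" using assms by measurable
  have "\<bar>indicator S x * f x\<bar> \<le> \<bar>c * indicator S x\<bar>" for x
    using assms(4)[of x] by (auto simp: indicator_def)
  then show "AE x in lborel. \<bar>indicator S x * f x\<bar> \<le> \<bar>c * indicator S x\<bar>" by simp
qed

lemma L2_on_integrable:
  assumes "S \<in> sets borel" "bounded S" "f \<in> L2_on S"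
  shows "set_integrable lborel S f"
  using L2_on_mult_integrable[OF assms(3) bounded_L2_on[OF assms(1,2), of "\<lambda>_. 1" 1]] by simp

lemma L2_mult_bounded:
  assumes "f \<in> L2_on UNIV" "g \<in> borel_measurable borel" "\<And>x. \<bar>g x\<bar> \<le> c"
  shows "(\<lambda>x. g x * f x) \<in> L2_on UNIV" "L2_norm_on UNIV (\<lambda>x. g x * f x) \<le> c * L2_norm_on UNIV f"
proof -
  have c: "c \<ge> 0" using assms(3)[of undefined] by linarith
  have "\<bar>g x * f x\<bar> \<le> \<bar>c * f x\<bar>" for x
    using assms(3)[of x] c by (simp add: abs_mult mult_right_mono)
  moreover have "(\<lambda>x. g x * f x) \<in> borel_measurable borel" using assms L2_UNIV_measurable[OF assms(1)] by measurable
  ultimately show "(\<lambda>x. g x * f x) \<in> L2_on UNIV" "L2_norm_on UNIV (\<lambda>x. g x * f x) \<le> c * L2_norm_on UNIV f"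
    using L2_bound[OF L2_scale[OF assms(1), of c]] c by (auto simp: L2_norm_scale)
qed

lemma L2_dominated_convergence:
  fixes g :: "nat \<Rightarrow> 'a::euclidean_space \<Rightarrow> real"
  assumes "\<And>n. g n \<in> borel_measurable borel" "f \<in> borel_measurable borel" "h \<in> L2_on UNIV"
    "AE x in lborel. (\<lambda>n. g n x) \<longlonglongrightarrow> f x" "\<And>n. AE x in lborel. \<bar>g n x\<bar> \<le> h x"
  shows "(\<lambda>n. L2_norm_on UNIV (\<lambda>x. g n x - f x)) \<longlonglongrightarrow> 0"
proof -
  have all: "AE x in lborel. \<forall>n. \<bar>g n x\<bar> \<le> h x" using assms(5) by (simp add: AE_all_countable)
  have "(\<lambda>n. \<integral>x. (g n x - f x)\<^sup>2 \<partial>lborel) \<longlonglongrightarrow> (\<integral>x. 0 \<partial>(lborel::'a measure))"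
  proof (rule integral_dominated_convergence[where w="\<lambda>x. 4 * (h x)\<^sup>2"])
    show "integrable lborel (\<lambda>x. 4 * (h x)\<^sup>2)" using assms(3) by (simp add: L2_UNIV)
    show "AE x in lborel. (\<lambda>i. (g i x - f x)\<^sup>2) \<longlonglongrightarrow> 0"
      using assms(4)
    proof eventually_elim
      fix x assume "(\<lambda>n. g n x) \<longlonglongrightarrow> f x"
      then have "(\<lambda>n. (g n x - f x)\<^sup>2) \<longlonglongrightarrow> (f x - f x)\<^sup>2" by (intro tendsto_intros)
      then show "(\<lambda>i. (g i x - f x)\<^sup>2) \<longlonglongrightarrow> 0" by simp
    qed
    fix n show "AE x in lborel. norm ((g n x - f x)\<^sup>2) \<le> 4 * (h x)\<^sup>2"
      using all assms(4)
    proof eventually_elim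
      fix x assume a: "\<forall>n. \<bar>g n x\<bar> \<le> h x" and l: "(\<lambda>n. g n x) \<longlonglongrightarrow> f x"
      have "\<bar>f x\<bar> \<le> h x" using tendsto_rabs[OF l] a by (auto intro: LIMSEQ_le_const2)
      then have "\<bar>g n x - f x\<bar> \<le> \<bar>2 * h x\<bar>" using a[rule_format, of n] by linarith
      then show "norm ((g n x - f x)\<^sup>2) \<le> 4 * (h x)\<^sup>2"
        unfolding abs_le_square_iff by (simp add: power_mult_distrib)
    qed
  qed (use assms in measurable)
  then have "(\<lambda>n. sqrt (\<integral>x. (g n x - f x)\<^sup>2 \<partial>lborel)) \<longlonglongrightarrow> sqrt 0" by (intro tendsto_real_sqrt) simp
  then show ?thesis by (simp add: L2_norm_on_def set_lebesgue_integral_def)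
qed

lemma L2_norm_zero_iff:
  assumes "f \<in> L2_on UNIV"
  shows "L2_norm_on UNIV f = 0 \<longleftrightarrow> (AE x in lborel. f x = 0)"
proof -
  have "L2_norm_on UNIV f = 0 \<longleftrightarrow> (\<integral>x. (f x)\<^sup>2 \<partial>lborel) = 0"
    by (simp add: L2_norm_on_def set_lebesgue_integral_def)
  also have "\<dots> \<longleftrightarrow> (AE x in lborel. (f x)\<^sup>2 = 0)"
    using assms by (intro integral_nonneg_eq_0_iff_AE) (auto simp: L2_UNIV)
  finally show ?thesis by simp
qed

lemma L2_norm_cong_AE:
  assumes "AE x in lborel. x \<in> S \<longrightarrow> f x = g x" "f \<in> L2_on S" "g \<in> L2_on S"
  shows "L2_norm_on S f = L2_norm_on S g"
proof -
  have m: "(\<lambda>x. indicator S x * f x) \<in> borel_measurable borel" "(\<lambda>x. indicator S x * g x) \<in> borel_measurable borel"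
    using assms(2,3) by (simp_all only: L2_on_iff[of _ S] L2_UNIV_measurable)
  have "(\<integral>x. (indicator S x * f x)\<^sup>2 \<partial>lborel) = (\<integral>x. (indicator S x * g x)\<^sup>2 \<partial>lborel)"
  proof (rule integral_cong_AE)
    show "AE x in lborel. (indicator S x * f x)\<^sup>2 = (indicator S x * g x)\<^sup>2"
      using assms(1) by eventually_elim (auto simp: indicator_def)
  qed (use m in measurable)
  then show ?thesis
    unfolding L2_norm_on_eq[of S] by (simp add: L2_norm_on_def set_lebesgue_integral_def)
qed

lemma L2_inner_tendsto:
  fixes f :: "'i \<Rightarrow> 'a::euclidean_space \<Rightarrow> real"
  assumes "\<And>i. f i \<in> L2_on S" "h \<in> L2_on S" "g \<in> L2_on S"
    "((\<lambda>i. L2_norm_on S (\<lambda>x. f i x - h x)) \<longlongrightarrow> 0) F"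
  shows "((\<lambda>i. LINT x:S|lborel. f i x * g x) \<longlongrightarrow> (LINT x:S|lborel. h x * g x)) F"
proof (rule Lim_null[THEN iffD2], rule Lim_null_comparison)
  have "norm ((LINT x:S|lborel. f i x * g x) - (LINT x:S|lborel. h x * g x))
      \<le> L2_norm_on S (\<lambda>x. f i x - h x) * L2_norm_on S g" for i
  proof -
    have "(LINT x:S|lborel. f i x * g x) - (LINT x:S|lborel. h x * g x) = (LINT x:S|lborel. (f i x - h x) * g x)"
      using L2_on_mult_integrable[OF assms(1)[of i] assms(3)] L2_on_mult_integrable[OF assms(2,3)]
      by (simp add: left_diff_distrib)
    then show ?thesis using L2_Cauchy_Schwarz[OF L2_diff[OF assms(1)[of i] assms(2)] assms(3)] by simp
  qed
  then show "\<forall>\<^sub>F i in F. norm ((LINT x:S|lborel. f i x * g x) - (LINT x:S|lborel. h x * g x))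
      \<le> L2_norm_on S (\<lambda>x. f i x - h x) * L2_norm_on S g" by simp
  show "((\<lambda>i. L2_norm_on S (\<lambda>x. f i x - h x) * L2_norm_on S g) \<longlongrightarrow> 0) F"
    using tendsto_mult_right[OF assms(4), of "L2_norm_on S g"] by simp
qed

section \<open>Density of compactly supported C2 functions in L2\<close>

definition C2_supported :: "real \<Rightarrow> real \<Rightarrow> (real \<Rightarrow> real) \<Rightarrow> (real \<Rightarrow> real) \<Rightarrow> (real \<Rightarrow> real) \<Rightarrow> bool" where
  "C2_supported b c f f' f'' \<longleftrightarrow>
     (\<forall>x. (f has_real_derivative f' x) (at x)) \<and> (\<forall>x. (f' has_real_derivative f'' x) (at x)) \<and>
     continuous_on UNIV f'' \<and> (\<exists>d>0. \<forall>x. f x \<noteq> 0 \<longrightarrow> b + d \<le> x \<and> x \<le> c - d)"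

text \<open>Measurability in the sense of \<open>measurable_on\<close> yields continuous functions
  converging to \<open>f\<close> almost everywhere, but no dominating function. Clipping the values
  by \<open>cl m\<close> and multiplying by the plateau \<open>z m\<close> supplies one. The same
  truncation is applied to \<open>f\<close> first, so two dominated limits remain: \<open>m\<close>
  is fixed by the first, \<open>n\<close> by the second.\<close>

lemma L2_dense_continuous:
  fixes f :: "real \<Rightarrow> real"
  assumes f: "f \<in> L2_on {b<..<c}" and e: "e > 0"
  shows "\<exists>g. continuous_on UNIV g \<and> (\<exists>d>0. \<forall>x. g x \<noteq> 0 \<longrightarrow> b + d \<le> x \<and> x \<le> c - d) \<and>
    L2_norm_on {b<..<c} (\<lambda>x. g x - f x) < (e::real)"
proof -
  define f0 where "f0 x = indicator {b<..<c} x * f x" for x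
  have f0: "f0 \<in> L2_on UNIV" using f unfolding f0_def by (simp only: L2_on_iff[of _ "{b<..<c}"])
  note m0 = L2_UNIV_measurable[OF f0]
  have "f0 \<in> borel_measurable lebesgue" using m0 by (simp add: measurable_completion)
  then have "f0 measurable_on UNIV" by (rule lebesgue_measurable_imp_measurable_on) simp
  then obtain N g where N: "negligible N" and g: "\<And>n. continuous_on UNIV (g n)"
    and lim: "\<And>x. x \<notin> N \<Longrightarrow> (\<lambda>n. g n x) \<longlonglongrightarrow> f0 x"
    unfolding measurable_on_def by auto
  have "AE x in lebesgue. x \<notin> N" using N by (simp add: negligible_iff_null_sets AE_not_in)
  then have aeN: "AE x in lborel. x \<notin> N" by (simp add: AE_completion_iff)
  \<comment> \<open>\<open>z m\<close> vanishes within \<open>1 / real (Suc m)\<close> of either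
    endpoint, which yields the required gap, and it equals one at each interior point as soon as
    \<open>m\<close> is large.\<close>
  define z where "z m x = max 0 (min 1 (real (Suc m) * (x - b) - 1)) * max 0 (min 1 (real (Suc m) * (c - x) - 1))" for m x
  define cl where "cl m y = max (- real m) (min (real m) y)" for m y
  have zc: "continuous_on UNIV (z m)" for m unfolding z_def by (intro continuous_intros)
  have clc: "continuous_on UNIV (cl m)" for m unfolding cl_def by (intro continuous_intros)
  have z01: "0 \<le> z m x" "z m x \<le> 1" for m x
    unfolding z_def by (auto intro!: mult_nonneg_nonneg mult_le_one)
  have clb: "\<bar>cl m y\<bar> \<le> \<bar>y\<bar>" "\<bar>cl m y\<bar> \<le> real m" for m y unfolding cl_def by auto
  have zsupp: "b + 1 / real (Suc m) \<le> x \<and> x \<le> c - 1 / real (Suc m)" if "z m x \<noteq> 0" for m x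
  proof -
    have "real (Suc m) * (x - b) - 1 > 0" "real (Suc m) * (c - x) - 1 > 0" using that unfolding z_def by auto
    then have "1 / real (Suc m) < x - b" "1 / real (Suc m) < c - x"
      by (simp_all add: divide_less_eq mult.commute)
    then show ?thesis by linarith
  qed
  have zm: "z m \<in> borel_measurable borel" for m using zc by (rule borel_measurable_continuous_onI)
  have clm: "cl m \<in> borel_measurable borel" for m using clc by (rule borel_measurable_continuous_onI)
  have gm: "g m \<in> borel_measurable borel" for m using g by (rule borel_measurable_continuous_onI)
  have 1: "(\<lambda>m. L2_norm_on UNIV (\<lambda>x. z m x * cl m (f0 x) - f0 x)) \<longlonglongrightarrow> 0"
  proof (rule L2_dominated_convergence)
    show "(\<lambda>x. \<bar>f0 x\<bar>) \<in> L2_on UNIV" using f0 m0 by (simp add: L2_UNIV)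
    show "(\<lambda>x. z n x * cl n (f0 x)) \<in> borel_measurable borel" for n
      using zm[of n] measurable_compose[OF m0 clm[of n]] by measurable
    show "AE x in lborel. \<bar>z n x * cl n (f0 x)\<bar> \<le> \<bar>f0 x\<bar>" for n
    proof (rule AE_I2)
      fix x have "\<bar>z n x * cl n (f0 x)\<bar> \<le> 1 * \<bar>f0 x\<bar>"
        unfolding abs_mult using z01[of n x] clb(1)[of n "f0 x"] by (intro mult_mono) auto
      then show "\<bar>z n x * cl n (f0 x)\<bar> \<le> \<bar>f0 x\<bar>" by simp
    qed
    show "AE x in lborel. (\<lambda>n. z n x * cl n (f0 x)) \<longlonglongrightarrow> f0 x"
    proof (rule AE_I2)
      fix x show "(\<lambda>n. z n x * cl n (f0 x)) \<longlonglongrightarrow> f0 x"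
      proof (cases "b < x \<and> x < c")
        case False
        then show ?thesis by (simp add: f0_def cl_def)
      next
        case True
        obtain n0 where n0: "real n0 \<ge> max (\<bar>f0 x\<bar>) (max (2/(x-b)) (2/(c-x)))" using real_arch_simple by blast
        have "z n x * cl n (f0 x) = f0 x" if "n \<ge> n0" for n
        proof -
          have n: "real (Suc n) \<ge> 2/(x-b)" "real (Suc n) \<ge> 2/(c-x)" "real n \<ge> \<bar>f0 x\<bar>" using n0 that by auto
          have "real (Suc n) * (x - b) \<ge> 2" "real (Suc n) * (c - x) \<ge> 2"
            using n True by (simp_all add: divide_le_eq)
          then have "z n x = 1" unfolding z_def by simp
          moreover have "cl n (f0 x) = f0 x" using n(3) unfolding cl_def by auto
          ultimately show ?thesis by simp
        qed
        then show ?thesis by (intro tendsto_eventually eventually_sequentiallyI[of n0])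
      qed
    qed
  qed (use m0 in auto)
  then have "\<forall>\<^sub>F m in sequentially. L2_norm_on UNIV (\<lambda>x. z m x * cl m (f0 x) - f0 x) < e/2"
    using e by (intro order_tendstoD(2)) auto
  then obtain m where m: "L2_norm_on UNIV (\<lambda>x. z m x * cl m (f0 x) - f0 x) < e/2"
    by (auto simp: eventually_sequentially)
  have clf: "(\<lambda>x. z m x * cl m (f0 x)) \<in> borel_measurable borel"
    using zm[of m] measurable_compose[OF m0 clm[of m]] by measurable
  have clg: "(\<lambda>x. z m x * cl m (g n x)) \<in> borel_measurable borel" for n
    using zm[of m] measurable_compose[OF gm clm[of m]] by measurable
  have ind: "(\<lambda>x. real m * indicator {b..c} x) \<in> L2_on UNIV" by (rule indicator_L2) auto
  have bd: "\<bar>z m x * cl m y\<bar> \<le> real m * indicator {b..c} x" for x y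
  proof (cases "z m x = 0")
    case False
    have "0 \<le> 1 / real (Suc m)" by simp
    then have "x \<in> {b..c}" using zsupp[OF False] unfolding atLeastAtMost_iff by linarith
    moreover have "\<bar>z m x * cl m y\<bar> \<le> 1 * real m"
      unfolding abs_mult using z01[of m x] clb(2)[of m y] by (intro mult_mono) auto
    ultimately show ?thesis by simp
  qed simp
  have 2: "(\<lambda>n. L2_norm_on UNIV (\<lambda>x. z m x * cl m (g n x) - z m x * cl m (f0 x))) \<longlonglongrightarrow> 0"
  proof (rule L2_dominated_convergence[OF clg clf ind])
    show "AE x in lborel. (\<lambda>n. z m x * cl m (g n x)) \<longlonglongrightarrow> z m x * cl m (f0 x)"
      using aeN
    proof eventually_elim
      fix x assume "x \<notin> N"
      then have "(\<lambda>n. cl m (g n x)) \<longlonglongrightarrow> cl m (f0 x)"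
        using lim clc[of m] by (auto simp: continuous_on_eq_continuous_at intro: isCont_tendsto_compose)
      then show "(\<lambda>n. z m x * cl m (g n x)) \<longlonglongrightarrow> z m x * cl m (f0 x)" by (intro tendsto_intros)
    qed
  qed (use bd in auto)
  then have "\<forall>\<^sub>F n in sequentially. L2_norm_on UNIV (\<lambda>x. z m x * cl m (g n x) - z m x * cl m (f0 x)) < e/2"
    using e by (intro order_tendstoD(2)) auto
  then obtain n where n: "L2_norm_on UNIV (\<lambda>x. z m x * cl m (g n x) - z m x * cl m (f0 x)) < e/2"
    by (auto simp: eventually_sequentially)
  let ?h = "\<lambda>x. z m x * cl m (g n x)"
  have in2: "(\<lambda>x. z m x * cl m (f0 x)) \<in> L2_on UNIV" "?h \<in> L2_on UNIV"
    using L2_bound(1)[OF ind clf AE_I2[OF order_trans[OF bd abs_ge_self]]]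
      L2_bound(1)[OF ind clg AE_I2[OF order_trans[OF bd abs_ge_self]]] .
  have "L2_norm_on UNIV (\<lambda>x. ?h x - f0 x) < e"
    using L2_norm_triangle3[OF in2(2,1) f0] m n by linarith
  moreover have "(\<lambda>x. indicator {b<..<c} x * (?h x - f x)) = (\<lambda>x. ?h x - f0 x)"
  proof
    fix x
    have "z m x = 0" if "\<not> (b < x \<and> x < c)"
    proof (rule ccontr)
      assume "z m x \<noteq> 0"
      from zsupp[OF this] that show False
        using divide_pos_pos[of 1 "real (Suc m)"] by linarith
    qed
    then show "indicator {b<..<c} x * (?h x - f x) = ?h x - f0 x"
      by (auto simp: f0_def indicator_def)
  qed
  ultimately have "L2_norm_on {b<..<c} (\<lambda>x. ?h x - f x) < e" unfolding L2_norm_on_eq[of "{b<..<c}"] by simp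
  moreover have "continuous_on UNIV ?h"
    using zc[of m] clc[of m] g[of n] by (intro continuous_on_mult continuous_on_compose2[OF clc g]) auto
  moreover have "\<exists>d>0. \<forall>x. ?h x \<noteq> 0 \<longrightarrow> b + d \<le> x \<and> x \<le> c - d"
    using zsupp[of m] by (intro exI[of _ "1 / real (Suc m)"]) auto
  ultimately show ?thesis by (intro exI[of _ ?h]) auto
qed

lemma compact_support_uniformly_continuous:
  fixes g :: "real \<Rightarrow> real"
  assumes "continuous_on UNIV g" "\<And>x. g x \<noteq> 0 \<Longrightarrow> p \<le> x \<and> x \<le> q" "e > 0"
  shows "\<exists>d>0. \<forall>x y. \<bar>x - y\<bar> < d \<longrightarrow> \<bar>g x - g y\<bar> < e"
proof -
  have "uniformly_continuous_on {p-1..q+1} g"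
    by (intro compact_uniformly_continuous) (auto intro: continuous_on_subset[OF assms(1)])
  then obtain d where d: "d > 0" "\<And>x y. x \<in> {p-1..q+1} \<Longrightarrow> y \<in> {p-1..q+1} \<Longrightarrow> dist y x < d \<Longrightarrow> dist (g y) (g x) < e"
    using assms(3) unfolding uniformly_continuous_on_def by blast
  have "\<bar>g x - g y\<bar> < e" if xy: "\<bar>x - y\<bar> < min d 1" for x y
  proof (cases "g x = 0 \<and> g y = 0")
    case True then show ?thesis using assms(3) by simp
  next
    case False
    then have "x \<in> {p-1..q+1}" "y \<in> {p-1..q+1}" using xy assms(2)[of x] assms(2)[of y] by (auto simp: abs_less_iff)
    then show ?thesis using d(2)[of y x] xy by (simp add: dist_real_def)
  qed
  then show ?thesis using d(1) by (intro exI[of _ "min d 1"]) auto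
qed

lemma compact_support_bounded:
  fixes g :: "real \<Rightarrow> real"
  assumes "continuous_on UNIV g" "\<And>x. g x \<noteq> 0 \<Longrightarrow> p \<le> x \<and> x \<le> q"
  obtains B where "B > 0" "\<And>x. \<bar>g x\<bar> \<le> B"
proof -
  have "compact (g ` {p..q})" by (intro compact_continuous_image continuous_on_subset[OF assms(1)]) auto
  then have "bounded (g ` {p..q})" by (rule compact_imp_bounded)
  then obtain B where B: "B > 0" "\<And>x. x \<in> {p..q} \<Longrightarrow> \<bar>g x\<bar> \<le> B" unfolding bounded_pos by auto
  have "\<bar>g x\<bar> \<le> B" for x using B assms(2)[of x] by (cases "g x = 0") auto
  with B(1) that show ?thesis by blast
qed

lemma antiderivative_UNIV:
  fixes g :: "real \<Rightarrow> real"
  assumes "continuous_on UNIV g"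
  shows "\<exists>G. \<forall>x. (G has_real_derivative g x) (at x)"
proof -
  have "\<exists>F. \<forall>x. -\<infinity> < ereal x \<longrightarrow> ereal x < \<infinity> \<longrightarrow> (F has_vector_derivative g x) (at x)"
    using assms by (intro einterval_antiderivative) (auto simp: continuous_on_eq_continuous_at)
  then show ?thesis by (auto simp: has_real_derivative_iff_has_vector_derivative)
qed

text \<open>The mean of \<open>g\<close> over \<open>(x, x + h)\<close> is a difference quotient of
  an antiderivative: it has one derivative more than \<open>g\<close>, is a value of
  \<open>g\<close> at a nearby point by the mean value theorem, and has its support enlarged by at
  most \<open>h\<close>, to the left.\<close>

lemma average_approximation:
  fixes g :: "real \<Rightarrow> real"
  assumes g: "continuous_on UNIV g" "\<And>x. g x \<noteq> 0 \<Longrightarrow> p \<le> x \<and> x \<le> q" and "e > 0" "d > 0"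
  shows "\<exists>h g1. 0 < h \<and> h \<le> d \<and> (\<forall>x. \<bar>g1 x - g x\<bar> \<le> e) \<and>
     (\<forall>x. (g1 has_real_derivative (g (x + h) - g x) / h) (at x)) \<and> (\<forall>x. g1 x \<noteq> 0 \<longrightarrow> p - d \<le> x \<and> x \<le> q)"
proof -
  obtain G where G: "\<And>x. (G has_real_derivative g x) (at x)" using antiderivative_UNIV[OF g(1)] by auto
  obtain d' where d': "d' > 0" "\<And>x y. \<bar>x - y\<bar> < d' \<Longrightarrow> \<bar>g x - g y\<bar> < e"
    using compact_support_uniformly_continuous[OF g assms(3)] by auto
  define h where "h = min d (d'/2)"
  have h: "0 < h" "h \<le> d" "h < d'" using d' assms unfolding h_def by auto
  let ?g1 = "\<lambda>x. (G (x + h) - G x) / h"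
  have mv: "\<exists>y. x < y \<and> y < x + h \<and> ?g1 x = g y" for x
  proof -
    obtain y where "x < y" "y < x + h" "G (x + h) - G x = (x + h - x) * g y"
      using MVT2[of x "x+h" G g] h G by auto
    then show ?thesis using h by (intro exI[of _ y]) auto
  qed
  have a1: "\<bar>?g1 x - g x\<bar> \<le> e" for x
  proof -
    obtain y where "x < y" "y < x + h" "?g1 x = g y" using mv[of x] by auto
    then show ?thesis using d'(2)[of y x] h by (simp add: abs_less_iff) linarith
  qed
  have a2: "(?g1 has_real_derivative (g (x + h) - g x) / h) (at x)" for x
    using h by (auto intro!: derivative_eq_intros DERIV_chain'[OF _ G, of "\<lambda>x. x + h" 1, simplified] G)
  have a3: "p - d \<le> x \<and> x \<le> q" if "?g1 x \<noteq> 0" for x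
  proof -
    obtain y where y: "x < y" "y < x + h" "?g1 x = g y" using mv[of x] by auto
    then have "p \<le> y \<and> y \<le> q" using g(2)[of y] that by simp
    then show ?thesis using y(1,2) h(2) by linarith
  qed
  show ?thesis by (rule exI[of _ h], rule exI[of _ ?g1]) (intro conjI allI impI h a1 a2 a3)
qed

lemma L2_norm_le_uniform:
  fixes f :: "real \<Rightarrow> real"
  assumes "\<And>x. b < x \<Longrightarrow> x < c \<Longrightarrow> \<bar>f x\<bar> \<le> e" "f \<in> borel_measurable borel" "b \<le> c" "e \<ge> 0"
  shows "L2_norm_on {b<..<c} f \<le> e * sqrt (c - b)"
proof -
  have "(LINT x:{b<..<c}|lborel. (f x)\<^sup>2) \<le> (LINT x:{b<..<c}|lborel. e\<^sup>2)"
  proof (rule set_integral_mono)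
    have "f \<in> L2_on {b<..<c}" by (rule bounded_L2_on[of _ _ e]) (use assms in auto)
    then show "set_integrable lborel {b<..<c} (\<lambda>x. (f x)\<^sup>2)" by (simp add: L2_on_def)
    show "set_integrable lborel {b<..<c} (\<lambda>x. e\<^sup>2)" unfolding set_integrable_def using assms(3) by simp
    show "\<And>x. x \<in> {b<..<c} \<Longrightarrow> (f x)\<^sup>2 \<le> e\<^sup>2"
      using assms(1,4) by (auto intro: power2_le_iff_abs_le[THEN iffD2])
  qed
  also have "\<dots> = e\<^sup>2 * (c - b)" using assms(3) by (simp add: set_lebesgue_integral_def)
  finally show ?thesis unfolding L2_norm_on_def
    using assms(4) by (metis real_sqrt_le_iff real_sqrt_mult real_sqrt_abs abs_of_nonneg)
qed

text \<open>Two successive means turn a continuous function into a C2 one. Each may use up a quarter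
  of the gap \<open>d\<close>, which leaves \<open>d/2\<close>.\<close>

lemma L2_dense_C2:
  assumes f: "f \<in> L2_on {b<..<c}" and e: "e > 0" and bc: "b < c"
  shows "\<exists>g g' g''. C2_supported b c g g' g'' \<and> L2_norm_on {b<..<c} (\<lambda>x. g x - f x) < (e::real)"
proof -
  obtain g d where g: "continuous_on UNIV g" "d > 0" "\<And>x. g x \<noteq> 0 \<Longrightarrow> b + d \<le> x \<and> x \<le> c - d"
    and ge: "L2_norm_on {b<..<c} (\<lambda>x. g x - f x) < e/2"
    using L2_dense_continuous[OF f, of "e/2"] e by auto
  \<comment> \<open>Two sup-norm errors \<open>r\<close> cost \<open>2 * r * sqrt (c - b)\<close> in
    L2, which is then at most \<open>e/4\<close>.\<close>
  define r where "r = e / 8 / (1 + sqrt (c - b))"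
  have sp: "0 < 1 + sqrt (c - b)" using bc by (simp add: add_pos_nonneg)
  have r: "r > 0" using e sp unfolding r_def by simp
  obtain h1 g1 where h1: "0 < h1" "h1 \<le> d/4" and g1: "\<And>x. \<bar>g1 x - g x\<bar> \<le> r"
    "\<And>x. (g1 has_real_derivative (g (x + h1) - g x) / h1) (at x)" "\<And>x. g1 x \<noteq> 0 \<Longrightarrow> b + d - d/4 \<le> x \<and> x \<le> c - d"
    using average_approximation[OF g(1,3) r, of "d/4"] g(2) by auto
  have g1c: "continuous_on UNIV g1" using g1(2) by (auto simp: continuous_on_eq_continuous_at intro: DERIV_isCont)
  obtain h2 g2 where h2: "0 < h2" "h2 \<le> d/4" and g2: "\<And>x. \<bar>g2 x - g1 x\<bar> \<le> r"
    "\<And>x. (g2 has_real_derivative (g1 (x + h2) - g1 x) / h2) (at x)" "\<And>x. g2 x \<noteq> 0 \<Longrightarrow> b + d - d/4 - d/4 \<le> x \<and> x \<le> c - d"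
    using average_approximation[OF g1c g1(3) r, of "d/4"] g(2) by auto
  have g2c: "continuous_on UNIV g2" using g2(2) by (auto simp: continuous_on_eq_continuous_at intro: DERIV_isCont)
  define g1' where "g1' x = (g (x + h1) - g x) / h1" for x
  have "C2_supported b c g2 (\<lambda>x. (g1 (x + h2) - g1 x) / h2) (\<lambda>x. (g1' (x + h2) - g1' x) / h2)"
    unfolding C2_supported_def
  proof (intro conjI allI)
    show "(g2 has_real_derivative (g1 (x + h2) - g1 x) / h2) (at x)" for x by (rule g2)
    have d1: "(g1 has_real_derivative g1' x) (at x)" for x using g1(2) by (simp add: g1'_def)
    show "((\<lambda>x. (g1 (x + h2) - g1 x) / h2) has_real_derivative (g1' (x + h2) - g1' x) / h2) (at x)" for x
      using h2 by (auto intro!: derivative_eq_intros DERIV_chain'[OF _ d1, of "\<lambda>x. x + h2" 1, simplified] d1)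
    show "continuous_on UNIV (\<lambda>x. (g1' (x + h2) - g1' x) / h2)"
      unfolding g1'_def using h1 h2 by (intro continuous_intros continuous_on_compose2[OF g(1)]) auto
    show "\<exists>d>0. \<forall>x. g2 x \<noteq> 0 \<longrightarrow> b + d \<le> x \<and> x \<le> c - d"
      using g2(3) g(2) by (intro exI[of _ "d/2"]) (auto dest!: g2(3))
  qed
  moreover have "L2_norm_on {b<..<c} (\<lambda>x. g2 x - f x) < e"
  proof -
    have m: "g \<in> borel_measurable borel" "g2 \<in> borel_measurable borel"
      using g(1) g2c by (auto intro: borel_measurable_continuous_onI)
    have supp: "g x = 0" "g2 x = 0" if "x \<notin> {b<..<c}" for x
    proof -
      show "g x = 0" using g(3)[of x] that g(2) by (cases "g x = 0") auto
      show "g2 x = 0" using g2(3)[of x] that g(2) by (cases "g2 x = 0") auto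
    qed
    obtain B1 where "\<And>x. \<bar>g x\<bar> \<le> B1" using compact_support_bounded[OF g(1,3)] by blast
    then have gL: "g \<in> L2_on {b<..<c}" using m by (intro bounded_L2_on[of _ _ B1]) auto
    obtain B2 where "\<And>x. \<bar>g2 x\<bar> \<le> B2" using compact_support_bounded[OF g2c g2(3)] by blast
    then have g2L: "g2 \<in> L2_on {b<..<c}" using m by (intro bounded_L2_on[of _ _ B2]) auto
    have "\<bar>g2 x - g x\<bar> \<le> 2 * r" for x using g1(1)[of x] g2(1)[of x] by linarith
    then have "L2_norm_on {b<..<c} (\<lambda>x. g2 x - g x) \<le> 2 * r * sqrt (c - b)"
      using m bc r by (intro L2_norm_le_uniform) auto
    also have "\<dots> \<le> 2 * r * (1 + sqrt (c - b))" using r by (intro mult_left_mono) auto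
    also have "\<dots> = e/4" using sp unfolding r_def by (simp add: field_simps)
    finally show ?thesis using L2_norm_triangle3[OF g2L gL f] ge e by linarith
  qed
  ultimately show ?thesis by blast
qed

section \<open>Affine changes of variable in L2\<close>

lemma integral_affine:
  fixes f :: "real \<Rightarrow> real"
  assumes "a \<noteq> 0"
  shows "(\<integral>x. f (a * x + b) \<partial>lborel) = (\<integral>x. f x \<partial>lborel) / \<bar>a\<bar>"
  using lborel_integral_real_affine[OF assms, of f b] assms by (simp add: add.commute)

lemma integrable_affine:
  fixes f :: "real \<Rightarrow> real"
  assumes "a \<noteq> 0" "integrable lborel f"
  shows "integrable lborel (\<lambda>x. f (a * x + b))"
  using lborel_integrable_real_affine[OF assms(2,1), of b] by (simp add: add.commute)

lemma L2_affine:
  assumes "f \<in> L2_on UNIV" "a \<noteq> (0::real)"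
  shows "(\<lambda>x. f (a * x + b)) \<in> L2_on UNIV" "L2_norm_on UNIV (\<lambda>x. f (a * x + b)) = L2_norm_on UNIV f / sqrt \<bar>a\<bar>"
proof -
  have "(\<lambda>x. f (a * x + b)) \<in> borel_measurable borel"
    using L2_UNIV_measurable[OF assms(1)] by measurable
  then show "(\<lambda>x. f (a * x + b)) \<in> L2_on UNIV"
    using integrable_affine[OF assms(2), of "\<lambda>x. (f x)\<^sup>2" b] assms(1) by (simp add: L2_UNIV)
  show "L2_norm_on UNIV (\<lambda>x. f (a * x + b)) = L2_norm_on UNIV f / sqrt \<bar>a\<bar>"
    using integral_affine[OF assms(2), of "\<lambda>x. (f x)\<^sup>2" b]
    by (simp add: L2_norm_on_def set_lebesgue_integral_def real_sqrt_divide)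
qed

lemma L2_approx_UNIV:
  fixes f :: "real \<Rightarrow> real"
  assumes f: "f \<in> L2_on UNIV" and e: "e > 0"
  shows "\<exists>g R. continuous_on UNIV g \<and> R > 0 \<and> (\<forall>x. g x \<noteq> 0 \<longrightarrow> \<bar>x\<bar> \<le> R) \<and> L2_norm_on UNIV (\<lambda>x. g x - f x) < e"
proof -
  note m = L2_UNIV_measurable[OF f]
  have "(\<lambda>n. L2_norm_on UNIV (\<lambda>x. indicator {- real n<..<real n} x * f x - f x)) \<longlonglongrightarrow> 0"
  proof (rule L2_dominated_convergence)
    show "(\<lambda>x. \<bar>f x\<bar>) \<in> L2_on UNIV" using f m by (simp add: L2_UNIV)
    show "AE x in lborel. (\<lambda>n. indicator {- real n<..<real n} x * f x) \<longlonglongrightarrow> f x"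
    proof (rule AE_I2)
      fix x
      obtain n0 where "real n0 > \<bar>x\<bar>" using reals_Archimedean2 by blast
      then have "indicator {- real n<..<real n} x * f x = f x" if "n \<ge> n0" for n
        using that by (auto simp: indicator_def abs_less_iff)
      then show "(\<lambda>n. indicator {- real n<..<real n} x * f x) \<longlonglongrightarrow> f x"
        by (intro tendsto_eventually eventually_sequentiallyI[of n0])
    qed
    show "AE x in lborel. \<bar>indicator {- real n<..<real n} x * f x\<bar> \<le> \<bar>f x\<bar>" for n
      by (auto simp: indicator_def)
  qed (use m in auto)
  then have "\<forall>\<^sub>F n in sequentially. L2_norm_on UNIV (\<lambda>x. indicator {- real n<..<real n} x * f x - f x) < e/2 \<and> n \<ge> 1"
    using e by (intro eventually_conj order_tendstoD(2) eventually_ge_at_top) auto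
  then obtain n where n: "L2_norm_on UNIV (\<lambda>x. indicator {- real n<..<real n} x * f x - f x) < e/2" "n \<ge> 1"
    by (auto simp: eventually_sequentially)
  have fn: "f \<in> L2_on {- real n<..<real n}" by (rule L2_UNIV_on[OF f]) simp
  obtain g d where g: "continuous_on UNIV g" "d > 0" "\<And>x. g x \<noteq> 0 \<Longrightarrow> - real n + d \<le> x \<and> x \<le> real n - d"
    and ge: "L2_norm_on {- real n<..<real n} (\<lambda>x. g x - f x) < e/2"
    using L2_dense_continuous[OF fn, of "e/2"] e by auto
  obtain B where B: "\<And>x. \<bar>g x\<bar> \<le> B" using compact_support_bounded[OF g(1,3)] by blast
  have g0: "g x = 0" if "x \<notin> {- real n<..<real n}" for x using g(3)[of x] that g(2) by (cases "g x = 0") auto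
  have ig: "(\<lambda>x. indicator {- real n<..<real n} x * g x) = g" using g0 by (auto simp: indicator_def fun_eq_iff)
  have gL: "g \<in> L2_on UNIV"
  proof -
    have "g \<in> L2_on {- real n<..<real n}"
      using g(1) B by (intro bounded_L2_on[of _ _ B]) (auto intro: borel_measurable_continuous_onI)
    then show ?thesis unfolding L2_on_iff[of _ "{- real n<..<real n}"] ig .
  qed
  have fL: "(\<lambda>x. indicator {- real n<..<real n} x * f x) \<in> L2_on UNIV"
    using fn by (simp only: L2_on_iff[of _ "{- real n<..<real n}"])
  have "(\<lambda>x. indicator {- real n<..<real n} x * (g x - f x)) = (\<lambda>x. g x - indicator {- real n<..<real n} x * f x)"
    using g0 by (auto simp: indicator_def fun_eq_iff)
  then have "L2_norm_on UNIV (\<lambda>x. g x - indicator {- real n<..<real n} x * f x) < e/2"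
    using ge unfolding L2_norm_on_eq[of "{- real n<..<real n}"] by simp
  then have "L2_norm_on UNIV (\<lambda>x. g x - f x) < e"
    using L2_norm_triangle3[OF gL fL f] n(1) by linarith
  moreover have "\<bar>x\<bar> \<le> real n" if "g x \<noteq> 0" for x using g(3)[OF that] g(2) by auto
  ultimately show ?thesis using g(1) n(2) by (intro exI[of _ g] exI[of _ "real n"]) auto
qed

text \<open>Three-epsilon argument: for a continuous compactly supported \<open>g\<close> the
  convergence is dominated, and the passage from \<open>f\<close> to \<open>g\<close> is uniform in
  \<open>n\<close> because the substitution \<open>A n * x + B n\<close> enlarges L2 norms by at
  most \<open>1 / sqrt c\<close>. The interval \<open>(0, I n)\<close> is allowed to vary because
  the slices of the domain vary with time.\<close>

lemma L2_affine_LIMSEQ: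
  assumes f: "f \<in> L2_on UNIV" and A: "A \<longlonglongrightarrow> a0" and B: "B \<longlonglongrightarrow> b0" and I: "I \<longlonglongrightarrow> i0"
    and c: "c > 0" "\<And>n. c \<le> \<bar>A n\<bar>"
  shows "(\<lambda>n. L2_norm_on UNIV (\<lambda>x::real. indicator {0<..<I n} x * f (A n * x + B n)
             - indicator {0<..<i0} x * f (a0 * x + b0))) \<longlonglongrightarrow> 0"
proof (rule LIMSEQ_I)
  fix e :: real assume e: "e > 0"
  have a0: "c \<le> \<bar>a0\<bar>" using LIMSEQ_le_const[OF tendsto_rabs[OF A]] c(2) by blast
  \<comment> \<open>The factor \<open>sqrt c\<close> offsets the Jacobian, so that
    \<open>r / sqrt c = e/4\<close>.\<close>
  define r where "r = e * sqrt c / 4"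
  have r: "r > 0" using e c(1) unfolding r_def by simp
  obtain g R where g: "continuous_on UNIV g" "R > 0" "\<And>x. g x \<noteq> 0 \<Longrightarrow> \<bar>x\<bar> \<le> R"
    and gf: "L2_norm_on UNIV (\<lambda>x. g x - f x) < r" using L2_approx_UNIV[OF f r] by auto
  have g': "- R \<le> x \<and> x \<le> R" if "g x \<noteq> 0" for x using g(3)[OF that] by auto
  obtain M where M: "M > 0" "\<And>x. \<bar>g x\<bar> \<le> M" using compact_support_bounded[OF g(1) g'] by blast
  obtain Bb where Bb: "\<And>n. \<bar>B n\<bar> \<le> Bb" using convergent_imp_Bseq[OF convergentI[OF B]] unfolding Bseq_def by auto
  have b0: "\<bar>b0\<bar> \<le> Bb" using LIMSEQ_le_const2[OF tendsto_rabs[OF B]] Bb by blast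
  define L where "L = (R + Bb) / c"
  have gm: "g \<in> borel_measurable borel" using g(1) by (rule borel_measurable_continuous_onI)
  have bnd: "\<bar>indicator S x * g (a * x + b)\<bar> \<le> M * indicator {-L..L} x" if "c \<le> \<bar>a\<bar>" "\<bar>b\<bar> \<le> Bb" for S :: "real set" and x a b
  proof (cases "g (a * x + b) = 0")
    case False
    then have "\<bar>a * x + b\<bar> \<le> R" by (rule g)
    then have "\<bar>a\<bar> * \<bar>x\<bar> \<le> R + Bb" using that(2) by (simp add: abs_mult[symmetric])
    moreover have "c * \<bar>x\<bar> \<le> \<bar>a\<bar> * \<bar>x\<bar>" using that(1) by (intro mult_right_mono) auto
    ultimately have "\<bar>x\<bar> \<le> L" unfolding L_def using c(1) by (simp add: le_divide_eq mult.commute)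
    then show ?thesis using M(2)[of "a*x+b"] M(1) by (auto simp: indicator_def abs_le_iff)
  qed (use M in simp)
  have meas: "(\<lambda>x. indicator {0<..<i} x * g (a * x + b)) \<in> borel_measurable borel" for i a b
    using gm by measurable
  have ind: "(\<lambda>x. M * indicator {-L..L} x) \<in> L2_on UNIV" by (rule indicator_L2) auto
  have gL: "(\<lambda>x. indicator {0<..<i} x * g (a * x + b)) \<in> L2_on UNIV" if "c \<le> \<bar>a\<bar>" "\<bar>b\<bar> \<le> Bb" for i a b
    by (rule L2_bound(1)[OF ind meas AE_I2[OF order_trans[OF bnd[OF that] abs_ge_self]]])
  have fL: "(\<lambda>x. indicator {0<..<i} x * f (a * x + b)) \<in> L2_on UNIV" if "c \<le> \<bar>a\<bar>" for i a b
    using L2_mult_bounded(1)[OF L2_affine(1)[OF f, of a b], of "indicator {0<..<i}" 1] that c(1) by auto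
  have gLU: "g \<in> L2_on UNIV"
  proof (rule L2_bound(1)[OF indicator_L2[of "{-R..R}" M] gm])
    show "AE x in lborel. \<bar>g x\<bar> \<le> \<bar>M * indicator {- R..R} x\<bar>"
      using M g' by (intro AE_I2) (auto simp: indicator_def)
  qed auto
  have close: "L2_norm_on UNIV (\<lambda>x. indicator {0<..<i} x * g (a * x + b) - indicator {0<..<i} x * f (a * x + b)) \<le> e/4"
    if "c \<le> \<bar>a\<bar>" for i a b
  proof -
    have h: "(\<lambda>x. g x - f x) \<in> L2_on UNIV" by (rule L2_diff[OF gLU f])
    have a: "a \<noteq> 0" using that c(1) by auto
    have eq: "(\<lambda>x. indicator {0<..<i} x * g (a * x + b) - indicator {0<..<i} x * f (a * x + b))
      = (\<lambda>x. indicator {0<..<i} x * (g (a * x + b) - f (a * x + b)))" by (simp add: algebra_simps)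
    have "L2_norm_on UNIV (\<lambda>x. indicator {0<..<i} x * (g (a * x + b) - f (a * x + b)))
       \<le> 1 * L2_norm_on UNIV (\<lambda>x. g (a * x + b) - f (a * x + b))"
      using L2_mult_bounded(2)[OF L2_affine(1)[OF h a, of b], of "indicator {0<..<i}" 1] by simp
    also have "\<dots> = L2_norm_on UNIV (\<lambda>x. g x - f x) / sqrt \<bar>a\<bar>" using L2_affine(2)[OF h a, of b] by simp
    also have "\<dots> \<le> r / sqrt c" using gf that c(1) r by (intro frac_le) auto
    also have "\<dots> = e/4" unfolding r_def using c(1) by simp
    finally show ?thesis unfolding eq .
  qed
  have "(\<lambda>n. L2_norm_on UNIV (\<lambda>x. indicator {0<..<I n} x * g (A n * x + B n) - indicator {0<..<i0} x * g (a0 * x + b0))) \<longlonglongrightarrow> 0"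
  proof (rule L2_dominated_convergence[OF meas meas ind])
    show "AE x in lborel. \<bar>indicator {0<..<I n} x * g (A n * x + B n)\<bar> \<le> M * indicator {- L..L} x" for n
      using bnd[OF c(2) Bb] by simp
    \<comment> \<open>At \<open>x = i0\<close> itself the indicators of \<open>(0, I n)\<close> may
      fail to converge; this is a null set.\<close>
    have "AE x in lborel. x \<noteq> i0" by (rule AE_lborel_singleton)
    then show "AE x in lborel. (\<lambda>n. indicator {0<..<I n} x * g (A n * x + B n)) \<longlonglongrightarrow> indicator {0<..<i0} x * g (a0 * x + b0)"
    proof eventually_elim
      fix x assume x: "x \<noteq> i0"
      have "(\<lambda>n. g (A n * x + B n)) \<longlonglongrightarrow> g (a0 * x + b0)"
        using g(1) by (intro isCont_tendsto_compose[of _ g]) (auto intro!: tendsto_intros A B simp: continuous_on_eq_continuous_at)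
      moreover have "(\<lambda>n. indicator {0<..<I n} x :: real) \<longlonglongrightarrow> indicator {0<..<i0} x"
      proof (cases "x < i0")
        case True
        then have "\<forall>\<^sub>F n in sequentially. x < I n" using I by (simp add: order_tendstoD(1))
        then have "\<forall>\<^sub>F n in sequentially. (indicator {0<..<I n} x :: real) = indicator {0<..<i0} x"
          by eventually_elim (use True in \<open>auto simp: indicator_def\<close>)
        then show ?thesis by (rule tendsto_eventually)
      next
        case False
        then have "\<forall>\<^sub>F n in sequentially. I n < x" using I x by (simp add: order_tendstoD(2))
        then have "\<forall>\<^sub>F n in sequentially. (indicator {0<..<I n} x :: real) = indicator {0<..<i0} x"
          by eventually_elim (use False in \<open>auto simp: indicator_def\<close>)
        then show ?thesis by (rule tendsto_eventually)
      qed
      ultimately show "(\<lambda>n. indicator {0<..<I n} x * g (A n * x + B n)) \<longlonglongrightarrow> indicator {0<..<i0} x * g (a0 * x + b0)"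
        by (intro tendsto_intros)
    qed
  qed
  then have "\<forall>\<^sub>F n in sequentially. L2_norm_on UNIV (\<lambda>x. indicator {0<..<I n} x * g (A n * x + B n) - indicator {0<..<i0} x * g (a0 * x + b0)) < e/4"
    using e by (intro order_tendstoD(2)) auto
  then obtain n0 where n0: "\<And>n. n \<ge> n0 \<Longrightarrow> L2_norm_on UNIV (\<lambda>x. indicator {0<..<I n} x * g (A n * x + B n) - indicator {0<..<i0} x * g (a0 * x + b0)) < e/4"
    by (auto simp: eventually_sequentially)
  show "\<exists>no. \<forall>n\<ge>no. norm (L2_norm_on UNIV (\<lambda>x. indicator {0<..<I n} x * f (A n * x + B n)
             - indicator {0<..<i0} x * f (a0 * x + b0)) - 0) < e"
  proof (intro exI[of _ n0] allI impI)
    fix n assume n: "n \<ge> n0"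
    note F = fL[OF c(2)[of n], of "I n" "B n"] and F0 = fL[OF a0, of i0 b0]
      and G = gL[OF c(2)[of n] Bb[of n], of "I n"] and G0 = gL[OF a0 b0, of i0]
    have "L2_norm_on UNIV (\<lambda>x. indicator {0<..<I n} x * f (A n * x + B n) - indicator {0<..<i0} x * f (a0 * x + b0))
      \<le> e/4 + e/4 + e/4"
      using L2_norm_triangle3[OF F G F0] L2_norm_triangle3[OF G G0 F0] n0[OF n]
        close[OF c(2)[of n], of "I n" "B n"] close[OF a0, of i0 b0]
        L2_norm_diff_commute[of UNIV "\<lambda>x. indicator {0<..<I n} x * f (A n * x + B n)" "\<lambda>x. indicator {0<..<I n} x * g (A n * x + B n)"]
      by linarith
    then show "norm (L2_norm_on UNIV (\<lambda>x. indicator {0<..<I n} x * f (A n * x + B n)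
             - indicator {0<..<i0} x * f (a0 * x + b0)) - 0) < e" using e by simp
  qed
qed

lemma L2_affine_tendsto:
  assumes f: "f \<in> L2_on UNIV" and A: "continuous_on S A" and B: "continuous_on S B" and I: "continuous_on S I"
    and c: "c > 0" "\<And>t. t \<in> S \<Longrightarrow> c \<le> \<bar>A t\<bar>" and t0: "t0 \<in> (S :: real set)"
  shows "((\<lambda>t. L2_norm_on UNIV (\<lambda>x::real. indicator {0<..<I t} x * f (A t * x + B t)
             - indicator {0<..<I t0} x * f (A t0 * x + B t0))) \<longlongrightarrow> 0) (at t0 within S)"
  unfolding tendsto_at_iff_sequentially
proof (intro allI impI)
  fix X :: "nat \<Rightarrow> real" assume X: "\<forall>i. X i \<in> S - {t0}" "X \<longlonglongrightarrow> t0"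
  have lim: "(\<lambda>n. h (X n)) \<longlonglongrightarrow> h t0" if "continuous_on S h" for h :: "real \<Rightarrow> real"
    by (rule continuous_on_tendsto_compose[OF that X(2) t0]) (use X in auto)
  show "((\<lambda>t. L2_norm_on UNIV (\<lambda>x::real. indicator {0<..<I t} x * f (A t * x + B t)
             - indicator {0<..<I t0} x * f (A t0 * x + B t0))) \<circ> X) \<longlonglongrightarrow> 0"
    unfolding comp_def using L2_affine_LIMSEQ[OF f lim[OF A] lim[OF B] lim[OF I] c(1)] c(2) X(1) by simp
qed

subsection \<open>Shears of the plane\<close>

lemma shear_measurable: "(\<lambda>p. (b * fst p + a * snd p + c, snd p)) \<in> (borel :: (real \<times> real) measure) \<rightarrow>\<^sub>M (borel :: (real \<times> real) measure)"
  by (intro borel_measurable_continuous_onI continuous_intros)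

text \<open>For fixed time the map is affine in space with slope \<open>b\<close>, and time is left
  alone; Tonelli does the rest. Both families of characteristics become coordinate lines under such
  maps.\<close>

lemma nn_integral_shear:
  fixes f :: "real \<times> real \<Rightarrow> ennreal"
  assumes [measurable]: "f \<in> borel_measurable borel" and b: "b \<noteq> 0"
  shows "(\<integral>\<^sup>+p. f (b * fst p + a * snd p + c, snd p) \<partial>lborel) = ennreal (1 / \<bar>b\<bar>) * (\<integral>\<^sup>+p. f p \<partial>lborel)"
proof -
  have 1: "(\<integral>\<^sup>+x. f (b * x + a * t + c, t) \<partial>lborel) = ennreal (1 / \<bar>b\<bar>) * (\<integral>\<^sup>+x. f (x, t) \<partial>lborel)" for t
  proof -
    have "(\<lambda>x. f (x, t)) \<in> borel_measurable borel" by measurable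
    from nn_integral_real_affine[OF this b, of "a * t + c"]
    have "(\<integral>\<^sup>+x. f (x, t) \<partial>lborel) = ennreal \<bar>b\<bar> * (\<integral>\<^sup>+x. f (b * x + a * t + c, t) \<partial>lborel)"
      by (simp add: ac_simps)
    then show ?thesis using b by (simp add: mult.assoc[symmetric] ennreal_mult[symmetric])
  qed
  have "(\<integral>\<^sup>+p. f (b * fst p + a * snd p + c, snd p) \<partial>lborel)
      = (\<integral>\<^sup>+t. (\<integral>\<^sup>+x. f (b * x + a * t + c, t) \<partial>lborel) \<partial>lborel)"
    by (subst lborel_pair.nn_integral_snd[where f="\<lambda>p. f (b * fst p + a * snd p + c, snd p)", unfolded lborel_prod fst_conv snd_conv, symmetric])
      (use measurable_compose[OF shear_measurable[of b a c] assms(1)] in auto)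
  also have "\<dots> = ennreal (1 / \<bar>b\<bar>) * (\<integral>\<^sup>+t. (\<integral>\<^sup>+x. f (x, t) \<partial>lborel) \<partial>lborel)"
    unfolding 1 by (rule nn_integral_cmult) measurable
  also have "(\<integral>\<^sup>+t. (\<integral>\<^sup>+x. f (x, t) \<partial>lborel) \<partial>lborel) = (\<integral>\<^sup>+p. f p \<partial>lborel)"
    by (subst lborel_pair.nn_integral_snd[where f=f, unfolded lborel_prod]) auto
  finally show ?thesis .
qed

lemma distr_shear:
  assumes b: "b \<noteq> (0::real)"
  shows "distr lborel borel (\<lambda>p. (b * fst p + a * snd p + c, snd p)) = density lborel (\<lambda>_::real \<times> real. ennreal (1 / \<bar>b\<bar>))"
proof (rule measure_eqI)
  fix A assume "A \<in> sets (distr lborel borel (\<lambda>p. (b * fst p + a * snd p + c, snd p)))"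
  then have A[measurable]: "A \<in> sets borel" by simp
  have sh[measurable]: "(\<lambda>p. (b * fst p + a * snd p + c, snd p)) \<in> borel \<rightarrow>\<^sub>M borel"
    by (intro borel_measurable_continuous_onI continuous_intros)
  have "emeasure (distr lborel borel (\<lambda>p. (b * fst p + a * snd p + c, snd p))) A
      = (\<integral>\<^sup>+p. indicator A p \<partial>distr lborel borel (\<lambda>p. (b * fst p + a * snd p + c, snd p)))" by simp
  also have "\<dots> = (\<integral>\<^sup>+p. indicator A (b * fst p + a * snd p + c, snd p) \<partial>lborel)"
    by (subst nn_integral_distr) auto
  also have "\<dots> = ennreal (1 / \<bar>b\<bar>) * (\<integral>\<^sup>+p. indicator A p \<partial>lborel)"
    by (rule nn_integral_shear[OF _ b]) measurable
  also have "\<dots> = emeasure (density lborel (\<lambda>_. ennreal (1 / \<bar>b\<bar>))) A"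
    by (simp add: emeasure_density nn_integral_cmult)
  finally show "emeasure (distr lborel borel (\<lambda>p. (b * fst p + a * snd p + c, snd p))) A
     = emeasure (density lborel (\<lambda>_. ennreal (1 / \<bar>b\<bar>))) A" .
qed simp

lemma integrable_shear:
  fixes f :: "real \<times> real \<Rightarrow> real"
  assumes b: "b \<noteq> 0" and f: "integrable lborel f"
  shows "integrable lborel (\<lambda>p. f (b * fst p + a * snd p + c, snd p))"
    "(\<integral>p. f (b * fst p + a * snd p + c, snd p) \<partial>lborel) = (\<integral>p. f p \<partial>lborel) / \<bar>b\<bar>"
proof -
  note sh = shear_measurable[of b a c]
  have m: "f \<in> borel_measurable borel" using f by auto
  have "integrable (density lborel (\<lambda>_. ennreal (1 / \<bar>b\<bar>))) f"
    using f m by (subst integrable_density) auto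
  then have "integrable (distr lborel borel (\<lambda>p. (b * fst p + a * snd p + c, snd p))) f" unfolding distr_shear[OF b] .
  then show "integrable lborel (\<lambda>p. f (b * fst p + a * snd p + c, snd p))"
    using sh m by (subst (asm) integrable_distr_eq) auto
  have "(\<integral>p. f (b * fst p + a * snd p + c, snd p) \<partial>lborel)
      = (\<integral>p. f p \<partial>distr lborel borel (\<lambda>p. (b * fst p + a * snd p + c, snd p)))"
    using sh m by (subst integral_distr) auto
  also have "\<dots> = (\<integral>p. f p \<partial>lborel) / \<bar>b\<bar>" unfolding distr_shear[OF b]
    using m by (subst integral_density) auto
  finally show "(\<integral>p. f (b * fst p + a * snd p + c, snd p) \<partial>lborel) = (\<integral>p. f p \<partial>lborel) / \<bar>b\<bar>" .
qed

lemma L2_shear: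
  assumes "b \<noteq> 0" "f \<in> L2_on UNIV"
  shows "(\<lambda>p. f (b * fst p + a * snd p + c, snd p)) \<in> L2_on (UNIV :: (real \<times> real) set)"
  using integrable_shear(1)[OF assms(1), of "\<lambda>p. (f p)\<^sup>2" a c] assms(2)
    measurable_compose[OF shear_measurable[of b a c] L2_UNIV_measurable[OF assms(2)]]
  by (simp add: L2_UNIV)

text \<open>A wave that is constant along a family of lines need not be square integrable over the
  plane; cutting time to a bounded interval restores this.\<close>

lemma L2_strip:
  assumes f: "f \<in> L2_on UNIV"
  shows "(\<lambda>p. f (fst p) * indicator {0<..<T} (snd p)) \<in> L2_on (UNIV :: (real \<times> real) set)"
proof -
  have [measurable]: "f \<in> borel_measurable borel" using f by (rule L2_UNIV_measurable)
  have "integrable (lborel \<Otimes>\<^sub>M lborel) (\<lambda>(x, y). ((f x)\<^sup>2 * indicator {0<..<T} y :: real))"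
  proof (rule lborel_pair.Fubini_integrable)
    show "integrable lborel (\<lambda>x. LBINT y. norm (case (x, y) of (x, y) \<Rightarrow> (f x)\<^sup>2 * indicator {0<..<T} y))"
      using f by (simp add: L2_UNIV)
    show "AE x in lborel. integrable lborel (\<lambda>y. case (x, y) of (x, y) \<Rightarrow> (f x)\<^sup>2 * indicator {0<..<T} y)"
      by (cases "0 \<le> T") auto
  qed measurable
  also have "(\<lambda>(x, y). ((f x)\<^sup>2 * indicator {0<..<T} y :: real)) = (\<lambda>p. (f (fst p) * indicator {0<..<T} (snd p))\<^sup>2)"
    by (auto simp: indicator_def fun_eq_iff)
  finally have "integrable lborel (\<lambda>p. (f (fst p) * indicator {0<..<T} (snd p))\<^sup>2)" by (simp only: lborel_prod)
  moreover have "(\<lambda>p. f (fst p) * indicator {0<..<T} (snd p)) \<in> borel_measurable (lborel \<Otimes>\<^sub>M lborel)"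
    by measurable
  then have "(\<lambda>p. f (fst p) * indicator {0<..<T} (snd p)) \<in> borel_measurable lborel" by (simp only: lborel_prod)
  ultimately show ?thesis by (simp add: L2_UNIV)
qed

lemma L2_strip_shear:
  assumes f: "f \<in> L2_on UNIV" and b: "b \<noteq> 0"
  shows "(\<lambda>p. f (b * fst p + a * snd p + c) * indicator {0<..<T} (snd p)) \<in> L2_on (UNIV :: (real \<times> real) set)"
  using L2_shear[OF b L2_strip[OF f, of T], of a c] by simp

text \<open>Cauchy-Schwarz on the time interval bounds the square of the time integral by
  \<open>T\<close> times the integral of the square, so a kernel on the strip becomes an L2 kernel
  on the line.\<close>

lemma L2_average:
  assumes m: "m \<in> L2_on (UNIV :: (real \<times> real) set)" and supp: "\<And>x t. t \<notin> {0<..<T} \<Longrightarrow> m (x, t) = 0" and "T \<ge> 0"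
  shows "(\<lambda>x. \<integral>t. m (x, t) \<partial>lborel) \<in> L2_on UNIV"
    "f \<in> L2_on UNIV \<Longrightarrow> (\<integral>p. f (fst p) * m p \<partial>lborel) = (\<integral>x. f x * (\<integral>t. m (x, t) \<partial>lborel) \<partial>lborel)"
proof -
  have mb: "m \<in> borel_measurable borel" using m by (rule L2_UNIV_measurable)
  then have mb2[measurable]: "m \<in> borel_measurable (lborel \<Otimes>\<^sub>M lborel)" by (simp add: lborel_prod)
  have meas: "(\<lambda>x. \<integral>t. m (x, t) \<partial>lborel) \<in> borel_measurable borel"
    using lborel.borel_measurable_lebesgue_integral[of "\<lambda>x t. m (x, t)" lborel] by simp
  have i2: "integrable (lborel \<Otimes>\<^sub>M lborel) (\<lambda>p. (m p)\<^sup>2)" using m by (simp add: L2_UNIV lborel_prod)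
  have AE: "AE x in lborel. (\<integral>t. m (x, t) \<partial>lborel)\<^sup>2 \<le> T * (\<integral>t. (m (x, t))\<^sup>2 \<partial>lborel)"
    using lborel_pair.AE_integrable_fst'[OF i2]
  proof eventually_elim
    fix x assume i: "integrable lborel (\<lambda>t. (m (x, t))\<^sup>2)"
    have L: "(\<lambda>t. m (x, t)) \<in> L2_on UNIV" using i mb unfolding L2_UNIV by (auto intro: measurable_compose[of _ borel borel])
    have o: "(\<lambda>t. 1 * indicator {0<..<T} t) \<in> L2_on UNIV" by (rule indicator_L2) auto
    have "(\<integral>t. m (x, t) \<partial>lborel) = (\<integral>t. m (x, t) * (1 * indicator {0<..<T} t) \<partial>lborel)"
      using supp by (intro Bochner_Integration.integral_cong) (auto simp: indicator_def)
    then have "\<bar>\<integral>t. m (x, t) \<partial>lborel\<bar> \<le> L2_norm_on UNIV (\<lambda>t. m (x, t)) * L2_norm_on UNIV (\<lambda>t. 1 * indicator {0<..<T} t)"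
      using L2_Cauchy_Schwarz_UNIV[OF L o] by simp
    then have "(\<integral>t. m (x, t) \<partial>lborel)\<^sup>2 \<le> (L2_norm_on UNIV (\<lambda>t. m (x, t)) * L2_norm_on UNIV (\<lambda>t. 1 * indicator {0<..<T} t))\<^sup>2"
      by (metis abs_ge_zero power2_abs power_mono)
    also have "\<dots> = (\<integral>t. (m (x, t))\<^sup>2 \<partial>lborel) * (\<integral>t. (1 * indicator {0<..<T} t)\<^sup>2 \<partial>lborel)"
      unfolding power_mult_distrib L2_norm_UNIV_sq ..
    also have "(\<lambda>t. (1 * indicator {0<..<T} t)\<^sup>2) = (\<lambda>t. indicator {0<..<T} t :: real)"
      by (auto simp: indicator_def fun_eq_iff)
    finally show "(\<integral>t. m (x, t) \<partial>lborel)\<^sup>2 \<le> T * (\<integral>t. (m (x, t))\<^sup>2 \<partial>lborel)"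
      using \<open>T \<ge> 0\<close> by (simp add: mult.commute)
  qed
  have "integrable lborel (\<lambda>x. (\<integral>t. m (x, t) \<partial>lborel)\<^sup>2)"
  proof (rule Bochner_Integration.integrable_bound)
    show "integrable lborel (\<lambda>x. T * (\<integral>t. (m (x, t))\<^sup>2 \<partial>lborel))"
      using lborel_pair.integrable_fst'[OF i2] by simp
    show "AE x in lborel. norm ((\<integral>t. m (x, t) \<partial>lborel)\<^sup>2) \<le> norm (T * (\<integral>t. (m (x, t))\<^sup>2 \<partial>lborel))"
      using AE by eventually_elim (use \<open>T \<ge> 0\<close> in \<open>simp add: abs_of_nonneg mult_nonneg_nonneg\<close>)
  qed (use meas in simp)
  with meas show "(\<lambda>x. \<integral>t. m (x, t) \<partial>lborel) \<in> L2_on UNIV" by (simp add: L2_UNIV)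
  assume f: "f \<in> L2_on UNIV"
  have eq: "f (fst p) * m p = f (fst p) * indicator {0<..<T} (snd p) * m p" for p
    using supp[of "snd p" "fst p"] by (auto simp: indicator_def)
  have "integrable lborel (\<lambda>p. f (fst p) * m p)"
    using L2_mult_integrable[OF L2_strip[OF f, of T] m] unfolding eq[symmetric] .
  then have "integrable (lborel \<Otimes>\<^sub>M lborel) (\<lambda>p. f (fst p) * m p)" by (simp only: lborel_prod)
  from lborel_pair.integral_fst'[OF this]
  show "(\<integral>p. f (fst p) * m p \<partial>lborel) = (\<integral>x. f x * (\<integral>t. m (x, t) \<partial>lborel) \<partial>lborel)"
    by (simp add: lborel_prod)
qed

text \<open>The shear is moved from \<open>f\<close> to \<open>m\<close> by substitution; then
  \<open>f\<close> depends on space alone and time is integrated out. The pairing with a travelling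
  wave is thus represented by one kernel \<open>K\<close> that does not depend on \<open>f\<close>,
  which the later density argument relies on.\<close>

lemma adjoint_shear:
  assumes m: "m \<in> L2_on (UNIV :: (real \<times> real) set)" and supp: "\<And>x t. t \<notin> {0<..<T} \<Longrightarrow> m (x, t) = 0"
    and "T \<ge> 0" and b: "b \<noteq> 0"
  shows "\<exists>K\<in>L2_on UNIV. \<forall>f\<in>L2_on UNIV.
    (\<integral>p. f (b * fst p + a * snd p + c) * m p \<partial>lborel) = (\<integral>x. f x * K x \<partial>lborel)"
proof -
  let ?m = "\<lambda>p. m (1/b * fst p + (- a/b) * snd p + (- c/b), snd p)"
  have mL: "?m \<in> L2_on UNIV" by (rule L2_shear[OF _ m]) (use b in simp)
  have ms: "\<And>x t. t \<notin> {0<..<T} \<Longrightarrow> ?m (x, t) = 0" using supp by simp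
  let ?K = "\<lambda>x. (\<integral>t. ?m (x, t) \<partial>lborel) / \<bar>b\<bar>"
  have KL: "?K \<in> L2_on UNIV" using L2_scale[OF L2_average(1)[OF mL ms \<open>T \<ge> 0\<close>], of "1 / \<bar>b\<bar>"] by simp
  have "(\<integral>p. f (b * fst p + a * snd p + c) * m p \<partial>lborel) = (\<integral>x. f x * ?K x \<partial>lborel)" if f: "f \<in> L2_on UNIV" for f
  proof -
    have eq: "f (fst p) * ?m p = f (fst p) * indicator {0<..<T} (snd p) * ?m p" for p
      using ms[of "snd p" "fst p"] by (auto simp: indicator_def)
    have i: "integrable lborel (\<lambda>p. f (fst p) * ?m p)"
      using L2_mult_integrable[OF L2_strip[OF f, of T] mL] unfolding eq[symmetric] .
    have "(\<integral>p. f (b * fst p + a * snd p + c) * m p \<partial>lborel) = (\<integral>p. f (fst p) * ?m p \<partial>lborel) / \<bar>b\<bar>"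
    proof -
      have "m (1/b * (b * fst p + a * snd p + c) + (- a/b) * snd p + (- c/b), snd p) = m p" for p
        using b by (cases p) (simp add: field_simps)
      then show ?thesis using integrable_shear(2)[OF b i, of a c] by simp
    qed
    also have "(\<integral>p. f (fst p) * ?m p \<partial>lborel) = (\<integral>x. f x * (\<integral>t. ?m (x, t) \<partial>lborel) \<partial>lborel)"
      by (rule L2_average(2)[OF mL ms \<open>T \<ge> 0\<close> f])
    finally show ?thesis by simp
  qed
  with KL show ?thesis by (intro bexI[of _ ?K] ballI)
qed

lemma adjoint_affine:
  assumes m: "m \<in> L2_on (UNIV :: real set)" and b: "b \<noteq> 0"
  shows "\<exists>K\<in>L2_on UNIV. \<forall>f. (\<integral>x. f (b * x + c) * m x \<partial>lborel) = (\<integral>x. f x * K x \<partial>lborel)"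
proof -
  let ?K = "\<lambda>x. m (1/b * x + (- c/b)) / \<bar>b\<bar>"
  have "?K \<in> L2_on UNIV" using L2_scale[OF L2_affine(1)[OF m, of "1/b" "- c/b"], of "1 / \<bar>b\<bar>"] b by simp
  moreover have "(\<integral>x. f (b * x + c) * m x \<partial>lborel) = (\<integral>x. f x * ?K x \<partial>lborel)" for f
  proof -
    have "m (1/b * (b * x + c) + (- c/b)) = m x" for x using b by (simp add: field_simps)
    then show ?thesis using integral_affine[OF b, of "\<lambda>x. f x * m (1/b * x + (- c/b))" c] by simp
  qed
  ultimately show ?thesis by (intro bexI[of _ ?K] allI)
qed

section \<open>The spaces H10 and Hm1\<close>

lemma continuous_L2_on:
  fixes f :: "'a::euclidean_space \<Rightarrow> real"
  assumes "continuous_on UNIV f" "S \<in> sets borel" "bounded S"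
  shows "f \<in> L2_on S"
proof -
  have "compact (f ` closure S)"
    using assms by (intro compact_continuous_image continuous_on_subset[OF assms(1)]) auto
  then have "bounded (f ` closure S)" by (rule compact_imp_bounded)
  then obtain B where "\<And>x. x \<in> closure S \<Longrightarrow> \<bar>f x\<bar> \<le> B"
    unfolding bounded_iff by auto
  then show ?thesis
    using assms closure_subset[of S] by (intro bounded_L2_on[of _ _ B]) (auto intro: borel_measurable_continuous_onI)
qed

lemma DERIV_continuous_UNIV: "(\<And>x. (f has_real_derivative f' x) (at x)) \<Longrightarrow> continuous_on UNIV f"
  by (auto simp: continuous_on_eq_continuous_at intro: DERIV_isCont)

lemma FTC_Ioo:
  assumes "a \<le> b" "\<And>x. (F has_real_derivative f x) (at x)" "continuous_on UNIV f"
  shows "(LINT x:{a<..<b}|lborel. f x) = F b - F a"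
proof -
  have "(LINT x:{a<..<b}|lborel. f x) = (LINT x:{a..b}|lborel. f x)"
    by (rule set_integral_discrete_difference[where X="{a,b}"]) auto
  also have "\<dots> = F b - F a"
    unfolding set_lebesgue_integral_def
    using assms by (intro integral_FTC_Icc) (auto simp: has_real_derivative_iff_has_vector_derivative[symmetric]
      intro: has_field_derivative_at_within continuous_on_subset)
  finally show ?thesis .
qed

lemma L2_integral_bound:
  assumes "g \<in> L2_on {b<..<c}" "b \<le> (c::real)"
  shows "\<bar>LINT y:{b<..<c}|lborel. g y\<bar> \<le> sqrt (c - b) * L2_norm_on {b<..<c} g"
proof -
  have 1: "(\<lambda>_. 1) \<in> L2_on {b<..<c}" by (rule continuous_L2_on) auto
  have "L2_norm_on {b<..<c} (\<lambda>_. 1) = sqrt (c - b)" using assms(2)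
    by (simp add: L2_norm_on_def set_lebesgue_integral_def)
  then show ?thesis using L2_Cauchy_Schwarz[OF assms(1) 1] by (simp add: mult.commute)
qed

lemma test_fun_real:
  "test_fun {0<..<a} f f' \<longleftrightarrow> (\<forall>x. (f has_real_derivative f' x) (at x)) \<and> continuous_on UNIV f' \<and>
     (\<exists>d>0. \<forall>x. f x \<noteq> 0 \<longrightarrow> d \<le> x \<and> x \<le> a - d)"
proof -
  have "(\<exists>K. compact K \<and> K \<subseteq> {0<..<a} \<and> (\<forall>x. x \<notin> K \<longrightarrow> f x = 0)) \<longleftrightarrow> (\<exists>d>0. \<forall>x. f x \<noteq> 0 \<longrightarrow> d \<le> x \<and> x \<le> a - d)"
  proof
    assume "\<exists>K. compact K \<and> K \<subseteq> {0<..<a} \<and> (\<forall>x. x \<notin> K \<longrightarrow> f x = 0)"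
    then obtain K where K: "compact K" "K \<subseteq> {0<..<a}" "\<And>x. x \<notin> K \<Longrightarrow> f x = 0" by auto
    show "\<exists>d>0. \<forall>x. f x \<noteq> 0 \<longrightarrow> d \<le> x \<and> x \<le> a - d"
    proof (cases "K = {}")
      case True then show ?thesis using K by (intro exI[of _ 1]) auto
    next
      case False
      obtain m where m: "m \<in> K" "\<And>x. x \<in> K \<Longrightarrow> m \<le> x" using compact_attains_inf[OF K(1) False] by auto
      obtain M where M: "M \<in> K" "\<And>x. x \<in> K \<Longrightarrow> x \<le> M" using compact_attains_sup[OF K(1) False] by auto
      have "0 < min m (a - M)" using m(1) M(1) K(2) by auto
      moreover have "\<forall>x. f x \<noteq> 0 \<longrightarrow> min m (a - M) \<le> x \<and> x \<le> a - min m (a - M)"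
      proof (intro allI impI)
        fix x assume "f x \<noteq> 0"
        then have "x \<in> K" using K(3) by blast
        then have "m \<le> x" "x \<le> M" using m(2) M(2) by auto
        then show "min m (a - M) \<le> x \<and> x \<le> a - min m (a - M)" by linarith
      qed
      ultimately show ?thesis by blast
    qed
  next
    assume "\<exists>d>0. \<forall>x. f x \<noteq> 0 \<longrightarrow> d \<le> x \<and> x \<le> a - d"
    then obtain d where "d > 0" "\<And>x. f x \<noteq> 0 \<Longrightarrow> d \<le> x \<and> x \<le> a - d" by auto
    then show "\<exists>K. compact K \<and> K \<subseteq> {0<..<a} \<and> (\<forall>x. x \<notin> K \<longrightarrow> f x = 0)"
      by (intro exI[of _ "{d..a-d}"]) auto
  qed
  then show ?thesis unfolding test_fun_def by simp
qed

lemma test_fun_L2_on: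
  assumes "test_fun {0<..<a::real} f f'"
  shows "f \<in> L2_on {b<..<c}" "f' \<in> L2_on {b<..<c}"
  using assms unfolding test_fun_real by (auto intro!: continuous_L2_on DERIV_continuous_UNIV)

lemma test_fun_boundary:
  assumes "test_fun {0<..<a::real} f f'"
  shows "f 0 = 0" "f a = 0"
proof -
  obtain d where d: "d > 0" "\<And>x. f x \<noteq> 0 \<Longrightarrow> d \<le> x \<and> x \<le> a - d"
    using assms unfolding test_fun_real by auto
  show "f 0 = 0" using d(1) d(2)[of 0] by (cases "f 0 = 0") auto
  show "f a = 0" using d(1) d(2)[of a] by (cases "f a = 0") auto
qed

lemma H10_derivE:
  assumes "H10_deriv a f g"
  obtains \<phi> G where "\<And>n::nat. test_fun {0<..<a} (\<phi> n) (G n)"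
    "(\<lambda>n. L2_norm_on {0<..<a} (\<lambda>x. \<phi> n x - f x)) \<longlonglongrightarrow> 0" "(\<lambda>n. L2_norm_on {0<..<a} (\<lambda>x. G n x - g x)) \<longlonglongrightarrow> 0"
  using assms unfolding H10_deriv_def by blast

lemma H10_derivD:
  assumes "H10_deriv a f g"
  shows "f \<in> L2_on {0<..<a}" "g \<in> L2_on {0<..<a}"
  using assms unfolding H10_deriv_def by auto

text \<open>The boundary terms vanish because of \<open>f\<close> alone, a limit of compactly
  supported functions. So \<open>p\<close> is free at the endpoints, and both the constant 1 and the
  stream function are admissible choices.\<close>

lemma H10_integration_by_parts:
  assumes H: "H10_deriv a f g" and a: "a \<ge> 0"
    and p: "\<And>x. (p has_real_derivative p' x) (at x)" "continuous_on UNIV p'"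
  shows "(LINT x:{0<..<a}|lborel. f x * p' x) = - (LINT x:{0<..<a}|lborel. g x * p x)"
proof -
  obtain \<phi> G where t: "\<And>n::nat. test_fun {0<..<a} (\<phi> n) (G n)"
    and l: "(\<lambda>n. L2_norm_on {0<..<a} (\<lambda>x. \<phi> n x - f x)) \<longlonglongrightarrow> 0" "(\<lambda>n. L2_norm_on {0<..<a} (\<lambda>x. G n x - g x)) \<longlonglongrightarrow> 0"
    using H10_derivE[OF H] by blast
  have pc: "continuous_on UNIV p" using p(1) by (rule DERIV_continuous_UNIV)
  have pL: "p \<in> L2_on {0<..<a}" "p' \<in> L2_on {0<..<a}" using pc p(2) by (auto intro!: continuous_L2_on)
  have eq: "(LINT x:{0<..<a}|lborel. \<phi> n x * p' x) = - (LINT x:{0<..<a}|lborel. G n x * p x)" for n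
  proof -
    note tn = t[of n, unfolded test_fun_real]
    have d: "((\<lambda>x. \<phi> n x * p x) has_real_derivative (G n x * p x + \<phi> n x * p' x)) (at x)" for x
      using tn p(1) by (auto intro!: derivative_eq_intros)
    have "(LINT x:{0<..<a}|lborel. G n x * p x + \<phi> n x * p' x) = \<phi> n a * p a - \<phi> n 0 * p 0"
      using tn pc p(2) by (intro FTC_Ioo[OF a d] continuous_intros) (auto intro: DERIV_continuous_UNIV)
    also have "\<dots> = 0" using test_fun_boundary[OF t[of n]] by simp
    finally show ?thesis
      using L2_on_mult_integrable[OF test_fun_L2_on(1)[OF t[of n]] pL(2)] L2_on_mult_integrable[OF test_fun_L2_on(2)[OF t[of n]] pL(1)]
      by simp
  qed
  have "(\<lambda>n. LINT x:{0<..<a}|lborel. \<phi> n x * p' x) \<longlonglongrightarrow> (LINT x:{0<..<a}|lborel. f x * p' x)"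
    by (rule L2_inner_tendsto[OF test_fun_L2_on(1)[OF t] H10_derivD(1)[OF H] pL(2) l(1)])
  moreover have "(\<lambda>n. - (LINT x:{0<..<a}|lborel. G n x * p x)) \<longlonglongrightarrow> - (LINT x:{0<..<a}|lborel. g x * p x)"
    by (intro tendsto_minus L2_inner_tendsto[OF test_fun_L2_on(2)[OF t] H10_derivD(2)[OF H] pL(1) l(2)])
  ultimately show ?thesis unfolding eq by (rule LIMSEQ_unique)
qed

lemma H10_integral_zero:
  assumes "H10_deriv a f g" "a \<ge> 0"
  shows "(LINT x:{0<..<a}|lborel. g x) = 0"
  using H10_integration_by_parts[OF assms, of "\<lambda>_. 1" "\<lambda>_. 0"] by (simp add: set_lebesgue_integral_def)

text \<open>The primitive is a parameter integral over the region \<open>0 < y < x\<close>, where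
  joint measurability is immediate.\<close>

lemma primitive_measurable:
  assumes "g \<in> L2_on {0<..<a::real}"
  shows "(\<lambda>x. LINT y:{0<..<min x a}|lborel. g y) \<in> borel_measurable borel"
proof -
  define g0 where "g0 y = indicator {0<..<a} y * g y" for y
  have "g0 \<in> L2_on UNIV" using assms unfolding g0_def by (simp only: L2_on_iff[of _ "{0<..<a}"])
  then have [measurable]: "g0 \<in> borel_measurable borel" by (rule L2_UNIV_measurable)
  have [measurable]: "{p :: real \<times> real. 0 < snd p \<and> snd p < fst p} \<in> sets (borel \<Otimes>\<^sub>M borel)"
    unfolding borel_prod by (intro borel_open open_Collect_conj open_Collect_less continuous_intros)
  have "(\<lambda>x. \<integral>y. indicator {p. 0 < snd p \<and> snd p < fst p} (x, y) * g0 y \<partial>lborel) \<in> borel_measurable borel"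
  proof (rule lborel.borel_measurable_lebesgue_integral)
    have "(\<lambda>p. indicator {p. 0 < snd p \<and> snd p < fst p} p * g0 (snd p)) \<in> borel_measurable (borel \<Otimes>\<^sub>M borel)"
      by measurable
    moreover have "borel_measurable (borel \<Otimes>\<^sub>M lborel) = borel_measurable (borel \<Otimes>\<^sub>M borel)"
      by (intro measurable_cong_sets sets_pair_measure_cong) auto
    ultimately show "(\<lambda>(x, y). indicator {p. 0 < snd p \<and> snd p < fst p} (x, y) * g0 y) \<in> borel_measurable (borel \<Otimes>\<^sub>M lborel)"
      by (simp add: case_prod_unfold)
  qed
  also have "(\<lambda>x. \<integral>y. indicator {p. 0 < snd p \<and> snd p < fst p} (x, y) * g0 y \<partial>lborel) = (\<lambda>x. LINT y:{0<..<min x a}|lborel. g y)"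
    unfolding set_lebesgue_integral_def g0_def
    by (intro ext Bochner_Integration.integral_cong) (auto simp: indicator_def)
  finally show ?thesis .
qed

text \<open>A test function is the primitive of its derivative. On a bounded interval the primitives
  of \<open>G n\<close> converge uniformly when \<open>G n\<close> converges in L2, so the
  approximating test functions have both \<open>f\<close> and the primitive of \<open>g\<close> as
  L2 limit.\<close>

lemma H10_representation:
  assumes H: "H10_deriv a f g" and a: "a \<ge> 0"
  shows "AE x in lborel. x \<in> {0<..<a} \<longrightarrow> f x = (LINT y:{0<..<x}|lborel. g y)"
proof -
  obtain \<phi> G where t: "\<And>n::nat. test_fun {0<..<a} (\<phi> n) (G n)"
    and l: "(\<lambda>n. L2_norm_on {0<..<a} (\<lambda>x. \<phi> n x - f x)) \<longlonglongrightarrow> 0" "(\<lambda>n. L2_norm_on {0<..<a} (\<lambda>x. G n x - g x)) \<longlonglongrightarrow> 0"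
    using H10_derivE[OF H] by blast
  define F where "F x = (LINT y:{0<..<min x a}|lborel. g y)" for x
  have gL: "g \<in> L2_on {0<..<a}" and fL: "f \<in> L2_on {0<..<a}" using H10_derivD[OF H] by auto
  have Fm: "F \<in> borel_measurable borel" unfolding F_def by (rule primitive_measurable[OF gL])
  have sub: "h \<in> L2_on {0<..<x}" "L2_norm_on {0<..<x} h \<le> L2_norm_on {0<..<a} h"
    if "h \<in> L2_on {0<..<a}" "x \<in> {0<..<a}" for h x
  proof -
    have "{0<..<x} \<subseteq> {0<..<a}" using that(2) by auto
    then show "h \<in> L2_on {0<..<x}" "L2_norm_on {0<..<x} h \<le> L2_norm_on {0<..<a} h"
      using L2_restrict[OF that(1), of "{0<..<x}"] by auto
  qed
  have bd: "\<bar>LINT y:{0<..<x}|lborel. h y\<bar> \<le> sqrt a * L2_norm_on {0<..<a} h"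
    if h: "h \<in> L2_on {0<..<a}" and x: "x \<in> {0<..<a}" for h x
  proof -
    have "\<bar>LINT y:{0<..<x}|lborel. h y\<bar> \<le> sqrt (x - 0) * L2_norm_on {0<..<x} h"
      using x by (intro L2_integral_bound sub[OF h x]) auto
    also have "\<dots> \<le> sqrt a * L2_norm_on {0<..<a} h"
      using x sub[OF h x] a by (intro mult_mono) auto
    finally show ?thesis .
  qed
  have FL: "F \<in> L2_on {0<..<a}"
    using bd[OF gL] Fm by (intro bounded_L2_on[of _ _ "sqrt a * L2_norm_on {0<..<a} g"]) (auto simp: F_def min_def)
  let ?e = "\<lambda>n. a * L2_norm_on {0<..<a} (\<lambda>x. G n x - g x)"
  have close: "L2_norm_on {0<..<a} (\<lambda>x. \<phi> n x - F x) \<le> ?e n" for n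
  proof -
    note tn = t[of n, unfolded test_fun_real]
    have GL: "G n \<in> L2_on {0<..<a}" using t by (rule test_fun_L2_on)
    have "\<bar>\<phi> n x - F x\<bar> \<le> sqrt a * L2_norm_on {0<..<a} (\<lambda>x. G n x - g x)" if x: "0 < x" "x < a" for x
    proof -
      have "(LINT y:{0<..<x}|lborel. G n y) = \<phi> n x - \<phi> n 0" using tn x by (intro FTC_Ioo) auto
      then have "\<phi> n x = (LINT y:{0<..<x}|lborel. G n y)" using test_fun_boundary[OF t[of n]] by simp
      then have "\<phi> n x - F x = (LINT y:{0<..<x}|lborel. G n y - g y)"
        using L2_on_integrable[OF _ _ sub(1)[OF GL]] L2_on_integrable[OF _ _ sub(1)[OF gL]] x by (simp add: F_def)
      then show ?thesis using bd[OF L2_diff[OF GL gL]] x by simp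
    qed
    moreover have "continuous_on UNIV (\<phi> n)" using tn by (auto intro: DERIV_continuous_UNIV)
    then have "\<phi> n \<in> borel_measurable borel" by (rule borel_measurable_continuous_onI)
    ultimately have "L2_norm_on {0<..<a} (\<lambda>x. \<phi> n x - F x) \<le> sqrt a * L2_norm_on {0<..<a} (\<lambda>x. G n x - g x) * sqrt (a - 0)"
      using a Fm by (intro L2_norm_le_uniform) auto
    also have "\<dots> = (sqrt a * sqrt a) * L2_norm_on {0<..<a} (\<lambda>x. G n x - g x)" by simp
    also have "sqrt a * sqrt a = a" using a by simp
    finally show ?thesis .
  qed
  have bound: "L2_norm_on {0<..<a} (\<lambda>x. f x - F x) \<le> L2_norm_on {0<..<a} (\<lambda>x. \<phi> n x - f x) + ?e n" for n
    using L2_norm_triangle3[OF fL test_fun_L2_on(1)[OF t[of n]] FL] close[of n] L2_norm_diff_commute[of "{0<..<a}" f "\<phi> n"]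
    by linarith
  have "(\<lambda>n. L2_norm_on {0<..<a} (\<lambda>x. \<phi> n x - f x) + ?e n) \<longlonglongrightarrow> 0 + a * 0"
    using l by (intro tendsto_intros)
  then have "L2_norm_on {0<..<a} (\<lambda>x. f x - F x) \<le> 0"
    using bound by (intro LIMSEQ_le_const[of _ "0 + a * 0", simplified]) auto
  then have z: "L2_norm_on UNIV (\<lambda>x. indicator {0<..<a} x * (f x - F x)) = 0"
    using L2_norm_nonneg[of "{0<..<a}" "\<lambda>x. f x - F x"] unfolding L2_norm_on_eq[of "{0<..<a}"] by linarith
  have "(\<lambda>x. indicator {0<..<a} x * (f x - F x)) \<in> L2_on UNIV"
    using L2_diff[OF fL FL] by (simp only: L2_on_iff[of _ "{0<..<a}"])
  from L2_norm_zero_iff[OF this] z have "AE x in lborel. indicator {0<..<a} x * (f x - F x) = 0" by simp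
  then show ?thesis by eventually_elim (auto simp: F_def min_def indicator_def)
qed

lemma C2_supported_derivs:
  assumes "C2_supported b c p p' p''"
  shows "continuous_on UNIV p" "continuous_on UNIV p'" "\<And>x. (p has_real_derivative p' x) (at x)"
  using assms unfolding C2_supported_def by (auto intro: DERIV_continuous_UNIV)

text \<open>By density \<open>h\<close> itself is an L2 limit of admissible \<open>p\<close>, so its
  squared norm is a limit of zeros.\<close>

lemma L2_orthogonal_C2:
  assumes h: "h \<in> L2_on {b<..<c}" and bc: "b < (c::real)"
    and orth: "\<And>p p' p''. C2_supported b c p p' p'' \<Longrightarrow> (LINT x:{b<..<c}|lborel. p x * h x) = 0"
  shows "AE x in lborel. x \<in> {b<..<c} \<longrightarrow> h x = 0"
proof -
  have "\<forall>n. \<exists>g. (\<exists>g' g''. C2_supported b c g g' g'') \<and> L2_norm_on {b<..<c} (\<lambda>x. g x - h x) < 1 / real (Suc n)"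
    using L2_dense_C2[OF h _ bc] by (metis zero_less_divide_1_iff of_nat_0_less_iff zero_less_Suc)
  then obtain g where g: "\<And>n. \<exists>g' g''. C2_supported b c (g n) g' g''" "\<And>n. L2_norm_on {b<..<c} (\<lambda>x. g n x - h x) < 1 / real (Suc n)"
    by metis
  have lim: "(\<lambda>n. L2_norm_on {b<..<c} (\<lambda>x. g n x - h x)) \<longlonglongrightarrow> 0"
  proof (rule tendsto_sandwich[OF _ _ tendsto_const LIMSEQ_inverse_real_of_nat])
    show "\<forall>\<^sub>F n in sequentially. L2_norm_on {b<..<c} (\<lambda>x. g n x - h x) \<le> inverse (real (Suc n))"
      using g(2) by (auto intro!: less_imp_le always_eventually simp: inverse_eq_divide)
  qed simp
  have gL: "g n \<in> L2_on {b<..<c}" for n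
    using g(1)[of n] C2_supported_derivs(1) by (auto intro!: continuous_L2_on)
  have "(\<lambda>n. LINT x:{b<..<c}|lborel. g n x * h x) \<longlonglongrightarrow> (LINT x:{b<..<c}|lborel. h x * h x)"
    by (rule L2_inner_tendsto[OF gL h h lim])
  moreover have "(LINT x:{b<..<c}|lborel. g n x * h x) = 0" for n using g(1)[of n] orth by blast
  ultimately have "(LINT x:{b<..<c}|lborel. h x * h x) = 0" by (simp add: LIMSEQ_const_iff)
  then have "L2_norm_on {b<..<c} h = 0" unfolding L2_norm_on_def by (simp add: power2_eq_square)
  then have z: "L2_norm_on UNIV (\<lambda>x. indicator {b<..<c} x * h x) = 0" by (simp only: L2_norm_on_eq[of "{b<..<c}"])
  have "(\<lambda>x. indicator {b<..<c} x * h x) \<in> L2_on UNIV" using h by (simp only: L2_on_iff[of _ "{b<..<c}"])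
  from L2_norm_zero_iff[OF this] z have "AE x in lborel. indicator {b<..<c} x * h x = 0" by simp
  then show ?thesis by eventually_elim (auto simp: indicator_def)
qed

lemma set_integral_cong_AE_L2:
  assumes "f \<in> L2_on S" "g \<in> L2_on S" "h \<in> L2_on S" "AE x in lborel. x \<in> S \<longrightarrow> f x = g x"
  shows "(LINT x:S|lborel. f x * h x) = (LINT x:S|lborel. g x * h x)"
  unfolding set_lebesgue_integral_def
proof (rule integral_cong_AE)
  show "(\<lambda>x. indicator S x *\<^sub>R (f x * h x)) \<in> borel_measurable lborel" "(\<lambda>x. indicator S x *\<^sub>R (g x * h x)) \<in> borel_measurable lborel"
    using L2_on_mult_integrable[OF assms(1,3)] L2_on_mult_integrable[OF assms(2,3)]
    unfolding set_integrable_def by (auto dest: borel_measurable_integrable)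
  show "AE x in lborel. indicator S x *\<^sub>R (f x * h x) = indicator S x *\<^sub>R (g x * h x)"
    using assms(4) by eventually_elim (auto simp: indicator_def)
qed

text \<open>Integration by parts against C2 functions expresses the pairing with the derivative
  through the function alone.\<close>

lemma H10_deriv_unique:
  assumes "H10_deriv a f1 g1" "H10_deriv a f2 g2" "a > 0" "AE x in lborel. x \<in> {0<..<a} \<longrightarrow> f1 x = f2 x"
  shows "AE x in lborel. x \<in> {0<..<a} \<longrightarrow> g1 x = g2 x"
proof -
  have f: "f1 \<in> L2_on {0<..<a}" "f2 \<in> L2_on {0<..<a}" and g: "g1 \<in> L2_on {0<..<a}" "g2 \<in> L2_on {0<..<a}"
    using assms(1,2) H10_derivD by auto
  have "AE x in lborel. x \<in> {0<..<a} \<longrightarrow> g1 x - g2 x = 0"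
  proof (rule L2_orthogonal_C2[OF L2_diff[OF g] assms(3)])
    fix p p' p'' assume C: "C2_supported 0 a p p' p''"
    note d = C2_supported_derivs[OF C]
    have L: "p \<in> L2_on {0<..<a}" "p' \<in> L2_on {0<..<a}" using d by (auto intro!: continuous_L2_on)
    have "(LINT x:{0<..<a}|lborel. f1 x * p' x) = (LINT x:{0<..<a}|lborel. f2 x * p' x)"
      by (rule set_integral_cong_AE_L2[OF f L(2) assms(4)])
    then have "(LINT x:{0<..<a}|lborel. g1 x * p x) = (LINT x:{0<..<a}|lborel. g2 x * p x)"
      using H10_integration_by_parts[OF assms(1) _ d(3,2)] H10_integration_by_parts[OF assms(2) _ d(3,2)] assms(3) by simp
    then show "(LINT x:{0<..<a}|lborel. p x * (g1 x - g2 x)) = 0"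
      using L2_on_mult_integrable[OF L(1) g(1)] L2_on_mult_integrable[OF L(1) g(2)]
      by (simp add: right_diff_distrib mult.commute)
  qed
  then show ?thesis by eventually_elim auto
qed

text \<open>The building block of every C1 cutoff below: they are combinations of such quadratic
  splines.\<close>

lemma DERIV_pos_part_square: "((\<lambda>y::real. (max 0 y)\<^sup>2) has_real_derivative 2 * max 0 y) (at y)"
proof (cases y "0::real" rule: linorder_cases)
  case less
  have "((\<lambda>y::real. 0) has_real_derivative 0) (at y)" by simp
  then have "((\<lambda>y::real. (max 0 y)\<^sup>2) has_real_derivative 0) (at y)"
    by (rule has_field_derivative_transform_within_open[of _ _ _ "{..<0}"]) (use less in auto)
  then show ?thesis using less by (simp add: max_def)
next
  case greater
  have "((\<lambda>y::real. y\<^sup>2) has_real_derivative 2 * y) (at y)" by (auto intro!: derivative_eq_intros)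
  then have "((\<lambda>y::real. (max 0 y)\<^sup>2) has_real_derivative 2 * y) (at y)"
    by (rule has_field_derivative_transform_within_open[of _ _ _ "{0<..}"]) (use greater in auto)
  then show ?thesis using greater by (simp add: max_def)
next
  case equal
  have "((\<lambda>h::real. max 0 h) \<longlongrightarrow> max 0 0) (at 0)" by (intro tendsto_intros)
  moreover have "((max 0 (0 + h))\<^sup>2 - (max 0 0)\<^sup>2) / h = max 0 h" for h :: real
    by (simp add: max_def power2_eq_square)
  ultimately show ?thesis unfolding equal DERIV_def by simp
qed

text \<open>Its derivative \<open>smooth_step'\<close> is the hat function on \<open>[1,3]\<close>
  with peak 1 at 2, so the step climbs from 0 at \<open>y = 1\<close> to 1 at \<open>y = 3\<close>.
  Starting at 1 instead of 0 leaves, after scaling, a gap at the endpoint.\<close>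

definition smooth_step :: "real \<Rightarrow> real" where
  "smooth_step y = ((max 0 (y - 1))\<^sup>2 - 2 * (max 0 (y - 2))\<^sup>2 + (max 0 (y - 3))\<^sup>2) / 2"

definition smooth_step' :: "real \<Rightarrow> real" where
  "smooth_step' y = max 0 (y - 1) - 2 * max 0 (y - 2) + max 0 (y - 3)"

lemma DERIV_smooth_step: "(smooth_step has_real_derivative smooth_step' y) (at y)"
proof -
  have d: "((\<lambda>y::real. (max 0 (y - c))\<^sup>2) has_real_derivative 2 * max 0 (y - c)) (at y)" for c
  proof -
    have "((\<lambda>y. y - c) has_real_derivative 1) (at y)" by (auto intro!: derivative_eq_intros)
    from DERIV_chain'[OF this DERIV_pos_part_square] show ?thesis by simp
  qed
  have "((\<lambda>y. ((max 0 (y - 1))\<^sup>2 - 2 * (max 0 (y - 2))\<^sup>2 + (max 0 (y - 3))\<^sup>2) / 2) has_real_derivative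
     (2 * max 0 (y - 1) - 2 * (2 * max 0 (y - 2)) + 2 * max 0 (y - 3)) / 2) (at y)"
    by (intro DERIV_cdivide DERIV_add DERIV_diff DERIV_cmult d)
  then show ?thesis unfolding smooth_step_def[abs_def] smooth_step'_def
    by (rule DERIV_cong) (simp add: add_divide_distrib diff_divide_distrib)
qed

lemma continuous_smooth_step [continuous_intros]:
  fixes f :: "'a::topological_space \<Rightarrow> real"
  assumes "continuous_on S f"
  shows "continuous_on S (\<lambda>x. smooth_step (f x))" "continuous_on S (\<lambda>x. smooth_step' (f x))"
proof -
  show "continuous_on S (\<lambda>x. smooth_step (f x))"
    unfolding smooth_step_def by (intro continuous_intros assms) simp
  show "continuous_on S (\<lambda>x. smooth_step' (f x))"
    unfolding smooth_step'_def by (intro continuous_intros assms)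
qed

lemma smooth_step_values:
  "y \<le> 1 \<Longrightarrow> smooth_step y = 0" "y \<ge> 3 \<Longrightarrow> smooth_step y = 1" "0 \<le> smooth_step y" "smooth_step y \<le> 1"
  "y \<ge> 3 \<Longrightarrow> smooth_step' y = 0" "0 \<le> smooth_step' y" "smooth_step' y \<le> 1"
proof -
  show "y \<le> 1 \<Longrightarrow> smooth_step y = 0" "y \<ge> 3 \<Longrightarrow> smooth_step' y = 0" "0 \<le> smooth_step' y" "smooth_step' y \<le> 1"
    by (auto simp: smooth_step_def smooth_step'_def max_def)
  have 3: "smooth_step y = 1" if "y \<ge> 3" using that
    by (simp add: smooth_step_def max_def power2_eq_square algebra_simps)
  then show "y \<ge> 3 \<Longrightarrow> smooth_step y = 1" .
  have "0 \<le> smooth_step y \<and> smooth_step y \<le> 1"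
  proof -
    consider "y \<le> 1" | "1 < y" "y \<le> 2" | "2 < y" "y < 3" | "3 \<le> y" by linarith
    then show ?thesis
    proof cases
      case 1 then show ?thesis by (simp add: smooth_step_def max_def)
    next
      case 2
      have "smooth_step y = (y - 1)\<^sup>2 / 2" using 2 by (simp add: smooth_step_def max_def)
      moreover have "(y - 1)\<^sup>2 \<le> 1" using 2 by (intro power_le_one) auto
      moreover have "0 \<le> (y - 1)\<^sup>2" by simp
      ultimately show ?thesis by linarith
    next
      case 3
      then have "smooth_step y = 1 - (3 - y)\<^sup>2 / 2"
        by (simp add: smooth_step_def max_def power2_eq_square field_simps)
      moreover have "(3 - y)\<^sup>2 \<le> 1" using 3 by (intro power_le_one) auto
      moreover have "0 \<le> (3 - y)\<^sup>2" by simp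
      ultimately show ?thesis by linarith
    next
      case 4 then show ?thesis using 3 by simp
    qed
  qed
  then show "0 \<le> smooth_step y" "smooth_step y \<le> 1" by auto
qed

lemma L2_on_dominated_convergence:
  fixes g :: "nat \<Rightarrow> 'a::euclidean_space \<Rightarrow> real"
  assumes S: "S \<in> sets borel" "bounded S"
    and "\<And>n. g n \<in> borel_measurable borel" "f \<in> borel_measurable borel"
    and "\<And>x. x \<in> S \<Longrightarrow> (\<lambda>n. g n x) \<longlonglongrightarrow> f x" "\<And>n x. x \<in> S \<Longrightarrow> \<bar>g n x\<bar> \<le> c"
  shows "(\<lambda>n. L2_norm_on S (\<lambda>x. g n x - f x)) \<longlonglongrightarrow> 0"
proof -
  have "(\<lambda>n. L2_norm_on UNIV (\<lambda>x. indicator S x * g n x - indicator S x * f x)) \<longlonglongrightarrow> 0"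
  proof (rule L2_dominated_convergence[OF _ _ indicator_L2[OF S, of c]])
    show "AE x in lborel. (\<lambda>n. indicator S x * g n x) \<longlonglongrightarrow> indicator S x * f x"
      using assms(5) by (intro AE_I2) (auto simp: indicator_def)
    show "AE x in lborel. \<bar>indicator S x * g n x\<bar> \<le> c * indicator S x" for n
      using assms(6) by (intro AE_I2) (auto simp: indicator_def)
  qed (use assms(1,3,4) in measurable)
  moreover have "(\<lambda>x. indicator S x * (g n x - f x)) = (\<lambda>x. indicator S x * g n x - indicator S x * f x)" for n
    by (simp add: right_diff_distrib)
  ultimately show ?thesis unfolding L2_norm_on_eq[of S] by simp
qed

text \<open>Multiplying by \<open>X n\<close>, which cuts off at distance of order
  \<open>1 / n\<close> from the ends, produces test functions. The dangerous term is
  \<open>f * X' n\<close>: there \<open>X' n\<close> has size \<open>n\<close>, but \<open>f\<close>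
  vanishes at the ends and is Lipschitz, so the product stays bounded. It is eventually zero at each
  interior point, and dominated convergence applies.\<close>

lemma H10_C1:
  assumes a: "a > 0" and d: "\<And>x. (f has_real_derivative f' x) (at x)" and c: "continuous_on UNIV f'"
    and f0: "f 0 = 0" "f a = 0"
  shows "H10_deriv a f f'"
proof -
  have fc: "continuous_on UNIV f" using d by (rule DERIV_continuous_UNIV)
  obtain L where L: "L > 0" "\<And>x. x \<in> {0..a} \<Longrightarrow> \<bar>f' x\<bar> \<le> L"
    using compact_imp_bounded[OF compact_continuous_image[OF continuous_on_subset[OF c, of "{0..a}"]]]
    unfolding bounded_pos by auto
  have lip: "\<bar>f x - f y\<bar> \<le> L * \<bar>x - y\<bar>" if "x \<in> {0..a}" "y \<in> {0..a}" for x y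
    using field_differentiable_bound[of "{0..a}" f f' L y x, OF _ has_field_derivative_at_within[OF d]] L that
    by (simp add: abs_minus_commute)
  have lip0: "\<bar>f x\<bar> \<le> L * x" "\<bar>f x\<bar> \<le> L * (a - x)" if "0 < x" "x < a" for x
    using lip[of x 0] lip[of x a] that f0 a by auto
  let ?N = "\<lambda>n. real (Suc n)"
  define X where "X n x = smooth_step (?N n * x) * smooth_step (?N n * (a - x))" for n x
  define X' where "X' n x = ?N n * smooth_step' (?N n * x) * smooth_step (?N n * (a - x))
     - smooth_step (?N n * x) * (?N n * smooth_step' (?N n * (a - x)))" for n x
  have dX: "(X n has_real_derivative X' n x) (at x)" for n x
  proof -
    have 1: "((\<lambda>x. smooth_step (?N n * x)) has_real_derivative (?N n * smooth_step' (?N n * x))) (at x)"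
    proof -
      have "((\<lambda>x. ?N n * x) has_real_derivative ?N n) (at x)" by (auto intro!: derivative_eq_intros)
      from DERIV_chain'[OF this DERIV_smooth_step] show ?thesis by (rule DERIV_cong) simp
    qed
    have "((\<lambda>x. ?N n * (a - x)) has_real_derivative (- ?N n)) (at x)" by (auto intro!: derivative_eq_intros)
    then have 2: "((\<lambda>x. smooth_step (?N n * (a - x))) has_real_derivative - (?N n * smooth_step' (?N n * (a - x)))) (at x)"
    proof -
      assume "((\<lambda>x. ?N n * (a - x)) has_real_derivative (- ?N n)) (at x)"
      from DERIV_chain'[OF this DERIV_smooth_step] show ?thesis by (rule DERIV_cong) (simp add: algebra_simps)
    qed
    show ?thesis unfolding X_def[abs_def] X'_def using DERIV_mult[OF 1 2] by (simp add: algebra_simps)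
  qed
  have X'c: "continuous_on UNIV (X' n)" for n
    unfolding X'_def by (intro continuous_intros)
  have Xc: "continuous_on UNIV (X n)" for n using dX by (rule DERIV_continuous_UNIV)
  have X01: "\<bar>X n x\<bar> \<le> 1" for n x
    unfolding X_def abs_mult using smooth_step_values(3,4) by (intro mult_le_one) (auto simp: abs_of_nonneg)
  have tf: "test_fun {0<..<a} (\<lambda>x. f x * X n x) (\<lambda>x. f' x * X n x + f x * X' n x)" for n
    unfolding test_fun_real
  proof (intro conjI allI)
    show "((\<lambda>x. f x * X n x) has_real_derivative f' x * X n x + f x * X' n x) (at x)" for x
      using DERIV_mult[OF d dX[of n]] by (simp add: algebra_simps)
    show "continuous_on UNIV (\<lambda>x. f' x * X n x + f x * X' n x)"
      by (intro continuous_intros c fc Xc X'c)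
    show "\<exists>d>0. \<forall>x. f x * X n x \<noteq> 0 \<longrightarrow> d \<le> x \<and> x \<le> a - d"
    proof (intro exI[of _ "1 / ?N n"] conjI allI impI)
      fix x assume "f x * X n x \<noteq> 0"
      then have "\<not> ?N n * x \<le> 1" "\<not> ?N n * (a - x) \<le> 1" unfolding X_def using smooth_step_values(1) by auto
      then have "1 < x * ?N n" "1 < (a - x) * ?N n" by (auto simp: mult.commute)
      then have "1 / ?N n < x" "1 / ?N n < a - x" by (simp_all only: divide_less_eq of_nat_0_less_iff zero_less_Suc simp_thms if_True)
      then show "1 / ?N n \<le> x" "x \<le> a - 1 / ?N n" by auto
    qed simp
  qed
  \<comment> \<open>Where \<open>smooth_step'\<close> is nonzero one has
    \<open>?N n * y < 3\<close>, so the bound \<open>L * y\<close> for \<open>f\<close> absorbs the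
    factor \<open>?N n\<close>.\<close>
  have key: "\<bar>f x * (?N n * smooth_step' (?N n * y))\<bar> \<le> 3 * L" if "\<bar>f x\<bar> \<le> L * y" "y > 0" for n x y
  proof (cases "?N n * y \<ge> 3")
    case True then show ?thesis using smooth_step_values(5) L by simp
  next
    case False
    have "\<bar>f x * (?N n * smooth_step' (?N n * y))\<bar> = \<bar>f x\<bar> * ?N n * smooth_step' (?N n * y)"
      using smooth_step_values(6) by (simp add: abs_mult)
    also have "\<dots> \<le> (L * y) * ?N n * 1"
      using that smooth_step_values(6,7) L by (intro mult_mono) auto
    also have "\<dots> = L * (?N n * y)" by simp
    also have "\<dots> \<le> L * 3" using False L by (intro mult_left_mono) auto
    finally show ?thesis by simp
  qed
  have bd: "\<bar>f x * X' n x\<bar> \<le> 6 * L" if x: "0 < x" "x < a" for n x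
  proof -
    have "f x * X' n x = f x * (?N n * smooth_step' (?N n * x)) * smooth_step (?N n * (a - x))
      - f x * (?N n * smooth_step' (?N n * (a - x))) * smooth_step (?N n * x)"
      unfolding X'_def by (simp add: algebra_simps)
    moreover have "\<bar>f x * (?N n * smooth_step' (?N n * x)) * smooth_step (?N n * (a - x))\<bar> \<le> (3 * L) * 1"
      unfolding abs_mult[of _ "smooth_step _"] using key[OF lip0(1)[OF x] x(1), of n] smooth_step_values(3,4) L
      by (intro mult_mono) auto
    moreover have "\<bar>f x * (?N n * smooth_step' (?N n * (a - x))) * smooth_step (?N n * x)\<bar> \<le> (3 * L) * 1"
      unfolding abs_mult[of _ "smooth_step _"] using key[OF lip0(2)[OF x], of n] x smooth_step_values(3,4) L
      by (intro mult_mono) auto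
    ultimately show ?thesis by linarith
  qed
  have ev: "\<forall>\<^sub>F n in sequentially. X n x = 1 \<and> X' n x = 0" if x: "0 < x" "x < a" for x
  proof -
    obtain n0 where n0: "real n0 \<ge> max (3/x) (3/(a-x))" using real_arch_simple by blast
    have "X n x = 1 \<and> X' n x = 0" if "n \<ge> n0" for n
    proof -
      have "?N n \<ge> 3/x" "?N n \<ge> 3/(a-x)" using n0 that by auto
      then have "?N n * x \<ge> 3" "?N n * (a - x) \<ge> 3" using x by (simp_all add: divide_le_eq)
      then show ?thesis unfolding X_def X'_def using smooth_step_values(2,5) by simp
    qed
    then show ?thesis by (rule eventually_sequentiallyI)
  qed
  have "bounded (f ` {0..a})"
    by (intro compact_imp_bounded compact_continuous_image continuous_on_subset[OF fc]) auto
  then obtain M where "\<forall>y\<in>f ` {0..a}. norm y \<le> M" unfolding bounded_iff by blast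
  then have M: "\<bar>f x\<bar> \<le> M" if "x \<in> {0..a}" for x using that by auto
  have "(\<lambda>n. L2_norm_on {0<..<a} (\<lambda>x. f x * X n x - f x)) \<longlonglongrightarrow> 0"
  proof (rule L2_on_dominated_convergence[of _ _ _ M])
    show "(\<lambda>n. f x * X n x) \<longlonglongrightarrow> f x" if "x \<in> {0<..<a}" for x
    proof (rule tendsto_eventually)
      have "0 < x" "x < a" using that by auto
      from ev[OF this] show "\<forall>\<^sub>F n in sequentially. f x * X n x = f x" by eventually_elim simp
    qed
    show "\<bar>f x * X n x\<bar> \<le> M" if "x \<in> {0<..<a}" for x n
    proof -
      have "\<bar>f x * X n x\<bar> \<le> \<bar>f x\<bar> * 1" unfolding abs_mult using X01 by (intro mult_left_mono) auto
      then show ?thesis using M[of x] that by simp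
    qed
  qed (auto intro!: borel_measurable_continuous_onI fc Xc continuous_intros)
  moreover have "(\<lambda>n. L2_norm_on {0<..<a} (\<lambda>x. (f' x * X n x + f x * X' n x) - f' x)) \<longlonglongrightarrow> 0"
  proof (rule L2_on_dominated_convergence[of _ _ _ "L + 6 * L"])
    show "(\<lambda>n. f' x * X n x + f x * X' n x) \<longlonglongrightarrow> f' x" if "x \<in> {0<..<a}" for x
    proof (rule tendsto_eventually)
      have "0 < x" "x < a" using that by auto
      from ev[OF this] show "\<forall>\<^sub>F n in sequentially. f' x * X n x + f x * X' n x = f' x" by eventually_elim simp
    qed
    show "\<bar>f' x * X n x + f x * X' n x\<bar> \<le> L + 6 * L" if "x \<in> {0<..<a}" for x n
    proof -
      have "\<bar>f' x * X n x\<bar> \<le> \<bar>f' x\<bar> * 1" unfolding abs_mult using X01 by (intro mult_left_mono) auto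
      moreover have "\<bar>f' x\<bar> \<le> L" using L(2)[of x] that by simp
      moreover have "\<bar>f x * X' n x\<bar> \<le> 6 * L" using bd[of x n] that by simp
      ultimately show ?thesis by linarith
    qed
  qed (auto intro!: borel_measurable_continuous_onI fc Xc c X'c continuous_intros)
  ultimately show ?thesis
    unfolding H10_deriv_def using tf fc c
    by (intro conjI exI[of _ "\<lambda>n x. f x * X n x"] exI[of _ "\<lambda>n x. f' x * X n x + f x * X' n x"] allI)
      (auto intro!: continuous_L2_on)
qed

section \<open>Linear structure, dilations and the Poincare inequality for H10\<close>

lemma test_fun_add:
  fixes f :: "'a::euclidean_space \<Rightarrow> real"
  assumes "test_fun S f f'" "test_fun S g g'"
  shows "test_fun S (\<lambda>x. f x + g x) (\<lambda>x. f' x + g' x)"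
proof -
  obtain K1 where K1: "compact K1" "K1 \<subseteq> S" "\<And>x. x \<notin> K1 \<Longrightarrow> f x = 0" using assms(1) unfolding test_fun_def by auto
  obtain K2 where K2: "compact K2" "K2 \<subseteq> S" "\<And>x. x \<notin> K2 \<Longrightarrow> g x = 0" using assms(2) unfolding test_fun_def by auto
  have "\<exists>K. compact K \<and> K \<subseteq> S \<and> (\<forall>x. x \<notin> K \<longrightarrow> f x + g x = 0)"
    using K1 K2 by (intro exI[of _ "K1 \<union> K2"]) (auto intro: compact_Un)
  then show ?thesis using assms unfolding test_fun_def by (auto intro!: GDERIV_add continuous_intros)
qed

lemma test_fun_scale:
  fixes f :: "'a::euclidean_space \<Rightarrow> real"
  assumes "test_fun S f f'"
  shows "test_fun S (\<lambda>x. c * f x) (\<lambda>x. c *\<^sub>R f' x)"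
proof -
  obtain K1 where K1: "compact K1" "K1 \<subseteq> S" "\<And>x. x \<notin> K1 \<Longrightarrow> f x = 0" using assms(1) unfolding test_fun_def by auto
  have "\<exists>K. compact K \<and> K \<subseteq> S \<and> (\<forall>x. x \<notin> K \<longrightarrow> c * f x = 0)" using K1 by (intro exI[of _ K1]) auto
  moreover have "GDERIV (\<lambda>x. c * f x) x :> c *\<^sub>R f' x" for x
    using GDERIV_mult[OF GDERIV_const[of c x], of f "f' x"] assms unfolding test_fun_def by simp
  ultimately show ?thesis using assms unfolding test_fun_def by (auto intro!: continuous_intros)
qed

lemma H10_deriv_add:
  assumes "H10_deriv a f1 g1" "H10_deriv a f2 g2"
  shows "H10_deriv a (\<lambda>x. f1 x + f2 x) (\<lambda>x. g1 x + g2 x)"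
proof -
  obtain p1 q1 where 1: "\<And>n::nat. test_fun {0<..<a} (p1 n) (q1 n)"
    "(\<lambda>n. L2_norm_on {0<..<a} (\<lambda>x. p1 n x - f1 x)) \<longlonglongrightarrow> 0" "(\<lambda>n. L2_norm_on {0<..<a} (\<lambda>x. q1 n x - g1 x)) \<longlonglongrightarrow> 0"
    using H10_derivE[OF assms(1)] by blast
  obtain p2 q2 where 2: "\<And>n::nat. test_fun {0<..<a} (p2 n) (q2 n)"
    "(\<lambda>n. L2_norm_on {0<..<a} (\<lambda>x. p2 n x - f2 x)) \<longlonglongrightarrow> 0" "(\<lambda>n. L2_norm_on {0<..<a} (\<lambda>x. q2 n x - g2 x)) \<longlonglongrightarrow> 0"
    using H10_derivE[OF assms(2)] by blast
  note L = H10_derivD[OF assms(1)] H10_derivD[OF assms(2)]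
  have sum: "(\<lambda>n. L2_norm_on {0<..<a} (\<lambda>x. (u n x + v n x) - (f x + g x))) \<longlonglongrightarrow> 0"
    if l: "(\<lambda>n. L2_norm_on {0<..<a} (\<lambda>x. u n x - f x)) \<longlonglongrightarrow> 0" "(\<lambda>n. L2_norm_on {0<..<a} (\<lambda>x. v n x - g x)) \<longlonglongrightarrow> 0"
      and "\<And>n. u n \<in> L2_on {0<..<a}" "\<And>n. v n \<in> L2_on {0<..<a}" "f \<in> L2_on {0<..<a}" "g \<in> L2_on {0<..<a}" for u v f g
  proof (rule tendsto_sandwich[OF _ _ tendsto_const])
    show "(\<lambda>n. L2_norm_on {0<..<a} (\<lambda>x. u n x - f x) + L2_norm_on {0<..<a} (\<lambda>x. v n x - g x)) \<longlonglongrightarrow> 0"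
      using tendsto_add[OF l] by simp
    have "L2_norm_on {0<..<a} (\<lambda>x. (u n x + v n x) - (f x + g x)) \<le> L2_norm_on {0<..<a} (\<lambda>x. u n x - f x) + L2_norm_on {0<..<a} (\<lambda>x. v n x - g x)" for n
      using L2_norm_triangle[OF L2_diff[OF that(3)[of n] that(5)] L2_diff[OF that(4)[of n] that(6)]] by (simp add: algebra_simps)
    then show "\<forall>\<^sub>F n in sequentially. L2_norm_on {0<..<a} (\<lambda>x. (u n x + v n x) - (f x + g x)) \<le> L2_norm_on {0<..<a} (\<lambda>x. u n x - f x) + L2_norm_on {0<..<a} (\<lambda>x. v n x - g x)"
      by simp
  qed simp
  show ?thesis unfolding H10_deriv_def
  proof (intro conjI exI allI)
    show "test_fun {0<..<a} (\<lambda>x. p1 n x + p2 n x) (\<lambda>x. q1 n x + q2 n x)" for n by (rule test_fun_add[OF 1(1) 2(1)])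
    show "(\<lambda>n. L2_norm_on {0<..<a} (\<lambda>x. (p1 n x + p2 n x) - (f1 x + f2 x))) \<longlonglongrightarrow> 0"
      by (rule sum[OF 1(2) 2(2) test_fun_L2_on(1)[OF 1(1)] test_fun_L2_on(1)[OF 2(1)] L(1,3)])
    show "(\<lambda>n. L2_norm_on {0<..<a} (\<lambda>x. (q1 n x + q2 n x) - (g1 x + g2 x))) \<longlonglongrightarrow> 0"
      by (rule sum[OF 1(3) 2(3) test_fun_L2_on(2)[OF 1(1)] test_fun_L2_on(2)[OF 2(1)] L(2,4)])
  qed (auto intro: L2_add L)
qed

lemma H10_deriv_scale:
  assumes "H10_deriv a f g"
  shows "H10_deriv a (\<lambda>x. c * f x) (\<lambda>x. c * g x)"
proof -
  obtain p q where 1: "\<And>n::nat. test_fun {0<..<a} (p n) (q n)"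
    "(\<lambda>n. L2_norm_on {0<..<a} (\<lambda>x. p n x - f x)) \<longlonglongrightarrow> 0" "(\<lambda>n. L2_norm_on {0<..<a} (\<lambda>x. q n x - g x)) \<longlonglongrightarrow> 0"
    using H10_derivE[OF assms(1)] by blast
  show ?thesis unfolding H10_deriv_def
  proof (intro conjI exI allI)
    show "test_fun {0<..<a} (\<lambda>x. c * p n x) (\<lambda>x. c * q n x)" for n
      using test_fun_scale[OF 1(1)[of n], of c] by simp
    have "(\<lambda>n. \<bar>c\<bar> * L2_norm_on {0<..<a} (\<lambda>x. p n x - f x)) \<longlonglongrightarrow> 0" "(\<lambda>n. \<bar>c\<bar> * L2_norm_on {0<..<a} (\<lambda>x. q n x - g x)) \<longlonglongrightarrow> 0"
      using tendsto_mult_left[OF 1(2), of "\<bar>c\<bar>"] tendsto_mult_left[OF 1(3), of "\<bar>c\<bar>"] by auto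
    then show "(\<lambda>n. L2_norm_on {0<..<a} (\<lambda>x. c * p n x - c * f x)) \<longlonglongrightarrow> 0" "(\<lambda>n. L2_norm_on {0<..<a} (\<lambda>x. c * q n x - c * g x)) \<longlonglongrightarrow> 0"
      unfolding L2_norm_scale[symmetric] by (simp_all add: right_diff_distrib)
  qed (auto intro: L2_scale H10_derivD[OF assms])
qed

lemma H10_deriv_zero: "H10_deriv a (\<lambda>x. 0) (\<lambda>x. 0)"
proof -
  have "test_fun {0<..<a} (\<lambda>x. 0) (\<lambda>x. 0)" unfolding test_fun_real by (auto intro: exI[of _ 1])
  then show ?thesis unfolding H10_deriv_def
    by (intro conjI exI[of _ "\<lambda>_ _. 0"]) (auto simp: L2_norm_on_def)
qed

lemma L2_on_dilate:
  assumes "h \<in> L2_on {0<..<b}" "0 < (c::real)"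
  shows "(\<lambda>x. h (x / c)) \<in> L2_on {0<..<b * c}" "L2_norm_on {0<..<b * c} (\<lambda>x. h (x / c)) = sqrt c * L2_norm_on {0<..<b} h"
proof -
  define h0 where "h0 x = indicator {0<..<b} x * h x" for x
  have L: "h0 \<in> L2_on UNIV" using assms(1) unfolding h0_def by (simp only: L2_on_iff[of _ "{0<..<b}"])
  have c: "1 / c \<noteq> 0" using assms by simp
  have e: "(\<lambda>x. indicator {0<..<b * c} x * h (x / c)) = (\<lambda>x. h0 (1 / c * x + 0))"
    using assms(2) by (auto simp: h0_def indicator_def fun_eq_iff field_simps)
  show "(\<lambda>x. h (x / c)) \<in> L2_on {0<..<b * c}"
    unfolding L2_on_iff[of _ "{0<..<b * c}"] e by (rule L2_affine(1)[OF L c])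
  show "L2_norm_on {0<..<b * c} (\<lambda>x. h (x / c)) = sqrt c * L2_norm_on {0<..<b} h"
    unfolding L2_norm_on_eq[of "{0<..<b * c}"] e L2_affine(2)[OF L c]
    using assms(2) by (simp add: L2_norm_on_eq[of "{0<..<b}"] h0_def[abs_def] real_sqrt_divide)
qed

lemma H10_deriv_dilate:
  assumes H: "H10_deriv b f g" and c: "0 < c"
  shows "H10_deriv (b * c) (\<lambda>x. f (x / c)) (\<lambda>x. g (x / c) / c)"
proof -
  obtain p q where 1: "\<And>n::nat. test_fun {0<..<b} (p n) (q n)"
    "(\<lambda>n. L2_norm_on {0<..<b} (\<lambda>x. p n x - f x)) \<longlonglongrightarrow> 0" "(\<lambda>n. L2_norm_on {0<..<b} (\<lambda>x. q n x - g x)) \<longlonglongrightarrow> 0"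
    using H10_derivE[OF H] by blast
  note L = H10_derivD[OF H]
  show ?thesis unfolding H10_deriv_def
  proof (intro conjI exI allI)
    show "(\<lambda>x. f (x / c)) \<in> L2_on {0<..<b * c}" by (rule L2_on_dilate(1)[OF L(1) c])
    show "(\<lambda>x. g (x / c) / c) \<in> L2_on {0<..<b * c}"
      using L2_scale[OF L2_on_dilate(1)[OF L(2) c], of "1/c"] by simp
    show "test_fun {0<..<b * c} (\<lambda>x. p n (x / c)) (\<lambda>x. q n (x / c) / c)" for n
      unfolding test_fun_real
    proof (intro conjI allI)
      note t = 1(1)[of n, unfolded test_fun_real]
      obtain d where d: "d > 0" "\<And>x. p n x \<noteq> 0 \<Longrightarrow> d \<le> x \<and> x \<le> b - d" using t by auto
      show "((\<lambda>x. p n (x / c)) has_real_derivative q n (x / c) / c) (at x)" for x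
      proof -
        have D: "(p n has_real_derivative q n (x / c)) (at (x / c))" by (rule t[THEN conjunct1, rule_format])
        have "((\<lambda>x. x / c) has_real_derivative 1 / c) (at x)" using c by (auto intro!: derivative_eq_intros)
        from DERIV_chain'[OF this D] show ?thesis by (rule DERIV_cong) simp
      qed
      have "continuous_on UNIV (q n)" using t by auto
      then show "continuous_on UNIV (\<lambda>x. q n (x / c) / c)"
      proof (rule continuous_on_divide[OF continuous_on_compose2[of UNIV "q n"] continuous_on_const])
        show "continuous_on UNIV (\<lambda>x. x / c)" using c by (intro continuous_intros) auto
      qed (use c in auto)
      show "\<exists>d>0. \<forall>x. p n (x / c) \<noteq> 0 \<longrightarrow> d \<le> x \<and> x \<le> b * c - d"
      proof (intro exI[of _ "d * c"] conjI allI impI)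
        fix x assume "p n (x / c) \<noteq> 0"
        then have "d \<le> x / c" "x / c \<le> b - d" using d(2) by auto
        then show "d * c \<le> x" "x \<le> b * c - d * c" using c by (simp_all add: field_simps)
      qed (use d c in simp)
    qed
    have *: "(\<lambda>n. sqrt c * L2_norm_on {0<..<b} (\<lambda>x. p n x - f x)) \<longlonglongrightarrow> 0"
      "(\<lambda>n. 1 / c * (sqrt c * L2_norm_on {0<..<b} (\<lambda>x. q n x - g x))) \<longlonglongrightarrow> 0"
      using tendsto_mult_left[OF 1(2), of "sqrt c"] tendsto_mult_left[OF 1(3), of "1 / c * sqrt c"] by auto
    have Lp: "(\<lambda>x. p n x - f x) \<in> L2_on {0<..<b}" "(\<lambda>x. q n x - g x) \<in> L2_on {0<..<b}" for n
      using test_fun_L2_on[OF 1(1)[of n]] L by (auto intro: L2_diff)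
    show "(\<lambda>n. L2_norm_on {0<..<b * c} (\<lambda>x. p n (x / c) - f (x / c))) \<longlonglongrightarrow> 0"
      using *(1) L2_on_dilate(2)[OF Lp(1) c] by simp
    have "L2_norm_on {0<..<b * c} (\<lambda>x. q n (x / c) / c - g (x / c) / c) = 1 / c * (sqrt c * L2_norm_on {0<..<b} (\<lambda>x. q n x - g x))" for n
      using L2_norm_scale[of "{0<..<b * c}" "1 / c" "\<lambda>x. q n (x / c) - g (x / c)"] L2_on_dilate(2)[OF Lp(2) c, of n] c
      by (simp add: diff_divide_distrib)
    then show "(\<lambda>n. L2_norm_on {0<..<b * c} (\<lambda>x. q n (x / c) / c - g (x / c) / c)) \<longlonglongrightarrow> 0"
      using *(2) by simp
  qed
qed

text \<open>Cauchy-Schwarz bounds the primitive of \<open>g\<close> uniformly, and the uniform bound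
  is then integrated; either step costs a factor \<open>sqrt a\<close>.\<close>

lemma H10_Poincare:
  assumes H: "H10_deriv a f g" and a: "a \<ge> 0"
  shows "L2_norm_on {0<..<a} f \<le> a * L2_norm_on {0<..<a} g"
proof -
  define F where "F x = (LINT y:{0<..<min x a}|lborel. g y)" for x
  note L = H10_derivD[OF H]
  have m: "F \<in> borel_measurable borel" unfolding F_def by (rule primitive_measurable[OF L(2)])
  have bd: "\<bar>F x\<bar> \<le> sqrt a * L2_norm_on {0<..<a} g" if x: "0 < x" "x < a" for x
  proof -
    have s: "g \<in> L2_on {0<..<x}" "L2_norm_on {0<..<x} g \<le> L2_norm_on {0<..<a} g"
      using L2_restrict[OF L(2), of "{0<..<x}"] x by (auto simp: subset_eq)
    have "\<bar>LINT y:{0<..<x}|lborel. g y\<bar> \<le> sqrt (x - 0) * L2_norm_on {0<..<x} g"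
      using x by (intro L2_integral_bound s(1)) auto
    also have "\<dots> \<le> sqrt a * L2_norm_on {0<..<a} g" using x s a by (intro mult_mono) auto
    finally show ?thesis using x by (simp add: F_def min_def)
  qed
  have FL: "F \<in> L2_on {0<..<a}" using bd m by (intro bounded_L2_on[of _ _ "sqrt a * L2_norm_on {0<..<a} g"]) auto
  have "L2_norm_on {0<..<a} f = L2_norm_on {0<..<a} F"
  proof (rule L2_norm_cong_AE[OF _ L(1) FL])
    show "AE x in lborel. x \<in> {0<..<a} \<longrightarrow> f x = F x"
      using H10_representation[OF H a] by eventually_elim (auto simp: F_def min_def)
  qed
  also have "\<dots> \<le> sqrt a * L2_norm_on {0<..<a} g * sqrt (a - 0)"
    using bd m a by (intro L2_norm_le_uniform) auto
  also have "\<dots> = (sqrt a * sqrt a) * L2_norm_on {0<..<a} g" by simp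
  also have "sqrt a * sqrt a = a" using a by simp
  finally show ?thesis .
qed

section \<open>Functionals that pair the derivative with an L2 function\<close>

definition weak_deriv :: "real \<Rightarrow> (real \<Rightarrow> real) \<Rightarrow> real \<Rightarrow> real" where
  "weak_deriv a f = (SOME g. H10_deriv a f g)"

lemma weak_deriv: "H10_deriv a f g \<Longrightarrow> H10_deriv a f (weak_deriv a f)"
  unfolding weak_deriv_def using someI[of "H10_deriv a f" g] .

text \<open>As a distribution this is minus the derivative of \<open>h\<close>. Elements of
  \<open>Hm1\<close> act on \<open>f\<close> alone, so a derivative of \<open>f\<close> has to be
  chosen; by \<open>H10_deriv_unique\<close> the choice does not affect the value.\<close>

definition pair_deriv :: "real \<Rightarrow> (real \<Rightarrow> real) \<Rightarrow> (real \<Rightarrow> real) \<Rightarrow> real" where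
  "pair_deriv a h f = (LINT x:{0<..<a}|lborel. h x * weak_deriv a f x)"

lemma pair_deriv_eq:
  assumes "H10_deriv a f g" "h \<in> L2_on {0<..<a}" "a > 0"
  shows "pair_deriv a h f = (LINT x:{0<..<a}|lborel. h x * g x)"
proof -
  have "(LINT x:{0<..<a}|lborel. weak_deriv a f x * h x) = (LINT x:{0<..<a}|lborel. g x * h x)"
    using assms(1) weak_deriv[OF assms(1)] H10_deriv_unique[OF weak_deriv[OF assms(1)] assms(1,3)]
    by (intro set_integral_cong_AE_L2 assms(2)) (auto dest: H10_derivD)
  then show ?thesis unfolding pair_deriv_def by (simp add: mult.commute)
qed

lemma pair_deriv_Hm1:
  assumes h: "h \<in> L2_on {0<..<a}" and a: "a > 0"
  shows "pair_deriv a h \<in> Hm1 a"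
  unfolding Hm1_def
proof (intro CollectI conjI ballI allI)
  fix f1 f2 assume "f1 \<in> H10 a" "f2 \<in> H10 a"
  then obtain g1 g2 where g: "H10_deriv a f1 g1" "H10_deriv a f2 g2" unfolding H10_def by auto
  show "pair_deriv a h (\<lambda>x. f1 x + f2 x) = pair_deriv a h f1 + pair_deriv a h f2"
    unfolding pair_deriv_eq[OF g(1) h a] pair_deriv_eq[OF g(2) h a] pair_deriv_eq[OF H10_deriv_add[OF g] h a]
    using L2_on_mult_integrable[OF h H10_derivD(2)[OF g(1)]] L2_on_mult_integrable[OF h H10_derivD(2)[OF g(2)]]
    by (simp add: distrib_left)
next
  fix c f assume "f \<in> H10 a"
  then obtain g where g: "H10_deriv a f g" unfolding H10_def by auto
  show "pair_deriv a h (\<lambda>x. c * f x) = c * pair_deriv a h f"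
    unfolding pair_deriv_eq[OF g h a] pair_deriv_eq[OF H10_deriv_scale[OF g] h a]
    by (simp add: mult.left_commute)
next
  have "\<bar>pair_deriv a h f\<bar> \<le> L2_norm_on {0<..<a} h * sqrt ((L2_norm_on {0<..<a} f)\<^sup>2 + (L2_norm_on {0<..<a} g)\<^sup>2)"
    if g: "H10_deriv a f g" for f g
  proof -
    have "\<bar>pair_deriv a h f\<bar> \<le> L2_norm_on {0<..<a} h * L2_norm_on {0<..<a} g"
      unfolding pair_deriv_eq[OF g h a] by (rule L2_Cauchy_Schwarz[OF h H10_derivD(2)[OF g]])
    also have "\<dots> \<le> L2_norm_on {0<..<a} h * sqrt ((L2_norm_on {0<..<a} f)\<^sup>2 + (L2_norm_on {0<..<a} g)\<^sup>2)"
      by (intro mult_left_mono real_le_rsqrt) auto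
    finally show ?thesis .
  qed
  then show "\<exists>C. \<forall>f g. H10_deriv a f g \<longrightarrow> \<bar>pair_deriv a h f\<bar> \<le> C * sqrt ((L2_norm_on {0<..<a} f)\<^sup>2 + (L2_norm_on {0<..<a} g)\<^sup>2)"
    by blast
qed

text \<open>A real \<open>Sup\<close> is informative only for a nonempty set that is bounded above.
  The zero function provides an element, hence also nonnegativity, and \<open>C\<close> provides the
  bound.\<close>

lemma Hm1_norm_bounds:
  assumes "\<And>f g. H10_deriv a f g \<Longrightarrow> (L2_norm_on {0<..<a} f)\<^sup>2 + (L2_norm_on {0<..<a} g)\<^sup>2 \<le> 1 \<Longrightarrow> \<bar>l f\<bar> \<le> C"
  shows "0 \<le> Hm1_norm a l" "Hm1_norm a l \<le> C"
proof -
  let ?S = "{\<bar>l f\<bar> | f g. H10_deriv a f g \<and> (L2_norm_on {0<..<a} f)\<^sup>2 + (L2_norm_on {0<..<a} g)\<^sup>2 \<le> 1}"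
  have ub: "x \<le> C" if "x \<in> ?S" for x using that assms by blast
  have mem: "\<bar>l (\<lambda>x. 0)\<bar> \<in> ?S"
    using H10_deriv_zero[of a] by (intro CollectI exI[of _ "\<lambda>x. 0"]) (auto simp: L2_norm_on_def)
  show "Hm1_norm a l \<le> C" unfolding Hm1_norm_def using ub mem by (intro cSup_least) auto
  have "bdd_above ?S" using ub by (auto simp: bdd_above_def)
  then have "\<bar>l (\<lambda>x. 0)\<bar> \<le> Sup ?S" by (rule cSup_upper[OF mem])
  then show "0 \<le> Hm1_norm a l" unfolding Hm1_norm_def by linarith
qed

lemma pair_deriv_bound:
  assumes "H10_deriv a f g" "h \<in> L2_on {0<..<a}" "a > 0" "(L2_norm_on {0<..<a} f)\<^sup>2 + (L2_norm_on {0<..<a} g)\<^sup>2 \<le> 1"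
  shows "\<bar>pair_deriv a h f\<bar> \<le> L2_norm_on {0<..<a} h"
proof -
  have "(L2_norm_on {0<..<a} g)\<^sup>2 \<le> 1" using assms(4) zero_le_power2[of "L2_norm_on {0<..<a} f"] by linarith
  then have "L2_norm_on {0<..<a} g \<le> 1" by (simp add: power_le_one_iff)
  then have "L2_norm_on {0<..<a} h * L2_norm_on {0<..<a} g \<le> L2_norm_on {0<..<a} h * 1"
    by (intro mult_left_mono) auto
  then show ?thesis
    using L2_Cauchy_Schwarz[OF assms(2) H10_derivD(2)[OF assms(1)]]
    unfolding pair_deriv_eq[OF assms(1-3)] by linarith
qed

text \<open>Replacing the almost minimiser \<open>f0\<close> by \<open>f0 - E f\<close> changes the
  energy by \<open>E^2 * B / 2 - E * (P - l)\<close>, which for \<open>E = P - l\<close> and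
  \<open>B \<le> 1\<close> is a decrease by at least \<open>E^2 / 2\<close>. Being within
  \<open>e^2 / 2\<close> of the infimum therefore forces \<open>|E| \<le> e\<close>.\<close>

lemma almost_critical_bound:
  fixes A B E I L P e l :: real
  assumes 1: "I \<le> (A - 2 * E * P + E\<^sup>2 * B) / 2 - (L - E * l)" and E: "E = P - l"
    and B: "B \<le> 1" and 2: "A / 2 - L < I + e\<^sup>2 / 2" and e: "e > 0"
  shows "\<bar>l - P\<bar> \<le> e"
proof -
  have "E\<^sup>2 * B \<le> E\<^sup>2 * 1" using B by (intro mult_left_mono) auto
  moreover have "(A - 2 * E * P + E\<^sup>2 * B) / 2 - (L - E * l) = A / 2 - L + (E\<^sup>2 * B) / 2 - E\<^sup>2"
    unfolding E by (simp add: power2_eq_square field_simps)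
  ultimately have "E\<^sup>2 \<le> e\<^sup>2" using 1 2 by linarith
  then have "\<bar>E\<bar> \<le> e" using e unfolding abs_le_square_iff[symmetric] by simp
  then show ?thesis unfolding E by linarith
qed

text \<open>An approximate Riesz representation: an almost minimiser of the Dirichlet energy minus the
  functional almost satisfies the Euler-Lagrange equation, so no completeness is needed.\<close>

lemma Hm1_approx_representation:
  assumes l: "l \<in> Hm1 a" and a: "a > 0" and e: "e > 0"
  shows "\<exists>h\<in>L2_on {0<..<a}. \<forall>f g. H10_deriv a f g \<longrightarrow> (L2_norm_on {0<..<a} f)\<^sup>2 + (L2_norm_on {0<..<a} g)\<^sup>2 \<le> 1 \<longrightarrow>
     \<bar>l f - (LINT x:{0<..<a}|lborel. h x * g x)\<bar> \<le> e"
proof -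
  let ?n = "L2_norm_on {0<..<a}"
  have add: "l (\<lambda>x. f x + h x) = l f + l h" if "f \<in> H10 a" "h \<in> H10 a" for f h using l that unfolding Hm1_def by blast
  have sc: "l (\<lambda>x. c * f x) = c * l f" if "f \<in> H10 a" for c f using l that unfolding Hm1_def by blast
  obtain C where C: "\<And>f g. H10_deriv a f g \<Longrightarrow> \<bar>l f\<bar> \<le> C * sqrt ((?n f)\<^sup>2 + (?n g)\<^sup>2)"
    using l unfolding Hm1_def by blast
  \<comment> \<open>Poincare's inequality replaces the full norm by the norm of the derivative, so
    the quadratic term dominates the functional and the energy is bounded below by
    \<open>- (D^2 / 2)\<close>.\<close>
  define D where "D = \<bar>C\<bar> * sqrt (a\<^sup>2 + 1)"
  have D: "\<bar>l f\<bar> \<le> D * ?n g" if H: "H10_deriv a f g" for f g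
  proof -
    have "(?n f)\<^sup>2 \<le> (a * ?n g)\<^sup>2" using H10_Poincare[OF H] a by (intro power_mono) auto
    then have "(?n f)\<^sup>2 + (?n g)\<^sup>2 \<le> (a\<^sup>2 + 1) * (?n g)\<^sup>2" by (simp add: power_mult_distrib distrib_right)
    then have "sqrt ((?n f)\<^sup>2 + (?n g)\<^sup>2) \<le> sqrt ((a\<^sup>2 + 1) * (?n g)\<^sup>2)" by (rule real_sqrt_le_mono)
    also have "\<dots> = sqrt (a\<^sup>2 + 1) * ?n g" by (simp add: real_sqrt_mult)
    finally have "sqrt ((?n f)\<^sup>2 + (?n g)\<^sup>2) \<le> sqrt (a\<^sup>2 + 1) * ?n g" .
    then have "\<bar>C\<bar> * sqrt ((?n f)\<^sup>2 + (?n g)\<^sup>2) \<le> D * ?n g" unfolding D_def mult.assoc by (rule mult_left_mono) simp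
    moreover have "C * sqrt ((?n f)\<^sup>2 + (?n g)\<^sup>2) \<le> \<bar>C\<bar> * sqrt ((?n f)\<^sup>2 + (?n g)\<^sup>2)" by (intro mult_right_mono) auto
    ultimately show ?thesis using C[OF H] by linarith
  qed
  define S where "S = {(?n g)\<^sup>2 / 2 - l f | f g. H10_deriv a f g}"
  have lb: "- (D\<^sup>2 / 2) \<le> x" if xS: "x \<in> S" for x
  proof -
    obtain f g where H: "H10_deriv a f g" "x = (?n g)\<^sup>2 / 2 - l f" using xS unfolding S_def by blast
    have "0 \<le> (?n g - D)\<^sup>2" by simp
    then have "D * ?n g \<le> (?n g)\<^sup>2 / 2 + D\<^sup>2 / 2" unfolding power2_diff by (simp add: field_simps)
    then show ?thesis using D[OF H(1)] H(2) by linarith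
  qed
  have bb: "bdd_below S" using lb by (rule bdd_belowI)
  have ne: "S \<noteq> {}" unfolding S_def using H10_deriv_zero by blast
  have "Inf S < Inf S + e\<^sup>2 / 2" using e by simp
  then obtain x where "x \<in> S" "x < Inf S + e\<^sup>2 / 2" using cInf_lessD[OF ne] by blast
  then obtain f0 g0 where H0: "H10_deriv a f0 g0" and x: "(?n g0)\<^sup>2 / 2 - l f0 < Inf S + e\<^sup>2 / 2"
    unfolding S_def by blast
  note L0 = H10_derivD(2)[OF H0]
  have "\<bar>l f - (LINT x:{0<..<a}|lborel. g0 x * g x)\<bar> \<le> e"
    if H: "H10_deriv a f g" and n: "(?n f)\<^sup>2 + (?n g)\<^sup>2 \<le> 1" for f g
  proof -
    note L = H10_derivD(2)[OF H]
    define P where "P = (LINT x:{0<..<a}|lborel. g0 x * g x)"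
    define E where "E = P - l f"
    \<comment> \<open>The competitor moves from \<open>f0\<close> by exactly the defect
      \<open>E\<close> of the Euler-Lagrange equation in the direction \<open>f\<close>.\<close>
    have H1: "H10_deriv a (\<lambda>x. f0 x + (- E) * f x) (\<lambda>x. g0 x + (- E) * g x)"
      by (rule H10_deriv_add[OF H0 H10_deriv_scale[OF H]])
    have "Inf S \<le> (?n (\<lambda>x. g0 x + (- E) * g x))\<^sup>2 / 2 - l (\<lambda>x. f0 x + (- E) * f x)"
    proof (rule cInf_lower[OF _ bb])
      show "(?n (\<lambda>x. g0 x + (- E) * g x))\<^sup>2 / 2 - l (\<lambda>x. f0 x + (- E) * f x) \<in> S"
        unfolding S_def using H1 by blast
    qed
    moreover have "l (\<lambda>x. f0 x + (- E) * f x) = l f0 - E * l f"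
    proof -
      have "f0 \<in> H10 a" "f \<in> H10 a" "(\<lambda>x. (- E) * f x) \<in> H10 a"
        using H0 H H10_deriv_scale[OF H, of "- E"] unfolding H10_def by blast+
      then show ?thesis using add[of f0 "\<lambda>x. (- E) * f x"] sc[of f "- E"] by simp
    qed
    moreover have "(?n (\<lambda>x. g0 x + (- E) * g x))\<^sup>2 = (?n g0)\<^sup>2 - 2 * E * P + E\<^sup>2 * (?n g)\<^sup>2"
    proof -
      have i: "set_integrable lborel {0<..<a} (\<lambda>x. (g0 x)\<^sup>2)" "set_integrable lborel {0<..<a} (\<lambda>x. (g x)\<^sup>2)"
        using L0 L by (simp_all add: L2_on_def)
      note i3 = L2_on_mult_integrable[OF L0 L]
      have eq: "(g0 x + (- E) * g x)\<^sup>2 = (g0 x)\<^sup>2 - 2 * E * (g0 x * g x) + E\<^sup>2 * (g x)\<^sup>2" for x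
        by (simp add: power2_eq_square algebra_simps)
      have "(LINT x:{0<..<a}|lborel. (g0 x)\<^sup>2 - 2 * E * (g0 x * g x) + E\<^sup>2 * (g x)\<^sup>2)
        = (LINT x:{0<..<a}|lborel. (g0 x)\<^sup>2) - 2 * E * (LINT x:{0<..<a}|lborel. g0 x * g x) + E\<^sup>2 * (LINT x:{0<..<a}|lborel. (g x)\<^sup>2)"
        using i i3 by (simp only: set_integral_add set_integral_diff set_integrable_mult_right set_integral_mult_right)
      then show ?thesis unfolding L2_norm_sq P_def eq .
    qed
    ultimately have "Inf S \<le> ((?n g0)\<^sup>2 - 2 * E * P + E\<^sup>2 * (?n g)\<^sup>2) / 2 - (l f0 - E * l f)" by simp
    moreover have "(?n g)\<^sup>2 \<le> 1" using n zero_le_power2[of "?n f"] by linarith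
    ultimately show ?thesis unfolding P_def[symmetric] by (rule almost_critical_bound[OF _ E_def _ x e])
  qed
  then show ?thesis using L0 by (intro bexI[of _ g0] allI impI)
qed

section \<open>Waves reflected at the moving end\<close>

text \<open>The Doppler factor: on the moving end \<open>t - x = (1 - k) * t - 1\<close> and
  \<open>t + x = (1 + k) * t + 1\<close>, so this is the slope of \<open>t - x\<close> as a function
  of \<open>t + x\<close> there.\<close>

definition refl_coef :: "real \<Rightarrow> real" where "refl_coef k = (1 - k) / (1 + k)"

text \<open>A wave reaching the moving end \<open>x = 1 + k t\<close> along \<open>t + x = s\<close> had left \<open>x = 0\<close> with
  \<open>t - x = reflect k s\<close> on the reflected characteristic.\<close>

definition reflect :: "real \<Rightarrow> real \<Rightarrow> real" where "reflect k s = refl_coef k * s - (refl_coef k + 1)"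

definition travel :: "real \<Rightarrow> (real \<Rightarrow> real) \<Rightarrow> real \<times> real \<Rightarrow> real" where
  "travel k f p = f (snd p - fst p) - f (reflect k (snd p + fst p))"

text \<open>The stream function conjugate to \<open>travel\<close>: its space derivative is minus the time derivative
  of \<open>travel\<close>.\<close>

definition stream :: "real \<Rightarrow> (real \<Rightarrow> real) \<Rightarrow> real \<Rightarrow> real \<Rightarrow> real" where
  "stream k f t x = f (t - x) + f (reflect k (t + x))"

lemma Qhat_open: "open (Qhat k s)"
proof -
  have "Qhat k s = {p. 0 < fst p \<and> fst p < 1 + k * snd p \<and> 0 < snd p \<and> snd p < s}"
    by (auto simp: Qhat_def alpha_def)
  also have "open \<dots>" by (intro open_Collect_conj open_Collect_less continuous_intros)
  finally show ?thesis .
qed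

lemma Qhat_borel [measurable]: "Qhat k s \<in> sets borel" using Qhat_open by (rule borel_open)

lemma Omega_borel [measurable]: "Omega k t \<in> sets borel" by (simp add: Omega_def)

lemma L2_continuous_add:
  assumes v: "L2_continuous k s v" and w: "L2_continuous k s w"
    and "\<And>t. t \<in> {0..s} \<Longrightarrow> (\<lambda>x. v (x, t)) \<in> L2_on (Omega k t)" "\<And>t. t \<in> {0..s} \<Longrightarrow> (\<lambda>x. w (x, t)) \<in> L2_on (Omega k t)"
  shows "L2_continuous k s (\<lambda>p. v p + w p)"
  unfolding L2_continuous_def
proof
  fix t0 assume t0: "t0 \<in> {0..s}"
  let ?d = "\<lambda>v t. \<lambda>x. indicator (Omega k t) x * v (x, t) - indicator (Omega k t0) x * v (x, t0)"
  have L: "?d v t \<in> L2_on UNIV" "?d w t \<in> L2_on UNIV" if "t \<in> {0..s}" for t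
    using assms(3,4)[OF that] assms(3,4)[OF t0]
    by (auto intro!: L2_diff simp: L2_on_iff[of _ "Omega k t"] L2_on_iff[of _ "Omega k t0"])
  have eq: "?d (\<lambda>p. v p + w p) t = (\<lambda>x. ?d v t x + ?d w t x)" for t by (simp add: algebra_simps fun_eq_iff)
  have l: "((\<lambda>t. L2_norm_on UNIV (?d v t)) \<longlongrightarrow> 0) (at t0 within {0..s})" "((\<lambda>t. L2_norm_on UNIV (?d w t)) \<longlongrightarrow> 0) (at t0 within {0..s})"
    using v w t0 unfolding L2_continuous_def by auto
  show "((\<lambda>t. L2_norm_on UNIV (?d (\<lambda>p. v p + w p) t)) \<longlongrightarrow> 0) (at t0 within {0..s})"
  proof (rule tendsto_sandwich[OF _ _ tendsto_const])
    show "((\<lambda>t. L2_norm_on UNIV (?d v t) + L2_norm_on UNIV (?d w t)) \<longlongrightarrow> 0) (at t0 within {0..s})"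
      using tendsto_add[OF l] by simp
    have "L2_norm_on UNIV (?d (\<lambda>p. v p + w p) t) \<le> L2_norm_on UNIV (?d v t) + L2_norm_on UNIV (?d w t)" if "t \<in> {0..s}" for t
      unfolding eq by (rule L2_norm_triangle[OF L[OF that]])
    then show "\<forall>\<^sub>F t in at t0 within {0..s}. L2_norm_on UNIV (?d (\<lambda>p. v p + w p) t) \<le> L2_norm_on UNIV (?d v t) + L2_norm_on UNIV (?d w t)"
      unfolding eventually_at_filter by (intro always_eventually) blast
  qed simp
qed

lemma L2_continuous_scale:
  assumes v: "L2_continuous k s v"
  shows "L2_continuous k s (\<lambda>p. c * v p)"
  unfolding L2_continuous_def
proof
  fix t0 assume t0: "t0 \<in> {0..s}"
  let ?d = "\<lambda>v t. \<lambda>x. indicator (Omega k t) x * v (x, t) - indicator (Omega k t0) x * v (x, t0)"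
  have eq: "?d (\<lambda>p. c * v p) t = (\<lambda>x. c * ?d v t x)" for t by (simp add: algebra_simps fun_eq_iff)
  have "((\<lambda>t. L2_norm_on UNIV (?d v t)) \<longlongrightarrow> 0) (at t0 within {0..s})"
    using v t0 unfolding L2_continuous_def by auto
  from tendsto_mult_left[OF this, of "\<bar>c\<bar>"]
  show "((\<lambda>t. L2_norm_on UNIV (?d (\<lambda>p. c * v p) t)) \<longlongrightarrow> 0) (at t0 within {0..s})"
    unfolding eq L2_norm_scale by simp
qed

lemma L2_continuous_affine:
  assumes f: "f \<in> L2_on UNIV" and b: "b \<noteq> 0"
  shows "L2_continuous k s (\<lambda>p. f (b * fst p + a * snd p + c))"
  unfolding L2_continuous_def
proof
  fix t0 assume t0: "t0 \<in> {0..s}"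
  have "((\<lambda>t. L2_norm_on UNIV (\<lambda>x. indicator {0<..<alpha k t} x * f (b * x + (a * t + c))
     - indicator {0<..<alpha k t0} x * f (b * x + (a * t0 + c)))) \<longlongrightarrow> 0) (at t0 within {0..s})"
    by (rule L2_affine_tendsto[OF f, of "{0..s}" "\<lambda>_. b" "\<lambda>t. a * t + c" "alpha k" "\<bar>b\<bar>"])
      (use b t0 in \<open>auto simp: alpha_def intro!: continuous_intros\<close>)
  then show "((\<lambda>t. L2_norm_on UNIV (\<lambda>x. indicator (Omega k t) x * f (b * fst (x, t) + a * snd (x, t) + c)
     - indicator (Omega k t0) x * f (b * fst (x, t0) + a * snd (x, t0) + c))) \<longlongrightarrow> 0) (at t0 within {0..s})"
    unfolding Omega_def by (simp add: add.assoc)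
qed

lemma L2_slice_affine:
  assumes f: "f \<in> L2_on UNIV" and b: "b \<noteq> 0"
  shows "(\<lambda>x. f (b * fst (x, t) + a * snd (x, t) + c)) \<in> L2_on (Omega k t)"
  using L2_UNIV_on[OF L2_affine(1)[OF f b, of "a * t + c"] Omega_borel[of k t]] by (simp add: add.assoc)

lemma L2_Qhat_affine:
  assumes f: "f \<in> L2_on UNIV" and b: "b \<noteq> 0"
  shows "(\<lambda>p. f (b * fst p + a * snd p + c)) \<in> L2_on (Qhat k s)"
proof -
  have "(\<lambda>p. f (b * fst p + a * snd p + c) * indicator {0<..<s} (snd p)) \<in> L2_on (Qhat k s)"
    by (rule L2_UNIV_on[OF L2_strip_shear[OF f b] Qhat_borel])
  moreover have "indicator (Qhat k s) p * (f (b * fst p + a * snd p + c) * indicator {0<..<s} (snd p)) =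
    indicator (Qhat k s) p * f (b * fst p + a * snd p + c)" for p
    by (auto simp: indicator_def Qhat_def)
  ultimately show ?thesis by (simp only: L2_on_iff[of _ "Qhat k s"])
qed

locale moving_end =
  fixes k :: real
  assumes k: "0 < k" "k < 1"
begin

abbreviation "q \<equiv> refl_coef k"
abbreviation "r \<equiv> reflect k"

lemma q: "0 < q" "q < 1" using k by (auto simp: refl_coef_def divide_less_eq)

lemma alpha_ge_1: "t \<ge> 0 \<Longrightarrow> 1 \<le> alpha k t" using k by (simp add: alpha_def)

text \<open>This equation fixes both coefficients of \<open>reflect\<close>: at the moving end the
  direct and the reflected argument coincide, which is the Dirichlet condition for
  \<open>travel\<close>.\<close>

lemma reflect_right: "r (t + alpha k t) = t - alpha k t"
proof -
  have "q * (1 + k) = 1 - k" using k by (simp add: refl_coef_def)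
  moreover have "r (t + alpha k t) = (q * (1 + k)) * t - 1"
    unfolding reflect_def alpha_def by (simp add: algebra_simps)
  ultimately have "r (t + alpha k t) = (1 - k) * t - 1" by simp
  then show ?thesis by (simp add: alpha_def left_diff_distrib)
qed

lemma reflect_strict_mono: "s < s' \<Longrightarrow> r s < r s'" using q by (simp add: reflect_def)

text \<open>Causality: strictly inside the domain the reflected argument lies before the direct one.
  A profile that vanishes up to some time therefore kills both parts of the wave together.\<close>

lemma reflect_lt: "x < alpha k t \<Longrightarrow> r (t + x) < t - x"
  using reflect_strict_mono[of "t + x" "t + alpha k t"] unfolding reflect_right by linarith

lemma travel_affine: "travel k f p = f ((-1) * fst p + 1 * snd p + 0) + (-1) * f (q * fst p + q * snd p + (- (q + 1)))"
  by (simp add: travel_def reflect_def algebra_simps)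

lemma stream_affine: "stream k f t x = f ((-1) * x + t) + f (q * x + (q * t + (- (q + 1))))"
  by (simp add: stream_def reflect_def algebra_simps)

lemma q_nonzero: "q \<noteq> 0" using q by simp

lemma travel_L2_Qhat:
  assumes f: "f \<in> L2_on UNIV"
  shows "travel k f \<in> L2_on (Qhat k s)"
  unfolding travel_affine[abs_def]
  by (rule L2_add[OF L2_Qhat_affine[OF f] L2_scale[OF L2_Qhat_affine[OF f q_nonzero]]]) simp

lemma travel_L2_slice:
  assumes f: "f \<in> L2_on UNIV"
  shows "(\<lambda>x. travel k f (x, t)) \<in> L2_on (Omega k t)"
  unfolding travel_affine
  by (rule L2_add[OF L2_slice_affine[OF f, of "-1"] L2_scale[OF L2_slice_affine[OF f q_nonzero]]]) simp

lemma travel_L2_continuous: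
  assumes f: "f \<in> L2_on UNIV"
  shows "L2_continuous k s (travel k f)"
proof -
  have m: "(-1::real) \<noteq> 0" by simp
  show ?thesis unfolding travel_affine[abs_def]
    by (rule L2_continuous_add[OF L2_continuous_affine[OF f m] L2_continuous_scale[OF L2_continuous_affine[OF f q_nonzero]]
        L2_slice_affine[OF f m] L2_scale[OF L2_slice_affine[OF f q_nonzero]]])
qed

lemma stream_L2_slice:
  assumes f: "f \<in> L2_on UNIV"
  shows "stream k f t \<in> L2_on (Omega k t)"
  unfolding stream_affine[abs_def]
  by (rule L2_add[OF L2_UNIV_on[OF L2_affine(1)[OF f, of "-1"]] L2_UNIV_on[OF L2_affine(1)[OF f q_nonzero]]]) (simp_all add: Omega_borel)

text \<open>The factor \<open>1 / alpha k t\<close> from differentiating the dilated test function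
  cancels the Jacobian of the dilation, so the pulled-back functional pairs \<open>g\<close> with a
  plain dilation of \<open>stream\<close>.\<close>

lemma pair_deriv_stream_dilate:
  assumes f: "f \<in> L2_on UNIV" and H: "H10_deriv 1 h g" and t: "t \<ge> 0"
  shows "pair_deriv (alpha k t) (stream k f t) (\<lambda>x. h (x / alpha k t))
     = (LINT y:{0<..<1}|lborel. stream k f t (alpha k t * y) * g y)"
proof -
  have a: "alpha k t > 0" using alpha_ge_1[OF t] by linarith
  have sL: "stream k f t \<in> L2_on {0<..<alpha k t}" using stream_L2_slice[OF f] by (simp add: Omega_def)
  have H': "H10_deriv (alpha k t) (\<lambda>x. h (x / alpha k t)) (\<lambda>x. g (x / alpha k t) / alpha k t)"
    using H10_deriv_dilate[OF H a] by simp
  have "pair_deriv (alpha k t) (stream k f t) (\<lambda>x. h (x / alpha k t))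
     = (\<integral>x. indicator {0<..<alpha k t} x * (stream k f t x * (g (x / alpha k t) / alpha k t)) \<partial>lborel)"
    unfolding pair_deriv_eq[OF H' sL a] set_lebesgue_integral_def by simp
  also have "\<dots> = alpha k t * (\<integral>y. indicator {0<..<alpha k t} (alpha k t * y) * (stream k f t (alpha k t * y) * (g (alpha k t * y / alpha k t) / alpha k t)) \<partial>lborel)"
    using lborel_integral_real_affine[of "alpha k t" "\<lambda>x. indicator {0<..<alpha k t} x * (stream k f t x * (g (x / alpha k t) / alpha k t))" 0] a
    by simp
  also have "\<dots> = (\<integral>y. alpha k t * (indicator {0<..<alpha k t} (alpha k t * y) * (stream k f t (alpha k t * y) * (g (alpha k t * y / alpha k t) / alpha k t))) \<partial>lborel)"
    by simp
  also have "\<dots> = (\<integral>y. indicator {0<..<1} y * (stream k f t (alpha k t * y) * g y) \<partial>lborel)"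
    using a by (intro Bochner_Integration.integral_cong) (auto simp: indicator_def zero_less_mult_iff)
  finally show ?thesis by (simp add: set_lebesgue_integral_def)
qed

lemma stream_dilate_affine: "stream k f t (alpha k t * y) = f ((- alpha k t) * y + t) + f ((q * alpha k t) * y + (q * t + (- (q + 1))))"
  by (simp add: stream_affine mult.assoc)

lemma stream_dilate_L2:
  assumes f: "f \<in> L2_on UNIV" and t: "t \<ge> 0"
  shows "(\<lambda>y. stream k f t (alpha k t * y)) \<in> L2_on {0<..<1}"
proof -
  have nz: "- alpha k t \<noteq> 0" "q * alpha k t \<noteq> 0" using alpha_ge_1[OF t] q by auto
  show ?thesis unfolding stream_dilate_affine
    by (rule L2_add[OF L2_UNIV_on[OF L2_affine(1)[OF f nz(1)]] L2_UNIV_on[OF L2_affine(1)[OF f nz(2)]]]) simp_all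
qed

text \<open>After the pull-back all functionals pair \<open>g\<close> with L2 functions on the fixed
  interval, so the \<open>Hm1\<close> distance is at most the L2 distance of the dilated streams.
  That distance is handled by \<open>L2_affine_tendsto\<close>, the slopes
  \<open>- alpha k t\<close> and \<open>q * alpha k t\<close> being bounded away from zero.\<close>

lemma stream_Hm1_continuous:
  assumes f: "f \<in> L2_on UNIV"
  shows "Hm1_continuous k s (\<lambda>t. pair_deriv (alpha k t) (stream k f t))"
  unfolding Hm1_continuous_def
proof
  fix t0 assume t0: "t0 \<in> {0..s}"
  let ?S = "\<lambda>t y. stream k f t (alpha k t * y)"
  let ?I = "indicator {0<..<1::real} :: real \<Rightarrow> real"
  let ?l = "\<lambda>t h. pair_deriv (alpha k t) (stream k f t) (\<lambda>x. h (x / alpha k t)) - pair_deriv (alpha k t0) (stream k f t0) (\<lambda>x. h (x / alpha k t0))"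
  have bound: "0 \<le> Hm1_norm 1 (?l t)" "Hm1_norm 1 (?l t) \<le> L2_norm_on {0<..<1} (\<lambda>y. ?S t y - ?S t0 y)" if t: "t \<in> {0..s}" for t
  proof -
    have L: "?S t \<in> L2_on {0<..<1}" "?S t0 \<in> L2_on {0<..<1}" using stream_dilate_L2[OF f] t t0 by auto
    have main: "\<bar>?l t h\<bar> \<le> L2_norm_on {0<..<1} (\<lambda>y. ?S t y - ?S t0 y)"
      if H: "H10_deriv 1 h g" and n: "(L2_norm_on {0<..<1} h)\<^sup>2 + (L2_norm_on {0<..<1} g)\<^sup>2 \<le> 1" for h g
    proof -
      note Lg = H10_derivD(2)[OF H]
      have "?l t h = (LINT y:{0<..<1}|lborel. (?S t y - ?S t0 y) * g y)"
        using pair_deriv_stream_dilate[OF f H, of t] pair_deriv_stream_dilate[OF f H, of t0] t t0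
          L2_on_mult_integrable[OF L(1) Lg] L2_on_mult_integrable[OF L(2) Lg]
        by (simp add: left_diff_distrib)
      also have "\<dots> = pair_deriv 1 (\<lambda>y. ?S t y - ?S t0 y) h"
        using pair_deriv_eq[OF H L2_diff[OF L]] by simp
      finally show ?thesis using pair_deriv_bound[OF H L2_diff[OF L] _ n] by simp
    qed
    show "0 \<le> Hm1_norm 1 (?l t)" by (rule Hm1_norm_bounds(1)[OF main])
    show "Hm1_norm 1 (?l t) \<le> L2_norm_on {0<..<1} (\<lambda>y. ?S t y - ?S t0 y)" by (rule Hm1_norm_bounds(2)[OF main])
  qed
  have l1: "((\<lambda>t. L2_norm_on UNIV (\<lambda>y. ?I y * f ((- alpha k t) * y + t) - ?I y * f ((- alpha k t0) * y + t0))) \<longlongrightarrow> 0) (at t0 within {0..s})"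
  proof (rule L2_affine_tendsto[OF f, of "{0..s}" "\<lambda>t. - alpha k t" "\<lambda>t. t" "\<lambda>_. 1" 1])
    show "1 \<le> \<bar>- alpha k t\<bar>" if "t \<in> {0..s}" for t using alpha_ge_1[of t] that by simp
    show "continuous_on {0..s} (\<lambda>t. - alpha k t)" unfolding alpha_def by (intro continuous_intros)
  qed (use t0 in simp_all)
  have l2: "((\<lambda>t. L2_norm_on UNIV (\<lambda>y. ?I y * f ((q * alpha k t) * y + (q * t + (- (q + 1)))) - ?I y * f ((q * alpha k t0) * y + (q * t0 + (- (q + 1)))))) \<longlongrightarrow> 0) (at t0 within {0..s})"
  proof (rule L2_affine_tendsto[OF f, of "{0..s}" "\<lambda>t. q * alpha k t" "\<lambda>t. q * t + (- (q + 1))" "\<lambda>_. 1" q])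
    show "q \<le> \<bar>q * alpha k t\<bar>" if "t \<in> {0..s}" for t
    proof -
      have "q * 1 \<le> q * alpha k t" using alpha_ge_1[of t] that q by (intro mult_left_mono) auto
      then show ?thesis by simp
    qed
    show "continuous_on {0..s} (\<lambda>t. q * alpha k t)" "continuous_on {0..s} (\<lambda>t. q * t + - (q + 1))"
      unfolding alpha_def by (intro continuous_intros)+
  qed (use t0 q in simp_all)
  show "((\<lambda>t. Hm1_norm 1 (?l t)) \<longlongrightarrow> 0) (at t0 within {0..s})"
  proof (rule tendsto_sandwich[OF _ _ tendsto_const])
    show "\<forall>\<^sub>F t in at t0 within {0..s}. 0 \<le> Hm1_norm 1 (?l t)"
      unfolding eventually_at_filter using bound(1) by (intro always_eventually) blast
    show "((\<lambda>t. L2_norm_on UNIV (\<lambda>y. ?I y * f ((- alpha k t) * y + t) - ?I y * f ((- alpha k t0) * y + t0)) +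
      L2_norm_on UNIV (\<lambda>y. ?I y * f ((q * alpha k t) * y + (q * t + (- (q + 1)))) - ?I y * f ((q * alpha k t0) * y + (q * t0 + (- (q + 1)))))) \<longlongrightarrow> 0) (at t0 within {0..s})"
      using tendsto_add[OF l1 l2] by simp
    have "Hm1_norm 1 (?l t) \<le> L2_norm_on UNIV (\<lambda>y. ?I y * f ((- alpha k t) * y + t) - ?I y * f ((- alpha k t0) * y + t0)) +
      L2_norm_on UNIV (\<lambda>y. ?I y * f ((q * alpha k t) * y + (q * t + (- (q + 1)))) - ?I y * f ((q * alpha k t0) * y + (q * t0 + (- (q + 1)))))"
      if t: "t \<in> {0..s}" for t
    proof -
      have L: "(\<lambda>y. ?I y * f (a * y + b)) \<in> L2_on UNIV" if "a \<noteq> 0" for a b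
        using L2_UNIV_on[OF L2_affine(1)[OF f that, of b], of "{0<..<1}"] by (simp add: L2_on_iff[of _ "{0<..<1}"])
      have nz: "- alpha k t \<noteq> 0" "- alpha k t0 \<noteq> 0" "q * alpha k t \<noteq> 0" "q * alpha k t0 \<noteq> 0"
        using alpha_ge_1[of t] alpha_ge_1[of t0] t t0 q by auto
      have eq: "(\<lambda>y. ?I y * (?S t y - ?S t0 y)) = (\<lambda>y. (?I y * f ((- alpha k t) * y + t) - ?I y * f ((- alpha k t0) * y + t0))
         + (?I y * f ((q * alpha k t) * y + (q * t + (- (q + 1)))) - ?I y * f ((q * alpha k t0) * y + (q * t0 + (- (q + 1))))))"
        unfolding stream_dilate_affine by (simp only: right_diff_distrib distrib_left) (simp add: algebra_simps)
      have "L2_norm_on {0<..<1} (\<lambda>y. ?S t y - ?S t0 y) \<le> L2_norm_on UNIV (\<lambda>y. ?I y * f ((- alpha k t) * y + t) - ?I y * f ((- alpha k t0) * y + t0)) +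
      L2_norm_on UNIV (\<lambda>y. ?I y * f ((q * alpha k t) * y + (q * t + (- (q + 1)))) - ?I y * f ((q * alpha k t0) * y + (q * t0 + (- (q + 1)))))"
        unfolding L2_norm_on_eq[of "{0<..<1}"] eq by (intro L2_norm_triangle L2_diff L nz)
      then show ?thesis using bound(2)[OF t] by linarith
    qed
    then show "\<forall>\<^sub>F t in at t0 within {0..s}. Hm1_norm 1 (?l t) \<le> L2_norm_on UNIV (\<lambda>y. ?I y * f ((- alpha k t) * y + t) - ?I y * f ((- alpha k t0) * y + t0)) +
      L2_norm_on UNIV (\<lambda>y. ?I y * f ((q * alpha k t) * y + (q * t + (- (q + 1)))) - ?I y * f ((q * alpha k t0) * y + (q * t0 + (- (q + 1)))))"
      unfolding eventually_at_filter by (intro always_eventually) blast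
  qed
qed

lemma travel_initial:
  assumes "\<And>s. s \<le> 0 \<Longrightarrow> f s = 0" "x \<in> Omega k 0"
  shows "travel k f (x, 0) = 0" "stream k f 0 x = 0"
proof -
  have "x > 0" "r x < - x" using assms(2) reflect_lt[of x 0] by (auto simp: Omega_def)
  then show "travel k f (x, 0) = 0" "stream k f 0 x = 0"
    using assms(1)[of "- x"] assms(1)[of "r x"] by (auto simp: travel_def stream_def)
qed

end

section \<open>The transposition identity\<close>

definition plane_C1 :: "(real \<times> real \<Rightarrow> real) \<Rightarrow> (real \<times> real \<Rightarrow> real) \<Rightarrow> (real \<times> real \<Rightarrow> real) \<Rightarrow> bool" where
  "plane_C1 f fx ft \<longleftrightarrow> (\<forall>p. GDERIV f p :> (fx p, ft p)) \<and> continuous_on UNIV fx \<and> continuous_on UNIV ft"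

lemma plane_C1_GDERIV: "plane_C1 f fx ft \<Longrightarrow> GDERIV f p :> (fx p, ft p)"
  unfolding plane_C1_def by blast

lemma plane_C1_continuous:
  assumes "plane_C1 f fx ft"
  shows "continuous_on UNIV f" "continuous_on UNIV fx" "continuous_on UNIV ft"
proof -
  have "isCont f p" for p
    using plane_C1_GDERIV[OF assms, of p] unfolding gderiv_def by (rule has_derivative_continuous)
  then show "continuous_on UNIV f" by (simp add: continuous_on_eq_continuous_at)
qed (use assms in \<open>auto simp: plane_C1_def\<close>)

lemma plane_C1_mult:
  assumes "plane_C1 f fx ft" "plane_C1 g gx gt"
  shows "plane_C1 (\<lambda>p. f p * g p) (\<lambda>p. fx p * g p + f p * gx p) (\<lambda>p. ft p * g p + f p * gt p)"
  unfolding plane_C1_def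
proof (intro conjI allI)
  fix p
  have "GDERIV (\<lambda>p. f p * g p) p :> f p *\<^sub>R (gx p, gt p) + g p *\<^sub>R (fx p, ft p)"
    by (intro GDERIV_mult plane_C1_GDERIV assms)
  then show "GDERIV (\<lambda>p. f p * g p) p :> (fx p * g p + f p * gx p, ft p * g p + f p * gt p)"
    by (rule GDERIV_subst) (simp add: algebra_simps)
qed (intro continuous_intros plane_C1_continuous[OF assms(1)] plane_C1_continuous[OF assms(2)])+

lemma plane_C1_add:
  assumes "plane_C1 f fx ft" "plane_C1 g gx gt"
  shows "plane_C1 (\<lambda>p. f p + g p) (\<lambda>p. fx p + gx p) (\<lambda>p. ft p + gt p)"
  unfolding plane_C1_def
proof (intro conjI allI)
  fix p
  have "GDERIV (\<lambda>p. f p + g p) p :> (fx p, ft p) + (gx p, gt p)"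
    by (intro GDERIV_add plane_C1_GDERIV assms)
  then show "GDERIV (\<lambda>p. f p + g p) p :> (fx p + gx p, ft p + gt p)" by simp
qed (intro continuous_intros plane_C1_continuous[OF assms(1)] plane_C1_continuous[OF assms(2)])+

lemma plane_C1_compose:
  assumes "\<And>x. (f has_real_derivative f' x) (at x)" "continuous_on UNIV f'"
  shows "plane_C1 (\<lambda>p. f (b * fst p + a * snd p + c)) (\<lambda>p. b * f' (b * fst p + a * snd p + c)) (\<lambda>p. a * f' (b * fst p + a * snd p + c))"
  unfolding plane_C1_def
proof (intro conjI allI)
  fix p :: "real \<times> real"
  have "GDERIV (\<lambda>p. b * fst p + a * snd p + c) p :> (b, a)"
    unfolding gderiv_def by (auto intro!: derivative_eq_intros simp: inner_prod_def mult.commute)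
  from GDERIV_DERIV_compose[OF this assms(1)]
  show "GDERIV (\<lambda>p. f (b * fst p + a * snd p + c)) p :> (b * f' (b * fst p + a * snd p + c), a * f' (b * fst p + a * snd p + c))"
    by (rule GDERIV_subst) (simp add: mult.commute)
next
  have "continuous_on UNIV (\<lambda>p. f' (b * fst p + a * snd p + c))"
    by (rule continuous_on_compose2[OF assms(2)]) (auto intro!: continuous_intros)
  then show "continuous_on UNIV (\<lambda>p. b * f' (b * fst p + a * snd p + c))" "continuous_on UNIV (\<lambda>p. a * f' (b * fst p + a * snd p + c))"
    by (rule continuous_on_mult[OF continuous_on_const])+
qed

lemma plane_C1_slice:
  assumes "plane_C1 f fx ft"
  shows "((\<lambda>x. f (x, t)) has_real_derivative fx (x, t)) (at x)" "((\<lambda>t. f (x, t)) has_real_derivative ft (x, t)) (at t)"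
proof -
  have d: "(f has_derivative (\<lambda>h. h \<bullet> (fx (x, t), ft (x, t)))) (at (x, t))"
    using plane_C1_GDERIV[OF assms] unfolding gderiv_def .
  have "((\<lambda>x. (x, t)) has_derivative (\<lambda>h. (h, 0))) (at x)" by (auto intro!: derivative_eq_intros)
  from has_derivative_compose[OF this d]
  show "((\<lambda>x. f (x, t)) has_real_derivative fx (x, t)) (at x)"
    unfolding has_field_derivative_def by (simp add: inner_prod_def mult_commute_abs)
  have "((\<lambda>t. (x, t)) has_derivative (\<lambda>h. (0, h))) (at t)" by (auto intro!: derivative_eq_intros)
  from has_derivative_compose[OF this d]
  show "((\<lambda>t. f (x, t)) has_real_derivative ft (x, t)) (at t)"
    unfolding has_field_derivative_def by (simp add: inner_prod_def mult_commute_abs)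
qed

lemma plane_C1_test_fun:
  assumes "plane_C1 f fx ft" "compact K" "K \<subseteq> S" "\<And>p. p \<notin> K \<Longrightarrow> f p = 0"
  shows "test_fun S f (\<lambda>p. (fx p, ft p))"
  using assms unfolding test_fun_def plane_C1_def by (auto intro!: continuous_on_Pair)

lemma Qhat_bounded: "bounded (Qhat k s)"
proof -
  have "Qhat k s \<subseteq> {0..1 + \<bar>k\<bar> * \<bar>s\<bar>} \<times> {0..\<bar>s\<bar>}"
  proof
    fix p assume "p \<in> Qhat k s"
    then obtain x t where p: "p = (x, t)" "0 < x" "x < 1 + k * t" "0 < t" "t < s"
      unfolding Qhat_def alpha_def by auto
    have "k * t \<le> \<bar>k\<bar> * \<bar>s\<bar>" using p by (intro mult_mono) auto
    then show "p \<in> {0..1 + \<bar>k\<bar> * \<bar>s\<bar>} \<times> {0..\<bar>s\<bar>}" using p by auto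
  qed
  moreover have "bounded ({0..1 + \<bar>k\<bar> * \<bar>s\<bar>} \<times> {0..\<bar>s\<bar>})" by (intro bounded_Times) auto
  ultimately show ?thesis by (rule bounded_subset[rotated])
qed

lemma set_integrable_bounded_mult:
  fixes f g :: "'a::euclidean_space \<Rightarrow> real"
  assumes "set_integrable lborel S f" "S \<in> sets borel" "g \<in> borel_measurable borel" "\<And>p. p \<in> S \<Longrightarrow> \<bar>g p\<bar> \<le> M"
  shows "set_integrable lborel S (\<lambda>p. f p * g p)"
  unfolding set_integrable_def
proof (rule Bochner_Integration.integrable_bound)
  have m: "(\<lambda>p. indicator S p *\<^sub>R f p) \<in> borel_measurable borel"
    using assms(1) unfolding set_integrable_def by (auto dest: borel_measurable_integrable)
  show "integrable lborel (\<lambda>p. M * (indicator S p *\<^sub>R f p))" using assms(1) unfolding set_integrable_def by simp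
  have "(\<lambda>p. indicator S p *\<^sub>R (f p * g p)) = (\<lambda>p. (indicator S p *\<^sub>R f p) * g p)" by auto
  then show "(\<lambda>p. indicator S p *\<^sub>R (f p * g p)) \<in> borel_measurable lborel" using m assms(3) by simp
  have "\<bar>f p * g p\<bar> \<le> \<bar>M * f p\<bar>" if "p \<in> S" for p
  proof -
    have "\<bar>f p\<bar> * \<bar>g p\<bar> \<le> \<bar>f p\<bar> * \<bar>M\<bar>" using assms(4)[OF that] by (intro mult_left_mono) auto
    then show ?thesis by (simp add: abs_mult mult.commute)
  qed
  then show "AE p in lborel. norm (indicator S p *\<^sub>R (f p * g p)) \<le> norm (M * (indicator S p *\<^sub>R f p))"
    by (auto simp: indicator_def)
qed

lemma set_integrable_continuous_mult:
  assumes "f \<in> L2_on (Qhat k s)" "continuous_on UNIV g"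
  shows "set_integrable lborel (Qhat k s) (\<lambda>p. f p * g p)"
  by (rule L2_on_mult_integrable[OF assms(1) continuous_L2_on[OF assms(2) Qhat_borel Qhat_bounded]])

lemma Qhat_Fubini:
  fixes h :: "real \<times> real \<Rightarrow> real"
  assumes h: "set_integrable lborel (Qhat k s) h"
  shows "(LINT p:Qhat k s|lborel. h p) = (LINT t:{0<..<s}|lborel. LINT x:Omega k t|lborel. h (x, t))"
    "set_integrable lborel {0<..<s} (\<lambda>t. LINT x:Omega k t|lborel. h (x, t))"
    "AE t in lborel. t \<in> {0<..<s} \<longrightarrow> set_integrable lborel (Omega k t) (\<lambda>x. h (x, t))"
proof -
  let ?h = "\<lambda>x t. indicator (Qhat k s) (x, t) *\<^sub>R h (x, t)"
  have i: "integrable (lborel \<Otimes>\<^sub>M lborel) (case_prod ?h)"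
    using h unfolding set_integrable_def lborel_prod by (simp add: case_prod_unfold)
  have e: "?h x t = indicator {0<..<s} t *\<^sub>R (indicator (Omega k t) x *\<^sub>R h (x, t))" for x t
    by (auto simp: indicator_def Qhat_def Omega_def)
  have A: "(\<integral>t. (\<integral>x. ?h x t \<partial>lborel) \<partial>lborel) = (\<integral>p. indicator (Qhat k s) p *\<^sub>R h p \<partial>lborel)"
    using lborel_pair.integral_snd[OF i] unfolding lborel_prod by (simp add: case_prod_unfold)
  show "(LINT p:Qhat k s|lborel. h p) = (LINT t:{0<..<s}|lborel. LINT x:Omega k t|lborel. h (x, t))"
    unfolding set_lebesgue_integral_def A[symmetric] e by simp
  show "set_integrable lborel {0<..<s} (\<lambda>t. LINT x:Omega k t|lborel. h (x, t))"
    using lborel_pair.integrable_snd[OF i] unfolding e set_integrable_def set_lebesgue_integral_def by simp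
  show "AE t in lborel. t \<in> {0<..<s} \<longrightarrow> set_integrable lborel (Omega k t) (\<lambda>x. h (x, t))"
    using lborel_pair.AE_integrable_snd[OF i]
  proof eventually_elim
    fix t assume "integrable lborel (\<lambda>x. ?h x t)"
    then show "t \<in> {0<..<s} \<longrightarrow> set_integrable lborel (Omega k t) (\<lambda>x. h (x, t))"
      unfolding e set_integrable_def by auto
  qed
qed

lemma weak_solutionD:
  assumes "weak_solution k s F f0 f1 z zx zt"
  shows "z \<in> L2_on (Qhat k s)" "zx \<in> L2_on (Qhat k s)" "zt \<in> L2_on (Qhat k s)"
    "\<And>t. t \<in> {0..s} \<Longrightarrow> H10_deriv (alpha k t) (\<lambda>x. z (x, t)) (\<lambda>x. zx (x, t))"
    "\<And>t. t \<in> {0..s} \<Longrightarrow> (\<lambda>x. zt (x, t)) \<in> L2_on (Omega k t)"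
    "L2_continuous k s z" "L2_continuous k s zt"
    "\<And>p G. test_fun (Qhat k s) p G \<Longrightarrow> (LINT x:Qhat k s|lborel. z x * snd (G x)) = - (LINT x:Qhat k s|lborel. zt x * p x)"
    "\<And>p G. test_fun (Qhat k s) p G \<Longrightarrow> (LINT x:Qhat k s|lborel. zx x * fst (G x) - zt x * snd (G x)) = (LINT x:Qhat k s|lborel. F x * p x)"
    "AE x in lborel. x \<in> Omega k s \<longrightarrow> z (x, s) = f0 x \<and> zt (x, s) = f1 x"
  using assms unfolding weak_solution_def by blast+

context moving_end
begin

text \<open>The lateral boundary contributes nothing, whatever \<open>p\<close> does there: at each
  time the slice of \<open>z\<close> is in H10, and the slicewise identities are integrated in
  time.\<close>

lemma weak_solution_x_parts:
  assumes W: "weak_solution k s F f0 f1 z zx zt" and p: "plane_C1 p px pt"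
  shows "(LINT y:Qhat k s|lborel. zx y * p y) = - (LINT y:Qhat k s|lborel. z y * px y)"
proof -
  note c = plane_C1_continuous[OF p]
  note i = set_integrable_continuous_mult[OF weak_solutionD(2)[OF W] c(1)] set_integrable_continuous_mult[OF weak_solutionD(1)[OF W] c(2)]
  have "(LINT x:Omega k t|lborel. zx (x, t) * p (x, t)) = - (LINT x:Omega k t|lborel. z (x, t) * px (x, t))" if t: "t \<in> {0<..<s}" for t
  proof -
    have H: "H10_deriv (alpha k t) (\<lambda>x. z (x, t)) (\<lambda>x. zx (x, t))" using weak_solutionD(4)[OF W, of t] t by simp
    have "continuous_on UNIV (\<lambda>x. px (x, t))" by (rule continuous_on_compose2[OF c(2)]) (auto intro!: continuous_intros)
    from H10_integration_by_parts[OF H _ plane_C1_slice(1)[OF p] this] alpha_ge_1[of t] t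
    show ?thesis by (simp add: Omega_def)
  qed
  then have "(LINT t:{0<..<s}|lborel. LINT x:Omega k t|lborel. zx (x, t) * p (x, t)) =
     (LINT t:{0<..<s}|lborel. - (LINT x:Omega k t|lborel. z (x, t) * px (x, t)))"
    by (intro set_lebesgue_integral_cong) auto
  also have "\<dots> = - (LINT t:{0<..<s}|lborel. (LINT x:Omega k t|lborel. z (x, t) * px (x, t)))"
    by (simp add: set_lebesgue_integral_def)
  finally show ?thesis unfolding Qhat_Fubini(1)[OF i(1)] Qhat_Fubini(1)[OF i(2)] .
qed

text \<open>Since \<open>z\<close> has only first derivatives, second derivatives are put on
  \<open>u\<close>. The weak equation is tested with \<open>u X\<close>, the relation defining
  \<open>zt\<close> with \<open>ut X\<close>, and \<open>ux X\<close> enters through parts in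
  \<open>x\<close>; all terms with an undifferentiated \<open>X\<close> cancel apart from the
  source. The wave equation for \<open>u\<close> is encoded by the same \<open>uxx\<close> occurring
  as the space derivative of \<open>ux\<close> and as the time derivative of
  \<open>ut\<close>.\<close>

lemma weak_solution_cutoff:
  assumes W: "weak_solution k s F f0 f1 z zx zt" and F: "F \<in> L2_on (Qhat k s)"
    and u: "plane_C1 u ux ut" "plane_C1 ux uxx uxt" "plane_C1 ut utx uxx"
    and X: "plane_C1 X Xx Xt"
    and K: "compact K" "K \<subseteq> Qhat k s" "\<And>p. p \<notin> K \<Longrightarrow> u p * X p = 0 \<and> ut p * X p = 0"
  shows "(LINT p:Qhat k s|lborel. F p * (u p * X p)) =
    (LINT p:Qhat k s|lborel. u p * (zx p * Xx p - zt p * Xt p) + z p * (ut p * Xt p - ux p * Xx p))"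
proof -
  let ?Q = "Qhat k s"
  note L = weak_solutionD(1-3)[OF W]
  note uc = plane_C1_continuous[OF u(1)] and uxc = plane_C1_continuous[OF u(2)] and utc = plane_C1_continuous[OF u(3)]
    and Xc = plane_C1_continuous[OF X]
  have t1: "test_fun ?Q (\<lambda>p. u p * X p) (\<lambda>p. (ux p * X p + u p * Xx p, ut p * X p + u p * Xt p))"
    by (rule plane_C1_test_fun[OF plane_C1_mult[OF u(1) X] K(1,2)]) (use K(3) in blast)
  have t2: "test_fun ?Q (\<lambda>p. ut p * X p) (\<lambda>p. (utx p * X p + ut p * Xx p, uxx p * X p + ut p * Xt p))"
    by (rule plane_C1_test_fun[OF plane_C1_mult[OF u(3) X] K(1,2)]) (use K(3) in blast)
  note i = set_integrable_continuous_mult[OF L(1)] set_integrable_continuous_mult[OF L(2)] set_integrable_continuous_mult[OF L(3)]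
  have I: "set_integrable lborel ?Q (\<lambda>p. z p * (uxx p * X p))" "set_integrable lborel ?Q (\<lambda>p. z p * (ut p * Xt p))"
    "set_integrable lborel ?Q (\<lambda>p. z p * (ux p * Xx p))"
    "set_integrable lborel ?Q (\<lambda>p. zx p * (ux p * X p))" "set_integrable lborel ?Q (\<lambda>p. zx p * (u p * Xx p))"
    "set_integrable lborel ?Q (\<lambda>p. zt p * (ut p * X p))" "set_integrable lborel ?Q (\<lambda>p. zt p * (u p * Xt p))"
    by (intro i continuous_on_mult uc uxc utc Xc)+
  have 1: "(LINT p:?Q|lborel. zx p * (ux p * X p)) + (LINT p:?Q|lborel. zx p * (u p * Xx p))
     - (LINT p:?Q|lborel. zt p * (ut p * X p)) - (LINT p:?Q|lborel. zt p * (u p * Xt p)) = (LINT p:?Q|lborel. F p * (u p * X p))"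
  proof -
    have "(LINT p:?Q|lborel. F p * (u p * X p)) = (LINT p:?Q|lborel. (zx p * (ux p * X p) + zx p * (u p * Xx p)) - (zt p * (ut p * X p) + zt p * (u p * Xt p)))"
      using weak_solutionD(9)[OF W t1] by (simp add: distrib_left)
    also have "\<dots> = (LINT p:?Q|lborel. zx p * (ux p * X p)) + (LINT p:?Q|lborel. zx p * (u p * Xx p))
     - ((LINT p:?Q|lborel. zt p * (ut p * X p)) + (LINT p:?Q|lborel. zt p * (u p * Xt p)))"
      by (simp only: set_integral_add set_integral_diff I)
    finally show ?thesis by simp
  qed
  have 2: "(LINT p:?Q|lborel. z p * (uxx p * X p)) + (LINT p:?Q|lborel. z p * (ut p * Xt p)) = - (LINT p:?Q|lborel. zt p * (ut p * X p))"
    using weak_solutionD(8)[OF W t2] I by (simp add: distrib_left set_integral_add)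
  have 3: "(LINT p:?Q|lborel. zx p * (ux p * X p)) = - ((LINT p:?Q|lborel. z p * (uxx p * X p)) + (LINT p:?Q|lborel. z p * (ux p * Xx p)))"
    using weak_solution_x_parts[OF W plane_C1_mult[OF u(2) X]] I by (simp add: distrib_left set_integral_add)
  have "(LINT p:?Q|lborel. u p * (zx p * Xx p - zt p * Xt p) + z p * (ut p * Xt p - ux p * Xx p))
    = (LINT p:?Q|lborel. (zx p * (u p * Xx p) - zt p * (u p * Xt p)) + (z p * (ut p * Xt p) - z p * (ux p * Xx p)))"
    by (simp add: algebra_simps)
  also have "\<dots> = ((LINT p:?Q|lborel. zx p * (u p * Xx p)) - (LINT p:?Q|lborel. zt p * (u p * Xt p)))
     + ((LINT p:?Q|lborel. z p * (ut p * Xt p)) - (LINT p:?Q|lborel. z p * (ux p * Xx p)))"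
    by (simp only: set_integral_add set_integral_diff I)
  finally show ?thesis using 1 2 3 by linarith
qed

end

section \<open>Cutoff functions and the passage to piecewise linear cutoffs\<close>

lemma set_integral_bounded_multipliers_tendsto:
  fixes f :: "'a::euclidean_space \<Rightarrow> real" and m :: "nat \<Rightarrow> 'a \<Rightarrow> real"
  assumes f: "set_integrable lborel S f" and S: "S \<in> sets borel"
    and m: "\<And>n. m n \<in> borel_measurable borel" "g \<in> borel_measurable borel"
    and lim: "\<And>p. p \<in> S \<Longrightarrow> (\<lambda>n. m n p) \<longlonglongrightarrow> g p" and bd: "\<And>n p. p \<in> S \<Longrightarrow> \<bar>m n p\<bar> \<le> C"
  shows "(\<lambda>n. LINT p:S|lborel. f p * m n p) \<longlonglongrightarrow> (LINT p:S|lborel. f p * g p)"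
  unfolding set_lebesgue_integral_def
proof (rule integral_dominated_convergence)
  have fm: "(\<lambda>p. indicator S p *\<^sub>R f p) \<in> borel_measurable borel"
    using f unfolding set_integrable_def by (auto dest: borel_measurable_integrable)
  have e: "(\<lambda>p. indicator S p *\<^sub>R (f p * h p)) = (\<lambda>p. (indicator S p *\<^sub>R f p) * h p)" for h :: "'a \<Rightarrow> real"
    by auto
  show "(\<lambda>p. indicator S p *\<^sub>R (f p * g p)) \<in> borel_measurable lborel" unfolding e using fm m by simp
  show "(\<lambda>p. indicator S p *\<^sub>R (f p * m n p)) \<in> borel_measurable lborel" for n unfolding e using fm m by simp
  show "integrable lborel (\<lambda>p. C * norm (indicator S p *\<^sub>R f p))"
    using f unfolding set_integrable_def by (intro integrable_mult_right integrable_norm)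
  show "AE p in lborel. (\<lambda>n. indicator S p *\<^sub>R (f p * m n p)) \<longlonglongrightarrow> indicator S p *\<^sub>R (f p * g p)"
    using lim by (intro AE_I2) (auto simp: indicator_def intro!: tendsto_intros)
  show "AE p in lborel. norm (indicator S p *\<^sub>R (f p * m n p)) \<le> C * norm (indicator S p *\<^sub>R f p)" for n
  proof (rule AE_I2)
    fix p
    show "norm (indicator S p *\<^sub>R (f p * m n p)) \<le> C * norm (indicator S p *\<^sub>R f p)"
    proof (cases "p \<in> S")
      case True
      have "\<bar>m n p\<bar> * \<bar>f p\<bar> \<le> C * \<bar>f p\<bar>" using bd[OF True] by (intro mult_right_mono) auto
      then show ?thesis using True by (simp add: abs_mult mult.commute)
    qed simp
  qed
qed

text \<open>A C1 regularisation of \<open>max 0 y\<close>: its derivative climbs linearly from 0 to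
  1 on the interval from 0 to \<open>1 / real (Suc n)\<close>.\<close>

definition smooth_pos :: "nat \<Rightarrow> real \<Rightarrow> real" where
  "smooth_pos n y = real (Suc n) / 2 * ((max 0 y)\<^sup>2 - (max 0 (y - 1 / real (Suc n)))\<^sup>2)"

definition smooth_pos' :: "nat \<Rightarrow> real \<Rightarrow> real" where
  "smooth_pos' n y = real (Suc n) * (max 0 y - max 0 (y - 1 / real (Suc n)))"

text \<open>A C1 approximation of \<open>cutoff h\<close>. The shift of the first term by
  \<open>1 / real (Suc n)\<close> makes it vanish on a neighbourhood of 0, as a compactly supported
  test function must.\<close>

definition ramp :: "real \<Rightarrow> nat \<Rightarrow> real \<Rightarrow> real" where
  "ramp h n y = (smooth_pos n (y - 1 / real (Suc n)) - smooth_pos n (y - h)) / h"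

definition ramp' :: "real \<Rightarrow> nat \<Rightarrow> real \<Rightarrow> real" where
  "ramp' h n y = (smooth_pos' n (y - 1 / real (Suc n)) - smooth_pos' n (y - h)) / h"

definition cutoff :: "real \<Rightarrow> real \<Rightarrow> real" where
  "cutoff h y = (max 0 y - max 0 (y - h)) / h"

text \<open>The values at the two kinks are those of the pointwise limit of
  \<open>ramp' h n\<close>, so that the convergence holds at every point.\<close>

definition cutoff' :: "real \<Rightarrow> real \<Rightarrow> real" where
  "cutoff' h y = (if 0 < y \<and> y \<le> h then 1 / h else 0)"

lemma DERIV_smooth_pos: "(smooth_pos n has_real_derivative smooth_pos' n y) (at y)"
proof -
  have d: "((\<lambda>y::real. (max 0 (y - c))\<^sup>2) has_real_derivative 2 * max 0 (y - c)) (at y)" for c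
  proof -
    have "((\<lambda>y. y - c) has_real_derivative 1) (at y)" by (auto intro!: derivative_eq_intros)
    from DERIV_chain'[OF this DERIV_pos_part_square] show ?thesis by simp
  qed
  have "((\<lambda>y. real (Suc n) / 2 * ((max 0 (y - 0))\<^sup>2 - (max 0 (y - 1 / real (Suc n)))\<^sup>2)) has_real_derivative
     real (Suc n) / 2 * (2 * max 0 (y - 0) - 2 * max 0 (y - 1 / real (Suc n)))) (at y)"
    by (intro DERIV_cmult DERIV_diff d)
  then show ?thesis unfolding smooth_pos_def[abs_def] smooth_pos'_def
    unfolding diff_0_right by (rule DERIV_cong) (simp add: right_diff_distrib del: of_nat_Suc)
qed

lemma smooth_pos'_bounds: "0 \<le> smooth_pos' n y" "smooth_pos' n y \<le> 1" "y \<le> 0 \<Longrightarrow> smooth_pos' n y = 0"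
  "1 / real (Suc n) \<le> y \<Longrightarrow> smooth_pos' n y = 1"
proof -
  have p: "0 < 1 / real (Suc n)" by simp
  show "0 \<le> smooth_pos' n y" unfolding smooth_pos'_def
  proof (rule mult_nonneg_nonneg)
    show "0 \<le> max 0 y - max 0 (y - 1 / real (Suc n))" using p by linarith
  qed simp
  have "max 0 y - max 0 (y - 1 / real (Suc n)) \<le> 1 / real (Suc n)" using p by linarith
  then have "real (Suc n) * (max 0 y - max 0 (y - 1 / real (Suc n))) \<le> real (Suc n) * (1 / real (Suc n))"
    by (rule mult_left_mono) simp
  then show "smooth_pos' n y \<le> 1" unfolding smooth_pos'_def by simp
  have "max 0 (y - 1 / real (Suc n)) = 0" "max 0 y = 0" if "y \<le> 0" using p that by linarith+
  then show "y \<le> 0 \<Longrightarrow> smooth_pos' n y = 0" unfolding smooth_pos'_def by simp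
  assume a: "1 / real (Suc n) \<le> y"
  have "max 0 y - max 0 (y - 1 / real (Suc n)) = 1 / real (Suc n)" using a p by linarith
  then show "smooth_pos' n y = 1" unfolding smooth_pos'_def by simp
qed

lemma smooth_pos_values: "y \<le> 0 \<Longrightarrow> smooth_pos n y = 0"
  "1 / real (Suc n) \<le> y \<Longrightarrow> smooth_pos n y = y - 1 / (2 * real (Suc n))"
proof -
  have p: "0 < 1 / real (Suc n)" by simp
  have "max 0 (y - 1 / real (Suc n)) = 0" "max 0 y = 0" if "y \<le> 0" using p that by linarith+
  then show "y \<le> 0 \<Longrightarrow> smooth_pos n y = 0" unfolding smooth_pos_def by simp
  assume a: "1 / real (Suc n) \<le> y"
  have "smooth_pos n y = real (Suc n) / 2 * (y\<^sup>2 - (y - 1 / real (Suc n))\<^sup>2)"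
  proof -
    have "max 0 y = y" "max 0 (y - 1 / real (Suc n)) = y - 1 / real (Suc n)" using a p by linarith+
    then show ?thesis unfolding smooth_pos_def by (simp only:)
  qed
  also have "\<dots> = y - 1 / (2 * real (Suc n))"
    by (simp add: power2_eq_square field_simps del: of_nat_Suc)
  finally show "smooth_pos n y = y - 1 / (2 * real (Suc n))" .
qed

lemma smooth_pos_lipschitz: "\<bar>smooth_pos n y - smooth_pos n w\<bar> \<le> \<bar>y - w\<bar>"
proof -
  have "norm (smooth_pos n y - smooth_pos n w) \<le> 1 * norm (y - w)"
    by (rule field_differentiable_bound[of UNIV "smooth_pos n" "smooth_pos' n"])
      (use DERIV_smooth_pos smooth_pos'_bounds(1,2) in \<open>auto simp: abs_of_nonneg\<close>)
  then show ?thesis by simp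
qed

lemma inverse_Suc_tendsto: "(\<lambda>n. 1 / real (Suc n)) \<longlonglongrightarrow> 0"
  using LIMSEQ_inverse_real_of_nat by (simp add: inverse_eq_divide)

lemma smooth_pos_tendsto: "(\<lambda>n. smooth_pos n y) \<longlonglongrightarrow> max 0 y"
proof (cases "y \<le> 0")
  case True then show ?thesis using smooth_pos_values(1) by simp
next
  case False
  have "\<forall>\<^sub>F n in sequentially. 1 / real (Suc n) < y"
    using inverse_Suc_tendsto False by (intro order_tendstoD(2)) auto
  then have "\<forall>\<^sub>F n in sequentially. y - 1/2 * (1 / real (Suc n)) = smooth_pos n y"
    by eventually_elim (simp add: smooth_pos_values(2) del: of_nat_Suc)
  moreover have "(\<lambda>n. y - 1/2 * (1 / real (Suc n))) \<longlonglongrightarrow> y - 1/2 * 0"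
    by (intro tendsto_intros inverse_Suc_tendsto)
  ultimately show ?thesis using False by (auto intro: Lim_transform_eventually)
qed

lemma smooth_pos_shift_tendsto: "(\<lambda>n. smooth_pos n (y - 1 / real (Suc n))) \<longlonglongrightarrow> max 0 y"
proof -
  have "(\<lambda>n. smooth_pos n (y - 1 / real (Suc n)) - smooth_pos n y) \<longlonglongrightarrow> 0"
  proof (rule Lim_null_comparison[OF _ inverse_Suc_tendsto])
    show "\<forall>\<^sub>F n in sequentially. norm (smooth_pos n (y - 1 / real (Suc n)) - smooth_pos n y) \<le> 1 / real (Suc n)"
    proof (rule always_eventually, rule allI)
      fix n show "norm (smooth_pos n (y - 1 / real (Suc n)) - smooth_pos n y) \<le> 1 / real (Suc n)"
        using smooth_pos_lipschitz[of n "y - 1 / real (Suc n)" y] by simp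
    qed
  qed
  from tendsto_add[OF this smooth_pos_tendsto[of y]] show ?thesis by simp
qed

lemma ramp_properties:
  assumes h: "h > 0"
  shows "(ramp h n has_real_derivative ramp' h n y) (at y)" "continuous_on UNIV (ramp' h n)"
    "\<bar>ramp' h n y\<bar> \<le> 1 / h" "\<bar>ramp h n y\<bar> \<le> (h + 1) / h" "y \<le> min (1 / real (Suc n)) h \<Longrightarrow> ramp h n y = 0"
    "(\<lambda>n. ramp h n y) \<longlonglongrightarrow> cutoff h y" "(\<lambda>n. ramp' h n y) \<longlonglongrightarrow> cutoff' h y"
proof -
  have d: "((\<lambda>y. smooth_pos n (y - c)) has_real_derivative smooth_pos' n (y - c)) (at y)" for c y
  proof -
    have "((\<lambda>y. y - c) has_real_derivative 1) (at y)" by (auto intro!: derivative_eq_intros)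
    from DERIV_chain'[OF this DERIV_smooth_pos] show ?thesis by simp
  qed
  show "(ramp h n has_real_derivative ramp' h n y) (at y)"
    unfolding ramp_def[abs_def] ramp'_def by (intro DERIV_cdivide DERIV_diff d)
  show "continuous_on UNIV (ramp' h n)"
    unfolding ramp'_def smooth_pos'_def using h by (intro continuous_intros) auto
  have "\<bar>smooth_pos' n (y - 1 / real (Suc n)) - smooth_pos' n (y - h)\<bar> \<le> 1"
    using smooth_pos'_bounds(1,2)[of n "y - 1 / real (Suc n)"] smooth_pos'_bounds(1,2)[of n "y - h"] by linarith
  then show "\<bar>ramp' h n y\<bar> \<le> 1 / h" unfolding ramp'_def using h by (simp add: divide_right_mono)
  have "0 < 1 / real (Suc n)" "1 / real (Suc n) \<le> 1" by auto
  then have "\<bar>(y - 1 / real (Suc n)) - (y - h)\<bar> \<le> h + 1" using h by linarith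
  then have "\<bar>smooth_pos n (y - 1 / real (Suc n)) - smooth_pos n (y - h)\<bar> \<le> h + 1"
    using smooth_pos_lipschitz[of n "y - 1 / real (Suc n)" "y - h"] by linarith
  then show "\<bar>ramp h n y\<bar> \<le> (h + 1) / h" unfolding ramp_def abs_divide using h by (simp add: divide_right_mono)
  show "y \<le> min (1 / real (Suc n)) h \<Longrightarrow> ramp h n y = 0"
    unfolding ramp_def using smooth_pos_values(1)[of "y - 1 / real (Suc n)" n] smooth_pos_values(1)[of "y - h" n] by simp
  show "(\<lambda>n. ramp h n y) \<longlonglongrightarrow> cutoff h y"
    unfolding ramp_def cutoff_def using h by (intro tendsto_intros smooth_pos_tendsto smooth_pos_shift_tendsto) auto
  have ev: "\<forall>\<^sub>F n in sequentially. c / real (Suc n) < w" if "w > 0" for c w :: real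
  proof -
    have "(\<lambda>n. c * (1 / real (Suc n))) \<longlonglongrightarrow> c * 0" by (intro tendsto_intros inverse_Suc_tendsto)
    then have "\<forall>\<^sub>F n in sequentially. c * (1 / real (Suc n)) < w" using that by (intro order_tendstoD(2)) auto
    then show ?thesis by simp
  qed
  have l1: "(\<lambda>n. smooth_pos' n (y - 1 / real (Suc n))) \<longlonglongrightarrow> (if 0 < y then 1 else 0)"
  proof (cases "0 < y")
    case True
    have "\<forall>\<^sub>F n in sequentially. smooth_pos' n (y - 1 / real (Suc n)) = 1"
      using ev[OF True, of 2]
    proof eventually_elim
      case (elim n)
      then have "1 / real (Suc n) \<le> y - 1 / real (Suc n)" by simp
      then show ?case by (rule smooth_pos'_bounds(4))
    qed
    then show ?thesis using True by (simp add: tendsto_eventually)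
  next
    case False
    have "smooth_pos' n (y - 1 / real (Suc n)) = 0" for n
    proof (rule smooth_pos'_bounds(3))
      have "0 < 1 / real (Suc n)" by simp
      then show "y - 1 / real (Suc n) \<le> 0" using False by linarith
    qed
    then show ?thesis using False by simp
  qed
  have l2: "(\<lambda>n. smooth_pos' n (y - h)) \<longlonglongrightarrow> (if h < y then 1 else 0)"
  proof (cases "h < y")
    case True
    then have "y - h > 0" by simp
    have "\<forall>\<^sub>F n in sequentially. smooth_pos' n (y - h) = 1"
      using ev[OF \<open>y - h > 0\<close>, of 1] by eventually_elim (auto intro: smooth_pos'_bounds(4))
    then show ?thesis using True by (simp add: tendsto_eventually)
  next
    case False then show ?thesis using smooth_pos'_bounds(3)[of "y - h"] by simp
  qed
  have "(\<lambda>n. ramp' h n y) \<longlonglongrightarrow> ((if 0 < y then 1 else 0) - (if h < y then 1 else 0)) / h"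
    unfolding ramp'_def using h by (intro tendsto_intros l1 l2) auto
  then show "(\<lambda>n. ramp' h n y) \<longlonglongrightarrow> cutoff' h y" unfolding cutoff'_def using h by (auto split: if_splits)
qed

lemma cutoff_bounds:
  assumes "h > 0"
  shows "0 \<le> cutoff h y" "cutoff h y \<le> 1" "h \<le> y \<Longrightarrow> cutoff h y = 1" "0 \<le> cutoff' h y" "cutoff' h y \<le> 1 / h"
    "continuous_on UNIV (cutoff h)" "cutoff' h \<in> borel_measurable borel"
proof -
  show "0 \<le> cutoff h y" "0 \<le> cutoff' h y" "cutoff' h y \<le> 1 / h" "h \<le> y \<Longrightarrow> cutoff h y = 1"
    using assms by (auto simp: cutoff_def cutoff'_def)
  have "max 0 y - max 0 (y - h) \<le> h" using assms by (simp add: max_def)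
  then show "cutoff h y \<le> 1" using assms by (simp add: cutoff_def)
  show "continuous_on UNIV (cutoff h)" unfolding cutoff_def using assms by (intro continuous_intros) auto
  have "cutoff' h = (\<lambda>y. 1 / h * indicator {0<..h} y)" by (auto simp: cutoff'_def fun_eq_iff indicator_def)
  then show "cutoff' h \<in> borel_measurable borel" by simp
qed

lemma cutoff_tendsto:
  assumes "y > 0" "\<And>n. h n > 0" "h \<longlonglongrightarrow> 0"
  shows "(\<lambda>n::nat. cutoff (h n) y) \<longlonglongrightarrow> 1"
proof -
  have "\<forall>\<^sub>F n in sequentially. h n < y" using assms by (intro order_tendstoD(2)) auto
  then have "\<forall>\<^sub>F n in sequentially. cutoff (h n) y = 1"
    by eventually_elim (use cutoff_bounds(3)[OF assms(2)] in \<open>auto intro: less_imp_le\<close>)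
  then show ?thesis by (rule tendsto_eventually)
qed

text \<open>Partial derivatives only change the profile and the two coefficients, so one family
  contains \<open>travel\<close> together with its derivatives of first and second order.\<close>

definition wave :: "real \<Rightarrow> real \<Rightarrow> real \<Rightarrow> (real \<Rightarrow> real) \<Rightarrow> real \<times> real \<Rightarrow> real" where
  "wave k c1 c2 f p = c1 * f (snd p - fst p) + c2 * f (reflect k (snd p + fst p))"

lemma plane_C1_scale:
  assumes "plane_C1 f fx ft"
  shows "plane_C1 (\<lambda>p. c * f p) (\<lambda>p. c * fx p) (\<lambda>p. c * ft p)"
proof -
  have "plane_C1 (\<lambda>p. c) (\<lambda>p. 0) (\<lambda>p. 0)"
    unfolding plane_C1_def
  proof (intro conjI allI continuous_on_const)
    show "GDERIV (\<lambda>p. c) p :> (0, 0)" for p :: "real \<times> real"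
      using GDERIV_const[of c p] by (simp add: zero_prod_def)
  qed
  from plane_C1_mult[OF this assms] show ?thesis by simp
qed

text \<open>Where \<open>f\<close> vanishes on an open set its derivative does too. With
  \<open>b = 0\<close> this margin makes the wave and its derivatives vanish inside the domain for
  small times, so the test functions below carry no cutoff near time 0.\<close>

lemma C2_supported_vanish:
  assumes "C2_supported b c f f' f''"
  shows "\<exists>d>0. \<forall>x. (x < b + d \<or> c - d < x) \<longrightarrow> f x = 0 \<and> f' x = 0"
proof -
  obtain d where d: "d > 0" "\<And>x. f x \<noteq> 0 \<Longrightarrow> b + d \<le> x \<and> x \<le> c - d"
    and D: "\<And>x. (f has_real_derivative f' x) (at x)"
    using assms unfolding C2_supported_def by blast
  have "f x = 0 \<and> f' x = 0" if x: "x < b + d \<or> c - d < x" for x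
  proof
    show "f x = 0" using d(2)[of x] x by force
    have z: "f y = 0" if "y \<in> {..<b+d} \<union> {c-d<..}" for y using d(2)[of y] that by force
    have "((\<lambda>x. 0) has_real_derivative 0) (at x)" by simp
    then have "(f has_real_derivative 0) (at x)"
      by (rule has_field_derivative_transform_within_open[of _ _ _ "{..<b+d} \<union> {c-d<..}"]) (use x z in auto)
    then show "f' x = 0" using D DERIV_unique by blast
  qed
  then show ?thesis using d(1) by blast
qed

context moving_end
begin

lemma wave_affine: "wave k c1 c2 f p = c1 * f ((-1) * fst p + 1 * snd p + 0) + c2 * f (q * fst p + q * snd p + (- (q + 1)))"
  by (simp add: wave_def reflect_def algebra_simps)

lemma travel_wave: "travel k f = wave k 1 (-1) f"
  by (simp add: travel_def wave_def fun_eq_iff)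

lemma wave_plane_C1:
  assumes "\<And>x. (f has_real_derivative f' x) (at x)" "continuous_on UNIV f'"
  shows "plane_C1 (wave k c1 c2 f) (wave k (- c1) (c2 * q) f') (wave k c1 (c2 * q) f')"
proof -
  have "plane_C1 (wave k c1 c2 f)
     (\<lambda>p. c1 * ((-1) * f' ((-1) * fst p + 1 * snd p + 0)) + c2 * (q * f' (q * fst p + q * snd p + (- (q + 1)))))
     (\<lambda>p. c1 * (1 * f' ((-1) * fst p + 1 * snd p + 0)) + c2 * (q * f' (q * fst p + q * snd p + (- (q + 1)))))"
    unfolding wave_affine[abs_def]
    by (rule plane_C1_add[OF plane_C1_scale[OF plane_C1_compose[OF assms]] plane_C1_scale[OF plane_C1_compose[OF assms]]])
  moreover have "(\<lambda>p. c1 * ((-1) * f' ((-1) * fst p + 1 * snd p + 0)) + c2 * (q * f' (q * fst p + q * snd p + (- (q + 1))))) = wave k (- c1) (c2 * q) f'"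
    unfolding wave_affine[abs_def] by (simp add: mult.assoc)
  moreover have "(\<lambda>p. c1 * (1 * f' ((-1) * fst p + 1 * snd p + 0)) + c2 * (q * f' (q * fst p + q * snd p + (- (q + 1))))) = wave k c1 (c2 * q) f'"
    unfolding wave_affine[abs_def] by (simp add: mult.assoc)
  ultimately show ?thesis by simp
qed

lemma wave_L2_slice:
  assumes f: "f \<in> L2_on UNIV"
  shows "(\<lambda>x. wave k c1 c2 f (x, t)) \<in> L2_on (Omega k t)"
  unfolding wave_affine
  by (rule L2_add[OF L2_scale[OF L2_slice_affine[OF f, of "-1"]] L2_scale[OF L2_slice_affine[OF f q_nonzero]]]) simp

lemma wave_L2_continuous:
  assumes f: "f \<in> L2_on UNIV"
  shows "L2_continuous k s (wave k c1 c2 f)"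
proof -
  have m: "(-1::real) \<noteq> 0" by simp
  show ?thesis unfolding wave_affine[abs_def]
    by (rule L2_continuous_add[OF L2_continuous_scale[OF L2_continuous_affine[OF f m]] L2_continuous_scale[OF L2_continuous_affine[OF f q_nonzero]]
        L2_scale[OF L2_slice_affine[OF f m]] L2_scale[OF L2_slice_affine[OF f q_nonzero]]])
qed

lemma wave_vanish:
  assumes "\<And>s. s < d \<Longrightarrow> f s = 0" "0 < x" "x < alpha k t" "t < d"
  shows "wave k c1 c2 f (x, t) = 0"
  using assms(1)[of "t - x"] assms(1)[of "r (t + x)"] assms(2-4) reflect_lt[OF assms(3)]
  by (simp add: wave_def)

text \<open>One factor for each of \<open>x = 0\<close>, the moving end and \<open>t = s\<close>.
  The width \<open>H\<close> in time is separate from the width \<open>h\<close> in space because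
  the two limits are taken one after the other.\<close>

lemma ramp_product_plane_C1:
  assumes h: "h > 0" and H: "H > 0"
  shows "plane_C1 (\<lambda>p. ramp h n (fst p) * ramp h n (alpha k (snd p) - fst p) * ramp H n (s - snd p))
    (\<lambda>p. (ramp' h n (fst p) * ramp h n (alpha k (snd p) - fst p) - ramp h n (fst p) * ramp' h n (alpha k (snd p) - fst p)) * ramp H n (s - snd p))
    (\<lambda>p. k * (ramp h n (fst p) * ramp' h n (alpha k (snd p) - fst p)) * ramp H n (s - snd p)
        - ramp h n (fst p) * ramp h n (alpha k (snd p) - fst p) * ramp' H n (s - snd p))"
proof -
  note Ph = ramp_properties(1,2)[OF h, of n] and PH = ramp_properties(1,2)[OF H, of n]
  have 1: "plane_C1 (\<lambda>p. ramp h n (fst p)) (\<lambda>p. ramp' h n (fst p)) (\<lambda>p. 0)"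
    using plane_C1_compose[OF Ph, of 1 0 0] by simp
  have 2: "plane_C1 (\<lambda>p. ramp h n (alpha k (snd p) - fst p)) (\<lambda>p. - ramp' h n (alpha k (snd p) - fst p)) (\<lambda>p. k * ramp' h n (alpha k (snd p) - fst p))"
  proof -
    have e: "(-1) * fst p + k * snd p + 1 = alpha k (snd p) - fst p" for p by (simp add: alpha_def)
    show ?thesis using plane_C1_compose[OF Ph, of "-1" k 1] unfolding e by simp
  qed
  have 3: "plane_C1 (\<lambda>p. ramp H n (s - snd p)) (\<lambda>p. 0) (\<lambda>p. - ramp' H n (s - snd p))"
    using plane_C1_compose[OF PH, of 0 "-1" s] by simp
  from plane_C1_mult[OF plane_C1_mult[OF 1 2] 3] show ?thesis by (simp add: algebra_simps)
qed

lemma layer_compact: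
  assumes "m > 0" "d > 0"
  shows "compact {p. m \<le> fst p \<and> m \<le> alpha k (snd p) - fst p \<and> m \<le> s - snd p \<and> d \<le> snd p}" (is "compact ?K")
    "{p. m \<le> fst p \<and> m \<le> alpha k (snd p) - fst p \<and> m \<le> s - snd p \<and> d \<le> snd p} \<subseteq> Qhat k s"
proof -
  show sub: "?K \<subseteq> Qhat k s" using assms by (auto simp: Qhat_def)
  have "closed ?K" unfolding alpha_def
    by (intro closed_Collect_conj closed_Collect_le continuous_intros)
  moreover have "bounded ?K" using Qhat_bounded sub by (rule bounded_subset)
  ultimately show "compact ?K" by (simp add: compact_eq_bounded_closed)
qed

lemma continuous_fst_snd_compose:
  fixes f :: "real \<Rightarrow> real"
  assumes "f \<in> borel_measurable borel"
  shows "(\<lambda>p. f (fst p)) \<in> borel_measurable (borel :: (real \<times> real) measure)"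
    "(\<lambda>p. f (alpha k (snd p) - fst p)) \<in> borel_measurable (borel :: (real \<times> real) measure)"
    "(\<lambda>p. f (s - snd p)) \<in> borel_measurable (borel :: (real \<times> real) measure)"
  unfolding alpha_def
  by (rule measurable_compose[OF _ assms], intro borel_measurable_continuous_onI continuous_intros)+

text \<open>Test functions have to be C1, while piecewise linear cutoffs have derivatives that are
  exact averages over a layer. With both widths fixed, \<open>n\<close> tends to infinity in
  \<open>weak_solution_cutoff\<close>. \<open>A\<close> collects the factors of the space derivative
  of the cutoff and \<open>B\<close> those of its time derivative, to which the motion of the end
  contributes the term with \<open>k\<close>.\<close>

lemma weak_solution_lipschitz_cutoff:
  assumes W: "weak_solution k s F f0 f1 z zx zt" and F: "F \<in> L2_on (Qhat k s)"
    and C: "C2_supported 0 b f f' f''" and h: "h > 0" and H: "H > 0"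
  defines "A \<equiv> \<lambda>p. zx p * travel k f p - z p * wave k (-1) (- q) f' p"
    and "B \<equiv> \<lambda>p. z p * wave k 1 (- q) f' p - zt p * travel k f p"
  shows "(LINT p:Qhat k s|lborel. (F p * travel k f p) * (cutoff h (fst p) * cutoff h (alpha k (snd p) - fst p) * cutoff H (s - snd p))) =
    (LINT p:Qhat k s|lborel. A p * ((cutoff' h (fst p) * cutoff h (alpha k (snd p) - fst p) - cutoff h (fst p) * cutoff' h (alpha k (snd p) - fst p)) * cutoff H (s - snd p)))
    + (LINT p:Qhat k s|lborel. B p * (k * (cutoff h (fst p) * cutoff' h (alpha k (snd p) - fst p)) * cutoff H (s - snd p)
        - cutoff h (fst p) * cutoff h (alpha k (snd p) - fst p) * cutoff' H (s - snd p)))"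
proof -
  let ?Q = "Qhat k s"
  let ?a = "\<lambda>n p. ramp h n (fst p)" and ?b = "\<lambda>n p. ramp h n (alpha k (snd p) - fst p)" and ?d = "\<lambda>n p. ramp H n (s - snd p)"
  let ?a' = "\<lambda>n p. ramp' h n (fst p)" and ?b' = "\<lambda>n p. ramp' h n (alpha k (snd p) - fst p)" and ?d' = "\<lambda>n p. ramp' H n (s - snd p)"
  let ?X = "\<lambda>n p. ?a n p * ?b n p * ?d n p"
  let ?Xx = "\<lambda>n p. (?a' n p * ?b n p - ?a n p * ?b' n p) * ?d n p"
  let ?Xt = "\<lambda>n p. k * (?a n p * ?b' n p) * ?d n p - ?a n p * ?b n p * ?d' n p"
  let ?u = "travel k f" and ?ux = "wave k (-1) (- q) f'" and ?ut = "wave k 1 (- q) f'"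
  have D: "\<And>x. (f has_real_derivative f' x) (at x)" "\<And>x. (f' has_real_derivative f'' x) (at x)"
    and c: "continuous_on UNIV f'" "continuous_on UNIV f''"
    using C unfolding C2_supported_def by (auto intro: DERIV_continuous_UNIV)
  have u: "plane_C1 ?u ?ux ?ut" unfolding travel_wave using wave_plane_C1[OF D(1) c(1), of 1 "-1"] by simp
  have ux: "plane_C1 ?ux (wave k 1 (- q * q) f'') (wave k (-1) (- q * q) f'')"
    using wave_plane_C1[OF D(2) c(2), of "-1" "- q"] by simp
  have ut: "plane_C1 ?ut (wave k (-1) (- q * q) f'') (wave k 1 (- q * q) f'')"
    using wave_plane_C1[OF D(2) c(2), of 1 "- q"] by simp
  obtain e where e: "e > 0" "\<And>x. x < e \<Longrightarrow> f x = 0 \<and> f' x = 0"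
    using C2_supported_vanish[OF C] by auto
  note L = weak_solutionD(1-3)[OF W]
  have id: "(LINT p:?Q|lborel. (F p * ?u p) * ?X n p) = (LINT p:?Q|lborel. A p * ?Xx n p) + (LINT p:?Q|lborel. B p * ?Xt n p)" for n
  proof -
    \<comment> \<open>Every ramp vanishes up to \<open>?m\<close>, which provides the gap at the
      three sides that carry a cutoff; \<open>e\<close> provides it at time 0.\<close>
    let ?m = "min (1 / real (Suc n)) (min h H)"
    let ?K = "{p. ?m \<le> fst p \<and> ?m \<le> alpha k (snd p) - fst p \<and> ?m \<le> s - snd p \<and> e \<le> snd p}"
    note X = ramp_product_plane_C1[OF h H, of n s]
    note Xc = plane_C1_continuous[OF X] and uc = plane_C1_continuous[OF u]
    have m: "?m > 0" using h H by simp
    note K = layer_compact[OF m e(1), of s]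
    have zero: "?u p * ?X n p = 0 \<and> ?ut p * ?X n p = 0" if "p \<notin> ?K" for p
    proof (cases "?X n p = 0")
      case False
      then have nz: "?a n p \<noteq> 0" "?b n p \<noteq> 0" "?d n p \<noteq> 0" by auto
      have g: "?m \<le> fst p" "?m \<le> alpha k (snd p) - fst p" "?m \<le> s - snd p"
        using nz ramp_properties(5)[OF h, of "fst p" n] ramp_properties(5)[OF h, of "alpha k (snd p) - fst p" n]
          ramp_properties(5)[OF H, of "s - snd p" n] by (force simp: min_le_iff_disj)+
      have x: "0 < fst p" "fst p < alpha k (snd p)"
        using less_le_trans[OF m g(1)] less_le_trans[OF m g(2)] by auto
      have t: "snd p < e" using that g by auto
      have "wave k 1 (-1) f (fst p, snd p) = 0" "wave k 1 (- q) f' (fst p, snd p) = 0"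
        using e(2) by (intro wave_vanish[OF _ x t]; blast)+
      then show ?thesis by (simp add: travel_wave)
    qed simp
    have "(LINT p:?Q|lborel. F p * (?u p * ?X n p)) =
      (LINT p:?Q|lborel. ?u p * (zx p * ?Xx n p - zt p * ?Xt n p) + z p * (?ut p * ?Xt n p - ?ux p * ?Xx n p))"
      by (rule weak_solution_cutoff[OF W F u ux ut X K zero])
    also have "\<dots> = (LINT p:?Q|lborel. A p * ?Xx n p + B p * ?Xt n p)"
      unfolding A_def B_def by (simp add: algebra_simps)
    also have "\<dots> = (LINT p:?Q|lborel. A p * ?Xx n p) + (LINT p:?Q|lborel. B p * ?Xt n p)"
    proof (rule set_integral_add(2))
      have "A p * ?Xx n p = zx p * (?u p * ?Xx n p) - z p * (?ux p * ?Xx n p)"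
        "B p * ?Xt n p = z p * (?ut p * ?Xt n p) - zt p * (?u p * ?Xt n p)" for p
        unfolding A_def B_def by (simp_all add: algebra_simps)
      then show "set_integrable lborel ?Q (\<lambda>p. A p * ?Xx n p)" "set_integrable lborel ?Q (\<lambda>p. B p * ?Xt n p)"
        by (simp_all only:) (intro set_integral_diff set_integrable_continuous_mult L continuous_on_mult uc Xc)+
    qed
    finally show ?thesis by (simp add: mult.assoc)
  qed
  define M where "M = (h + 1) / h + 1 / h + (H + 1) / H + 1 / H"
  have M: "\<bar>?a n p\<bar> \<le> M" "\<bar>?b n p\<bar> \<le> M" "\<bar>?d n p\<bar> \<le> M" "\<bar>?a' n p\<bar> \<le> M" "\<bar>?b' n p\<bar> \<le> M" "\<bar>?d' n p\<bar> \<le> M" for n p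
  proof -
    have pos: "0 \<le> (h + 1) / h" "0 \<le> 1 / h" "0 \<le> (H + 1) / H" "0 \<le> 1 / H" using h H by auto
    show "\<bar>?a n p\<bar> \<le> M" "\<bar>?b n p\<bar> \<le> M" "\<bar>?d n p\<bar> \<le> M" "\<bar>?a' n p\<bar> \<le> M" "\<bar>?b' n p\<bar> \<le> M" "\<bar>?d' n p\<bar> \<le> M"
      unfolding M_def using pos ramp_properties(3,4)[OF h, of n "fst p"] ramp_properties(3,4)[OF h, of n "alpha k (snd p) - fst p"]
        ramp_properties(3,4)[OF H, of n "s - snd p"] by linarith+
  qed
  have M0: "0 \<le> M" using M(1)[of 0 "(0,0)"] by linarith
  have prod3: "\<bar>x * y * w\<bar> \<le> M * M * M" if "\<bar>x\<bar> \<le> M" "\<bar>y\<bar> \<le> M" "\<bar>w\<bar> \<le> M" for x y w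
    unfolding abs_mult using that M0 by (intro mult_mono) auto
  have bX: "\<bar>?X n p\<bar> \<le> M * M * M" for n p by (rule prod3[OF M(1-3)])
  have bXx: "\<bar>?Xx n p\<bar> \<le> 2 * (M * M * M)" for n p
  proof -
    have "?Xx n p = ?a' n p * ?b n p * ?d n p - ?a n p * ?b' n p * ?d n p" by (simp add: algebra_simps)
    then show ?thesis using prod3[OF M(4,2,3), of n p n p n p] prod3[OF M(1,5,3), of n p n p n p] by linarith
  qed
  have bXt: "\<bar>?Xt n p\<bar> \<le> 2 * (M * M * M)" for n p
  proof -
    have "\<bar>k * (?a n p * ?b' n p * ?d n p)\<bar> \<le> 1 * (M * M * M)"
      unfolding abs_mult[of k] using k prod3[OF M(1,5,3), of n p n p n p] by (intro mult_mono) auto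
    moreover have "?Xt n p = k * (?a n p * ?b' n p * ?d n p) - ?a n p * ?b n p * ?d' n p" by (simp add: algebra_simps)
    ultimately show ?thesis using prod3[OF M(1,2,6), of n p n p n p] by linarith
  qed
  have uc: "continuous_on UNIV ?u" "continuous_on UNIV ?ux" "continuous_on UNIV ?ut" by (rule plane_C1_continuous[OF u])+
  have iA: "set_integrable lborel ?Q A" "set_integrable lborel ?Q B" "set_integrable lborel ?Q (\<lambda>p. F p * ?u p)"
    unfolding A_def B_def by (intro set_integral_diff set_integrable_continuous_mult L uc F)+
  have rm: "ramp h n \<in> borel_measurable borel" "ramp' h n \<in> borel_measurable borel" if "h > 0" for h n
    using ramp_properties(1,2)[OF that, of n] by (auto intro!: borel_measurable_continuous_onI DERIV_continuous_UNIV)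
  have cm: "cutoff h \<in> borel_measurable borel" "cutoff' h \<in> borel_measurable borel" if "h > 0" for h
    using cutoff_bounds(6,7)[OF that] by (auto intro!: borel_measurable_continuous_onI)
  note meas = continuous_fst_snd_compose[OF rm(1)[OF h]] continuous_fst_snd_compose[OF rm(2)[OF h]]
    continuous_fst_snd_compose[OF rm(1)[OF H]] continuous_fst_snd_compose[OF rm(2)[OF H]]
    continuous_fst_snd_compose[OF cm(1)[OF h]] continuous_fst_snd_compose[OF cm(2)[OF h]]
    continuous_fst_snd_compose[OF cm(1)[OF H]] continuous_fst_snd_compose[OF cm(2)[OF H]]
  note lims = ramp_properties(6,7)[OF h] ramp_properties(6,7)[OF H]
  have l0: "(\<lambda>n. LINT p:?Q|lborel. (F p * ?u p) * ?X n p) \<longlonglongrightarrow>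
     (LINT p:?Q|lborel. (F p * ?u p) * (cutoff h (fst p) * cutoff h (alpha k (snd p) - fst p) * cutoff H (s - snd p)))"
    by (rule set_integral_bounded_multipliers_tendsto[OF iA(3) Qhat_borel _ _ _ bX])
      (intro borel_measurable_times meas tendsto_intros lims)+
  have l1: "(\<lambda>n. LINT p:?Q|lborel. A p * ?Xx n p) \<longlonglongrightarrow>
     (LINT p:?Q|lborel. A p * ((cutoff' h (fst p) * cutoff h (alpha k (snd p) - fst p) - cutoff h (fst p) * cutoff' h (alpha k (snd p) - fst p)) * cutoff H (s - snd p)))"
    by (rule set_integral_bounded_multipliers_tendsto[OF iA(1) Qhat_borel _ _ _ bXx])
      (intro borel_measurable_times borel_measurable_diff meas tendsto_intros lims)+
  have l2: "(\<lambda>n. LINT p:?Q|lborel. B p * ?Xt n p) \<longlonglongrightarrow>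
     (LINT p:?Q|lborel. B p * (k * (cutoff h (fst p) * cutoff' h (alpha k (snd p) - fst p)) * cutoff H (s - snd p)
        - cutoff h (fst p) * cutoff h (alpha k (snd p) - fst p) * cutoff' H (s - snd p)))"
    by (rule set_integral_bounded_multipliers_tendsto[OF iA(2) Qhat_borel _ _ _ bXt])
      (intro borel_measurable_times borel_measurable_diff borel_measurable_const meas tendsto_intros lims)+
  from tendsto_add[OF l1 l2] l0 show ?thesis unfolding id by (rule LIMSEQ_unique[rotated])
qed

end

section \<open>Boundary layers at the two lateral ends\<close>

lemma L2_swap:
  assumes "m \<in> L2_on (UNIV :: (real \<times> real) set)"
  shows "(\<lambda>p. m (snd p, fst p)) \<in> L2_on (UNIV :: (real \<times> real) set)"
proof -
  have "integrable (lborel \<Otimes>\<^sub>M lborel) (\<lambda>p. (m p)\<^sup>2)" using assms by (simp add: L2_UNIV lborel_prod)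
  then have "integrable (lborel \<Otimes>\<^sub>M lborel) (\<lambda>(x, y). (m (y, x))\<^sup>2)"
    using lborel_pair.integrable_product_swap_iff[of "\<lambda>p. (m p)\<^sup>2"] by simp
  then have "integrable lborel (\<lambda>p. (m (snd p, fst p))\<^sup>2)" by (simp add: lborel_prod case_prod_unfold)
  moreover have "(\<lambda>p. (snd p, fst p)) \<in> (borel :: (real \<times> real) measure) \<rightarrow>\<^sub>M (borel :: (real \<times> real) measure)"
    by (intro borel_measurable_continuous_onI continuous_intros)
  from measurable_compose[OF this L2_UNIV_measurable[OF assms]]
  have "(\<lambda>p. m (snd p, fst p)) \<in> borel_measurable borel" .
  ultimately show ?thesis by (simp add: L2_UNIV)
qed

lemma cutoff'_integral:
  assumes h: "h > 0" and S: "S \<in> sets borel" and that: "c \<noteq> 0"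
  shows "set_integrable lborel S (\<lambda>x. cutoff' h (c * x + b))" "c = 1 \<or> c = -1 \<Longrightarrow> (LINT x:S|lborel. cutoff' h (c * x + b)) \<le> 1"
proof -
  have e: "cutoff' h = (\<lambda>y. 1 / h * indicator {0<..h} y)" by (auto simp: cutoff'_def fun_eq_iff indicator_def)
  have i: "integrable lborel (cutoff' h)" unfolding e using h by simp
  have i2: "integrable lborel (\<lambda>x. cutoff' h (c * x + b))" by (rule integrable_affine[OF that i])
  show s: "set_integrable lborel S (\<lambda>x. cutoff' h (c * x + b))"
    unfolding set_integrable_def by (rule integrable_mult_indicator[OF _ i2]) (use S in simp)
  assume c: "c = 1 \<or> c = -1"
  have "(LINT x:S|lborel. cutoff' h (c * x + b)) \<le> (\<integral>x. cutoff' h (c * x + b) \<partial>lborel)"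
    unfolding set_lebesgue_integral_def
    by (rule integral_mono[OF s[unfolded set_integrable_def] i2]) (use h in \<open>auto simp: indicator_def cutoff'_def\<close>)
  also have "\<dots> = (\<integral>x. cutoff' h x \<partial>lborel) / \<bar>c\<bar>" by (rule integral_affine[OF that])
  also have "\<dots> = 1" using c h unfolding e by auto
  finally show "(LINT x:S|lborel. cutoff' h (c * x + b)) \<le> 1" .
qed

lemma indicator_atMost_measurable: "(\<lambda>y::real. indicator {..h::real} y :: real) \<in> borel_measurable borel" by simp

text \<open>On the layer \<open>|f|\<close> is at most the integral of \<open>|g|\<close> over that
  layer, and \<open>cutoff'\<close> has mass at most one. At the right end \<open>f\<close> is
  written as an integral from \<open>a\<close>, which is possible because \<open>g\<close> has mean
  zero. The lemma trades \<open>f\<close> with the factor \<open>1 / h\<close> for \<open>g\<close>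
  without any singular factor.\<close>

lemma H10_layer:
  assumes H: "H10_deriv a f g" and a: "a > 0" and h: "h > 0"
  shows "(LINT x:{0<..<a}|lborel. \<bar>f x\<bar> * cutoff' h x) \<le> (LINT x:{0<..<a}|lborel. \<bar>g x\<bar> * indicator {..h} x)"
    "(LINT x:{0<..<a}|lborel. \<bar>f x\<bar> * cutoff' h (a - x)) \<le> (LINT x:{0<..<a}|lborel. \<bar>g x\<bar> * indicator {..h} (a - x))"
proof -
  let ?S = "{0<..<a}"
  have L: "f \<in> L2_on ?S" "g \<in> L2_on ?S" using H10_derivD[OF H] by auto
  have if': "set_integrable lborel ?S f" "set_integrable lborel ?S g" by (rule L2_on_integrable; use L in simp)+
  have ia: "set_integrable lborel ?S (\<lambda>x. \<bar>f x\<bar>)" "set_integrable lborel ?S (\<lambda>x. \<bar>g x\<bar>)"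
    using if' by (auto intro: set_integrable_abs)
  have key: "(LINT x:?S|lborel. \<bar>f x\<bar> * cutoff' h (c * x + b)) \<le> (LINT x:?S|lborel. \<bar>g x\<bar> * indicator {..h} (c * x + b))"
    if c: "c = 1 \<or> c = -1" and bd: "AE x in lborel. x \<in> ?S \<and> c * x + b \<le> h \<longrightarrow> \<bar>f x\<bar> \<le> (LINT x:?S|lborel. \<bar>g x\<bar> * indicator {..h} (c * x + b))" for c b
  proof -
    let ?J = "LINT x:?S|lborel. \<bar>g x\<bar> * indicator {..h} (c * x + b)"
    have J0: "0 \<le> ?J" unfolding set_lebesgue_integral_def by (intro Bochner_Integration.integral_nonneg) (simp add: indicator_def)
    have c0: "c \<noteq> 0" using c by auto
    have m: "(\<lambda>x. cutoff' h (c * x + b)) \<in> borel_measurable borel"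
      using cutoff_bounds(7)[OF h] by measurable
    have i1: "set_integrable lborel ?S (\<lambda>x. \<bar>f x\<bar> * cutoff' h (c * x + b))"
      by (rule set_integrable_bounded_mult[OF ia(1) _ m, of "1/h"]) (use cutoff_bounds(4,5)[OF h] in auto)
    have i2: "set_integrable lborel ?S (\<lambda>x. ?J * cutoff' h (c * x + b))"
      using cutoff'_integral(1)[OF h _ c0, of ?S b] by simp
    have "(LINT x:?S|lborel. \<bar>f x\<bar> * cutoff' h (c * x + b)) \<le> (LINT x:?S|lborel. ?J * cutoff' h (c * x + b))"
      unfolding set_lebesgue_integral_def[of _ _ "\<lambda>x. \<bar>f x\<bar> * cutoff' h (c * x + b)"] set_lebesgue_integral_def[of _ _ "\<lambda>x. ?J * cutoff' h (c * x + b)"]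
    proof (rule integral_mono_AE[OF i1[unfolded set_integrable_def] i2[unfolded set_integrable_def]])
      show "AE x in lborel. indicator ?S x *\<^sub>R (\<bar>f x\<bar> * cutoff' h (c * x + b)) \<le> indicator ?S x *\<^sub>R (?J * cutoff' h (c * x + b))"
        using bd
      proof eventually_elim
        fix x assume *: "x \<in> ?S \<and> c * x + b \<le> h \<longrightarrow> \<bar>f x\<bar> \<le> ?J"
        show "indicator ?S x *\<^sub>R (\<bar>f x\<bar> * cutoff' h (c * x + b)) \<le> indicator ?S x *\<^sub>R (?J * cutoff' h (c * x + b))"
        proof (cases "x \<in> ?S \<and> c * x + b \<le> h")
          case True
          then have "\<bar>f x\<bar> * cutoff' h (c * x + b) \<le> ?J * cutoff' h (c * x + b)"
            using * cutoff_bounds(4)[OF h] by (intro mult_right_mono) auto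
          then show ?thesis using True by simp
        next
          case False
          then show ?thesis by (cases "x \<in> ?S") (auto simp: cutoff'_def)
        qed
      qed
    qed
    also have "\<dots> = ?J * (LINT x:?S|lborel. cutoff' h (c * x + b))" by (rule set_integral_mult_right)
    also have "\<dots> \<le> ?J * 1" using cutoff'_integral(2)[OF h _ c0 c, of ?S b] J0 by (intro mult_left_mono) auto
    finally show ?thesis by simp
  qed
  have ig: "set_integrable lborel ?S (\<lambda>x. \<bar>g x\<bar> * indicator {..h} (c * x + b))" for c b
  proof (rule set_integrable_bounded_mult[OF ia(2)])
    show "(\<lambda>x. indicator {..h} (c * x + b) :: real) \<in> borel_measurable borel" by measurable
    show "\<bar>indicator {..h} (c * p + b) :: real\<bar> \<le> 1" for p by (auto simp: indicator_def)
  qed simp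
  have sub: "\<bar>LINT y:R|lborel. g y\<bar> \<le> (LINT x:?S|lborel. \<bar>g x\<bar> * indicator {..h} (c * x + b))"
    if R: "R \<subseteq> ?S" "R \<in> sets borel" "\<And>y. y \<in> R \<Longrightarrow> c * y + b \<le> h" for R c b
  proof -
    have "\<bar>LINT y:R|lborel. g y\<bar> \<le> (LINT y:R|lborel. \<bar>g y\<bar>)"
      using set_integral_norm_bound[OF set_integrable_subset[OF if'(2), of R]] R by simp
    also have "\<dots> \<le> (LINT x:?S|lborel. \<bar>g x\<bar> * indicator {..h} (c * x + b))"
      unfolding set_lebesgue_integral_def
    proof (rule integral_mono)
      show "integrable lborel (\<lambda>x. indicator R x *\<^sub>R \<bar>g x\<bar>)"
        using set_integrable_subset[OF ia(2), of R] R unfolding set_integrable_def by simp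
      show "integrable lborel (\<lambda>x. indicator ?S x *\<^sub>R (\<bar>g x\<bar> * indicator {..h} (c * x + b)))"
        using ig unfolding set_integrable_def .
      show "indicator R x *\<^sub>R \<bar>g x\<bar> \<le> indicator ?S x *\<^sub>R (\<bar>g x\<bar> * indicator {..h} (c * x + b))" for x
        using R(1) R(3)[of x] by (auto simp: indicator_def)
    qed
    finally show ?thesis .
  qed
  have rep: "AE x in lborel. x \<in> ?S \<longrightarrow> f x = (LINT y:{0<..<x}|lborel. g y)"
    by (rule H10_representation[OF H]) (use a in simp)
  have "AE x in lborel. x \<in> ?S \<and> 1 * x + 0 \<le> h \<longrightarrow> \<bar>f x\<bar> \<le> (LINT x:?S|lborel. \<bar>g x\<bar> * indicator {..h} (1 * x + 0))"
    using rep
  proof eventually_elim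
    fix x assume r: "x \<in> ?S \<longrightarrow> f x = (LINT y:{0<..<x}|lborel. g y)"
    show "x \<in> ?S \<and> 1 * x + 0 \<le> h \<longrightarrow> \<bar>f x\<bar> \<le> (LINT x:?S|lborel. \<bar>g x\<bar> * indicator {..h} (1 * x + 0))"
    proof
      assume x: "x \<in> ?S \<and> 1 * x + 0 \<le> h"
      then have "\<bar>LINT y:{0<..<x}|lborel. g y\<bar> \<le> (LINT x:?S|lborel. \<bar>g x\<bar> * indicator {..h} (1 * x + 0))"
        by (intro sub) auto
      then show "\<bar>f x\<bar> \<le> (LINT x:?S|lborel. \<bar>g x\<bar> * indicator {..h} (1 * x + 0))" using r x by simp
    qed
  qed
  from key[OF _ this] show "(LINT x:?S|lborel. \<bar>f x\<bar> * cutoff' h x) \<le> (LINT x:?S|lborel. \<bar>g x\<bar> * indicator {..h} x)" by simp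
  have "AE x in lborel. x \<in> ?S \<and> (-1) * x + a \<le> h \<longrightarrow> \<bar>f x\<bar> \<le> (LINT x:?S|lborel. \<bar>g x\<bar> * indicator {..h} ((-1) * x + a))"
    using rep
  proof eventually_elim
    fix x assume r: "x \<in> ?S \<longrightarrow> f x = (LINT y:{0<..<x}|lborel. g y)"
    show "x \<in> ?S \<and> (-1) * x + a \<le> h \<longrightarrow> \<bar>f x\<bar> \<le> (LINT x:?S|lborel. \<bar>g x\<bar> * indicator {..h} ((-1) * x + a))"
    proof
      assume x: "x \<in> ?S \<and> (-1) * x + a \<le> h"
      have i: "set_integrable lborel {0<..<x} g" "set_integrable lborel {x<..<a} g"
        using x by (auto intro!: set_integrable_subset[OF if'(2)])
      have "(LINT y:?S|lborel. g y) = (LINT y:{0<..<x} \<union> {x<..<a}|lborel. g y)"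
        by (rule set_integral_discrete_difference[where X="{x}"]) (use x in auto)
      also have "\<dots> = (LINT y:{0<..<x}|lborel. g y) + (LINT y:{x<..<a}|lborel. g y)"
        by (rule set_integral_Un) (use i in auto)
      finally have "f x = - (LINT y:{x<..<a}|lborel. g y)"
        using H10_integral_zero[OF H] r x a by simp
      moreover have "\<bar>LINT y:{x<..<a}|lborel. g y\<bar> \<le> (LINT x:?S|lborel. \<bar>g x\<bar> * indicator {..h} ((-1) * x + a))"
        by (rule sub) (use x in auto)
      ultimately show "\<bar>f x\<bar> \<le> (LINT x:?S|lborel. \<bar>g x\<bar> * indicator {..h} ((-1) * x + a))" by simp
    qed
  qed
  from key[OF _ this] show "(LINT x:?S|lborel. \<bar>f x\<bar> * cutoff' h (a - x)) \<le> (LINT x:?S|lborel. \<bar>g x\<bar> * indicator {..h} (a - x))"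
    by (simp add: add.commute)
qed

lemma set_integral_mono_real:
  fixes f g :: "'a \<Rightarrow> real"
  assumes "set_integrable M A f" "set_integrable M A g" "\<And>x. x \<in> A \<Longrightarrow> f x \<le> g x"
  shows "(LINT x:A|M. f x) \<le> (LINT x:A|M. g x)"
  using assms by (rule set_integral_mono)

context moving_end
begin

lemma weak_solution_layer:
  assumes W: "weak_solution k s F f0 f1 z zx zt" and h: "h > 0"
  shows "(LINT p:Qhat k s|lborel. \<bar>z p\<bar> * cutoff' h (fst p)) \<le> (LINT p:Qhat k s|lborel. \<bar>zx p\<bar> * indicator {..h} (fst p))"
    "(LINT p:Qhat k s|lborel. \<bar>z p\<bar> * cutoff' h (alpha k (snd p) - fst p)) \<le> (LINT p:Qhat k s|lborel. \<bar>zx p\<bar> * indicator {..h} (alpha k (snd p) - fst p))"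
proof -
  note L = weak_solutionD(1,2)[OF W]
  have ia: "set_integrable lborel (Qhat k s) (\<lambda>p. \<bar>z p\<bar>)" "set_integrable lborel (Qhat k s) (\<lambda>p. \<bar>zx p\<bar>)"
    using L2_on_integrable[OF Qhat_borel Qhat_bounded] L by (auto intro: set_integrable_abs)
  note cm = continuous_fst_snd_compose[OF cutoff_bounds(7)[OF h]]
  note im = continuous_fst_snd_compose[OF indicator_atMost_measurable[of h]]
  have bi: "\<bar>indicator {..h} y :: real\<bar> \<le> 1" for y by (auto simp: indicator_def)
  have bc: "\<bar>cutoff' h y\<bar> \<le> 1 / h" for y using cutoff_bounds(4,5)[OF h, of y] by simp
  have i: "set_integrable lborel (Qhat k s) (\<lambda>p. \<bar>z p\<bar> * cutoff' h (fst p))" "set_integrable lborel (Qhat k s) (\<lambda>p. \<bar>z p\<bar> * cutoff' h (alpha k (snd p) - fst p))"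
    "set_integrable lborel (Qhat k s) (\<lambda>p. \<bar>zx p\<bar> * indicator {..h} (fst p))" "set_integrable lborel (Qhat k s) (\<lambda>p. \<bar>zx p\<bar> * indicator {..h} (alpha k (snd p) - fst p))"
    by (rule set_integrable_bounded_mult[OF ia(1) Qhat_borel cm(1) bc] set_integrable_bounded_mult[OF ia(1) Qhat_borel cm(2) bc]
        set_integrable_bounded_mult[OF ia(2) Qhat_borel im(1) bi] set_integrable_bounded_mult[OF ia(2) Qhat_borel im(2) bi])+
  have a: "alpha k t > 0" "H10_deriv (alpha k t) (\<lambda>x. z (x, t)) (\<lambda>x. zx (x, t))" if "t \<in> {0<..<s}" for t
    using alpha_ge_1[of t] weak_solutionD(4)[OF W, of t] that by auto
  show "(LINT p:Qhat k s|lborel. \<bar>z p\<bar> * cutoff' h (fst p)) \<le> (LINT p:Qhat k s|lborel. \<bar>zx p\<bar> * indicator {..h} (fst p))"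
    unfolding Qhat_Fubini(1)[OF i(1)] Qhat_Fubini(1)[OF i(3)]
  proof (rule set_integral_mono_real[OF Qhat_Fubini(2)[OF i(1)] Qhat_Fubini(2)[OF i(3)]])
    fix t assume t: "t \<in> {0<..<s}"
    show "(LINT x:Omega k t|lborel. \<bar>z (x, t)\<bar> * cutoff' h (fst (x, t))) \<le> (LINT x:Omega k t|lborel. \<bar>zx (x, t)\<bar> * indicator {..h} (fst (x, t)))"
      using H10_layer(1)[OF a(2)[OF t] a(1)[OF t] h] by (simp add: Omega_def)
  qed
  show "(LINT p:Qhat k s|lborel. \<bar>z p\<bar> * cutoff' h (alpha k (snd p) - fst p)) \<le> (LINT p:Qhat k s|lborel. \<bar>zx p\<bar> * indicator {..h} (alpha k (snd p) - fst p))"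
    unfolding Qhat_Fubini(1)[OF i(2)] Qhat_Fubini(1)[OF i(4)]
  proof (rule set_integral_mono_real[OF Qhat_Fubini(2)[OF i(2)] Qhat_Fubini(2)[OF i(4)]])
    fix t assume t: "t \<in> {0<..<s}"
    show "(LINT x:Omega k t|lborel. \<bar>z (x, t)\<bar> * cutoff' h (alpha k (snd (x, t)) - fst (x, t))) \<le> (LINT x:Omega k t|lborel. \<bar>zx (x, t)\<bar> * indicator {..h} (alpha k (snd (x, t)) - fst (x, t)))"
      using H10_layer(2)[OF a(2)[OF t] a(1)[OF t] h] by (simp add: Omega_def)
  qed
qed

text \<open>As \<open>h < 1 \<le> alpha k t\<close>, the interval \<open>(0, h)\<close> lies in
  every slice, so arbitrary values of \<open>zx\<close> off the domain do not enter.\<close>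

lemma boundary_mean_L2:
  assumes zx: "zx \<in> L2_on (Qhat k s)" and h: "0 < h" "h < 1"
  shows "(\<lambda>t. (LINT x:{0<..<h}|lborel. zx (x, t)) / h) \<in> L2_on {0<..<s}"
proof -
  define m where "m p = indicator {0<..<h} (fst p) * (indicator (Qhat k s) p * zx p)" for p
  have "(\<lambda>p. indicator (Qhat k s) p * zx p) \<in> L2_on UNIV" using zx by (simp only: L2_on_iff[of _ "Qhat k s"])
  moreover have "(\<lambda>p::real \<times> real. indicator {0<..<h} (fst p) :: real) \<in> borel_measurable borel"
    by (rule continuous_fst_snd_compose(1)) simp
  ultimately have mL: "m \<in> L2_on UNIV" unfolding m_def[abs_def]
    by (rule L2_mult_bounded(1)[of _ _ 1]) (auto simp: indicator_def)
  have "(\<lambda>t. \<integral>x. m (snd (t, x), fst (t, x)) \<partial>lborel) \<in> L2_on UNIV"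
    by (rule L2_average(1)[OF L2_swap[OF mL], of h]) (use h in \<open>auto simp: m_def\<close>)
  from L2_scale[OF this, of "1 / h"]
  have 1: "(\<lambda>t. 1 / h * (\<integral>x. m (x, t) \<partial>lborel)) \<in> L2_on UNIV" by simp
  have "indicator {0<..<s} t * ((LINT x:{0<..<h}|lborel. zx (x, t)) / h) = 1 / h * (\<integral>x. m (x, t) \<partial>lborel)" for t
  proof (cases "t \<in> {0<..<s}")
    case True
    have "m (x, t) = indicator {0<..<h} x *\<^sub>R zx (x, t)" for x
      using True h alpha_ge_1[of t] by (auto simp: m_def indicator_def Qhat_def)
    then show ?thesis using True by (simp add: set_lebesgue_integral_def)
  next
    case False
    then have "m (x, t) = 0" for x by (auto simp: m_def indicator_def Qhat_def)
    then show ?thesis using False by simp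
  qed
  then show ?thesis using 1 by (simp only: L2_on_iff[of _ "{0<..<s}"])
qed

end

text \<open>Each point of \<open>S\<close> leaves the layers eventually, since \<open>l\<close> is
  positive there.\<close>

lemma layer_integral_tendsto:
  fixes f l :: "'a::euclidean_space \<Rightarrow> real" and h :: "nat \<Rightarrow> real"
  assumes "set_integrable lborel S f" "S \<in> sets borel" "\<And>n. (\<lambda>p. indicator {..h n} (l p) :: real) \<in> borel_measurable borel"
    "\<And>p. p \<in> S \<Longrightarrow> 0 < l p" "h \<longlonglongrightarrow> 0"
  shows "(\<lambda>n. LINT p:S|lborel. f p * indicator {..h n} (l p)) \<longlonglongrightarrow> 0"
proof -
  have "(\<lambda>n. LINT p:S|lborel. f p * indicator {..h n} (l p)) \<longlonglongrightarrow> (LINT p:S|lborel. f p * 0)"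
  proof (rule set_integral_bounded_multipliers_tendsto[OF assms(1,2,3)])
    fix p assume p: "p \<in> S"
    have "\<forall>\<^sub>F n in sequentially. h n < l p" using assms(4)[OF p] assms(5) by (intro order_tendstoD(2)) auto
    then have "\<forall>\<^sub>F n in sequentially. indicator {..h n} (l p) = (0::real)" by eventually_elim simp
    then show "(\<lambda>n. indicator {..h n} (l p) :: real) \<longlonglongrightarrow> 0" by (rule tendsto_eventually)
    show "\<bar>indicator {..h n} (l p) :: real\<bar> \<le> 1" for n by (auto simp: indicator_def)
  qed simp
  then show ?thesis by (simp add: set_lebesgue_integral_def)
qed

text \<open>The six terms arise from the two lateral layers. \<open>a4\<close> and \<open>a5\<close>
  are the space and time contributions of \<open>z\<close> at the moving end and share a
  bound.\<close>

lemma abs_six_terms: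
  fixes e :: real
  assumes "e = a1 - a2 - a3 + a4 + a5 - a6" "\<bar>a1\<bar> \<le> b1" "\<bar>a2\<bar> \<le> b2" "\<bar>a3\<bar> \<le> b3" "\<bar>a4\<bar> \<le> b4" "\<bar>a5\<bar> \<le> b4" "\<bar>a6\<bar> \<le> b6"
  shows "\<bar>e\<bar> \<le> 2 * b1 + 2 * b3 + 2 * b6 + 2 * b2 + 2 * b4"
  using assms by linarith

lemma set_integral_diff_bound:
  fixes f g h :: "'a \<Rightarrow> real"
  assumes i: "set_integrable N S f" "set_integrable N S g" "set_integrable N S h"
    and bd: "\<And>p. p \<in> S \<Longrightarrow> \<bar>f p - g p\<bar> \<le> h p"
  shows "\<bar>(LINT p:S|N. f p) - (LINT p:S|N. g p)\<bar> \<le> (LINT p:S|N. h p)"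
proof -
  have d: "set_integrable N S (\<lambda>p. f p - g p)" by (rule set_integral_diff(1)[OF i(1,2)])
  have "\<bar>LINT p:S|N. f p - g p\<bar> \<le> (LINT p:S|N. \<bar>f p - g p\<bar>)"
    using set_integral_norm_bound[OF d] by simp
  also have "\<dots> \<le> (LINT p:S|N. h p)"
    by (rule set_integral_mono_real[OF set_integrable_abs[OF d] i(3) bd])
  finally show ?thesis unfolding set_integral_diff(2)[OF i(1,2)] .
qed

context moving_end
begin

lemma wave_bound:
  assumes "\<And>x. \<bar>f x\<bar> \<le> B"
  shows "\<bar>wave k c1 c2 f p\<bar> \<le> (\<bar>c1\<bar> + \<bar>c2\<bar>) * B"
proof -
  have "\<bar>c1 * f (snd p - fst p)\<bar> \<le> \<bar>c1\<bar> * B" "\<bar>c2 * f (r (snd p + fst p))\<bar> \<le> \<bar>c2\<bar> * B"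
    unfolding abs_mult using assms by (auto intro: mult_left_mono)
  then show ?thesis unfolding wave_def distrib_right by linarith
qed

lemma travel_right_end: "travel k f (alpha k t, t) = 0"
  using reflect_right[of t] by (simp add: travel_def)

text \<open>The spatial width \<open>h n\<close> tends to zero. At \<open>x = 0\<close> the
  derivative of the cutoff averages \<open>zx * travel k f\<close>, which tends to the flux
  \<open>g\<close> times the boundary value. At the moving end the wave vanishes in proportion to
  the distance, which compensates the factor \<open>1 / h n\<close>; terms containing
  \<open>z\<close> are controlled by its layer estimate on either side. What remains are integrals
  of fixed functions over shrinking layers.\<close>

lemma weak_solution_lateral_limit:
  assumes W: "weak_solution k s F f0 f1 z zx zt" and F: "F \<in> L2_on (Qhat k s)"
    and C: "C2_supported 0 b f f' f''" and H: "H > 0" and G: "x_deriv_at_0 s zx g"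
  shows "(LINT p:Qhat k s|lborel. (F p * travel k f p) * cutoff H (s - snd p)) =
    (LINT t:{0<..<s}|lborel. g t * (travel k f (0, t) * cutoff H (s - t)))
    + (LINT p:Qhat k s|lborel. (zt p * travel k f p - z p * wave k 1 (- q) f' p) * cutoff' H (s - snd p))"
proof -
  let ?Q = "Qhat k s"
  let ?u = "travel k f" and ?ux = "wave k (-1) (- q) f'" and ?ut = "wave k 1 (- q) f'"
  let ?d = "\<lambda>p. cutoff H (s - snd p)" and ?d' = "\<lambda>p. cutoff' H (s - snd p)"
  \<comment> \<open>At most 1/2, so that the two lateral layers do not interfere, the slices having
    length at least 1.\<close>
  define h where "h n = 1 / real (Suc n) * (1/2)" for n
  have "(\<lambda>n. 1 / real (Suc n) * (1/2)) \<longlonglongrightarrow> 0 * (1/2)" by (intro tendsto_mult inverse_Suc_tendsto tendsto_const)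
  then have hlim: "h \<longlonglongrightarrow> 0" unfolding h_def[abs_def] by simp
  have h: "h n > 0" "h n \<le> 1/2" for n unfolding h_def by simp_all
  define A where "A p = zx p * ?u p - z p * ?ux p" for p
  define B where "B p = z p * ?ut p - zt p * ?u p" for p
  let ?a = "\<lambda>n p. cutoff (h n) (fst p)" and ?b = "\<lambda>n p. cutoff (h n) (alpha k (snd p) - fst p)"
  let ?a' = "\<lambda>n p. cutoff' (h n) (fst p)" and ?b' = "\<lambda>n p. cutoff' (h n) (alpha k (snd p) - fst p)"
  have D: "\<And>x. (f has_real_derivative f' x) (at x)"
    and c: "continuous_on UNIV f" "continuous_on UNIV f'"
    using C unfolding C2_supported_def by (auto intro: DERIV_continuous_UNIV)
  have u: "plane_C1 ?u ?ux ?ut" unfolding travel_wave using wave_plane_C1[OF D(1) c(2), of 1 "-1"] by simp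
  note uc = plane_C1_continuous[OF u]
  obtain d where d: "\<And>x. (x < 0 + d \<or> b - d < x) \<Longrightarrow> f x = 0 \<and> f' x = 0"
    using C2_supported_vanish[OF C] by blast
  have sf: "d \<le> x \<and> x \<le> b - d" if "f x \<noteq> 0" for x using d[of x] that by force
  have sf': "d \<le> x \<and> x \<le> b - d" if "f' x \<noteq> 0" for x using d[of x] that by force
  obtain B1 where B1: "B1 > 0" "\<And>x. \<bar>f x\<bar> \<le> B1" using compact_support_bounded[OF c(1) sf] by blast
  obtain B2 where B2: "B2 > 0" "\<And>x. \<bar>f' x\<bar> \<le> B2" using compact_support_bounded[OF c(2) sf'] by blast
  define M where "M = 2 * (B1 + B2)"
  have M0: "M > 0" using B1(1) B2(1) unfolding M_def by simp
  have ub: "\<bar>?u p\<bar> \<le> M" "\<bar>?ux p\<bar> \<le> M" "\<bar>?ut p\<bar> \<le> M" for p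
  proof -
    show "\<bar>?u p\<bar> \<le> M" using wave_bound[of f B1 1 "-1" p, OF B1(2)] B2(1) unfolding M_def travel_wave by simp
    have "(1 + q) * B2 \<le> 2 * B2" using q B2(1) by (intro mult_right_mono) auto
    also have "2 * B2 \<le> M" using B1(1) unfolding M_def by simp
    finally have "(1 + q) * B2 \<le> M" .
    then show "\<bar>?ux p\<bar> \<le> M" "\<bar>?ut p\<bar> \<le> M"
      using wave_bound[of f' B2 "-1" "- q" p, OF B2(2)] wave_bound[of f' B2 1 "- q" p, OF B2(2)] q by auto
  qed
  have lip: "\<bar>?u (x, t) - ?u (y, t)\<bar> \<le> M * \<bar>x - y\<bar>" for x y t
    using field_differentiable_bound[of UNIV "\<lambda>x. ?u (x, t)" "\<lambda>x. ?ux (x, t)" M x y] plane_C1_slice(1)[OF u] ub(2)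
    by simp
  note L = weak_solutionD(1-3)[OF W]
  have iL: "set_integrable lborel ?Q z" "set_integrable lborel ?Q zx" "set_integrable lborel ?Q zt"
    using L2_on_integrable[OF Qhat_borel Qhat_bounded] L by auto
  have iabs: "set_integrable lborel ?Q (\<lambda>p. \<bar>z p\<bar>)" "set_integrable lborel ?Q (\<lambda>p. \<bar>zx p\<bar>)" "set_integrable lborel ?Q (\<lambda>p. \<bar>zt p\<bar>)"
    using iL by (auto intro: set_integrable_abs)
  have iA: "set_integrable lborel ?Q A" "set_integrable lborel ?Q B" "set_integrable lborel ?Q (\<lambda>p. F p * ?u p)"
    unfolding A_def[abs_def] B_def[abs_def] by (intro set_integral_diff set_integrable_continuous_mult L uc F)+
  have cm: "cutoff h \<in> borel_measurable borel" "cutoff' h \<in> borel_measurable borel" if "h > 0" for h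
    using cutoff_bounds(6,7)[OF that] by (auto intro!: borel_measurable_continuous_onI)
  note m1 = continuous_fst_snd_compose[OF cm(1)[OF h(1)]] continuous_fst_snd_compose[OF cm(2)[OF h(1)]]
    continuous_fst_snd_compose[OF cm(1)[OF H]] continuous_fst_snd_compose[OF cm(2)[OF H]]
  note im = continuous_fst_snd_compose[OF indicator_atMost_measurable]
  have cb: "\<bar>cutoff h y\<bar> \<le> 1" "\<bar>cutoff' h y\<bar> \<le> 1 / h" if "h > 0" for h y
    using cutoff_bounds(1,2,4,5)[OF that, of y] by auto
  have Qpos: "0 < fst p" "0 < alpha k (snd p) - fst p" "0 < snd p" "snd p < s" if "p \<in> ?Q" for p
    using that by (auto simp: Qhat_def)
  text \<open>Terms whose cutoffs carry no derivative across the lateral boundary.\<close>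
  have l0: "(\<lambda>n. LINT p:?Q|lborel. (F p * ?u p) * (?a n p * ?b n p * ?d p)) \<longlonglongrightarrow> (LINT p:?Q|lborel. (F p * ?u p) * (1 * 1 * ?d p))"
  proof (rule set_integral_bounded_multipliers_tendsto[OF iA(3) Qhat_borel])
    show "(\<lambda>n. ?a n p * ?b n p * ?d p) \<longlonglongrightarrow> 1 * 1 * ?d p" if "p \<in> ?Q" for p
      by (intro tendsto_mult tendsto_const cutoff_tendsto Qpos[OF that] h hlim)
    show "\<bar>?a n p * ?b n p * ?d p\<bar> \<le> 1" for n p
      unfolding abs_mult using cb(1)[OF h(1)] cb(1)[OF H] by (intro mult_le_one mult_nonneg_nonneg) auto
  qed (intro borel_measurable_times borel_measurable_const m1)+
  have l1: "(\<lambda>n. LINT p:?Q|lborel. B p * (?a n p * ?b n p * ?d' p)) \<longlonglongrightarrow> (LINT p:?Q|lborel. B p * (1 * 1 * ?d' p))"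
  proof (rule set_integral_bounded_multipliers_tendsto[OF iA(2) Qhat_borel])
    show "(\<lambda>n. ?a n p * ?b n p * ?d' p) \<longlonglongrightarrow> 1 * 1 * ?d' p" if "p \<in> ?Q" for p
      by (intro tendsto_mult tendsto_const cutoff_tendsto Qpos[OF that] h hlim)
    show "\<bar>?a n p * ?b n p * ?d' p\<bar> \<le> 1 * 1 * (1 / H)" for n p
      unfolding abs_mult using cb(1)[OF h(1)] cb(2)[OF H] H by (intro mult_mono mult_nonneg_nonneg) auto
  qed (intro borel_measurable_times borel_measurable_const m1)+
  text \<open>The layer terms, compared with the boundary mean of \<open>zx\<close>.\<close>
  let ?w = "\<lambda>p. ?u (0, snd p)"
  have wm: "?w \<in> borel_measurable borel"
    by (rule borel_measurable_continuous_onI, rule continuous_on_compose2[OF uc(1)]) (auto intro!: continuous_intros)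
  let ?E = "\<lambda>n p. A p * ((?a' n p * ?b n p - ?a n p * ?b' n p) * ?d p) + B p * (k * (?a n p * ?b' n p) * ?d p)"
  \<comment> \<open>Of all layer terms only this one survives: \<open>travel k f\<close> is frozen
    at its boundary value, so that integrating over the layer produces a mean of
    \<open>zx\<close>.\<close>
  let ?T = "\<lambda>n p. zx p * (?w p * ?d p * ?a' n p)"
  let ?R = "\<lambda>n p. M * (2 * (\<bar>zx p\<bar> * indicator {..h n} (fst p)) + 2 * (\<bar>zx p\<bar> * indicator {..h n} (alpha k (snd p) - fst p))
      + 2 * (\<bar>zt p\<bar> * indicator {..h n} (alpha k (snd p) - fst p)) + 2 * (\<bar>z p\<bar> * ?a' n p) + 2 * (\<bar>z p\<bar> * ?b' n p))"
  have iE: "set_integrable lborel ?Q (?E n)" for n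
  proof (rule set_integral_add(1))
    have n0: "0 \<le> 1 / h n" using h(1)[of n] by simp
    show "set_integrable lborel ?Q (\<lambda>p. A p * ((?a' n p * ?b n p - ?a n p * ?b' n p) * ?d p))"
    proof (rule set_integrable_bounded_mult[OF iA(1) Qhat_borel])
      fix p
      have "\<bar>?a' n p * ?b n p\<bar> \<le> 1 / h n * 1" "\<bar>?a n p * ?b' n p\<bar> \<le> 1 * (1 / h n)"
        unfolding abs_mult using cb[OF h(1)[of n]] n0 by (intro mult_mono; simp)+
      then have "\<bar>?a' n p * ?b n p - ?a n p * ?b' n p\<bar> \<le> 2 / h n" by simp
      then have "\<bar>?a' n p * ?b n p - ?a n p * ?b' n p\<bar> * \<bar>?d p\<bar> \<le> 2 / h n * 1"
        using cb(1)[OF H] n0 by (intro mult_mono) auto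
      then show "\<bar>(?a' n p * ?b n p - ?a n p * ?b' n p) * ?d p\<bar> \<le> 2 / h n * 1" unfolding abs_mult .
    qed (intro borel_measurable_times borel_measurable_diff m1)
    show "set_integrable lborel ?Q (\<lambda>p. B p * (k * (?a n p * ?b' n p) * ?d p))"
    proof (rule set_integrable_bounded_mult[OF iA(2) Qhat_borel])
      show "\<bar>k * (?a n p * ?b' n p) * ?d p\<bar> \<le> 1 * (1 * (1 / h n)) * 1" for p
        unfolding abs_mult using cb[OF h(1)[of n]] cb(1)[OF H] n0 k by (intro mult_mono mult_nonneg_nonneg) auto
    qed (intro borel_measurable_times borel_measurable_const m1)
  qed
  have iT: "set_integrable lborel ?Q (?T n)" for n
  proof (rule set_integrable_bounded_mult[OF iL(2) Qhat_borel])
    show "\<bar>?w p * ?d p * ?a' n p\<bar> \<le> M * 1 * (1 / h n)" for p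
      unfolding abs_mult using cb(2)[OF h(1)[of n]] cb(1)[OF H] ub(1) M0 h(1)[of n] by (intro mult_mono mult_nonneg_nonneg) auto
  qed (intro borel_measurable_times m1 wm)
  have bi: "\<bar>indicator {..h n} y :: real\<bar> \<le> 1" for n y by (auto simp: indicator_def)
  note iR1 = set_integrable_bounded_mult[OF iabs(2) Qhat_borel im(1) bi]
    and iR2 = set_integrable_bounded_mult[OF iabs(2) Qhat_borel im(2) bi]
    and iR3 = set_integrable_bounded_mult[OF iabs(3) Qhat_borel im(2) bi]
    and iR4 = set_integrable_bounded_mult[OF iabs(1) Qhat_borel m1(4) cb(2)[OF h(1)]]
    and iR5 = set_integrable_bounded_mult[OF iabs(1) Qhat_borel m1(5) cb(2)[OF h(1)]]
  have iR: "set_integrable lborel ?Q (?R n)" for n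
    by (intro set_integrable_mult_right set_integral_add(1) iR1 iR2 iR3 iR4 iR5)
  have point: "\<bar>?E n p - ?T n p\<bar> \<le> ?R n p" if p: "p \<in> ?Q" for n p
  proof -
    obtain x t where xt: "p = (x, t)" by (cases p)
    have x: "0 < x" "x < alpha k t" "0 < t" using p xt by (auto simp: Qhat_def)
    let ?ia = "indicator {..h n} x :: real" and ?ib = "indicator {..h n} (alpha k t - x) :: real"
    note cbn = cb[OF h(1)[of n]]
    have nz: "0 \<le> ?a' n p" "0 \<le> ?b' n p" using cutoff_bounds(4)[OF h(1)[of n]] by auto
    \<comment> \<open>The wave is Lipschitz in \<open>x\<close> with constant \<open>M\<close>; over
      a layer of width \<open>h n\<close> this cancels the \<open>1 / h n\<close> of the
      cutoff.\<close>
    have l: "\<bar>(?u p - ?w p) * ?a' n p\<bar> \<le> M * ?ia"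
    proof (cases "x \<le> h n")
      case True
      have "\<bar>?u p - ?w p\<bar> \<le> M * h n"
        using lip[of x t 0] x(1) True M0 xt by (simp add: order_trans[OF _ mult_left_mono])
      then have "\<bar>?u p - ?w p\<bar> * \<bar>?a' n p\<bar> \<le> (M * h n) * (1 / h n)" using cbn(2) M0 h(1)[of n] by (intro mult_mono) auto
      then show ?thesis using True h(1)[of n] by (simp add: abs_mult)
    qed (use xt in \<open>simp add: cutoff'_def\<close>)
    \<comment> \<open>The same compensation, now because the wave is zero at the moving end
      itself.\<close>
    have rr: "\<bar>?u p * ?b' n p\<bar> \<le> M * ?ib"
    proof (cases "alpha k t - x \<le> h n")
      case True
      have "\<bar>?u p\<bar> \<le> M * \<bar>x - alpha k t\<bar>" using lip[of x t "alpha k t"] travel_right_end[of f t] xt by simp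
      also have "\<dots> \<le> M * h n" using True x M0 by (intro mult_left_mono) auto
      finally have "\<bar>?u p\<bar> * \<bar>?b' n p\<bar> \<le> (M * h n) * (1 / h n)" using cbn(2) M0 h(1)[of n] by (intro mult_mono) auto
      then show ?thesis using True h(1)[of n] by (simp add: abs_mult)
    qed (use xt in \<open>simp add: cutoff'_def\<close>)
    \<comment> \<open>The right cutoff equals one on the left layer.\<close>
    have ab: "?a' n p * ?b n p = ?a' n p"
    proof (cases "x \<le> h n")
      case True
      have "h n \<le> alpha k t - x" using True h(2)[of n] alpha_ge_1[of t] x by linarith
      then have "?b n p = 1" using xt cutoff_bounds(3)[OF h(1)[of n]] by simp
      then show ?thesis by simp
    qed (use xt in \<open>simp add: cutoff'_def\<close>)
    have ad: "\<bar>?a n p * ?d p\<bar> \<le> 1" "\<bar>k * ?a n p * ?d p\<bar> \<le> 1"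
      unfolding abs_mult using cbn(1) cb(1)[OF H] k by (intro mult_le_one mult_nonneg_nonneg; simp)+
    have "\<bar>?E n p - ?T n p\<bar> \<le> 2 * (\<bar>zx p\<bar> * (M * ?ia) * 1) + 2 * (\<bar>zx p\<bar> * (M * ?ib) * 1) + 2 * (\<bar>zt p\<bar> * (M * ?ib) * 1)
        + 2 * (\<bar>z p\<bar> * M * ?a' n p * 1) + 2 * (\<bar>z p\<bar> * M * ?b' n p * 1)"
    proof (rule abs_six_terms)
      show "?E n p - ?T n p = zx p * ((?u p - ?w p) * ?a' n p) * ?d p - z p * ?ux p * ?a' n p * ?d p
       - zx p * (?u p * ?b' n p) * (?a n p * ?d p) + z p * ?ux p * ?b' n p * (?a n p * ?d p)
       + z p * ?ut p * ?b' n p * (k * ?a n p * ?d p) - zt p * (?u p * ?b' n p) * (k * ?a n p * ?d p)"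
        unfolding ab A_def B_def by (simp add: algebra_simps)
      show "\<bar>zx p * ((?u p - ?w p) * ?a' n p) * ?d p\<bar> \<le> \<bar>zx p\<bar> * (M * ?ia) * 1"
        unfolding abs_mult[of _ "?d p"] abs_mult[of "zx p"] using l cb(1)[OF H] M0 by (intro mult_mono mult_nonneg_nonneg) auto
      show "\<bar>z p * ?ux p * ?a' n p * ?d p\<bar> \<le> \<bar>z p\<bar> * M * ?a' n p * 1"
        unfolding abs_mult using ub(2)[of p] cb(1)[OF H] nz M0 by (intro mult_mono mult_nonneg_nonneg) auto
      show "\<bar>zx p * (?u p * ?b' n p) * (?a n p * ?d p)\<bar> \<le> \<bar>zx p\<bar> * (M * ?ib) * 1"
        unfolding abs_mult[of _ "?a n p * ?d p"] abs_mult[of "zx p"] using rr ad M0 by (intro mult_mono mult_nonneg_nonneg) auto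
      show "\<bar>zt p * (?u p * ?b' n p) * (k * ?a n p * ?d p)\<bar> \<le> \<bar>zt p\<bar> * (M * ?ib) * 1"
        unfolding abs_mult[of _ "k * ?a n p * ?d p"] abs_mult[of "zt p"] using rr ad M0 by (intro mult_mono mult_nonneg_nonneg) auto
      show "\<bar>z p * ?ux p * ?b' n p * (?a n p * ?d p)\<bar> \<le> \<bar>z p\<bar> * M * ?b' n p * 1"
        unfolding abs_mult[of _ "?a n p * ?d p"] abs_mult[of "z p * _"] abs_mult[of "z p"] using ub(2)[of p] ad nz M0 by (intro mult_mono mult_nonneg_nonneg) auto
      show "\<bar>z p * ?ut p * ?b' n p * (k * ?a n p * ?d p)\<bar> \<le> \<bar>z p\<bar> * M * ?b' n p * 1"
        unfolding abs_mult[of _ "k * ?a n p * ?d p"] abs_mult[of "z p * _"] abs_mult[of "z p"] using ub(3)[of p] ad nz M0 by (intro mult_mono mult_nonneg_nonneg) auto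
    qed
    also have "\<dots> = ?R n p"
      unfolding xt fst_conv snd_conv by (simp add: algebra_simps)
    finally show ?thesis .
  qed
  \<comment> \<open>The terms with \<open>|z|\<close> are absorbed into those with
    \<open>|zx|\<close> on the same layer by \<open>weak_solution_layer\<close>, which raises two
    coefficients from 2 to 4.\<close>
  have Rint: "(LINT p:?Q|lborel. ?R n p) \<le> M * (4 * (LINT p:?Q|lborel. \<bar>zx p\<bar> * indicator {..h n} (fst p))
     + 4 * (LINT p:?Q|lborel. \<bar>zx p\<bar> * indicator {..h n} (alpha k (snd p) - fst p)) + 2 * (LINT p:?Q|lborel. \<bar>zt p\<bar> * indicator {..h n} (alpha k (snd p) - fst p)))" for n
  proof -
    have "(LINT p:?Q|lborel. ?R n p) = M * (2 * (LINT p:?Q|lborel. \<bar>zx p\<bar> * indicator {..h n} (fst p))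
      + 2 * (LINT p:?Q|lborel. \<bar>zx p\<bar> * indicator {..h n} (alpha k (snd p) - fst p)) + 2 * (LINT p:?Q|lborel. \<bar>zt p\<bar> * indicator {..h n} (alpha k (snd p) - fst p))
      + 2 * (LINT p:?Q|lborel. \<bar>z p\<bar> * ?a' n p) + 2 * (LINT p:?Q|lborel. \<bar>z p\<bar> * ?b' n p))"
      by (simp only: set_integral_mult_right set_integral_add set_integrable_mult_right iR1 iR2 iR3 iR4 iR5 simp_thms)
    also have "\<dots> \<le> M * (4 * (LINT p:?Q|lborel. \<bar>zx p\<bar> * indicator {..h n} (fst p))
     + 4 * (LINT p:?Q|lborel. \<bar>zx p\<bar> * indicator {..h n} (alpha k (snd p) - fst p)) + 2 * (LINT p:?Q|lborel. \<bar>zt p\<bar> * indicator {..h n} (alpha k (snd p) - fst p)))"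
      using weak_solution_layer[OF W h(1)[of n]] M0 by (intro mult_left_mono) auto
    finally show ?thesis .
  qed
  have diff0: "(\<lambda>n. (LINT p:?Q|lborel. ?E n p) - (LINT p:?Q|lborel. ?T n p)) \<longlonglongrightarrow> 0"
  proof (rule Lim_null_comparison)
    have "norm ((LINT p:?Q|lborel. ?E n p) - (LINT p:?Q|lborel. ?T n p)) \<le> M * (4 * (LINT p:?Q|lborel. \<bar>zx p\<bar> * indicator {..h n} (fst p))
     + 4 * (LINT p:?Q|lborel. \<bar>zx p\<bar> * indicator {..h n} (alpha k (snd p) - fst p)) + 2 * (LINT p:?Q|lborel. \<bar>zt p\<bar> * indicator {..h n} (alpha k (snd p) - fst p)))" for n
      unfolding real_norm_def by (rule order_trans[OF set_integral_diff_bound[OF iE iT iR point] Rint])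
    then show "\<forall>\<^sub>F n in sequentially. norm ((LINT p:?Q|lborel. ?E n p) - (LINT p:?Q|lborel. ?T n p)) \<le> M * (4 * (LINT p:?Q|lborel. \<bar>zx p\<bar> * indicator {..h n} (fst p))
     + 4 * (LINT p:?Q|lborel. \<bar>zx p\<bar> * indicator {..h n} (alpha k (snd p) - fst p)) + 2 * (LINT p:?Q|lborel. \<bar>zt p\<bar> * indicator {..h n} (alpha k (snd p) - fst p)))"
      by simp
    have "(\<lambda>n. M * (4 * (LINT p:?Q|lborel. \<bar>zx p\<bar> * indicator {..h n} (fst p))
     + 4 * (LINT p:?Q|lborel. \<bar>zx p\<bar> * indicator {..h n} (alpha k (snd p) - fst p)) + 2 * (LINT p:?Q|lborel. \<bar>zt p\<bar> * indicator {..h n} (alpha k (snd p) - fst p)))) \<longlonglongrightarrow> M * (4 * 0 + 4 * 0 + 2 * 0)"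
      by (intro tendsto_intros layer_integral_tendsto iabs Qhat_borel im Qpos hlim)
    then show "(\<lambda>n. M * (4 * (LINT p:?Q|lborel. \<bar>zx p\<bar> * indicator {..h n} (fst p))
     + 4 * (LINT p:?Q|lborel. \<bar>zx p\<bar> * indicator {..h n} (alpha k (snd p) - fst p)) + 2 * (LINT p:?Q|lborel. \<bar>zt p\<bar> * indicator {..h n} (alpha k (snd p) - fst p)))) \<longlonglongrightarrow> 0"
      by simp
  qed
  \<comment> \<open>Integrating over the layer reproduces exactly the mean that occurs in
    \<open>x_deriv_at_0\<close>.\<close>
  have T: "(LINT p:?Q|lborel. ?T n p) = (LINT t:{0<..<s}|lborel. ((LINT x:{0<..<h n}|lborel. zx (x, t)) / h n) * (?u (0, t) * cutoff H (s - t)))" for n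
    unfolding Qhat_Fubini(1)[OF iT]
  proof (rule set_lebesgue_integral_cong)
    show "\<forall>t. t \<in> {0<..<s} \<longrightarrow> (LINT x:Omega k t|lborel. ?T n (x, t)) = ((LINT x:{0<..<h n}|lborel. zx (x, t)) / h n) * (?u (0, t) * cutoff H (s - t))"
    proof (intro allI impI)
      fix t assume t: "t \<in> {0<..<s}"
      have a: "h n < alpha k t" using h(2)[of n] alpha_ge_1[of t] t by simp
      have "(LINT x:Omega k t|lborel. ?T n (x, t)) = (LINT x:{0<..h n}|lborel. zx (x, t) * (1 / h n * (?u (0, t) * cutoff H (s - t))))"
        unfolding set_lebesgue_integral_def using a h(1)[of n]
        by (intro Bochner_Integration.integral_cong) (auto simp: indicator_def Omega_def cutoff'_def)
      also have "\<dots> = (LINT x:{0<..<h n}|lborel. zx (x, t) * (1 / h n * (?u (0, t) * cutoff H (s - t))))"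
        by (rule set_integral_discrete_difference[where X="{h n}"]) auto
      finally show "(LINT x:Omega k t|lborel. ?T n (x, t)) = ((LINT x:{0<..<h n}|lborel. zx (x, t)) / h n) * (?u (0, t) * cutoff H (s - t))"
        by simp
    qed
  qed simp
  have gL: "g \<in> L2_on {0<..<s}" and gl: "((\<lambda>h. L2_norm_on {0<..<s} (\<lambda>t. (LINT x:{0<..<h}|lborel. zx (x, t)) / h - g t)) \<longlongrightarrow> 0) (at_right 0)"
    using G unfolding x_deriv_at_0_def by auto
  have "filterlim h (at_right 0) sequentially"
    by (rule tendsto_imp_filterlim_at_right[OF hlim]) (use h(1) in simp)
  then have gn: "(\<lambda>n. L2_norm_on {0<..<s} (\<lambda>t. (LINT x:{0<..<h n}|lborel. zx (x, t)) / h n - g t)) \<longlonglongrightarrow> 0"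
    by (rule filterlim_compose[OF gl])
  have wL: "(\<lambda>t. ?u (0, t) * cutoff H (s - t)) \<in> L2_on {0<..<s}"
  proof (rule continuous_L2_on)
    have "continuous_on UNIV (\<lambda>t. ?u (0, t))"
      by (rule continuous_on_compose2[OF uc(1)]) (auto intro!: continuous_intros)
    moreover have "continuous_on UNIV (\<lambda>t. cutoff H (s - t))"
      by (rule continuous_on_compose2[OF cutoff_bounds(6)[OF H]]) (auto intro!: continuous_intros)
    ultimately show "continuous_on UNIV (\<lambda>t. ?u (0, t) * cutoff H (s - t))"
      by (rule continuous_on_mult)
  qed auto
  have h1: "h n < 1" for n using h(2)[of n] by linarith
  have Tl: "(\<lambda>n. LINT p:?Q|lborel. ?T n p) \<longlonglongrightarrow> (LINT t:{0<..<s}|lborel. g t * (?u (0, t) * cutoff H (s - t)))"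
    unfolding T by (rule L2_inner_tendsto[OF boundary_mean_L2[OF L(2) h(1) h1] gL wL gn])
  have El: "(\<lambda>n. LINT p:?Q|lborel. ?E n p) \<longlonglongrightarrow> (LINT t:{0<..<s}|lborel. g t * (?u (0, t) * cutoff H (s - t)))"
    using tendsto_add[OF diff0 Tl] by simp
  have id: "(LINT p:?Q|lborel. (F p * ?u p) * (?a n p * ?b n p * ?d p)) = (LINT p:?Q|lborel. ?E n p) - (LINT p:?Q|lborel. B p * (?a n p * ?b n p * ?d' p))" for n
  proof -
    have n0: "0 \<le> 1 / h n" using h(1)[of n] by simp
    have i1: "set_integrable lborel ?Q (\<lambda>p. B p * (?a n p * ?b n p * ?d' p))"
    proof (rule set_integrable_bounded_mult[OF iA(2) Qhat_borel])
      show "\<bar>?a n p * ?b n p * ?d' p\<bar> \<le> 1 * 1 * (1 / H)" for p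
        unfolding abs_mult using cb(1)[OF h(1)] cb(2)[OF H] H by (intro mult_mono mult_nonneg_nonneg) auto
    qed (intro borel_measurable_times m1)
    have i2: "set_integrable lborel ?Q (\<lambda>p. B p * (k * (?a n p * ?b' n p) * ?d p))"
    proof (rule set_integrable_bounded_mult[OF iA(2) Qhat_borel])
      show "\<bar>k * (?a n p * ?b' n p) * ?d p\<bar> \<le> 1 * (1 * (1 / h n)) * 1" for p
        unfolding abs_mult using cb[OF h(1)[of n]] cb(1)[OF H] n0 k by (intro mult_mono mult_nonneg_nonneg) auto
    qed (intro borel_measurable_times borel_measurable_const m1)
    have i3: "set_integrable lborel ?Q (\<lambda>p. A p * ((?a' n p * ?b n p - ?a n p * ?b' n p) * ?d p))"
      using set_integral_diff(1)[OF iE i2, of n] by simp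
    have "(LINT p:?Q|lborel. B p * (k * (?a n p * ?b' n p) * ?d p - ?a n p * ?b n p * ?d' p))
      = (LINT p:?Q|lborel. B p * (k * (?a n p * ?b' n p) * ?d p)) - (LINT p:?Q|lborel. B p * (?a n p * ?b n p * ?d' p))"
      unfolding right_diff_distrib by (rule set_integral_diff(2)[OF i2 i1])
    moreover have "(LINT p:?Q|lborel. ?E n p) = (LINT p:?Q|lborel. A p * ((?a' n p * ?b n p - ?a n p * ?b' n p) * ?d p)) + (LINT p:?Q|lborel. B p * (k * (?a n p * ?b' n p) * ?d p))"
      by (rule set_integral_add(2)[OF i3 i2])
    ultimately show ?thesis
      using weak_solution_lipschitz_cutoff[OF W F C h(1)[of n] H] unfolding A_def[symmetric] B_def[symmetric] by linarith
  qed
  have "(LINT p:?Q|lborel. (F p * ?u p) * (1 * 1 * ?d p)) = (LINT t:{0<..<s}|lborel. g t * (?u (0, t) * cutoff H (s - t))) - (LINT p:?Q|lborel. B p * (1 * 1 * ?d' p))"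
    using l0 tendsto_diff[OF El l1] unfolding id by (rule LIMSEQ_unique)
  moreover have "- (LINT p:?Q|lborel. B p * (1 * 1 * ?d' p)) = (LINT p:?Q|lborel. (zt p * ?u p - z p * ?ut p) * ?d' p)"
  proof -
    have e: "(zt p * ?u p - z p * ?ut p) * ?d' p = - (B p * (1 * 1 * ?d' p))" for p
      by (simp add: B_def algebra_simps)
    show ?thesis unfolding e by (simp add: set_lebesgue_integral_def)
  qed
  ultimately show ?thesis by simp
qed

end

section \<open>The final time: the identity for C2 profiles\<close>

lemma L2_continuous_inner:
  assumes v: "L2_continuous k s v" and w: "L2_continuous k s w" and t0: "t0 \<in> {0..s}"
    and L: "\<And>t. t \<in> {0..s} \<Longrightarrow> (\<lambda>x. v (x, t)) \<in> L2_on (Omega k t)" "\<And>t. t \<in> {0..s} \<Longrightarrow> (\<lambda>x. w (x, t)) \<in> L2_on (Omega k t)"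
  shows "((\<lambda>t. LINT x:Omega k t|lborel. v (x, t) * w (x, t)) \<longlongrightarrow> (LINT x:Omega k t0|lborel. v (x, t0) * w (x, t0))) (at t0 within {0..s})"
proof -
  define V where "V t x = indicator (Omega k t) x * v (x, t)" for t x
  define W where "W t x = indicator (Omega k t) x * w (x, t)" for t x
  have VL: "V t \<in> L2_on UNIV" and WL: "W t \<in> L2_on UNIV" if "t \<in> {0..s}" for t
    using L[OF that] unfolding V_def[abs_def] W_def[abs_def] by (simp_all only: L2_on_iff[of _ "Omega k t"])
  have eq: "(LINT x:Omega k t|lborel. v (x, t) * w (x, t)) = (\<integral>x. V t x * W t x \<partial>lborel)" for t
    unfolding set_lebesgue_integral_def V_def W_def by (rule Bochner_Integration.integral_cong) (auto simp: indicator_def)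
  have lV: "((\<lambda>t. L2_norm_on UNIV (\<lambda>x. V t x - V t0 x)) \<longlongrightarrow> 0) (at t0 within {0..s})"
    and lW: "((\<lambda>t. L2_norm_on UNIV (\<lambda>x. W t x - W t0 x)) \<longlongrightarrow> 0) (at t0 within {0..s})"
    using v w t0 unfolding L2_continuous_def V_def W_def by auto
  let ?N = "L2_norm_on (UNIV :: real set)"
  let ?b = "\<lambda>t. ?N (\<lambda>x. V t x - V t0 x) * (?N (\<lambda>x. W t x - W t0 x) + ?N (W t0)) + ?N (V t0) * ?N (\<lambda>x. W t x - W t0 x)"
  have bd: "norm ((\<integral>x. V t x * W t x \<partial>lborel) - (\<integral>x. V t0 x * W t0 x \<partial>lborel)) \<le> ?b t" if t: "t \<in> {0..s}" for t
  proof -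
    note V = VL[OF t] and W = WL[OF t] and V0 = VL[OF t0] and W0 = WL[OF t0]
    note dV = L2_diff[OF V V0] and dW = L2_diff[OF W W0]
    have "(\<integral>x. V t x * W t x \<partial>lborel) = (\<integral>x. ((V t x - V t0 x) * W t x + V t0 x * (W t x - W t0 x)) + V t0 x * W t0 x \<partial>lborel)"
      by (simp add: algebra_simps)
    also have "\<dots> = ((\<integral>x. (V t x - V t0 x) * W t x \<partial>lborel) + (\<integral>x. V t0 x * (W t x - W t0 x) \<partial>lborel)) + (\<integral>x. V t0 x * W t0 x \<partial>lborel)"
      using L2_mult_integrable[OF dV W] L2_mult_integrable[OF V0 dW] L2_mult_integrable[OF V0 W0]
      by (simp only: Bochner_Integration.integral_add Bochner_Integration.integrable_add)
    finally have e: "(\<integral>x. V t x * W t x \<partial>lborel) - (\<integral>x. V t0 x * W t0 x \<partial>lborel)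
       = (\<integral>x. (V t x - V t0 x) * W t x \<partial>lborel) + (\<integral>x. V t0 x * (W t x - W t0 x) \<partial>lborel)" by simp
    have "?N (W t) \<le> ?N (\<lambda>x. W t x - W t0 x) + ?N (W t0)" using L2_norm_triangle[OF dW W0] by simp
    then have "?N (\<lambda>x. V t x - V t0 x) * ?N (W t) \<le> ?N (\<lambda>x. V t x - V t0 x) * (?N (\<lambda>x. W t x - W t0 x) + ?N (W t0))"
      by (rule mult_left_mono) simp
    then show ?thesis unfolding e real_norm_def
      using L2_Cauchy_Schwarz_UNIV[OF dV W] L2_Cauchy_Schwarz_UNIV[OF V0 dW] by linarith
  qed
  have "((\<lambda>t. ?b t) \<longlongrightarrow> 0 * (0 + ?N (W t0)) + ?N (V t0) * 0) (at t0 within {0..s})"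
    by (intro tendsto_intros lV lW)
  then have bl: "((\<lambda>t. ?b t) \<longlongrightarrow> 0) (at t0 within {0..s})" by simp
  have "((\<lambda>t. (\<integral>x. V t x * W t x \<partial>lborel) - (\<integral>x. V t0 x * W t0 x \<partial>lborel)) \<longlongrightarrow> 0) (at t0 within {0..s})"
  proof (rule Lim_null_comparison[OF _ bl])
    show "\<forall>\<^sub>F t in at t0 within {0..s}. norm ((\<integral>x. V t x * W t x \<partial>lborel) - (\<integral>x. V t0 x * W t0 x \<partial>lborel)) \<le> ?b t"
      unfolding eventually_at_filter using bd by (intro always_eventually) blast
  qed
  then show ?thesis unfolding eq by (rule Lim_null[THEN iffD2])
qed

text \<open>For large \<open>n\<close> the weight is a probability density on the last
  \<open>1 / real (Suc n)\<close> time units before \<open>s\<close>, so continuity of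
  \<open>N\<close> from the left decides the limit.\<close>

lemma one_sided_average_tendsto:
  assumes N: "set_integrable lborel {0<..<s} N" and lim: "(N \<longlongrightarrow> L) (at s within {0..s})" and s: "s > 0"
  shows "(\<lambda>n. LINT t:{0<..<s}|lborel. N t * cutoff' (1 / real (Suc n)) (s - t)) \<longlonglongrightarrow> L"
proof (rule LIMSEQ_I)
  fix e :: real assume e: "e > 0"
  have "\<forall>\<^sub>F t in at s within {0..s}. dist (N t) L < e/2" using lim e by (intro tendstoD) auto
  then obtain d where d: "d > 0" "\<And>t. t \<in> {0..s} \<Longrightarrow> t \<noteq> s \<Longrightarrow> dist t s < d \<Longrightarrow> dist (N t) L < e/2"
    unfolding eventually_at by auto
  have "\<forall>\<^sub>F n in sequentially. 1 / real (Suc n) < min d s"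
    using inverse_Suc_tendsto d(1) s by (intro order_tendstoD(2)) auto
  then obtain n0 where n0: "\<And>n. n \<ge> n0 \<Longrightarrow> 1 / real (Suc n) < min d s" by (auto simp: eventually_sequentially)
  show "\<exists>no. \<forall>n\<ge>no. norm ((LINT t:{0<..<s}|lborel. N t * cutoff' (1 / real (Suc n)) (s - t)) - L) < e"
  proof (intro exI[of _ n0] allI impI)
    fix n assume n: "n \<ge> n0"
    define h where "h = 1 / real (Suc n)"
    have h: "h > 0" "h < d" "h < s" using n0[OF n] unfolding h_def by auto
    let ?c = "\<lambda>t. cutoff' h (s - t)"
    have one: "(-1::real) \<noteq> 0" by simp
    have ic: "set_integrable lborel {0<..<s} ?c" using cutoff'_integral(1)[OF h(1) _ one, of "{0<..<s}" s] by simp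
    \<comment> \<open>Since \<open>h < s\<close>, the whole layer lies in \<open>(0, s)\<close> and
      no mass is lost.\<close>
    have c1: "(LINT t:{0<..<s}|lborel. ?c t) = 1"
    proof -
      have "(LINT t:{0<..<s}|lborel. ?c t) = (\<integral>t. cutoff' h ((-1) * t + s) \<partial>lborel)"
        unfolding set_lebesgue_integral_def using h by (intro Bochner_Integration.integral_cong) (auto simp: indicator_def cutoff'_def)
      also have "\<dots> = (\<integral>t. cutoff' h t \<partial>lborel) / \<bar>-1\<bar>" by (rule integral_affine) simp
      also have "(\<integral>t. cutoff' h t \<partial>lborel) = (\<integral>y. 1 / h * indicator {0<..h} y \<partial>lborel)"
        by (rule Bochner_Integration.integral_cong) (auto simp: cutoff'_def indicator_def)
      also have "\<dots> = 1" using h by simp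
      finally show ?thesis by simp
    qed
    have m: "?c \<in> borel_measurable borel" using cutoff_bounds(7)[OF h(1)] by measurable
    have iN: "set_integrable lborel {0<..<s} (\<lambda>t. N t * ?c t)"
      by (rule set_integrable_bounded_mult[OF N _ m, of "1/h"]) (use cutoff_bounds(4,5)[OF h(1)] in auto)
    have "\<bar>(LINT t:{0<..<s}|lborel. N t * ?c t) - (LINT t:{0<..<s}|lborel. L * ?c t)\<bar> \<le> (LINT t:{0<..<s}|lborel. e/2 * ?c t)"
    proof (rule set_integral_diff_bound[OF iN])
      fix t assume t: "t \<in> {0<..<s}"
      show "\<bar>N t * ?c t - L * ?c t\<bar> \<le> e/2 * ?c t"
      proof (cases "s - t \<le> h")
        case True
        then have "\<bar>N t - L\<bar> \<le> e/2" using d(2)[of t] t h by (auto simp: dist_real_def)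
        then have "\<bar>N t - L\<bar> * ?c t \<le> e/2 * ?c t" using cutoff_bounds(4)[OF h(1)] by (intro mult_right_mono) auto
        moreover have "\<bar>N t * ?c t - L * ?c t\<bar> = \<bar>N t - L\<bar> * ?c t"
          using cutoff_bounds(4)[OF h(1), of "s - t"] by (simp add: left_diff_distrib[symmetric] abs_mult)
        ultimately show ?thesis by simp
      qed (simp add: cutoff'_def)
    qed (use ic in simp_all)
    also have "\<dots> = e/2" using c1 by simp
    also have "\<dots> < e" using e by simp
    finally show "norm ((LINT t:{0<..<s}|lborel. N t * cutoff' (1 / real (Suc n)) (s - t)) - L) < e"
      using c1 unfolding h_def by simp
  qed
qed

lemma C2_supported_L2:
  assumes "C2_supported b c f f' f''"
  shows "f \<in> L2_on UNIV" "f' \<in> L2_on UNIV"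
proof -
  obtain d where d: "\<And>x. (x < b + d \<or> c - d < x) \<Longrightarrow> f x = 0 \<and> f' x = 0"
    using C2_supported_vanish[OF assms] by blast
  note cont = C2_supported_derivs[OF assms]
  have "g \<in> L2_on UNIV" if g: "continuous_on UNIV g" "\<And>x. (x < b + d \<or> c - d < x) \<Longrightarrow> g x = 0" for g
  proof -
    have "g \<in> L2_on {b + d..c - d}" by (rule continuous_L2_on[OF g(1)]) auto
    moreover have "(\<lambda>x. indicator {b + d..c - d} x * g x) = g"
      using g(2) by (force simp: indicator_def fun_eq_iff not_le)
    ultimately show ?thesis using L2_on_iff[of g "{b + d..c - d}"] by simp
  qed
  then show "f \<in> L2_on UNIV" "f' \<in> L2_on UNIV" using cont d by blast+
qed

context moving_end
begin

lemma Qhat_mono: "s \<le> T \<Longrightarrow> Qhat k s \<subseteq> Qhat k T" by (auto simp: Qhat_def)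

text \<open>Now the cutoff width in time tends to zero and yields the values at
  \<open>t = s\<close>; here the L2 continuity of the slices enters. The final term is
  \<open>zt * u - z * u'\<close>. In its second part \<open>u'\<close> is minus the space derivative
  of \<open>stream\<close>, and integration by parts, with no boundary term since the slice of
  \<open>z\<close> is in H10, produces \<open>pair_deriv\<close>.\<close>

lemma transposition_identity_C2:
  assumes W: "weak_solution k s F f0 f1 z zx zt" and F: "F \<in> L2_on (Qhat k s)"
    and C: "C2_supported 0 b f f' f''" and G: "x_deriv_at_0 s zx g" and s: "s > 0"
    and f0: "f0 \<in> H10 (alpha k s)" and f1: "f1 \<in> L2_on (Omega k s)"
  shows "(LINT p:Qhat k s|lborel. travel k f p * F p) =
     (LINT x:Omega k s|lborel. travel k f (x, s) * f1 x) - pair_deriv (alpha k s) (stream k f s) f0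
     + (LINT t:{0<..<s}|lborel. travel k f (0, t) * g t)"
proof -
  let ?Q = "Qhat k s" and ?u = "travel k f" and ?ut = "wave k 1 (- q) f'"
  define h where "h n = 1 / real (Suc n)" for n
  have h: "h n > 0" for n unfolding h_def by simp
  have hlim: "h \<longlonglongrightarrow> 0" unfolding h_def[abs_def] by (rule inverse_Suc_tendsto)
  note cont = C2_supported_derivs[OF C] and fL = C2_supported_L2[OF C]
  have u: "plane_C1 ?u (wave k (-1) (- q) f') ?ut" unfolding travel_wave using wave_plane_C1[OF cont(3,2), of 1 "-1"] by simp
  note uc = plane_C1_continuous[OF u]
  note L = weak_solutionD(1-3)[OF W]
  define D where "D p = zt p * ?u p - z p * ?ut p" for p
  have iD: "set_integrable lborel ?Q D"
    unfolding D_def[abs_def] by (intro set_integral_diff set_integrable_continuous_mult L uc)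
  have iF: "set_integrable lborel ?Q (\<lambda>p. F p * ?u p)" by (intro set_integrable_continuous_mult F uc)
  have cm: "cutoff h \<in> borel_measurable borel" "cutoff' h \<in> borel_measurable borel" if "h > 0" for h
    using cutoff_bounds(6,7)[OF that] by (auto intro!: borel_measurable_continuous_onI)
  have cb: "\<bar>cutoff h y\<bar> \<le> 1" "\<bar>cutoff' h y\<bar> \<le> 1 / h" if "h > 0" for h y
    using cutoff_bounds(1,2,4,5)[OF that, of y] by auto
  have l1: "(\<lambda>n. LINT p:?Q|lborel. (F p * ?u p) * cutoff (h n) (s - snd p)) \<longlonglongrightarrow> (LINT p:?Q|lborel. (F p * ?u p) * 1)"
  proof (rule set_integral_bounded_multipliers_tendsto[OF iF Qhat_borel _ _ _ cb(1)[OF h]])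
    show "(\<lambda>n. cutoff (h n) (s - snd p)) \<longlonglongrightarrow> 1" if "p \<in> ?Q" for p
      using that by (intro cutoff_tendsto h hlim) (auto simp: Qhat_def)
  qed (intro borel_measurable_const continuous_fst_snd_compose cm h)+
  have gL: "g \<in> L2_on {0<..<s}" using G unfolding x_deriv_at_0_def by auto
  have ut0: "continuous_on UNIV (\<lambda>t. ?u (0, t))"
    by (rule continuous_on_compose2[OF uc(1)]) (auto intro!: continuous_intros)
  have ig: "set_integrable lborel {0<..<s} (\<lambda>t. g t * ?u (0, t))"
    by (rule L2_on_mult_integrable[OF gL continuous_L2_on[OF ut0]]) auto
  have l2: "(\<lambda>n. LINT t:{0<..<s}|lborel. (g t * ?u (0, t)) * cutoff (h n) (s - t)) \<longlonglongrightarrow> (LINT t:{0<..<s}|lborel. (g t * ?u (0, t)) * 1)"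
  proof (rule set_integral_bounded_multipliers_tendsto[OF ig _ _ _ _ cb(1)[OF h]])
    show "(\<lambda>n. cutoff (h n) (s - t)) \<longlonglongrightarrow> 1" if "t \<in> {0<..<s}" for t
      using that by (intro cutoff_tendsto h hlim) auto
    show "(\<lambda>t. cutoff (h n) (s - t)) \<in> borel_measurable borel" for n using cm(1)[OF h] by measurable
  qed auto
  define N where "N t = (LINT x:Omega k t|lborel. D (x, t))" for t
  have sl: "(\<lambda>x. zt (x, t)) \<in> L2_on (Omega k t)" "(\<lambda>x. z (x, t)) \<in> L2_on (Omega k t)"
    "(\<lambda>x. ?u (x, t)) \<in> L2_on (Omega k t)" "(\<lambda>x. ?ut (x, t)) \<in> L2_on (Omega k t)" if "t \<in> {0..s}" for t
    using weak_solutionD(5)[OF W that] H10_derivD(1)[OF weak_solutionD(4)[OF W that]] travel_L2_slice[OF fL(1)] wave_L2_slice[OF fL(2)]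
    by (auto simp: Omega_def)
  have NN: "N t = (LINT x:Omega k t|lborel. zt (x, t) * ?u (x, t)) - (LINT x:Omega k t|lborel. z (x, t) * ?ut (x, t))" if "t \<in> {0..s}" for t
    unfolding N_def D_def
    by (rule set_integral_diff(2)[OF L2_on_mult_integrable[OF sl(1,3)[OF that]] L2_on_mult_integrable[OF sl(2,4)[OF that]]])
  have sin: "s \<in> {0..s}" using s by simp
  have "((\<lambda>t. (LINT x:Omega k t|lborel. zt (x, t) * ?u (x, t)) - (LINT x:Omega k t|lborel. z (x, t) * ?ut (x, t))) \<longlongrightarrow> N s) (at s within {0..s})"
    unfolding NN[OF sin]
    by (intro tendsto_diff L2_continuous_inner weak_solutionD(6,7)[OF W] travel_L2_continuous wave_L2_continuous fL sl sin)
  then have Nl: "(N \<longlongrightarrow> N s) (at s within {0..s})"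
    by (rule Lim_transform_eventually) (auto simp: eventually_at_filter NN)
  have iN: "set_integrable lborel {0<..<s} N" unfolding N_def[abs_def] by (rule Qhat_Fubini(2)[OF iD])
  have l3: "(\<lambda>n. LINT p:?Q|lborel. D p * cutoff' (h n) (s - snd p)) \<longlonglongrightarrow> N s"
  proof -
    have "(LINT p:?Q|lborel. D p * cutoff' (h n) (s - snd p)) = (LINT t:{0<..<s}|lborel. N t * cutoff' (h n) (s - t))" for n
    proof -
      have i: "set_integrable lborel ?Q (\<lambda>p. D p * cutoff' (h n) (s - snd p))"
        by (rule set_integrable_bounded_mult[OF iD Qhat_borel continuous_fst_snd_compose(3)[OF cm(2)[OF h]] cb(2)[OF h]])
      show ?thesis unfolding Qhat_Fubini(1)[OF i] N_def by simp
    qed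
    then show ?thesis using one_sided_average_tendsto[OF iN Nl s] unfolding h_def by simp
  qed
  have "(LINT p:?Q|lborel. (F p * ?u p) * cutoff (h n) (s - snd p)) =
    (LINT t:{0<..<s}|lborel. (g t * ?u (0, t)) * cutoff (h n) (s - t)) + (LINT p:?Q|lborel. D p * cutoff' (h n) (s - snd p))" for n
    using weak_solution_lateral_limit[OF W F C h G, of n] unfolding D_def by (simp add: mult.assoc)
  then have main: "(LINT p:?Q|lborel. (F p * ?u p) * 1) = (LINT t:{0<..<s}|lborel. (g t * ?u (0, t)) * 1) + N s"
    using l1 tendsto_add[OF l2 l3] LIMSEQ_unique by auto
  have a: "alpha k s > 0" using alpha_ge_1[of s] s by simp
  note H = weak_solutionD(4)[OF W sin]
  obtain g0 where g0: "H10_deriv (alpha k s) f0 g0" using f0 unfolding H10_def by auto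
  have AE0: "AE x in lborel. x \<in> {0<..<alpha k s} \<longrightarrow> z (x, s) = f0 x"
    using weak_solutionD(10)[OF W] by eventually_elim (auto simp: Omega_def)
  have AE1: "AE x in lborel. x \<in> Omega k s \<longrightarrow> zt (x, s) = f1 x"
    using weak_solutionD(10)[OF W] by eventually_elim auto
  have st: "(LINT x:{0<..<alpha k s}|lborel. z (x, s) * (- ?ut (x, s))) = - (LINT x:{0<..<alpha k s}|lborel. zx (x, s) * stream k f s x)"
  proof (rule H10_integration_by_parts[OF H])
    fix x
    have "((\<lambda>x. f (s - x)) has_real_derivative - f' (s - x)) (at x)"
    proof -
      have "((\<lambda>x. s - x) has_real_derivative -1) (at x)" by (auto intro!: derivative_eq_intros)
      from DERIV_chain'[OF this cont(3)] show ?thesis by simp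
    qed
    moreover have "((\<lambda>x. f (r (s + x))) has_real_derivative q * f' (r (s + x))) (at x)"
    proof -
      have "((\<lambda>x. r (s + x)) has_real_derivative q) (at x)" unfolding reflect_def by (auto intro!: derivative_eq_intros)
      from DERIV_chain'[OF this cont(3)] show ?thesis by (simp add: mult.commute)
    qed
    ultimately have "((\<lambda>x. f (s - x) + f (r (s + x))) has_real_derivative - f' (s - x) + q * f' (r (s + x))) (at x)"
      by (rule DERIV_add)
    then show "(stream k f s has_real_derivative - ?ut (x, s)) (at x)"
      unfolding stream_def[abs_def] wave_def by simp
  next
    show "continuous_on UNIV (\<lambda>x. - ?ut (x, s))"
      by (rule continuous_on_minus, rule continuous_on_compose2[OF uc(3)]) (auto intro!: continuous_intros)
  qed (use a in simp)
  have sL: "stream k f s \<in> L2_on {0<..<alpha k s}" using stream_L2_slice[OF fL(1), of s] by (simp add: Omega_def)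
  have "(LINT x:{0<..<alpha k s}|lborel. zx (x, s) * stream k f s x) = (LINT x:{0<..<alpha k s}|lborel. g0 x * stream k f s x)"
    by (rule set_integral_cong_AE_L2[OF H10_derivD(2)[OF H] H10_derivD(2)[OF g0] sL H10_deriv_unique[OF H g0 a AE0]])
  also have "\<dots> = pair_deriv (alpha k s) (stream k f s) f0"
    unfolding pair_deriv_eq[OF g0 sL a] by (simp add: mult.commute)
  finally have "(LINT x:Omega k s|lborel. z (x, s) * ?ut (x, s)) = pair_deriv (alpha k s) (stream k f s) f0"
    using st by (simp add: Omega_def set_lebesgue_integral_def)
  moreover have "(LINT x:Omega k s|lborel. zt (x, s) * ?u (x, s)) = (LINT x:Omega k s|lborel. f1 x * ?u (x, s))"
    by (rule set_integral_cong_AE_L2[OF sl(1)[OF sin] f1 sl(3)[OF sin] AE1])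
  ultimately show ?thesis using main NN[OF sin] by (simp add: mult.commute)
qed

end

section \<open>Functionals with an L2 kernel and the passage to general profiles\<close>

definition L2_dual :: "((real \<Rightarrow> real) \<Rightarrow> real) \<Rightarrow> bool" where
  "L2_dual \<Phi> \<longleftrightarrow> (\<exists>K\<in>L2_on UNIV. \<forall>f\<in>L2_on UNIV. \<Phi> f = (\<integral>x. f x * K x \<partial>lborel))"

lemma L2_dual_add:
  assumes "L2_dual \<Phi>" "L2_dual \<Psi>"
  shows "L2_dual (\<lambda>f. \<Phi> f + \<Psi> f)"
proof -
  obtain K K' where K: "K \<in> L2_on UNIV" "\<And>f. f \<in> L2_on UNIV \<Longrightarrow> \<Phi> f = (\<integral>x. f x * K x \<partial>lborel)"
    and K': "K' \<in> L2_on UNIV" "\<And>f. f \<in> L2_on UNIV \<Longrightarrow> \<Psi> f = (\<integral>x. f x * K' x \<partial>lborel)"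
    using assms unfolding L2_dual_def by blast
  have "\<Phi> f + \<Psi> f = (\<integral>x. f x * (K x + K' x) \<partial>lborel)" if f: "f \<in> L2_on UNIV" for f
    using L2_mult_integrable[OF f K(1)] L2_mult_integrable[OF f K'(1)] K(2)[OF f] K'(2)[OF f] by (simp add: distrib_left)
  then show ?thesis unfolding L2_dual_def using L2_add[OF K(1) K'(1)] by (intro bexI[of _ "\<lambda>x. K x + K' x"]) auto
qed

lemma L2_dual_scale:
  assumes "L2_dual \<Phi>"
  shows "L2_dual (\<lambda>f. c * \<Phi> f)"
proof -
  obtain K where K: "K \<in> L2_on UNIV" "\<And>f. f \<in> L2_on UNIV \<Longrightarrow> \<Phi> f = (\<integral>x. f x * K x \<partial>lborel)"
    using assms unfolding L2_dual_def by blast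
  have "c * \<Phi> f = (\<integral>x. f x * (c * K x) \<partial>lborel)" if f: "f \<in> L2_on UNIV" for f
    using K(2)[OF f] by (simp add: mult.left_commute)
  then show ?thesis unfolding L2_dual_def using L2_scale[OF K(1), of c] by (intro bexI[of _ "\<lambda>x. c * K x"]) auto
qed

lemma L2_dual_cong:
  assumes "L2_dual \<Psi>" "\<And>f. f \<in> L2_on UNIV \<Longrightarrow> \<Phi> f = \<Psi> f"
  shows "L2_dual \<Phi>"
  using assms unfolding L2_dual_def by fastforce

lemma L2_dual_affine_on:
  assumes m: "m \<in> L2_on S" and b: "b \<noteq> 0"
  shows "L2_dual (\<lambda>f. LINT x:S|lborel. f (b * x + c) * m x)"
proof -
  have "(\<lambda>x. indicator S x * m x) \<in> L2_on UNIV" using m by (simp only: L2_on_iff[of _ S])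
  from adjoint_affine[OF this b, of c] obtain K where "K \<in> L2_on UNIV"
    "\<And>f. (\<integral>x. f (b * x + c) * (indicator S x * m x) \<partial>lborel) = (\<integral>x. f x * K x \<partial>lborel)" by blast
  then show ?thesis unfolding L2_dual_def set_lebesgue_integral_def
    by (intro bexI[of _ K] ballI) (simp_all add: mult.left_commute)
qed

lemma L2_dual_affine_Qhat:
  assumes m: "m \<in> L2_on (Qhat k s)" and b: "b \<noteq> 0" and s: "s \<ge> 0"
  shows "L2_dual (\<lambda>f. LINT p:Qhat k s|lborel. f (b * fst p + a * snd p + c) * m p)"
proof -
  have mL: "(\<lambda>x. indicator (Qhat k s) x * m x) \<in> L2_on UNIV" using m by (simp only: L2_on_iff[of _ "Qhat k s"])
  have "indicator (Qhat k s) (x, t) * m (x, t) = 0" if "t \<notin> {0<..<s}" for x t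
    using that by (auto simp: indicator_def Qhat_def)
  from adjoint_shear[OF mL this s b, of a c] obtain K where "K \<in> L2_on UNIV"
    "\<And>f. f \<in> L2_on UNIV \<Longrightarrow> (\<integral>p. f (b * fst p + a * snd p + c) * (indicator (Qhat k s) p * m p) \<partial>lborel) = (\<integral>x. f x * K x \<partial>lborel)" by blast
  then show ?thesis unfolding L2_dual_def set_lebesgue_integral_def
    by (intro bexI[of _ K] ballI) (simp_all add: mult.left_commute)
qed

text \<open>The kernel is orthogonal to all C2 profiles, hence zero almost everywhere on
  \<open>(0,T)\<close>, and \<open>f\<close> lives only there. An explicit kernel does the work of
  continuity plus density.\<close>

lemma L2_dual_zero:
  assumes d: "L2_dual \<Phi>" and T: "T > 0" and z: "\<And>f f' f''. C2_supported 0 T f f' f'' \<Longrightarrow> \<Phi> f = 0"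
    and f: "f \<in> L2_on UNIV" "\<And>x. x \<notin> {0<..<T} \<Longrightarrow> f x = 0"
  shows "\<Phi> f = 0"
proof -
  obtain K where K: "K \<in> L2_on UNIV" "\<And>f. f \<in> L2_on UNIV \<Longrightarrow> \<Phi> f = (\<integral>x. f x * K x \<partial>lborel)"
    using d unfolding L2_dual_def by blast
  have KL: "K \<in> L2_on {0<..<T}" by (rule L2_UNIV_on[OF K(1)]) simp
  have restr: "(\<integral>x. g x * K x \<partial>lborel) = (LINT x:{0<..<T}|lborel. K x * g x)" if "\<And>x. x \<notin> {0<..<T} \<Longrightarrow> g x = 0" for g
    unfolding set_lebesgue_integral_def using that by (intro Bochner_Integration.integral_cong) (auto simp: indicator_def)
  have "AE x in lborel. x \<in> {0<..<T} \<longrightarrow> K x = 0"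
  proof (rule L2_orthogonal_C2[OF KL T])
    fix p p' p'' assume C: "C2_supported 0 T p p' p''"
    obtain d where "d > 0" "\<And>x. (x < 0 + d \<or> T - d < x) \<Longrightarrow> p x = 0"
      using C2_supported_vanish[OF C] by blast
    then have "p x = 0" if "x \<notin> {0<..<T}" for x using that by force
    from restr[OF this] show "(LINT x:{0<..<T}|lborel. p x * K x) = 0"
      using z[OF C] K(2)[OF C2_supported_L2(1)[OF C]] by (simp add: mult.commute)
  qed
  then have "(LINT x:{0<..<T}|lborel. K x * f x) = (LINT x:{0<..<T}|lborel. 0 * f x)"
    by (intro set_integral_cong_AE_L2[OF KL]) (auto intro: L2_UNIV_on[OF f(1)])
  then show ?thesis using K(2)[OF f(1)] restr[OF f(2)] by (simp add: set_lebesgue_integral_def)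
qed

context moving_end
begin

lemma travel_Qhat_dual:
  assumes m: "m \<in> L2_on (Qhat k s)" and s: "s \<ge> 0"
  shows "L2_dual (\<lambda>f. LINT p:Qhat k s|lborel. travel k f p * m p)"
proof (rule L2_dual_cong)
  let ?A = "\<lambda>f b a c. LINT p:Qhat k s|lborel. f (b * fst p + a * snd p + c) * m p"
  show "L2_dual (\<lambda>f. ?A f (-1) 1 0 + (-1) * ?A f q q (- (q + 1)))"
    by (intro L2_dual_add L2_dual_scale L2_dual_affine_Qhat m s q_nonzero) simp
  fix f :: "real \<Rightarrow> real" assume f: "f \<in> L2_on UNIV"
  have one: "(-1::real) \<noteq> 0" by simp
  show "(LINT p:Qhat k s|lborel. travel k f p * m p) = ?A f (-1) 1 0 + (-1) * ?A f q q (- (q + 1))"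
    unfolding travel_affine distrib_right mult.assoc[of "-1" "f _"]
    using L2_on_mult_integrable[OF L2_Qhat_affine[OF f one, of 1 0 k s] m] L2_on_mult_integrable[OF L2_Qhat_affine[OF f q_nonzero, of q "- (q + 1)" k s] m]
    by (simp only: set_integral_add set_integral_mult_right set_integrable_mult_right)
qed

lemma travel_slice_dual:
  assumes m: "m \<in> L2_on (Omega k t)"
  shows "L2_dual (\<lambda>f. LINT x:Omega k t|lborel. travel k f (x, t) * m x)"
    "L2_dual (\<lambda>f. LINT x:Omega k t|lborel. stream k f t x * m x)"
proof -
  let ?A = "\<lambda>f b c. LINT x:Omega k t|lborel. f (b * x + c) * m x"
  have one: "(-1::real) \<noteq> 0" by simp
  have i: "set_integrable lborel (Omega k t) (\<lambda>x. f (b * x + c) * m x)" if "f \<in> L2_on UNIV" "b \<noteq> 0" for f b c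
    by (rule L2_on_mult_integrable[OF L2_UNIV_on[OF L2_affine(1)[OF that] Omega_borel] m])
  show "L2_dual (\<lambda>f. LINT x:Omega k t|lborel. travel k f (x, t) * m x)"
  proof (rule L2_dual_cong)
    show "L2_dual (\<lambda>f. ?A f (-1) t + (-1) * ?A f q (q * t + (- (q + 1))))"
      by (intro L2_dual_add L2_dual_scale L2_dual_affine_on m q_nonzero one)
    fix f :: "real \<Rightarrow> real" assume f: "f \<in> L2_on UNIV"
    have "travel k f (x, t) = f ((-1) * x + t) + (-1) * f (q * x + (q * t + (- (q + 1))))" for x
      unfolding travel_affine by (simp add: add.assoc)
    then show "(LINT x:Omega k t|lborel. travel k f (x, t) * m x) = ?A f (-1) t + (-1) * ?A f q (q * t + (- (q + 1)))"
      using i[OF f one, of t] i[OF f q_nonzero, of "q * t + (- (q + 1))"]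
      by (simp only: distrib_right mult.assoc[of "-1" "f _"] set_integral_add set_integral_mult_right set_integrable_mult_right)
  qed
  show "L2_dual (\<lambda>f. LINT x:Omega k t|lborel. stream k f t x * m x)"
  proof (rule L2_dual_cong)
    show "L2_dual (\<lambda>f. ?A f (-1) t + ?A f q (q * t + (- (q + 1))))"
      by (intro L2_dual_add L2_dual_scale L2_dual_affine_on m q_nonzero one)
    fix f :: "real \<Rightarrow> real" assume f: "f \<in> L2_on UNIV"
    show "(LINT x:Omega k t|lborel. stream k f t x * m x) = ?A f (-1) t + ?A f q (q * t + (- (q + 1)))"
      using i[OF f one, of t] i[OF f q_nonzero, of "q * t + (- (q + 1))"]
      by (simp only: stream_affine distrib_right set_integral_add)
  qed
qed

lemma travel_boundary_dual:
  assumes m: "m \<in> L2_on {0<..<s}"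
  shows "L2_dual (\<lambda>f. LINT t:{0<..<s}|lborel. travel k f (0, t) * m t)"
proof (rule L2_dual_cong)
  let ?A = "\<lambda>f b c. LINT x:{0<..<s}|lborel. f (b * x + c) * m x"
  have one: "(1::real) \<noteq> 0" by simp
  have i: "set_integrable lborel {0<..<s} (\<lambda>x. f (b * x + c) * m x)" if "f \<in> L2_on UNIV" "b \<noteq> 0" for f b c
    by (rule L2_on_mult_integrable[OF L2_UNIV_on[OF L2_affine(1)[OF that]] m]) simp
  show "L2_dual (\<lambda>f. ?A f 1 0 + (-1) * ?A f q (- (q + 1)))"
    by (intro L2_dual_add L2_dual_scale L2_dual_affine_on m q_nonzero one)
  fix f :: "real \<Rightarrow> real" assume f: "f \<in> L2_on UNIV"
  have "travel k f (0, t) = f (1 * t + 0) + (-1) * f (q * t + (- (q + 1)))" for t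
    unfolding travel_affine by simp
  then show "(LINT t:{0<..<s}|lborel. travel k f (0, t) * m t) = ?A f 1 0 + (-1) * ?A f q (- (q + 1))"
    using i[OF f one, of 0] i[OF f q_nonzero, of "- (q + 1)"]
    by (simp only: distrib_right mult.assoc[of "-1" "f _"] set_integral_add set_integral_mult_right set_integrable_mult_right)
qed

text \<open>With \<open>z\<close> held fixed each of the four terms is a functional of
  \<open>f\<close> with an L2 kernel; \<open>?P\<close> is their signed sum and vanishes on C2
  profiles. \<open>pair_deriv\<close> is rewritten with one derivative \<open>g0\<close> of
  \<open>f0\<close> so that it takes this form.\<close>

lemma transposition_identity:
  assumes W: "weak_solution k s F f0 f1 z zx zt" and F: "F \<in> L2_on (Qhat k s)"
    and f: "f \<in> L2_on UNIV" "\<And>x. x \<notin> {0<..<T} \<Longrightarrow> f x = 0" and G: "x_deriv_at_0 s zx g" and s: "0 < s" and T: "T > 0"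
    and f0: "f0 \<in> H10 (alpha k s)" and f1: "f1 \<in> L2_on (Omega k s)"
  shows "(LINT p:Qhat k s|lborel. travel k f p * F p) =
     (LINT x:Omega k s|lborel. travel k f (x, s) * f1 x) - pair_deriv (alpha k s) (stream k f s) f0
     + (LINT t:{0<..<s}|lborel. travel k f (0, t) * g t)"
proof -
  obtain g0 where g0: "H10_deriv (alpha k s) f0 g0" using f0 unfolding H10_def by auto
  have g0L: "g0 \<in> L2_on (Omega k s)" using H10_derivD(2)[OF g0] by (simp add: Omega_def)
  have gL: "g \<in> L2_on {0<..<s}" using G unfolding x_deriv_at_0_def by auto
  have a: "alpha k s > 0" using alpha_ge_1[of s] s by simp
  have pd: "pair_deriv (alpha k s) (stream k h s) f0 = (LINT x:Omega k s|lborel. stream k h s x * g0 x)" if "h \<in> L2_on UNIV" for h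
    using pair_deriv_eq[OF g0 _ a] stream_L2_slice[OF that, of s] by (simp add: Omega_def)
  let ?P = "\<lambda>f. (LINT p:Qhat k s|lborel. travel k f p * F p) + ((-1) * (LINT x:Omega k s|lborel. travel k f (x, s) * f1 x)
     + ((LINT x:Omega k s|lborel. stream k f s x * g0 x) + (-1) * (LINT t:{0<..<s}|lborel. travel k f (0, t) * g t)))"
  have "L2_dual ?P"
    by (intro L2_dual_add L2_dual_scale travel_Qhat_dual travel_slice_dual travel_boundary_dual F f1 g0L gL) (use s in simp)
  moreover have "?P p = 0" if C: "C2_supported 0 T p p' p''" for p p' p''
    using transposition_identity_C2[OF W F C G s f0 f1] pd[OF C2_supported_L2(1)[OF C]] by simp
  ultimately have "?P f = 0" by (rule L2_dual_zero[OF _ T _ f])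
  then show ?thesis using pd[OF f(1)] by simp
qed

text \<open>Existence: \<open>w\<close> is the value of \<open>travel k f\<close> at
  \<open>x = 0\<close>, and the zero initial data follow from \<open>f\<close> vanishing at
  nonpositive arguments.\<close>

lemma travel_transposition_solution:
  assumes f: "f \<in> L2_on UNIV" "\<And>x. x \<notin> {0<..<T} \<Longrightarrow> f x = 0" and T: "T > 0"
    and w: "\<And>t. t \<in> {0<..<T} \<Longrightarrow> w t = f t - f (r t)"
  shows "transposition_solution k T w (travel k f) (\<lambda>t. pair_deriv (alpha k t) (stream k f t))"
  unfolding transposition_solution_def
proof (intro conjI ballI allI impI)
  show "travel k f \<in> L2_on (Qhat k T)" by (rule travel_L2_Qhat[OF f(1)])
  show "(\<lambda>x. travel k f (x, t)) \<in> L2_on (Omega k t)" for t by (rule travel_L2_slice[OF f(1)])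
  show "pair_deriv (alpha k t) (stream k f t) \<in> Hm1 (alpha k t)" if "t \<in> {0..T}" for t
    using stream_L2_slice[OF f(1), of t] alpha_ge_1[of t] that by (intro pair_deriv_Hm1) (auto simp: Omega_def)
  show "L2_continuous k T (travel k f)" by (rule travel_L2_continuous[OF f(1)])
  show "Hm1_continuous k T (\<lambda>t. pair_deriv (alpha k t) (stream k f t))" by (rule stream_Hm1_continuous[OF f(1)])
  have z: "f s = 0" if "s \<le> 0" for s using f(2)[of s] that by simp
  show "AE x in lborel. x \<in> Omega k 0 \<longrightarrow> travel k f (x, 0) = 0" using travel_initial(1)[OF z] by simp
  show "pair_deriv (alpha k 0) (stream k f 0) h = 0" for h
  proof -
    have "(\<lambda>x. indicator {0<..<alpha k 0} x * (stream k f 0 x * weak_deriv (alpha k 0) h x)) = (\<lambda>x. 0)"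
      using travel_initial(2)[OF z] by (auto simp: fun_eq_iff indicator_def Omega_def)
    then show ?thesis unfolding pair_deriv_def set_lebesgue_integral_def by simp
  qed
  fix s F f0 f1 z zx zt g
  assume *: "0 < s \<and> s \<le> T \<and> F \<in> L2_on (Qhat k T) \<and> f0 \<in> H10 (alpha k s) \<and> f1 \<in> L2_on (Omega k s) \<and>
     weak_solution k s F f0 f1 z zx zt \<and> x_deriv_at_0 s zx g"
  then have s: "0 < s" "s \<le> T" and W: "weak_solution k s F f0 f1 z zx zt" and G: "x_deriv_at_0 s zx g"
    and f01: "f0 \<in> H10 (alpha k s)" "f1 \<in> L2_on (Omega k s)" by auto
  have F: "F \<in> L2_on (Qhat k s)" using * L2_restrict(1)[OF _ Qhat_borel Qhat_mono] by blast
  have "(LINT t:{0<..<s}|lborel. w t * g t) = (LINT t:{0<..<s}|lborel. travel k f (0, t) * g t)"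
    by (rule set_lebesgue_integral_cong) (use w s in \<open>auto simp: travel_def\<close>)
  then show "(LINT p:Qhat k s|lborel. travel k f p * F p) =
     (LINT x:Omega k s|lborel. travel k f (x, s) * f1 x) - pair_deriv (alpha k s) (stream k f s) f0 + (LINT t:{0<..<s}|lborel. w t * g t)"
    using transposition_identity[OF W F f G s(1) T f01] by simp
qed

end

section \<open>Uniqueness of solutions by transposition\<close>

definition C1_compact :: "(real \<Rightarrow> real) \<Rightarrow> (real \<Rightarrow> real) \<Rightarrow> bool" where
  "C1_compact f f' \<longleftrightarrow> (\<forall>x. (f has_real_derivative f' x) (at x)) \<and> continuous_on UNIV f' \<and>
     (\<exists>R. \<forall>x. \<bar>x\<bar> > R \<longrightarrow> f x = 0 \<and> f' x = 0)"

lemma C1_compactD: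
  assumes "C1_compact f f'"
  shows "\<And>x. (f has_real_derivative f' x) (at x)" "continuous_on UNIV f" "continuous_on UNIV f'"
    "f \<in> L2_on UNIV" "f' \<in> L2_on UNIV" "\<exists>R. \<forall>x. f' x \<noteq> 0 \<longrightarrow> - R \<le> x \<and> x \<le> R"
proof -
  obtain R where R: "\<And>x. \<bar>x\<bar> > R \<Longrightarrow> f x = 0 \<and> f' x = 0" using assms unfolding C1_compact_def by blast
  show d: "(f has_real_derivative f' x) (at x)" for x using assms unfolding C1_compact_def by blast
  show c: "continuous_on UNIV f" using d by (rule DERIV_continuous_UNIV)
  show c': "continuous_on UNIV f'" using assms unfolding C1_compact_def by blast
  have "g \<in> L2_on UNIV" if g: "continuous_on UNIV g" "\<And>x. \<bar>x\<bar> > R \<Longrightarrow> g x = 0" for g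
  proof -
    have "g \<in> L2_on {- R..R}" by (rule continuous_L2_on[OF g(1)]) auto
    moreover have "(\<lambda>x. indicator {- R..R} x * g x) = g"
      using g(2) by (force simp: indicator_def fun_eq_iff abs_le_iff not_le)
    ultimately show ?thesis using L2_on_iff[of g "{- R..R}"] by simp
  qed
  then show "f \<in> L2_on UNIV" "f' \<in> L2_on UNIV" using c c' R by blast+
  have "- R \<le> x \<and> x \<le> R" if "f' x \<noteq> 0" for x using R[of x] that by (cases "\<bar>x\<bar> > R") auto
  then show "\<exists>R. \<forall>x. f' x \<noteq> 0 \<longrightarrow> - R \<le> x \<and> x \<le> R" by blast
qed

lemma C1_compact_add:
  assumes "C1_compact f f'" "C1_compact g g'"
  shows "C1_compact (\<lambda>x. f x + g x) (\<lambda>x. f' x + g' x)"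
proof -
  obtain R1 where R1: "\<And>x. \<bar>x\<bar> > R1 \<Longrightarrow> f x = 0 \<and> f' x = 0" using assms(1) unfolding C1_compact_def by blast
  obtain R2 where R2: "\<And>x. \<bar>x\<bar> > R2 \<Longrightarrow> g x = 0 \<and> g' x = 0" using assms(2) unfolding C1_compact_def by blast
  have "\<forall>x. \<bar>x\<bar> > max R1 R2 \<longrightarrow> f x + g x = 0 \<and> f' x + g' x = 0" using R1 R2 by simp
  then show ?thesis using C1_compactD(1,3)[OF assms(1)] C1_compactD(1,3)[OF assms(2)]
    unfolding C1_compact_def by (intro conjI allI exI[of _ "max R1 R2"] DERIV_add continuous_on_add) auto
qed

lemma C1_compact_affine:
  assumes "C1_compact f f'" "a > 0"
  shows "C1_compact (\<lambda>x. f (a * x + b)) (\<lambda>x. a * f' (a * x + b))"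
proof -
  obtain R where R: "\<And>x. \<bar>x\<bar> > R \<Longrightarrow> f x = 0 \<and> f' x = 0" using assms(1) unfolding C1_compact_def by blast
  have "f (a * x + b) = 0 \<and> a * f' (a * x + b) = 0" if x: "\<bar>x\<bar> > (R + \<bar>b\<bar>) / a" for x
  proof -
    have "R + \<bar>b\<bar> < \<bar>a * x\<bar>" using x assms(2) by (simp add: abs_mult divide_less_eq mult.commute)
    then show ?thesis using R[of "a * x + b"] by simp
  qed
  moreover have "((\<lambda>x. f (a * x + b)) has_real_derivative a * f' (a * x + b)) (at x)" for x
  proof -
    have "((\<lambda>x. a * x + b) has_real_derivative a) (at x)" by (auto intro!: derivative_eq_intros)
    from DERIV_chain'[OF this C1_compactD(1)[OF assms(1)]] show ?thesis by (simp add: mult.commute)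
  qed
  moreover have "continuous_on UNIV (\<lambda>x. f' (a * x + b))"
    by (rule continuous_on_compose2[OF C1_compactD(3)[OF assms(1)]]) (auto intro!: continuous_intros)
  then have "continuous_on UNIV (\<lambda>x. a * f' (a * x + b))" by (rule continuous_on_mult[OF continuous_on_const])
  ultimately show ?thesis unfolding C1_compact_def by blast
qed

lemma test_fun_gradient_support:
  assumes t: "test_fun S f G"
  shows "\<exists>K. compact K \<and> K \<subseteq> S \<and> (\<forall>p. p \<notin> K \<longrightarrow> f p = 0 \<and> G p = 0)"
proof -
  obtain K where K: "compact K" "K \<subseteq> S" "\<And>p. p \<notin> K \<Longrightarrow> f p = 0" using t unfolding test_fun_def by auto
  have "G p = 0" if p: "p \<notin> K" for p
  proof -
    have d: "(f has_derivative (\<lambda>h. h \<bullet> G p)) (at p)" using t unfolding test_fun_def gderiv_def by blast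
    have "((\<lambda>x. 0) has_derivative (\<lambda>h. 0)) (at p)" by simp
    then have "(f has_derivative (\<lambda>h. 0)) (at p)"
      by (rule has_derivative_transform_within_open[of _ _ _ _ "- K"]) (use p K compact_imp_closed in auto)
    from has_derivative_unique[OF d this] have "G p \<bullet> G p = 0" by (rule fun_cong)
    then show "G p = 0" by simp
  qed
  with K show ?thesis by blast
qed

text \<open>Integrating first along the lines with direction \<open>(c,1)\<close>, on which the weight is constant.\<close>

lemma test_fun_transport_integral:
  fixes f :: "real \<times> real \<Rightarrow> real"
  assumes t: "test_fun S f G" and h: "continuous_on UNIV h"
  shows "(\<integral>p. h (fst p - c * snd p) * (c * fst (G p) + snd (G p)) \<partial>lborel) = 0"
proof -
  obtain K where Kc: "compact K" and KS: "K \<subseteq> S" and Kf: "\<And>p. p \<notin> K \<Longrightarrow> f p = 0" and KG: "\<And>p. p \<notin> K \<Longrightarrow> G p = 0"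
    using test_fun_gradient_support[OF t] by blast
  note K = Kc Kf KG
  have Gc: "continuous_on UNIV G" using t unfolding test_fun_def by blast
  define D where "D p = c * fst (G p) + snd (G p)" for p
  have Dc: "continuous_on UNIV D" unfolding D_def[abs_def] by (intro continuous_intros Gc)
  have hc: "continuous_on UNIV (\<lambda>p::real \<times> real. h (fst p - c * snd p))"
    by (rule continuous_on_compose2[OF h]) (auto intro!: continuous_intros)
  have "integrable lborel (\<lambda>p. indicator K p *\<^sub>R (h (fst p - c * snd p) * D p))"
    by (rule borel_integrable_compact[OF K(1)]) (intro continuous_on_mult continuous_on_subset[OF hc] continuous_on_subset[OF Dc]; simp)
  moreover have "(\<lambda>p. indicator K p *\<^sub>R (h (fst p - c * snd p) * D p)) = (\<lambda>p. h (fst p - c * snd p) * D p)"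
  proof
    fix p show "indicator K p *\<^sub>R (h (fst p - c * snd p) * D p) = h (fst p - c * snd p) * D p"
      using KG[of p] by (cases "p \<in> K") (simp_all add: D_def)
  qed
  ultimately have i: "integrable lborel (\<lambda>p. h (fst p - c * snd p) * D p)" by simp
  let ?F = "\<lambda>p. h (fst p) * D (fst p + c * snd p, snd p)"
  have one: "(1::real) \<noteq> 0" by simp
  have i2: "integrable lborel ?F"
    using integrable_shear(1)[OF one i, of c 0] by simp
  have eq: "(\<integral>p. h (fst p - c * snd p) * D p \<partial>lborel) = (\<integral>p. ?F p \<partial>lborel)"
    using integrable_shear(2)[OF one i, of c 0] by simp
  have inner: "(\<integral>t. D (x + c * t, t) \<partial>lborel) = 0" for x
  proof -
    obtain R where R: "\<And>p. p \<in> K \<Longrightarrow> norm p \<le> R" using compact_imp_bounded[OF K(1)] unfolding bounded_iff by blast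
    define b where "b = \<bar>R\<bar> + 1"
    have out: "p \<notin> K" if "\<bar>snd p\<bar> \<ge> b" for p
    proof
      assume "p \<in> K"
      then have "norm (snd p) \<le> R" using R[of p] norm_snd_le[of "snd p" "fst p"] by simp
      then show False using that unfolding b_def by simp
    qed
    have d: "((\<lambda>t. f (x + c * t, t)) has_real_derivative D (x + c * t, t)) (at t)" for t
    proof -
      have g: "(f has_derivative (\<lambda>h. h \<bullet> G (x + c * t, t))) (at (x + c * t, t))"
        using t unfolding test_fun_def gderiv_def by blast
      have "((\<lambda>t. (x + c * t, t)) has_derivative (\<lambda>h. (c * h, h))) (at t)" by (auto intro!: derivative_eq_intros)
      from has_derivative_compose[OF this g]
      show ?thesis unfolding has_field_derivative_def D_def
        by (rule has_derivative_subst) (simp add: fun_eq_iff inner_prod_def algebra_simps)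
    qed
    have "continuous_on UNIV (\<lambda>t. D (x + c * t, t))"
      by (rule continuous_on_compose2[OF Dc]) (auto intro!: continuous_intros)
    from FTC_Ioo[OF _ d this, of "- b" b]
    have "(LINT t:{- b<..<b}|lborel. D (x + c * t, t)) = 0"
      using K(2)[OF out, of "(x + c * b, b)"] K(2)[OF out, of "(x + c * (- b), - b)"] by (simp add: b_def)
    moreover have "(LINT t:{- b<..<b}|lborel. D (x + c * t, t)) = (\<integral>t. D (x + c * t, t) \<partial>lborel)"
      unfolding set_lebesgue_integral_def
    proof (rule Bochner_Integration.integral_cong)
      fix t show "indicator {- b<..<b} t *\<^sub>R D (x + c * t, t) = D (x + c * t, t)"
        using K(3)[OF out, of "(x + c * t, t)"] by (cases "\<bar>t\<bar> \<ge> b") (auto simp: indicator_def D_def abs_le_iff)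
    qed simp
    ultimately show ?thesis by simp
  qed
  have "(\<integral>p. ?F p \<partial>lborel) = (\<integral>x. (\<integral>t. ?F (x, t) \<partial>lborel) \<partial>lborel)"
    using lborel_pair.integral_fst'[of ?F] i2 by (simp add: lborel_prod)
  also have "\<dots> = 0" using inner by simp
  finally show ?thesis using eq unfolding D_def by simp
qed

lemma test_fun_transport_set_integral:
  fixes f :: "real \<times> real \<Rightarrow> real"
  assumes t: "test_fun S f G" and h: "continuous_on UNIV h"
  shows "(LINT p:S|lborel. h (fst p - c * snd p) * (c * fst (G p) + snd (G p))) = 0"
proof -
  obtain K where Kc: "compact K" and KS: "K \<subseteq> S" and Kf: "\<And>p. p \<notin> K \<Longrightarrow> f p = 0" and KG: "\<And>p. p \<notin> K \<Longrightarrow> G p = 0"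
    using test_fun_gradient_support[OF t] by blast
  note K = KS KG
  have "(LINT p:S|lborel. h (fst p - c * snd p) * (c * fst (G p) + snd (G p))) = (\<integral>p. h (fst p - c * snd p) * (c * fst (G p) + snd (G p)) \<partial>lborel)"
    unfolding set_lebesgue_integral_def
  proof (rule Bochner_Integration.integral_cong)
    fix p show "indicator S p *\<^sub>R (h (fst p - c * snd p) * (c * fst (G p) + snd (G p))) = h (fst p - c * snd p) * (c * fst (G p) + snd (G p))"
      using KG[of p] subsetD[OF KS, of p] by (cases "p \<in> K") simp_all
  qed simp
  then show ?thesis using test_fun_transport_integral[OF t h] by simp
qed

section \<open>Backward waves by d'Alembert's formula\<close>

context moving_end
begin

definition unreflect :: "real \<Rightarrow> real" where "unreflect y = 1 / q * y + (1 / q + 1)"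

lemma unreflect_reflect: "unreflect (r y) = y" "r (unreflect y) = y"
  using q by (auto simp: unreflect_def reflect_def field_simps)

text \<open>\<open>unreflect\<close> sends -1 to 1 and has slope \<open>1 / q \<ge> 1\<close>. Each
  application thus advances by at least 2, which keeps the number of echoes finite.\<close>

lemma unreflect_ge: "y \<ge> -1 \<Longrightarrow> y + 2 \<le> unreflect y"
proof -
  assume y: "y \<ge> -1"
  have "1 \<le> 1 / q" using q by simp
  then have "1 * (y + 1) \<le> 1 / q * (y + 1)" using y by (intro mult_right_mono) auto
  then show ?thesis unfolding unreflect_def by (simp add: algebra_simps add_divide_distrib)
qed

text \<open>Partial sums of the series of \<open>c ^ j\<close> times \<open>e\<close> composed with
  the \<open>j\<close>-th iterate of \<open>unreflect\<close>: the images of the final data under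
  successive reflections backward in time. The weight \<open>c\<close> is 1 for a profile and
  \<open>1 / q\<close> for its derivative, by the chain rule.\<close>

fun echo :: "(real \<Rightarrow> real) \<Rightarrow> real \<Rightarrow> nat \<Rightarrow> real \<Rightarrow> real" where
  "echo e c 0 y = 0"
| "echo e c (Suc n) y = e y + c * echo e c n (unreflect y)"

lemma echo_C1_compact:
  assumes "C1_compact e e'"
  shows "C1_compact (echo e 1 n) (echo e' (1 / q) n)"
proof (induction n)
  case 0
  then show ?case by (auto simp: C1_compact_def)
next
  case (Suc n)
  have "C1_compact (\<lambda>y. e y + echo e 1 n (1 / q * y + (1 / q + 1))) (\<lambda>y. e' y + 1 / q * echo e' (1 / q) n (1 / q * y + (1 / q + 1)))"
    using q by (intro C1_compact_add assms C1_compact_affine Suc) simp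
  then show ?case by (simp add: unreflect_def)
qed

lemma echo_far:
  assumes "\<And>y. y \<ge> a \<Longrightarrow> e y = 0" "y \<ge> a" "y \<ge> 0"
  shows "echo e c n y = 0"
  using assms(2,3)
proof (induction n arbitrary: y)
  case (Suc n)
  have "unreflect y \<ge> y + 2" using Suc.prems by (intro unreflect_ge) simp
  then show ?case using Suc assms(1)[of y] by simp
qed simp

text \<open>After \<open>n\<close> reflections an argument that starts at \<open>a - n\<close> or
  later has passed \<open>a\<close>, where \<open>e\<close> is zero; of the advance by 2 only one
  unit per reflection is spent.\<close>

lemma echo_stable:
  assumes "\<And>y. y \<ge> a \<Longrightarrow> e y = 0" "y \<ge> a - real n" "y \<ge> 0"
  shows "echo e c (Suc n) y = echo e c n y"
  using assms(2,3)
proof (induction n arbitrary: y)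
  case 0
  then show ?case using assms(1)[of y] by simp
next
  case (Suc n)
  have "unreflect y \<ge> y + 2" using Suc.prems by (intro unreflect_ge) simp
  then have "echo e c (Suc n) (unreflect y) = echo e c n (unreflect y)" using Suc.prems by (intro Suc.IH) auto
  then show ?case by (simp only: echo.simps(2)[of e c "Suc n" y] echo.simps(2)[of e c n y])
qed


text \<open>With \<open>E\<close> the echo sum, \<open>E (t + x) - E (t - x)\<close> is zero at
  \<open>x = 0\<close> by cancellation, and zero at the moving end if \<open>E\<close> is invariant
  under \<open>r\<close> at the arguments reached there. The echo sum is built to have this
  invariance. The arguments occurring at time \<open>s\<close> exceed \<open>s - alpha k s\<close>,
  where all echoes are silent and \<open>E\<close> is \<open>e\<close>, so the final data are
  met.\<close>

lemma backward_wave: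
  assumes e: "C1_compact e e'" and s: "s > 0"
    and supp: "\<And>y. y \<le> s - alpha k s \<or> s + alpha k s \<le> y \<Longrightarrow> e y = 0 \<and> e' y = 0"
    and f0: "\<And>x. x \<in> Omega k s \<Longrightarrow> f0 x = e (s + x) - e (s - x)"
    and f1: "\<And>x. x \<in> Omega k s \<Longrightarrow> f1 x = e' (s + x) - e' (s - x)"
  shows "\<exists>z zx zt g. weak_solution k s (\<lambda>_. 0) f0 f1 z zx zt \<and> x_deriv_at_0 s zx g"
proof -
  let ?a = "s + alpha k s"
  have a: "alpha k s \<ge> 1" using alpha_ge_1[of s] s by simp
  obtain N where N: "?a \<le> real N" using real_arch_simple by blast
  define E where "E = echo e 1 (Suc N)"
  define E' where "E' = echo e' (1 / q) (Suc N)"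
  have EC: "C1_compact E E'" unfolding E_def E'_def by (rule echo_C1_compact[OF e])
  note ED = C1_compactD[OF EC]
  \<comment> \<open>\<open>e\<close> is zero at \<open>r y\<close>, so the echo sum loses its first
    term there and one application of \<open>unreflect\<close> returns to \<open>y\<close>; the
    choice of \<open>N\<close> makes the two partial sums agree.\<close>
  have lateral: "E (r y) = E y" if y: "0 \<le> y" "y \<le> ?a" for y
  proof -
    have "r y \<le> s - alpha k s" using reflect_strict_mono[of y ?a] reflect_right[of s] y by (cases "y = ?a") auto
    then have "E (r y) = echo e 1 N y" unfolding E_def using supp by (simp add: unreflect_reflect)
    also have "\<dots> = E y" unfolding E_def by (rule echo_stable[symmetric, of ?a]) (use supp N y in auto)
    finally show ?thesis .
  qed
  \<comment> \<open>One application of \<open>unreflect\<close> already carries such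
    \<open>y\<close> to \<open>s + alpha k s\<close> or beyond, where \<open>e\<close>
    vanishes.\<close>
  have final: "E y = e y" "E' y = e' y" if y: "s - alpha k s < y" for y
  proof -
    have "s - alpha k s = (1 - k) * s - 1" by (simp add: alpha_def left_diff_distrib)
    moreover have "0 < (1 - k) * s" using k s by simp
    ultimately have m: "s - alpha k s > -1" by linarith
    have "unreflect (s - alpha k s) = ?a" using reflect_right[of s] unreflect_reflect(1)[of ?a] by simp
    moreover have "unreflect (s - alpha k s) \<le> unreflect y"
      unfolding unreflect_def using y q by (intro add_right_mono mult_left_mono) auto
    ultimately have u: "?a \<le> unreflect y" by simp
    have "0 \<le> unreflect y" using u a s by linarith
    then show "E y = e y" "E' y = e' y"
      unfolding E_def E'_def echo.simps(2) using echo_far[of ?a e "unreflect y" 1 N, OF _ u] echo_far[of ?a e' "unreflect y" "1/q" N, OF _ u] supp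
      by simp_all
  qed
  define z where "z p = E (snd p + fst p) - E (snd p - fst p)" for p :: "real \<times> real"
  define zx where "zx p = E' (snd p + fst p) + E' (snd p - fst p)" for p :: "real \<times> real"
  define zt where "zt p = E' (snd p + fst p) - E' (snd p - fst p)" for p :: "real \<times> real"
  have za: "z = (\<lambda>p. E (1 * fst p + 1 * snd p + 0) + (-1) * E ((-1) * fst p + 1 * snd p + 0))"
    "zx = (\<lambda>p. E' (1 * fst p + 1 * snd p + 0) + E' ((-1) * fst p + 1 * snd p + 0))"
    "zt = (\<lambda>p. E' (1 * fst p + 1 * snd p + 0) + (-1) * E' ((-1) * fst p + 1 * snd p + 0))"
    unfolding z_def[abs_def] zx_def[abs_def] zt_def[abs_def] by (simp_all add: add.commute)
  have one: "(1::real) \<noteq> 0" "(-1::real) \<noteq> 0" by simp_all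
  have P: "plane_C1 z zx zt"
  proof -
    note pc = plane_C1_compose[OF ED(1,3)]
    have "plane_C1 (\<lambda>p. E (1 * fst p + 1 * snd p + 0) + (-1) * E ((-1) * fst p + 1 * snd p + 0))
      (\<lambda>p. 1 * E' (1 * fst p + 1 * snd p + 0) + (-1) * ((-1) * E' ((-1) * fst p + 1 * snd p + 0)))
      (\<lambda>p. 1 * E' (1 * fst p + 1 * snd p + 0) + (-1) * (1 * E' ((-1) * fst p + 1 * snd p + 0)))"
      by (rule plane_C1_add[OF pc plane_C1_scale[OF pc]])
    then show ?thesis by (simp only: za mult_1_left mult_minus1 minus_minus)
  qed
  note cont = plane_C1_continuous[OF P]
  have sc: "continuous_on UNIV (\<lambda>x. v (x, t))" if "continuous_on UNIV v" for v :: "real \<times> real \<Rightarrow> real" and t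
    by (rule continuous_on_compose2[OF that]) (auto intro!: continuous_intros)
  have H: "H10_deriv (alpha k t) (\<lambda>x. z (x, t)) (\<lambda>x. zx (x, t))" if t: "t \<in> {0..s}" for t
  proof (rule H10_C1[OF _ plane_C1_slice(1)[OF P] sc[OF cont(2)]])
    show "alpha k t > 0" using alpha_ge_1[of t] t by simp
    show "z (0, t) = 0" by (simp add: z_def)
    have "k * t \<le> k * s" using k t by (intro mult_left_mono) auto
    then have "t + alpha k t \<le> ?a" using t by (simp add: alpha_def)
    then have "E (r (t + alpha k t)) = E (t + alpha k t)" using t alpha_ge_1[of t] by (intro lateral) auto
    then show "z (alpha k t, t) = 0" by (simp add: z_def reflect_right)
  qed
  have W: "weak_solution k s (\<lambda>_. 0) f0 f1 z zx zt"
    unfolding weak_solution_def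
  proof (intro conjI ballI allI impI)
    show "z \<in> L2_on (Qhat k s)" "zx \<in> L2_on (Qhat k s)" "zt \<in> L2_on (Qhat k s)"
      by (intro continuous_L2_on cont Qhat_borel Qhat_bounded)+
    show "H10_deriv (alpha k t) (\<lambda>x. z (x, t)) (\<lambda>x. zx (x, t))" if "t \<in> {0..s}" for t by (rule H[OF that])
    show "(\<lambda>x. zt (x, t)) \<in> L2_on (Omega k t)" for t
      by (intro continuous_L2_on sc cont Omega_borel) (simp add: Omega_def)
    show "L2_continuous k s z" unfolding za
      by (rule L2_continuous_add[OF L2_continuous_affine[OF ED(4) one(1)] L2_continuous_scale[OF L2_continuous_affine[OF ED(4) one(2)]]
          L2_slice_affine[OF ED(4) one(1)] L2_scale[OF L2_slice_affine[OF ED(4) one(2)]]])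
    show "L2_continuous k s zx" unfolding za
      by (rule L2_continuous_add[OF L2_continuous_affine[OF ED(5) one(1)] L2_continuous_affine[OF ED(5) one(2)]
          L2_slice_affine[OF ED(5) one(1)] L2_slice_affine[OF ED(5) one(2)]])
    show "L2_continuous k s zt" unfolding za
      by (rule L2_continuous_add[OF L2_continuous_affine[OF ED(5) one(1)] L2_continuous_scale[OF L2_continuous_affine[OF ED(5) one(2)]]
          L2_slice_affine[OF ED(5) one(1)] L2_scale[OF L2_slice_affine[OF ED(5) one(2)]]])
    show "AE x in lborel. x \<in> Omega k s \<longrightarrow> z (x, s) = f0 x \<and> zt (x, s) = f1 x"
    proof (rule AE_I2, intro impI)
      fix x assume x: "x \<in> Omega k s"
      then have "s - alpha k s < s + x" "s - alpha k s < s - x" using a by (auto simp: Omega_def)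
      then show "z (x, s) = f0 x \<and> zt (x, s) = f1 x" using f0[OF x] f1[OF x] final by (simp add: z_def zt_def)
    qed
  next
    fix f G assume t: "test_fun (Qhat k s) f G"
    have fP: "plane_C1 f (\<lambda>p. fst (G p)) (\<lambda>p. snd (G p))"
    proof -
      have "\<And>p. GDERIV f p :> G p" "continuous_on UNIV G" using t unfolding test_fun_def by blast+
      then show ?thesis unfolding plane_C1_def by (simp add: continuous_on_fst continuous_on_snd)
    qed
    obtain K where K: "compact K" "K \<subseteq> Qhat k s" "\<And>p. p \<notin> K \<Longrightarrow> f p = 0" "\<And>p. p \<notin> K \<Longrightarrow> G p = 0"
      using test_fun_gradient_support[OF t] by blast
    \<comment> \<open>The product vanishes near the boundary, so its time derivative integrates to
      zero; this is the transport lemma with speed 0 and weight 1.\<close>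
    have "test_fun (Qhat k s) (\<lambda>p. z p * f p) (\<lambda>p. (zx p * f p + z p * fst (G p), zt p * f p + z p * snd (G p)))"
      by (rule plane_C1_test_fun[OF plane_C1_mult[OF P fP] K(1,2)]) (use K(3) in simp)
    from test_fun_transport_set_integral[OF this, of "\<lambda>_. 1" 0]
    have "(LINT p:Qhat k s|lborel. zt p * f p + z p * snd (G p)) = 0" by simp
    moreover have i: "set_integrable lborel (Qhat k s) (\<lambda>p. v p * w p)" if "continuous_on UNIV v" "continuous_on UNIV w" for v w :: "real \<times> real \<Rightarrow> real"
      by (rule L2_on_mult_integrable[OF continuous_L2_on[OF that(1) Qhat_borel Qhat_bounded] continuous_L2_on[OF that(2) Qhat_borel Qhat_bounded]])
    ultimately show "(LINT p:Qhat k s|lborel. z p * snd (G p)) = - (LINT p:Qhat k s|lborel. zt p * f p)"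
      using set_integral_add(2)[OF i[OF cont(3) plane_C1_continuous(1)[OF fP]] i[OF cont(1) plane_C1_continuous(3)[OF fP]]] by linarith
    have Ec: "continuous_on UNIV (\<lambda>y. E' (- y))" by (rule continuous_on_compose2[OF ED(3)]) (auto intro!: continuous_intros)
    \<comment> \<open>Each of the two travelling parts is constant along its own characteristics;
      the weak wave equation is the difference of the two identities.\<close>
    have 1: "(LINT p:Qhat k s|lborel. E' (fst p - (-1) * snd p) * ((-1) * fst (G p) + snd (G p))) = 0"
      "(LINT p:Qhat k s|lborel. E' (- (fst p - 1 * snd p)) * (1 * fst (G p) + snd (G p))) = 0"
      using test_fun_transport_set_integral[OF t ED(3), of "-1"] test_fun_transport_set_integral[OF t Ec, of 1] by auto
    have pc: "continuous_on UNIV (\<lambda>p::real \<times> real. E' (fst p - (-1) * snd p))" "continuous_on UNIV (\<lambda>p::real \<times> real. E' (- (fst p - 1 * snd p)))"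
      by (rule continuous_on_compose2[OF ED(3)]; auto intro!: continuous_intros)+
    have gc: "continuous_on UNIV (\<lambda>p. (-1) * fst (G p) + snd (G p))" "continuous_on UNIV (\<lambda>p. 1 * fst (G p) + snd (G p))"
      using plane_C1_continuous(2,3)[OF fP] by (auto intro!: continuous_intros)
    have "(LINT p:Qhat k s|lborel. zx p * fst (G p) - zt p * snd (G p)) =
      (LINT p:Qhat k s|lborel. E' (- (fst p - 1 * snd p)) * (1 * fst (G p) + snd (G p)) - E' (fst p - (-1) * snd p) * ((-1) * fst (G p) + snd (G p)))"
      unfolding zx_def zt_def by (simp add: algebra_simps)
    also have "\<dots> = 0" unfolding set_integral_diff(2)[OF i[OF pc(2) gc(2)] i[OF pc(1) gc(1)]] 1 by simp
    finally show "(LINT p:Qhat k s|lborel. zx p * fst (G p) - zt p * snd (G p)) = (LINT p:Qhat k s|lborel. 0 * f p)"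
      by (simp add: set_lebesgue_integral_def)
  qed
  \<comment> \<open>The mean of \<open>zx\<close> over \<open>(0,h)\<close> is twice a central
    difference quotient of \<open>E\<close>, and uniform continuity of \<open>E'\<close> gives even
    uniform convergence to \<open>zx (0, t) = 2 * E' t\<close>.\<close>
  have G: "x_deriv_at_0 s zx (\<lambda>t. 2 * E' t)"
    unfolding x_deriv_at_0_def
  proof
    show "(\<lambda>t. 2 * E' t) \<in> L2_on {0<..<s}" by (intro continuous_L2_on continuous_on_mult continuous_on_const ED(3)) auto
    obtain R where R: "\<And>x. E' x \<noteq> 0 \<Longrightarrow> - R \<le> x \<and> x \<le> R" using ED(6) by blast
    show "((\<lambda>h. L2_norm_on {0<..<s} (\<lambda>t. (LINT x:{0<..<h}|lborel. zx (x, t)) / h - 2 * E' t)) \<longlongrightarrow> 0) (at_right 0)"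
    proof (rule tendstoI)
      fix \<epsilon> :: real assume \<epsilon>: "\<epsilon> > 0"
      define d where "d = \<epsilon> / 4 / (1 + sqrt s)"
      have sp: "0 < 1 + sqrt s" using s by (simp add: add_pos_nonneg)
      have d: "d > 0" using \<epsilon> sp unfolding d_def by simp
      obtain m where m: "m > 0" "\<And>x y. \<bar>x - y\<bar> < m \<Longrightarrow> \<bar>E' x - E' y\<bar> < d"
        using compact_support_uniformly_continuous[OF ED(3) R d] by blast
      have "dist (L2_norm_on {0<..<s} (\<lambda>t. (LINT x:{0<..<h}|lborel. zx (x, t)) / h - 2 * E' t)) 0 < \<epsilon>" if h: "0 < h" "h < m" for h
      proof -
        have mean: "(LINT x:{0<..<h}|lborel. zx (x, t)) = E (t + h) - E (t - h)" for t
          using FTC_Ioo[OF _ plane_C1_slice(1)[OF P] sc[OF cont(2)], of 0 h t] h by (simp add: z_def)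
        have "L2_norm_on {0<..<s} (\<lambda>t. (E (t + h) - E (t - h)) / h - 2 * E' t) \<le> 2 * d * sqrt (s - 0)"
        proof (rule L2_norm_le_uniform)
          fix t
          obtain y1 where y1: "t < y1" "y1 < t + h" "E (t + h) - E t = (t + h - t) * E' y1"
            using MVT2[of t "t + h" E E'] h ED(1) by auto
          obtain y2 where y2: "t - h < y2" "y2 < t" "E t - E (t - h) = (t - (t - h)) * E' y2"
            using MVT2[of "t - h" t E E'] h ED(1) by auto
          have "E (t + h) - E (t - h) = h * (E' y1 + E' y2)" using y1(3) y2(3) by (simp add: distrib_left)
          then have "(E (t + h) - E (t - h)) / h - 2 * E' t = (E' y1 - E' t) + (E' y2 - E' t)" using h by simp
          moreover have "\<bar>E' y1 - E' t\<bar> < d" "\<bar>E' y2 - E' t\<bar> < d" using y1 y2 h by (intro m(2); simp)+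
          ultimately show "\<bar>(E (t + h) - E (t - h)) / h - 2 * E' t\<bar> \<le> 2 * d" by linarith
        next
          have "continuous_on UNIV (\<lambda>t. E (t + h))" "continuous_on UNIV (\<lambda>t. E (t - h))"
            by (rule continuous_on_compose2[OF ED(2)]; auto intro!: continuous_intros)+
          then show "(\<lambda>t. (E (t + h) - E (t - h)) / h - 2 * E' t) \<in> borel_measurable borel"
            using ED(3) h by (intro borel_measurable_continuous_onI continuous_intros) auto
        qed (use s d in auto)
        also have "\<dots> \<le> 2 * d * (1 + sqrt s)" using d by (intro mult_left_mono) auto
        also have "\<dots> = \<epsilon> / 2" unfolding d_def using sp by (simp add: field_simps)
        also have "\<dots> < \<epsilon>" using \<epsilon> by simp
        finally show ?thesis unfolding mean by simp
      qed
      then show "\<forall>\<^sub>F h in at_right 0. dist (L2_norm_on {0<..<s} (\<lambda>t. (LINT x:{0<..<h}|lborel. zx (x, t)) / h - 2 * E' t)) 0 < \<epsilon>"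
        unfolding eventually_at_right_field using m(1) by (intro exI[of _ m]) auto
    qed
  qed
  show ?thesis using W G by blast
qed

end

section \<open>Uniqueness by testing with explicit final data\<close>

lemma test_fun_H10_deriv:
  assumes "test_fun {0<..<a::real} f f'"
  shows "H10_deriv a f f'"
  unfolding H10_deriv_def
proof (intro conjI exI)
  show "f \<in> L2_on {0<..<a}" "f' \<in> L2_on {0<..<a}" using test_fun_L2_on[OF assms] by blast+
  show "\<forall>n::nat. test_fun {0<..<a} ((\<lambda>_. f) n) ((\<lambda>_. f') n)" using assms by simp
qed (simp_all add: L2_norm_on_def)

lemma Hm1_zero:
  assumes "l \<in> Hm1 a"
  shows "l (\<lambda>_. 0) = 0"
proof -
  have "l (\<lambda>x. 0 * f x) = 0 * l f" if "f \<in> H10 a" for f using that assms unfolding Hm1_def by blast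
  moreover have "(\<lambda>_. 0) \<in> H10 a" using H10_deriv_zero[of a] unfolding H10_def by blast
  ultimately have "l (\<lambda>x. 0 * 0) = 0 * l (\<lambda>_. 0)" .
  then show ?thesis by simp
qed

lemma Hm1_tendsto:
  assumes l: "l \<in> Hm1 a" and H: "H10_deriv a f g"
    and t: "\<And>n::nat. test_fun {0<..<a} (\<phi> n) (G n)"
    and c: "(\<lambda>n. L2_norm_on {0<..<a} (\<lambda>x. \<phi> n x - f x)) \<longlonglongrightarrow> 0" "(\<lambda>n. L2_norm_on {0<..<a} (\<lambda>x. G n x - g x)) \<longlonglongrightarrow> 0"
  shows "(\<lambda>n. l (\<phi> n)) \<longlonglongrightarrow> l f"
proof -
  obtain C where C: "\<And>f g. H10_deriv a f g \<Longrightarrow> \<bar>l f\<bar> \<le> C * sqrt ((L2_norm_on {0<..<a} f)\<^sup>2 + (L2_norm_on {0<..<a} g)\<^sup>2)"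
    and add: "\<And>f h. f \<in> H10 a \<Longrightarrow> h \<in> H10 a \<Longrightarrow> l (\<lambda>x. f x + h x) = l f + l h"
    and sc: "\<And>c f. f \<in> H10 a \<Longrightarrow> l (\<lambda>x. c * f x) = c * l f"
    using l unfolding Hm1_def by blast
  have fH: "f \<in> H10 a" using H unfolding H10_def by blast
  have b: "\<bar>l (\<phi> n) - l f\<bar> \<le> C * sqrt ((L2_norm_on {0<..<a} (\<lambda>x. \<phi> n x - f x))\<^sup>2 + (L2_norm_on {0<..<a} (\<lambda>x. G n x - g x))\<^sup>2)" for n
  proof -
    note n = test_fun_H10_deriv[OF t[of n]]
    note m = H10_deriv_scale[OF H, of "-1"]
    have "\<phi> n \<in> H10 a" "(\<lambda>x. (-1) * f x) \<in> H10 a" using n m unfolding H10_def by blast+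
    from add[OF this] sc[OF fH, of "-1"] have "l (\<lambda>x. \<phi> n x + (-1) * f x) = l (\<phi> n) - l f" by simp
    with C[OF H10_deriv_add[OF n m]] show ?thesis by simp
  qed
  have "(\<lambda>n. C * sqrt ((L2_norm_on {0<..<a} (\<lambda>x. \<phi> n x - f x))\<^sup>2 + (L2_norm_on {0<..<a} (\<lambda>x. G n x - g x))\<^sup>2)) \<longlonglongrightarrow> C * sqrt (0\<^sup>2 + 0\<^sup>2)"
    by (intro tendsto_intros c)
  then have z: "(\<lambda>n. C * sqrt ((L2_norm_on {0<..<a} (\<lambda>x. \<phi> n x - f x))\<^sup>2 + (L2_norm_on {0<..<a} (\<lambda>x. G n x - g x))\<^sup>2)) \<longlonglongrightarrow> 0" by simp
  have "(\<lambda>n. l (\<phi> n) - l f) \<longlonglongrightarrow> 0"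
    by (rule Lim_null_comparison[OF _ z]) (simp add: b)
  then show ?thesis by (simp add: LIM_zero_iff)
qed

lemma transposition_solutionD:
  assumes "transposition_solution k T w u l"
  shows "u \<in> L2_on (Qhat k T)" "\<And>t. t \<in> {0..T} \<Longrightarrow> (\<lambda>x. u (x, t)) \<in> L2_on (Omega k t)"
    "\<And>t. t \<in> {0..T} \<Longrightarrow> l t \<in> Hm1 (alpha k t)"
    "\<And>s F f0 f1 z zx zt g. 0 < s \<Longrightarrow> s \<le> T \<Longrightarrow> F \<in> L2_on (Qhat k T) \<Longrightarrow>
        f0 \<in> H10 (alpha k s) \<Longrightarrow> f1 \<in> L2_on (Omega k s) \<Longrightarrow>
        weak_solution k s F f0 f1 z zx zt \<Longrightarrow> x_deriv_at_0 s zx g \<Longrightarrow>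
        (LINT p:Qhat k s|lborel. u p * F p) =
        (LINT x:Omega k s|lborel. u (x, s) * f1 x) - l s f0 + (LINT t:{0<..<s}|lborel. w t * g t)"
  using assms unfolding transposition_solution_def by blast+

lemma DERIV_affine_compose:
  fixes f f' :: "real \<Rightarrow> real"
  assumes "\<And>x. (f has_real_derivative f' x) (at x)"
  shows "((\<lambda>x. f (a * x + b)) has_real_derivative a * f' (a * x + b)) (at x)"
proof -
  have "((\<lambda>x. a * x + b) has_real_derivative a) (at x)" by (auto intro!: derivative_eq_intros)
  from DERIV_chain'[OF this assms] show ?thesis by (simp add: mult.commute)
qed

text \<open>\<open>d = 1\<close> makes the profile even about \<open>s\<close>, and
  \<open>d = -1\<close> with \<open>c = 0\<close> makes it odd. The final data of the corresponding
  backward wave then reduce to a pure velocity and a pure displacement, respectively.\<close>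

lemma C1_compact_mirror:
  assumes P: "\<And>x. (P has_real_derivative p x) (at x)" and pc: "continuous_on UNIV p"
    and z: "\<And>y. a \<le> \<bar>y - s\<bar> \<Longrightarrow> (P (y - s) + d * P (s - y)) / 2 + c = 0 \<and> (p (y - s) - d * p (s - y)) / 2 = 0"
  shows "C1_compact (\<lambda>y. (P (y - s) + d * P (s - y)) / 2 + c) (\<lambda>y. (p (y - s) - d * p (s - y)) / 2)"
  unfolding C1_compact_def
proof (intro conjI allI exI impI)
  fix y
  have 1: "((\<lambda>y. P (y - s)) has_real_derivative p (y - s)) (at y)" using DERIV_affine_compose[OF P, of 1 "- s" y] by simp
  have 2: "((\<lambda>y. P (s - y)) has_real_derivative - p (s - y)) (at y)" using DERIV_affine_compose[OF P, of "-1" s y] by simp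
  show "((\<lambda>y. (P (y - s) + d * P (s - y)) / 2 + c) has_real_derivative (p (y - s) - d * p (s - y)) / 2) (at y)"
    using DERIV_add[OF DERIV_cdivide[OF DERIV_add[OF 1 DERIV_cmult[OF 2, of d]], of 2] DERIV_const[of c]] by simp
next
  have "continuous_on UNIV (\<lambda>y. p (y - s))" "continuous_on UNIV (\<lambda>y. p (s - y))"
    by (rule continuous_on_compose2[OF pc]; auto intro!: continuous_intros)+
  then show "continuous_on UNIV (\<lambda>y. (p (y - s) - d * p (s - y)) / 2)"
    by (intro continuous_on_divide continuous_on_diff continuous_on_mult continuous_on_const) auto
next
  fix y assume "\<bar>y\<bar> > \<bar>a\<bar> + \<bar>s\<bar>"
  then have "a \<le> \<bar>y - s\<bar>" by linarith
  from z[OF this] show "(P (y - s) + d * P (s - y)) / 2 + c = 0" "(p (y - s) - d * p (s - y)) / 2 = 0" by blast+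
qed

context moving_end
begin

text \<open>Both solutions are tested with the same backward wave with source zero; the boundary
  integral involves only \<open>w\<close> and \<open>g\<close> and drops out of the
  comparison.\<close>

lemma transposition_difference:
  assumes S: "transposition_solution k T w u l" "transposition_solution k T w u' l'" and s: "0 < s" "s \<le> T"
    and e: "C1_compact e e'"
    and supp: "\<And>y. alpha k s \<le> \<bar>y - s\<bar> \<Longrightarrow> e y = 0 \<and> e' y = 0"
    and f0: "\<And>x. x \<in> Omega k s \<Longrightarrow> f0 x = e (s + x) - e (s - x)"
    and f1: "\<And>x. x \<in> Omega k s \<Longrightarrow> f1 x = e' (s + x) - e' (s - x)"
    and H: "f0 \<in> H10 (alpha k s)" "f1 \<in> L2_on (Omega k s)"
  shows "(LINT x:Omega k s|lborel. u (x, s) * f1 x) - l s f0 = (LINT x:Omega k s|lborel. u' (x, s) * f1 x) - l' s f0"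
proof -
  have supp': "e y = 0 \<and> e' y = 0" if "y \<le> s - alpha k s \<or> s + alpha k s \<le> y" for y
    by (rule supp) (use that in linarith)
  obtain z zx zt g where W: "weak_solution k s (\<lambda>_. 0) f0 f1 z zx zt" "x_deriv_at_0 s zx g"
    using backward_wave[OF e s(1) supp' f0 f1] by blast
  have "(\<lambda>_. 0) \<in> L2_on (Qhat k T)" by (simp add: L2_on_def set_borel_measurable_def set_integrable_def)
  from transposition_solutionD(4)[OF S(1) s this H W] transposition_solutionD(4)[OF S(2) s this H W] show ?thesis
    by (simp add: set_lebesgue_integral_def)
qed

text \<open>Final data \<open>(0, p)\<close> isolate the displacement. The profile of the backward
  wave is the even part of an antiderivative of \<open>p\<close>, up to a constant, and C2 functions
  \<open>p\<close> suffice by \<open>L2_orthogonal_C2\<close>.\<close>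

lemma transposition_unique_slice:
  assumes S: "transposition_solution k T w u l" "transposition_solution k T w u' l'" and s: "0 < s" "s \<le> T"
  shows "AE x in lborel. x \<in> Omega k s \<longrightarrow> u (x, s) = u' (x, s)"
proof -
  let ?a = "alpha k s"
  have a: "?a > 0" using alpha_ge_1[of s] s by simp
  have st: "s \<in> {0..T}" using s by simp
  note uL = transposition_solutionD(2)[OF S(1) st] transposition_solutionD(2)[OF S(2) st]
  have zH: "(\<lambda>_. 0) \<in> H10 ?a" using H10_deriv_zero[of ?a] unfolding H10_def by blast
  have l0: "l s (\<lambda>_. 0) = 0" "l' s (\<lambda>_. 0) = 0"
    by (rule Hm1_zero[OF transposition_solutionD(3)[OF S(1) st]], rule Hm1_zero[OF transposition_solutionD(3)[OF S(2) st]])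
  have "AE x in lborel. x \<in> {0<..<?a} \<longrightarrow> u (x, s) - u' (x, s) = 0"
  proof (rule L2_orthogonal_C2[OF _ a])
    show "(\<lambda>x. u (x, s) - u' (x, s)) \<in> L2_on {0<..<?a}" using L2_diff[OF uL] by (simp add: Omega_def)
    fix p p' p'' assume C: "C2_supported 0 ?a p p' p''"
    have p0: "p x = 0" if "x \<le> 0 \<or> ?a \<le> x" for x
    proof (rule ccontr)
      assume "p x \<noteq> 0"
      moreover obtain d where "d > 0" "\<And>x. p x \<noteq> 0 \<Longrightarrow> 0 + d \<le> x \<and> x \<le> ?a - d" using C unfolding C2_supported_def by blast
      ultimately show False using that by fastforce
    qed
    have pc: "continuous_on UNIV p" by (rule C2_supported_derivs[OF C])
    obtain P where P: "\<And>x. (P has_real_derivative p x) (at x)" using antiderivative_UNIV[OF pc] by blast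
    have P0: "P x = P 0" if "x \<le> 0" for x
    proof (cases "x = 0")
      case False
      with that have "x < 0" by simp
      from MVT2[OF this, of P p] P obtain y where "x < y" "y < 0" "P 0 - P x = (0 - x) * p y" by blast
      then show ?thesis using p0[of y] by simp
    qed simp
    have Pa: "P x = P ?a" if "?a \<le> x" for x
    proof (cases "x = ?a")
      case False
      with that have "?a < x" by simp
      from MVT2[OF this, of P p] P obtain y where "?a < y" "y < x" "P x - P ?a = (x - ?a) * p y" by blast
      then show ?thesis using p0[of y] by simp
    qed simp
    \<comment> \<open>Outside the window the even part of \<open>P\<close> is the constant
      \<open>(P ?a + P 0) / 2\<close>; subtracting it makes the support compact and leaves the data
      unchanged.\<close>
    define c where "c = - (P ?a + P 0) / 2"
    let ?e = "\<lambda>y. (P (y - s) + 1 * P (s - y)) / 2 + c" and ?e' = "\<lambda>y. (p (y - s) - 1 * p (s - y)) / 2"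
    have supp: "?e y = 0 \<and> ?e' y = 0" if "?a \<le> \<bar>y - s\<bar>" for y
    proof (cases "y \<ge> s")
      case True
      with that have "?a \<le> y - s" "s - y \<le> 0" by auto
      then have "P (y - s) = P ?a" "P (s - y) = P 0" "p (y - s) = 0" "p (s - y) = 0" using Pa P0 p0 by blast+
      then show ?thesis by (simp add: c_def field_simps)
    next
      case False
      with that have "?a \<le> s - y" "y - s \<le> 0" by auto
      then have "P (s - y) = P ?a" "P (y - s) = P 0" "p (y - s) = 0" "p (s - y) = 0" using Pa P0 p0 by blast+
      then show ?thesis by (simp add: c_def field_simps)
    qed
    have Cm: "C1_compact ?e ?e'" by (rule C1_compact_mirror[OF P pc]) (rule supp)
    have "(LINT x:Omega k s|lborel. u (x, s) * p x) - l s (\<lambda>_. 0) = (LINT x:Omega k s|lborel. u' (x, s) * p x) - l' s (\<lambda>_. 0)"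
    proof (rule transposition_difference[OF S s Cm])
      show "?e y = 0 \<and> ?e' y = 0" if "?a \<le> \<bar>y - s\<bar>" for y by (rule supp[OF that])
      show "0 = (P (s + x - s) + 1 * P (s - (s + x))) / 2 + c - ((P (s - x - s) + 1 * P (s - (s - x))) / 2 + c)" for x by simp
      show "p x = (p (s + x - s) - 1 * p (s - (s + x))) / 2 - (p (s - x - s) - 1 * p (s - (s - x))) / 2" if "x \<in> Omega k s" for x
        using that p0[of "- x"] by (simp add: Omega_def)
      show "p \<in> L2_on (Omega k s)" by (rule continuous_L2_on[OF pc]) (auto simp: Omega_def)
    qed (rule zH)
    then have eq: "(LINT x:Omega k s|lborel. u (x, s) * p x) = (LINT x:Omega k s|lborel. u' (x, s) * p x)" using l0 by simp
    have pL: "p \<in> L2_on (Omega k s)" by (rule continuous_L2_on[OF pc]) (auto simp: Omega_def)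
    have "(LINT x:Omega k s|lborel. p x * (u (x, s) - u' (x, s))) = (LINT x:Omega k s|lborel. u (x, s) * p x - u' (x, s) * p x)"
      by (simp add: algebra_simps)
    also have "\<dots> = 0"
      using set_integral_diff(2)[OF L2_on_mult_integrable[OF uL(1) pL] L2_on_mult_integrable[OF uL(2) pL]] eq by simp
    finally show "(LINT x:{0<..<?a}|lborel. p x * (u (x, s) - u' (x, s))) = 0" by (simp add: Omega_def)
  qed
  then show ?thesis by eventually_elim (simp add: Omega_def)
qed

text \<open>Final data \<open>(p, 0)\<close> with \<open>p\<close> a test function isolate the
  velocity functional; continuity of both functionals on H10 covers the rest.\<close>

lemma transposition_unique_dt:
  assumes S: "transposition_solution k T w u l" "transposition_solution k T w u' l'" and s: "0 < s" "s \<le> T"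
    and f: "f \<in> H10 (alpha k s)"
  shows "l s f = l' s f"
proof -
  let ?a = "alpha k s"
  have st: "s \<in> {0..T}" using s by simp
  have test: "l s p = l' s p" if t: "test_fun {0<..<?a} p p'" for p p'
  proof -
    obtain K where K: "K \<subseteq> {0<..<?a}" "\<And>x. x \<notin> K \<Longrightarrow> p x = 0 \<and> p' x = 0" using test_fun_gradient_support[OF t] by blast
    have p0: "p x = 0" "p' x = 0" if "x \<le> 0 \<or> ?a \<le> x" for x
    proof -
      have "x \<notin> {0<..<?a}" using that by auto
      with K(1) have "x \<notin> K" by blast
      from K(2)[OF this] show "p x = 0" "p' x = 0" by blast+
    qed
    have d: "\<And>x. (p has_real_derivative p' x) (at x)" and c: "continuous_on UNIV p'" using t unfolding test_fun_real by blast+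
    let ?e = "\<lambda>y. (p (y - s) + (-1) * p (s - y)) / 2 + 0" and ?e' = "\<lambda>y. (p' (y - s) - (-1) * p' (s - y)) / 2"
    have supp: "?e y = 0 \<and> ?e' y = 0" if "?a \<le> \<bar>y - s\<bar>" for y
    proof -
      have "(?a \<le> y - s \<and> s - y \<le> 0) \<or> (y - s \<le> 0 \<and> ?a \<le> s - y)" using that by linarith
      then show ?thesis using p0[of "y - s"] p0[of "s - y"] by auto
    qed
    have Cm: "C1_compact ?e ?e'" by (rule C1_compact_mirror[OF d c]) (rule supp)
    have "(LINT x:Omega k s|lborel. u (x, s) * 0) - l s p = (LINT x:Omega k s|lborel. u' (x, s) * 0) - l' s p"
    proof (rule transposition_difference[OF S s Cm])
      show "?e y = 0 \<and> ?e' y = 0" if "?a \<le> \<bar>y - s\<bar>" for y by (rule supp[OF that])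
      show "p x = (p (s + x - s) + (-1) * p (s - (s + x))) / 2 + 0 - ((p (s - x - s) + (-1) * p (s - (s - x))) / 2 + 0)" if "x \<in> Omega k s" for x
        using that p0(1)[of "- x"] by (simp add: Omega_def)
      show "0 = (p' (s + x - s) - (-1) * p' (s - (s + x))) / 2 - (p' (s - x - s) - (-1) * p' (s - (s - x))) / 2" for x by simp
      show "p \<in> H10 ?a" using test_fun_H10_deriv[OF t] unfolding H10_def by blast
      show "(\<lambda>_. 0) \<in> L2_on (Omega k s)" by (simp add: L2_on_def set_borel_measurable_def set_integrable_def)
    qed
    then show ?thesis by (simp add: set_lebesgue_integral_def)
  qed
  obtain g where g: "H10_deriv ?a f g" using f unfolding H10_def by blast
  obtain \<phi> G where t: "\<And>n::nat. test_fun {0<..<?a} (\<phi> n) (G n)"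
    and c: "(\<lambda>n. L2_norm_on {0<..<?a} (\<lambda>x. \<phi> n x - f x)) \<longlonglongrightarrow> 0" "(\<lambda>n. L2_norm_on {0<..<?a} (\<lambda>x. G n x - g x)) \<longlonglongrightarrow> 0"
    using H10_derivE[OF g] by blast
  have "(\<lambda>n. l s (\<phi> n)) \<longlonglongrightarrow> l s f" "(\<lambda>n. l' s (\<phi> n)) \<longlonglongrightarrow> l' s f"
    using Hm1_tendsto[OF transposition_solutionD(3)[OF S(1) st] g t c] Hm1_tendsto[OF transposition_solutionD(3)[OF S(2) st] g t c] .
  moreover have "l s (\<phi> n) = l' s (\<phi> n)" for n by (rule test[OF t])
  ultimately show ?thesis using LIMSEQ_unique by simp
qed

text \<open>Agreement on almost all of every slice becomes agreement almost everywhere in the plane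
  by integrating the squared difference with Fubini.\<close>

lemma transposition_unique:
  assumes S: "transposition_solution k T w u l" "transposition_solution k T w u' l'"
  shows "AE p in lborel. p \<in> Qhat k T \<longrightarrow> u p = u' p"
proof -
  let ?v = "\<lambda>p. u p - u' p"
  have v: "?v \<in> L2_on (Qhat k T)" by (rule L2_diff[OF transposition_solutionD(1)[OF S(1)] transposition_solutionD(1)[OF S(2)]])
  have i: "set_integrable lborel (Qhat k T) (\<lambda>p. ?v p * ?v p)" by (rule L2_on_mult_integrable[OF v v])
  have "(LINT x:Omega k t|lborel. ?v (x, t) * ?v (x, t)) = 0" if t: "t \<in> {0<..<T}" for t
  proof -
    have "AE x in lborel. x \<in> Omega k t \<longrightarrow> u (x, t) = u' (x, t)" by (rule transposition_unique_slice[OF S]) (use t in auto)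
    then have z: "AE x in lborel. x \<in> Omega k t \<longrightarrow> ?v (x, t) = (\<lambda>_. 0) x" by eventually_elim simp
    have tt: "t \<in> {0..T}" using t by simp
    note vt = L2_diff[OF transposition_solutionD(2)[OF S(1) tt] transposition_solutionD(2)[OF S(2) tt]]
    from set_integral_cong_AE_L2[OF vt L2_zero vt z] show ?thesis by (simp add: set_lebesgue_integral_def)
  qed
  then have "(LINT t:{0<..<T}|lborel. LINT x:Omega k t|lborel. ?v (x, t) * ?v (x, t)) = (LINT t:{0<..<T}|lborel. 0)"
    by (intro set_lebesgue_integral_cong) auto
  then have "(LINT p:Qhat k T|lborel. (?v p)\<^sup>2) = 0"
    using Qhat_Fubini(1)[OF i] by (simp add: power2_eq_square set_lebesgue_integral_def)
  then have "L2_norm_on (Qhat k T) ?v = 0" by (simp only: L2_norm_on_def real_sqrt_zero)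
  then have "L2_norm_on UNIV (\<lambda>p. indicator (Qhat k T) p * ?v p) = 0" by (simp only: L2_norm_on_eq[of "Qhat k T"])
  moreover have "(\<lambda>p. indicator (Qhat k T) p * ?v p) \<in> L2_on UNIV" using v by (simp only: L2_on_iff[of _ "Qhat k T"])
  ultimately have "AE p in lborel. indicator (Qhat k T) p * ?v p = 0" by (simp only: L2_norm_zero_iff)
  then show ?thesis by eventually_elim (auto simp: indicator_def)
qed


section \<open>Controls and equilibria\<close>

text \<open>Iterates the equation \<open>f = w + f o r\<close>, which a profile must satisfy to
  produce the control \<open>w\<close> at \<open>x = 0\<close>. Partial sums are enough because
  iterates of \<open>r\<close> reach the nonpositive axis, where controls are extended by
  zero.\<close>

fun cascade :: "nat \<Rightarrow> (real \<Rightarrow> real) \<Rightarrow> real \<Rightarrow> real" where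
  "cascade 0 w y = 0"
| "cascade (Suc n) w y = w y + cascade n w (r y)"

lemma cascade_reflect: "cascade n w (r y) = cascade n w (q * y + (- (q + 1)))"
  by (simp only: reflect_def diff_conv_add_uminus)

lemma cascade_L2:
  assumes "w \<in> L2_on UNIV"
  shows "cascade n w \<in> L2_on UNIV"
proof (induction n)
  case (Suc n)
  have "(\<lambda>y. w y + cascade n w (q * y + (- (q + 1)))) \<in> L2_on UNIV"
    by (rule L2_add[OF assms L2_affine(1)[OF Suc q_nonzero]])
  then show ?case by (simp only: cascade.simps(2)[abs_def] cascade_reflect)
qed simp

lemma cascade_linear: "cascade n (\<lambda>x. v x + c * w x) y = cascade n v y + c * cascade n w y"
  by (induction n arbitrary: y) (simp_all add: algebra_simps)

text \<open>In the form \<open>r y = q * (y - 1) - 1\<close> it is visible that a round trip to the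
  moving end takes at least two time units. An argument up to \<open>n\<close> is therefore
  nonpositive after at most \<open>n\<close> applications.\<close>

lemma reflect_le: "y \<le> 1 \<Longrightarrow> r y \<le> -1" "y \<ge> 1 \<Longrightarrow> r y \<le> y - 2"
proof -
  have r: "r y = q * (y - 1) - 1" by (simp add: reflect_def algebra_simps)
  show "r y \<le> -1" if "y \<le> 1" using mult_nonneg_nonpos[of q "y - 1"] q that by (simp add: r)
  show "r y \<le> y - 2" if "y \<ge> 1" using mult_right_mono[of q 1 "y - 1"] q that by (simp add: r)
qed

lemma cascade_nonpos:
  assumes "\<And>x. x \<le> 0 \<Longrightarrow> w x = 0" "y \<le> 0"
  shows "cascade n w y = 0"
  using assms(2)
proof (induction n arbitrary: y)
  case (Suc n)
  have "r y \<le> 0" using reflect_le(1)[of y] Suc.prems by simp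
  then show ?case using Suc assms(1)[of y] by simp
qed simp

lemma cascade_stable:
  assumes "\<And>x. x \<le> 0 \<Longrightarrow> w x = 0" "y \<le> real n"
  shows "cascade (Suc n) w y = cascade n w y"
  using assms(2)
proof (induction n arbitrary: y)
  case 0
  then show ?case using assms(1)[of y] by simp
next
  case (Suc n)
  have "r y \<le> real n" using reflect_le[of y] Suc.prems by (cases "y \<le> 1") auto
  then have "cascade (Suc n) w (r y) = cascade n w (r y)" by (rule Suc.IH)
  then show ?case by (simp only: cascade.simps(2)[of "Suc n" w y] cascade.simps(2)[of n w y])
qed

text \<open>Each step composes with one affine map, which \<open>adjoint_affine\<close> moves to the
  kernel; hence the induction over arbitrary \<open>K\<close>.\<close>

lemma cascade_dual:
  assumes "K \<in> L2_on UNIV"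
  shows "L2_dual (\<lambda>w. \<integral>x. cascade n w x * K x \<partial>lborel)"
  using assms
proof (induction n arbitrary: K)
  case 0
  show ?case unfolding L2_dual_def by (intro bexI[of _ "\<lambda>_. 0"]) simp_all
next
  case (Suc n)
  obtain K' where K': "K' \<in> L2_on UNIV" "\<And>f. (\<integral>x. f (q * x + (- (q + 1))) * K x \<partial>lborel) = (\<integral>x. f x * K' x \<partial>lborel)"
    using adjoint_affine[OF Suc.prems q_nonzero, of "- (q + 1)"] by blast
  show ?case
  proof (rule L2_dual_cong)
    show "L2_dual (\<lambda>w. (\<integral>x. w x * K x \<partial>lborel) + (\<integral>x. cascade n w x * K' x \<partial>lborel))"
      by (rule L2_dual_add[OF _ Suc.IH[OF K'(1)]]) (use Suc.prems in \<open>auto simp: L2_dual_def\<close>)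
    fix w :: "real \<Rightarrow> real" assume w: "w \<in> L2_on UNIV"
    have "(\<integral>x. cascade (Suc n) w x * K x \<partial>lborel) = (\<integral>x. w x * K x + cascade n w (q * x + (- (q + 1))) * K x \<partial>lborel)"
      by (simp only: cascade.simps(2) cascade_reflect distrib_right)
    also have "\<dots> = (\<integral>x. w x * K x \<partial>lborel) + (\<integral>x. cascade n w (q * x + (- (q + 1))) * K x \<partial>lborel)"
      by (rule Bochner_Integration.integral_add[OF L2_mult_integrable[OF w Suc.prems]
          L2_mult_integrable[OF L2_affine(1)[OF cascade_L2[OF w] q_nonzero] Suc.prems]])
    also have "\<dots> = (\<integral>x. w x * K x \<partial>lborel) + (\<integral>x. cascade n w x * K' x \<partial>lborel)" by (simp only: K'(2))
    finally show "(\<integral>x. cascade (Suc n) w x * K x \<partial>lborel) = (\<integral>x. w x * K x \<partial>lborel) + (\<integral>x. cascade n w x * K' x \<partial>lborel)" .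
  qed
qed

text \<open>The inner indicator extends the control by zero, as the iteration requires; the outer
  one makes the profile vanish outside \<open>(0,T)\<close>. Nothing observed before time
  \<open>T\<close> is lost, since both arguments in \<open>travel\<close> are below \<open>T\<close>
  on \<open>Qhat k T\<close>. The number of terms covers arguments up to \<open>T\<close> by
  \<open>cascade_stable\<close>.\<close>

definition profile :: "real \<Rightarrow> (real \<Rightarrow> real) \<Rightarrow> real \<Rightarrow> real" where
  "profile T w x = indicator {0<..<T} x * cascade (nat \<lceil>T\<rceil>) (\<lambda>x. indicator {0<..<T} x * w x) x"

lemma profile_L2:
  assumes "w \<in> L2_on {0<..<T}"
  shows "profile T w \<in> L2_on UNIV"
proof -
  have "(\<lambda>x. indicator {0<..<T} x * w x) \<in> L2_on UNIV" using assms by (simp only: L2_on_iff[of _ "{0<..<T}"])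
  from L2_UNIV_on[OF cascade_L2[OF this], of "{0<..<T}" "nat \<lceil>T\<rceil>"]
  show ?thesis unfolding profile_def[abs_def] by (simp only: L2_on_iff[of _ "{0<..<T}"] greaterThanLessThan_borel)
qed

lemma profile_outside: "x \<notin> {0<..<T} \<Longrightarrow> profile T w x = 0"
  by (simp add: profile_def)

lemma profile_linear: "profile T (\<lambda>x. v x + c * w x) x = profile T v x + c * profile T w x"
proof -
  have "(\<lambda>x. indicator {0<..<T} x * (v x + c * w x)) = (\<lambda>x. indicator {0<..<T} x * v x + c * (indicator {0<..<T} x * w x))"
    by (simp add: fun_eq_iff algebra_simps)
  then show ?thesis by (simp only: profile_def cascade_linear) (simp add: algebra_simps)
qed

text \<open>For \<open>t\<close> in \<open>(0,T)\<close> the argument \<open>r t\<close> is below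
  \<open>T\<close>: it is either nonpositive, where cascade and truncation both give zero, or inside
  the interval, where the truncation has no effect.\<close>

lemma profile_boundary:
  assumes t: "t \<in> {0<..<T}"
  shows "w t = profile T w t - profile T w (r t)"
proof -
  let ?w = "\<lambda>x. indicator {0<..<T} x * w x" and ?N = "nat \<lceil>T\<rceil>"
  have w0: "?w x = 0" if "x \<le> 0" for x using that by simp
  have "t \<le> T" using t by simp
  then have "t \<le> real ?N" using real_nat_ceiling_ge by (rule order.trans)
  from cascade_stable[of ?w, OF w0 this] have "cascade ?N ?w t = w t + cascade ?N ?w (r t)" using t by simp
  moreover have "profile T w (r t) = cascade ?N ?w (r t)"
  proof (cases "r t \<le> 0")
    case True
    with cascade_nonpos[of ?w, OF w0 True] show ?thesis by (simp add: profile_def)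
  next
    case False
    moreover have "r t < T" using reflect_le[of t] t by (cases "t \<le> 1") auto
    ultimately show ?thesis by (simp add: profile_def)
  qed
  ultimately show ?thesis using t by (simp add: profile_def)
qed

lemma travel_profile_linear:
  "travel k (profile T (\<lambda>x. v x + c * w x)) p = travel k (profile T v) p + c * travel k (profile T w) p"
  by (simp add: travel_def profile_linear algebra_simps)

text \<open>\<open>\<kappa>\<close> is the adjoint of the control-to-state map applied to
  \<open>m\<close>. It corresponds to \<open>p_x (0, .)\<close> for the adjoint state
  \<open>p\<close> with source \<open>m\<close>, but is obtained from kernels instead of solving for
  \<open>p\<close>.\<close>

lemma travel_profile_dual:
  assumes m: "m \<in> L2_on (Qhat k T)" and T: "T > 0"
  shows "\<exists>\<kappa>\<in>L2_on {0<..<T}. \<forall>w\<in>L2_on {0<..<T}.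
    (LINT p:Qhat k T|lborel. travel k (profile T w) p * m p) = (LINT t:{0<..<T}|lborel. w t * \<kappa> t)"
proof -
  let ?i = "indicator {0<..<T} :: real \<Rightarrow> real"
  obtain K where K: "K \<in> L2_on UNIV" "\<And>f. f \<in> L2_on UNIV \<Longrightarrow> (LINT p:Qhat k T|lborel. travel k f p * m p) = (\<integral>x. f x * K x \<partial>lborel)"
    using travel_Qhat_dual[OF m] T unfolding L2_dual_def by auto
  have "K \<in> L2_on {0<..<T}" by (rule L2_UNIV_on[OF K(1)]) simp
  then have "(\<lambda>x. ?i x * K x) \<in> L2_on UNIV" by (simp only: L2_on_iff[of _ "{0<..<T}"])
  from cascade_dual[OF this, of "nat \<lceil>T\<rceil>"] obtain \<kappa> where \<kappa>: "\<kappa> \<in> L2_on UNIV"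
    "\<And>w. w \<in> L2_on UNIV \<Longrightarrow> (\<integral>x. cascade (nat \<lceil>T\<rceil>) w x * (?i x * K x) \<partial>lborel) = (\<integral>x. w x * \<kappa> x \<partial>lborel)"
    unfolding L2_dual_def by auto
  show ?thesis
  proof (intro bexI ballI)
    show "\<kappa> \<in> L2_on {0<..<T}" by (rule L2_UNIV_on[OF \<kappa>(1)]) simp
    fix w :: "real \<Rightarrow> real" assume w: "w \<in> L2_on {0<..<T}"
    have wL: "(\<lambda>x. ?i x * w x) \<in> L2_on UNIV" using w by (simp only: L2_on_iff[of _ "{0<..<T}"])
    have "(LINT p:Qhat k T|lborel. travel k (profile T w) p * m p) = (\<integral>x. profile T w x * K x \<partial>lborel)"
      by (rule K(2)[OF profile_L2[OF w]])
    also have "\<dots> = (\<integral>x. cascade (nat \<lceil>T\<rceil>) (\<lambda>x. ?i x * w x) x * (?i x * K x) \<partial>lborel)"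
      by (simp add: profile_def mult_ac)
    also have "\<dots> = (\<integral>x. (?i x * w x) * \<kappa> x \<partial>lborel)" by (rule \<kappa>(2)[OF wL])
    also have "\<dots> = (LINT t:{0<..<T}|lborel. w t * \<kappa> t)" by (simp add: set_lebesgue_integral_def mult.assoc)
    finally show "(LINT p:Qhat k T|lborel. travel k (profile T w) p * m p) = (LINT t:{0<..<T}|lborel. w t * \<kappa> t)" .
  qed
qed

text \<open>Existence turns the choice in \<open>state_pair\<close> into an actual solution.\<close>

lemma state_transposition_solution:
  assumes w: "(\<lambda>t. w1 t + w2 t) \<in> L2_on {0<..<T}" and T: "T > 0"
  shows "transposition_solution k T (\<lambda>t. w1 t + w2 t) (state k T w1 w2) (state_dt k T w1 w2)"
proof -
  have "\<exists>p. transposition_solution k T (\<lambda>t. w1 t + w2 t) (fst p) (snd p)"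
    using travel_transposition_solution[OF profile_L2[OF w] profile_outside T profile_boundary] by (metis fst_conv snd_conv)
  from someI_ex[OF this] show ?thesis unfolding state_def state_dt_def state_pair_def .
qed

text \<open>By uniqueness the chosen state agrees almost everywhere with the explicit wave, so the
  cost becomes an explicit quadratic functional of \<open>w2\<close>.\<close>

lemma J2_profile:
  assumes w: "(\<lambda>t. w1 t + w2 t) \<in> L2_on {0<..<T}" and T: "T > 0" and u2: "u2 \<in> L2_on (Qhat k T)"
  shows "J2 k T \<sigma> u2 w1 w2 = 1/2 * (LINT p:Qhat k T|lborel. (travel k (profile T (\<lambda>t. w1 t + w2 t)) p - u2 p)\<^sup>2) +
     \<sigma>/2 * (LINT t:{0<..<T}|lborel. (w2 t)\<^sup>2)"
proof -
  let ?f = "profile T (\<lambda>t. w1 t + w2 t)"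
  note S = state_transposition_solution[OF w T]
  note S' = travel_transposition_solution[OF profile_L2[OF w] profile_outside T profile_boundary]
  have "AE p in lborel. p \<in> Qhat k T \<longrightarrow> state k T w1 w2 p = travel k ?f p" by (rule transposition_unique[OF S S'])
  then have "AE p in lborel. p \<in> Qhat k T \<longrightarrow> state k T w1 w2 p - u2 p = travel k ?f p - u2 p" by eventually_elim simp
  from L2_norm_cong_AE[OF this L2_diff[OF transposition_solutionD(1)[OF S] u2] L2_diff[OF transposition_solutionD(1)[OF S'] u2]]
  have "(L2_norm_on (Qhat k T) (\<lambda>p. state k T w1 w2 p - u2 p))\<^sup>2 = (L2_norm_on (Qhat k T) (\<lambda>p. travel k ?f p - u2 p))\<^sup>2" by simp
  then show ?thesis unfolding J2_def L2_norm_sq by simp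
qed

end

section \<open>Equilibria with prescribed total control\<close>

lemma set_integral_square_add:
  assumes f: "f \<in> L2_on S" and g: "g \<in> L2_on S"
  shows "(LINT x:S|lborel. (f x + g x)\<^sup>2) = (LINT x:S|lborel. (f x)\<^sup>2) + 2 * (LINT x:S|lborel. g x * f x) + (LINT x:S|lborel. (g x)\<^sup>2)"
proof -
  have i: "set_integrable lborel S (\<lambda>x. f x * f x)" "set_integrable lborel S (\<lambda>x. 2 * (g x * f x))" "set_integrable lborel S (\<lambda>x. g x * g x)"
    using L2_on_mult_integrable[OF f f] L2_on_mult_integrable[OF g f] L2_on_mult_integrable[OF g g] by simp_all
  have "(LINT x:S|lborel. (f x + g x)\<^sup>2) = (LINT x:S|lborel. (f x * f x + 2 * (g x * f x)) + g x * g x)"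
    by (simp add: power2_eq_square algebra_simps)
  also have "\<dots> = (LINT x:S|lborel. f x * f x) + (LINT x:S|lborel. 2 * (g x * f x)) + (LINT x:S|lborel. g x * g x)"
    by (simp only: set_integral_add(2)[OF set_integral_add(1)[OF i(1,2)] i(3)] set_integral_add(2)[OF i(1,2)])
  finally show ?thesis by (simp add: power2_eq_square)
qed

context moving_end
begin

text \<open>Every control is the total control \<open>w1 + w2\<close> of some equilibrium: the follower's optimality
  condition gives \<open>w2\<close> explicitly in terms of the state, hence of \<open>w1 + w2\<close> alone, and then
  \<open>w1\<close> makes up for the difference.\<close>

lemma nash_total_control:
  assumes w: "w \<in> L2_on {0<..<T}" and T: "T > 0" and u2: "u2 \<in> L2_on (Qhat k T)" and \<sigma>: "\<sigma> > 0"
  shows "\<exists>w1\<in>L2_on {0<..<T}. \<exists>w2. nash k T \<sigma> u2 w1 w2 \<and> (\<lambda>t. w1 t + w2 t) = w"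
proof -
  let ?S = "\<lambda>w. travel k (profile T w)" and ?Q = "Qhat k T" and ?I = "{0<..<T}"
  have SL: "?S v \<in> L2_on ?Q" if "v \<in> L2_on ?I" for v by (rule travel_L2_Qhat[OF profile_L2[OF that]])
  define y where "y p = ?S w p - u2 p" for p
  have y: "y \<in> L2_on ?Q" unfolding y_def[abs_def] by (rule L2_diff[OF SL[OF w] u2])
  obtain \<kappa> where \<kappa>: "\<kappa> \<in> L2_on ?I" "\<And>v. v \<in> L2_on ?I \<Longrightarrow> (LINT p:?Q|lborel. ?S v p * y p) = (LINT t:?I|lborel. v t * \<kappa> t)"
    using travel_profile_dual[OF y T] by blast
  \<comment> \<open>Zero of the first variation: at this total control the derivative of the cost in
    a direction \<open>d\<close> is \<open>(d, \<kappa>) + \<sigma> * (d, w2)\<close>.\<close>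
  define w2 where "w2 t = (- 1 / \<sigma>) * \<kappa> t" for t
  have w2: "w2 \<in> L2_on ?I" unfolding w2_def[abs_def] by (rule L2_scale[OF \<kappa>(1)])
  define w1 where "w1 t = w t - w2 t" for t
  have w1: "w1 \<in> L2_on ?I" unfolding w1_def[abs_def] by (rule L2_diff[OF w w2])
  have J: "J2 k T \<sigma> u2 w1 v = 1/2 * (LINT p:?Q|lborel. (?S (\<lambda>t. w1 t + v t) p - u2 p)\<^sup>2) + \<sigma>/2 * (LINT t:?I|lborel. (v t)\<^sup>2)"
    if v: "v \<in> L2_on ?I" for v by (rule J2_profile[OF L2_add[OF w1 v] T u2])
  have tot: "(\<lambda>t. w1 t + w2 t) = w" by (simp add: w1_def)
  have "J2 k T \<sigma> u2 w1 w2 \<le> J2 k T \<sigma> u2 w1 v" if v: "v \<in> L2_on ?I" for v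
  proof -
    define d where "d t = v t - w2 t" for t
    have d: "d \<in> L2_on ?I" unfolding d_def[abs_def] by (rule L2_diff[OF v w2])
    have "(\<lambda>t. w1 t + v t) = (\<lambda>t. w t + 1 * d t)" by (simp add: w1_def d_def fun_eq_iff)
    then have e: "?S (\<lambda>t. w1 t + v t) p - u2 p = y p + ?S d p" for p
      using travel_profile_linear[of T w 1 d p] by (simp add: y_def)
    have vd: "v t = w2 t + d t" for t by (simp add: d_def)
    have Q: "(LINT p:?Q|lborel. (?S (\<lambda>t. w1 t + v t) p - u2 p)\<^sup>2) = (LINT p:?Q|lborel. (y p)\<^sup>2) + 2 * (LINT t:?I|lborel. d t * \<kappa> t) + (LINT p:?Q|lborel. (?S d p)\<^sup>2)"
      unfolding e set_integral_square_add[OF y SL[OF d]] \<kappa>(2)[OF d] ..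
    have I: "(LINT t:?I|lborel. (v t)\<^sup>2) = (LINT t:?I|lborel. (w2 t)\<^sup>2) + 2 * (LINT t:?I|lborel. d t * w2 t) + (LINT t:?I|lborel. (d t)\<^sup>2)"
      unfolding vd by (rule set_integral_square_add[OF w2 d])
    have "(LINT t:?I|lborel. d t * w2 t) = (LINT t:?I|lborel. (- 1 / \<sigma>) * (d t * \<kappa> t))" unfolding w2_def by (simp add: mult.left_commute)
    also have "\<dots> = (- 1 / \<sigma>) * (LINT t:?I|lborel. d t * \<kappa> t)" by (rule set_integral_mult_right)
    finally have c: "\<sigma> * (LINT t:?I|lborel. d t * w2 t) = - (LINT t:?I|lborel. d t * \<kappa> t)" using \<sigma> by simp
    have n: "0 \<le> (LINT p:?Q|lborel. (?S d p)\<^sup>2)" "0 \<le> (LINT t:?I|lborel. (d t)\<^sup>2)"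
      by (simp_all add: set_lebesgue_integral_def)
    \<comment> \<open>After expanding around \<open>w2\<close> the terms linear in \<open>d\<close>
      cancel by \<open>c\<close>, and the remainder is a sum of nonnegative terms.\<close>
    have real: "1/2 * Y + \<sigma>/2 * W \<le> 1/2 * (Y + 2 * K + A) + \<sigma>/2 * (W + 2 * D + B)"
      if "\<sigma> * D = - K" "0 \<le> A" "0 \<le> B" for Y W K A D B :: real
    proof -
      have "1/2 * (Y + 2 * K + A) + \<sigma>/2 * (W + 2 * D + B) = 1/2 * Y + \<sigma>/2 * W + (K + \<sigma> * D) + 1/2 * A + \<sigma>/2 * B"
        by (simp add: algebra_simps)
      moreover have "0 \<le> \<sigma>/2 * B" using \<sigma> that by simp
      ultimately show ?thesis using that by linarith
    qed
    show ?thesis unfolding J[OF v] J[OF w2] Q I tot y_def[symmetric] by (rule real[OF c n])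
  qed
  then have "nash k T \<sigma> u2 w1 w2" unfolding nash_def is_arg_min_linorder using w2 by blast
  with w1 tot show ?thesis by blast
qed

end

text \<open>From \<open>exp x - 1 \<ge> x\<close> the right-hand side is at least
  \<open>2 * (1 + k) / (1 - k) ^ 3\<close>, and \<open>(1 - k)^2 \<le> 1 \<le> 1 + k\<close> gives
  the rest.\<close>

lemma exp_threshold:
  fixes k :: real
  assumes k: "0 < k" "k < 1"
  shows "2 / (1 - k) \<le> (exp (2 * k * (1 + k) / (1 - k) ^ 3) - 1) / k"
proof -
  have "(1 - k)\<^sup>2 \<le> 1" using k by (simp add: power_le_one)
  then have "2 * (1 - k)\<^sup>2 \<le> 2 * (1 + k)" using k by simp
  then have "2 * (1 - k)\<^sup>2 / (1 - k) ^ 3 \<le> 2 * (1 + k) / (1 - k) ^ 3" using k by (intro divide_right_mono) auto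
  moreover have "2 * (1 - k)\<^sup>2 / (1 - k) ^ 3 = 2 / (1 - k)" using k by (simp add: power2_eq_square power3_eq_cube)
  ultimately have "2 / (1 - k) \<le> 2 * (1 + k) / (1 - k) ^ 3" by simp
  also have "\<dots> = (2 * k * (1 + k) / (1 - k) ^ 3) / k" using k by simp
  also have "\<dots> \<le> (exp (2 * k * (1 + k) / (1 - k) ^ 3) - 1) / k"
  proof (rule divide_right_mono)
    show "2 * k * (1 + k) / (1 - k) ^ 3 \<le> exp (2 * k * (1 + k) / (1 - k) ^ 3) - 1"
      using exp_ge_add_one_self[of "2 * k * (1 + k) / (1 - k) ^ 3"] by linarith
  qed (use k in simp)
  finally show ?thesis .
qed

section \<open>Reaching prescribed final states\<close>

context moving_end
begin

lemma unreflect_strict_mono: "s < s' \<Longrightarrow> unreflect s < unreflect s'"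
  using q by (simp add: unreflect_def divide_strict_right_mono)

text \<open>The values of \<open>f\<close> on the two disjoint intervals \<open>(r T, T - alpha k T)\<close> and
  \<open>(T - alpha k T, T)\<close>, which lie in \<open>(0, T)\<close> because \<open>T \<ge> 2 / (1 - k)\<close>, can be chosen freely.\<close>

lemma exact_control_profile:
  assumes T: "2 / (1 - k) \<le> T" and v: "v \<in> L2_on {0<..<alpha k T}" and h: "h \<in> L2_on {0<..<alpha k T}"
  shows "\<exists>f\<in>L2_on UNIV. (\<forall>y. y \<notin> {0<..<T} \<longrightarrow> f y = 0) \<and>
    (\<forall>x\<in>Omega k T. travel k f (x, T) = v x \<and> stream k f T x = h x)"
proof -
  let ?a = "alpha k T"
  have "0 < 2 / (1 - k)" using k by simp
  with T have T0: "T > 0" by linarith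
  have a: "?a > 0" using alpha_ge_1[of T] T0 by simp
  have "2 \<le> T * (1 - k)" using T k by (simp add: divide_le_eq)
  then have "(1 + k) \<le> (1 - k) * (T - 1)" by (simp add: algebra_simps)
  then have "1 \<le> q * (T - 1)" using k by (simp add: refl_coef_def le_divide_eq)
  \<comment> \<open>The left end of the interval that will carry \<open>B\<close> is nonnegative;
    this is where the lower bound on \<open>T\<close> enters.\<close>
  then have rT: "r T \<ge> 0" by (simp add: reflect_def algebra_simps)
  \<comment> \<open>Solves \<open>A - B = v\<close> and \<open>A + B = h\<close>, the values
    required of \<open>travel\<close> and \<open>stream\<close> at time \<open>T\<close>.\<close>
  define A where "A x = indicator {0<..<?a} x * (1/2 * (v x + h x))" for x
  define B where "B x = indicator {0<..<?a} x * (1/2 * (h x - v x))" for x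
  \<comment> \<open>\<open>A\<close> is laid out along the direct characteristics, on
    \<open>(T - ?a, T)\<close>, and \<open>B\<close> along the reflected ones, on
    \<open>(r T, T - ?a)\<close>.\<close>
  define f where "f y = A ((-1) * y + T) + B (1 / q * y + ((1 / q + 1) - T))" for y
  have f: "f y = A (T - y) + B (unreflect y - T)" for y
    unfolding f_def unreflect_def by (simp add: add_diff_eq)
  have "A \<in> L2_on UNIV" "B \<in> L2_on UNIV"
    using L2_scale[OF L2_add[OF v h], of "1/2"] L2_scale[OF L2_diff[OF h v], of "1/2"]
    unfolding A_def[abs_def] B_def[abs_def] by (simp_all only: L2_on_iff[of _ "{0<..<?a}"])
  then have fL: "f \<in> L2_on UNIV" unfolding f_def[abs_def] using q
    by (intro L2_add L2_affine(1)) auto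
  have A0: "A x = 0" if "x \<le> 0 \<or> ?a \<le> x" for x using that by (auto simp: A_def)
  have B0: "B x = 0" if "x \<le> 0 \<or> ?a \<le> x" for x using that by (auto simp: B_def)
  \<comment> \<open>The two intervals meet at the characteristic that hits the moving end at time
    \<open>T\<close>.\<close>
  have mid: "unreflect (T - ?a) = T + ?a" using unreflect_reflect(1)[of "T + ?a"] by (simp add: reflect_right)
  have low: "r T < T - ?a" using reflect_strict_mono[of T "T + ?a"] a by (simp add: reflect_right)
  have "f y = 0" if "y \<notin> {0<..<T}" for y
  proof (cases "y \<le> 0")
    case True
    then have "y \<le> r T" using rT by simp
    then have "unreflect y \<le> unreflect (r T)" using unreflect_strict_mono[of y "r T"] by (cases "y = r T") auto
    then have "unreflect y \<le> T" by (simp add: unreflect_reflect)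
    moreover have "?a \<le> T - y" using True low rT by linarith
    ultimately show ?thesis using A0 B0 by (simp add: f)
  next
    case False
    with that have "T \<le> y" by simp
    then have "T - ?a < y" using a by linarith
    from unreflect_strict_mono[OF this] have "?a \<le> unreflect y - T" by (simp add: mid)
    then show ?thesis using A0[of "T - y"] B0 \<open>T \<le> y\<close> by (simp add: f)
  qed
  moreover have "travel k f (x, T) = v x \<and> stream k f T x = h x" if x: "x \<in> Omega k T" for x
  proof -
    have x': "0 < x" "x < ?a" using x by (auto simp: Omega_def)
    have "T - ?a < T - x" using x' by simp
    from unreflect_strict_mono[OF this] have "?a \<le> unreflect (T - x) - T" by (simp add: mid)
    then have 1: "f (T - x) = A x" using B0 by (simp add: f)
    have "r (T + x) < T - ?a" using reflect_strict_mono[of "T + x" "T + ?a"] x' by (simp add: reflect_right)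
    then have 2: "f (r (T + x)) = B x" using A0[of "T - r (T + x)"] by (simp add: f unreflect_reflect)
    have "A x = 1/2 * (v x + h x)" "B x = 1/2 * (h x - v x)" using x' by (simp_all add: A_def B_def)
    then show ?thesis by (simp add: travel_def stream_def 1 2)
  qed
  ultimately show ?thesis using fL by blast
qed

lemma reachable_subset:
  assumes T: "T > 0"
  shows "reachable k T \<sigma> u2 \<subseteq> L2_on {0<..<alpha k T} \<times> Hm1 (alpha k T)"
proof
  fix y assume "y \<in> reachable k T \<sigma> u2"
  then obtain w1 w2 where y: "y = ((\<lambda>x. state k T w1 w2 (x, T)), state_dt k T w1 w2 T)" and w1: "w1 \<in> L2_on {0<..<T}" and n: "nash k T \<sigma> u2 w1 w2"
    unfolding reachable_def by blast
  have "w2 \<in> L2_on {0<..<T}" using n unfolding nash_def is_arg_min_def by blast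
  from state_transposition_solution[OF L2_add[OF w1 this] T]
  have "(\<lambda>x. state k T w1 w2 (x, T)) \<in> L2_on (Omega k T)" "state_dt k T w1 w2 T \<in> Hm1 (alpha k T)"
    using T by (auto dest: transposition_solutionD(2,3)[of _ _ _ _ _ T])
  then show "y \<in> L2_on {0<..<alpha k T} \<times> Hm1 (alpha k T)" by (simp add: y Omega_def)
qed

text \<open>The displacement is attained exactly. For the velocity, \<open>v1\<close> is replaced by
  the pairing with an L2 function \<open>h\<close>, and \<open>h\<close> is attained exactly as
  \<open>stream\<close>; the only error is that of the replacement.\<close>

lemma reachable_dense:
  assumes T: "2 / (1 - k) \<le> T" and u2: "u2 \<in> L2_on (Qhat k T)" and \<sigma>: "\<sigma> > 0"
    and v0: "v0 \<in> L2_on {0<..<alpha k T}" and v1: "v1 \<in> Hm1 (alpha k T)" and e: "\<epsilon> > 0"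
  shows "\<exists>(y0, y1)\<in>reachable k T \<sigma> u2. L2_norm_on {0<..<alpha k T} (\<lambda>x. y0 x - v0 x) < \<epsilon> \<and> Hm1_norm (alpha k T) (\<lambda>f. y1 f - v1 f) < \<epsilon>"
proof -
  let ?a = "alpha k T"
  have "0 < 2 / (1 - k)" using k by simp
  with T have T0: "T > 0" by linarith
  have a: "?a > 0" using alpha_ge_1[of T] T0 by simp
  obtain h where h: "h \<in> L2_on {0<..<?a}"
    "\<And>f g. H10_deriv ?a f g \<Longrightarrow> (L2_norm_on {0<..<?a} f)\<^sup>2 + (L2_norm_on {0<..<?a} g)\<^sup>2 \<le> 1 \<Longrightarrow>
       \<bar>v1 f - (LINT x:{0<..<?a}|lborel. h x * g x)\<bar> \<le> \<epsilon> / 2"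
    using Hm1_approx_representation[OF v1 a, of "\<epsilon> / 2"] e by auto
  obtain f where f: "f \<in> L2_on UNIV" "\<And>y. y \<notin> {0<..<T} \<Longrightarrow> f y = 0"
    "\<And>x. x \<in> Omega k T \<Longrightarrow> travel k f (x, T) = v0 x" "\<And>x. x \<in> Omega k T \<Longrightarrow> stream k f T x = h x"
    using exact_control_profile[OF T v0 h(1)] by blast
  \<comment> \<open>The boundary value of \<open>travel k f\<close> at \<open>x = 0\<close>, with
    \<open>r\<close> written out so that \<open>L2_affine\<close> applies.\<close>
  define w where "w t = f t - f (q * t + (- (q + 1)))" for t
  have w: "w \<in> L2_on {0<..<T}"
    unfolding w_def[abs_def] by (rule L2_UNIV_on[OF L2_diff[OF f(1) L2_affine(1)[OF f(1) q_nonzero]]]) simp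
  obtain w1 w2 where w12: "w1 \<in> L2_on {0<..<T}" "nash k T \<sigma> u2 w1 w2" "(\<lambda>t. w1 t + w2 t) = w"
    using nash_total_control[OF w T0 u2 \<sigma>] by blast
  have S: "transposition_solution k T w (state k T w1 w2) (state_dt k T w1 w2)"
    using state_transposition_solution[of w1 w2 T] w T0 unfolding w12(3) by simp
  have wf: "w t = f t - f (r t)" for t unfolding w_def reflect_def diff_conv_add_uminus ..
  have S': "transposition_solution k T w (travel k f) (\<lambda>t. pair_deriv (alpha k t) (stream k f t))"
    by (rule travel_transposition_solution[OF f(1,2) T0 wf])
  have "AE x in lborel. x \<in> Omega k T \<longrightarrow> state k T w1 w2 (x, T) = travel k f (x, T)"
    by (rule transposition_unique_slice[OF S S' T0]) simp
  then have z: "AE x in lborel. x \<in> {0<..<?a} \<longrightarrow> state k T w1 w2 (x, T) - v0 x = (\<lambda>_. 0) x"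
    by eventually_elim (use f(3) in \<open>auto simp: Omega_def\<close>)
  have "(\<lambda>x. state k T w1 w2 (x, T)) \<in> L2_on {0<..<?a}"
    using transposition_solutionD(2)[OF S, of T] T0 by (simp add: Omega_def)
  from L2_norm_cong_AE[OF z L2_diff[OF this v0] L2_zero]
  have n0: "L2_norm_on {0<..<?a} (\<lambda>x. state k T w1 w2 (x, T) - v0 x) < \<epsilon>" using e by (simp add: L2_norm_on_def)
  have "Hm1_norm ?a (\<lambda>p. state_dt k T w1 w2 T p - v1 p) \<le> \<epsilon> / 2"
  proof (rule Hm1_norm_bounds(2))
    fix p g assume p: "H10_deriv ?a p g" and n: "(L2_norm_on {0<..<?a} p)\<^sup>2 + (L2_norm_on {0<..<?a} g)\<^sup>2 \<le> 1"
    have "p \<in> H10 ?a" using p unfolding H10_def by blast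
    then have "state_dt k T w1 w2 T p = pair_deriv ?a (stream k f T) p"
      by (rule transposition_unique_dt[OF S S' T0 order_refl])
    also have "\<dots> = (LINT x:{0<..<?a}|lborel. stream k f T x * g x)"
      using stream_L2_slice[OF f(1), of T] by (intro pair_deriv_eq[OF p _ a]) (simp add: Omega_def)
    also have "\<dots> = (LINT x:{0<..<?a}|lborel. h x * g x)"
      by (rule set_lebesgue_integral_cong) (use f(4) in \<open>auto simp: Omega_def\<close>)
    finally show "\<bar>state_dt k T w1 w2 T p - v1 p\<bar> \<le> \<epsilon> / 2" using h(2)[OF p n] by (simp add: abs_minus_commute)
  qed
  with e have n1: "Hm1_norm ?a (\<lambda>p. state_dt k T w1 w2 T p - v1 p) < \<epsilon>" by linarith
  have "((\<lambda>x. state k T w1 w2 (x, T)), state_dt k T w1 w2 T) \<in> reachable k T \<sigma> u2"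
    unfolding reachable_def using w12(1,2) by blast
  then show ?thesis by (rule bexI[rotated]) (simp add: n0 n1)
qed

end

theorem theorem4p1:
  fixes k T \<sigma> :: real and u2 :: "real \<times> real \<Rightarrow> real"
  assumes "\<sigma> > 0"
    and "u2 \<in> L2_on (Qhat k T)"
    and "0 < k" and "k < 1"
    and "T > (exp (2 * k * (1 + k) / (1 - k) ^ 3) - 1) / k"
  shows "dense_in_L2_Hm1 (alpha k T) (reachable k T \<sigma> u2)"
proof -
  interpret moving_end k using assms(3,4) by unfold_locales
  have T: "2 / (1 - k) \<le> T" using exp_threshold[OF assms(3,4)] assms(5) by linarith
  moreover have "0 < 2 / (1 - k)" using assms(4) by simp
  ultimately have "T > 0" by linarith
  then show ?thesis unfolding dense_in_L2_Hm1_def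
    using reachable_subset reachable_dense[OF T assms(2,1)] by blast
qed

end
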